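(* Let $\iota\colon B\hookrightarrow A$ be an embedding of integral domains and let $h\in B\setminus\{0\}$ be such that $\iota$ induces an isomorphism $B/hB\cong A/hA$. Denote by $\overline{\iota}\colon B_h\hookrightarrow A_h$ the induced embedding of localizations. Let $\Phi$ be an arbitrary irreducible simply-laced root system of rank at least $3$. Then the canonical homomorphism $$\mathrm{St}(\Phi,B)\to\mathrm{St}(\Phi,B_h)\times_{\mathrm{St}(\Phi,A_h)}\mathrm{St}(\Phi,A),\qquad g\mapsto(\lambda_h(g),\iota(g)),$$ onto the pullback of the diagram $\mathrm{St}(\Phi,A)\xrightarrow{\lambda_h}\mathrm{St}(\Phi,A_h)\xleftarrow{\overline{\iota}}\mathrm{St}(\Phi,B_h)$ is surjective.
   Context: For an irreducible simply-laced root system $\Phi$ of rank $\geq 2$ and a commutative ring $R$, the Steinberg group $\mathrm{St}(\Phi,R)$ is the group with generators $x_\alpha(\xi)$ ($\alpha\in\Phi$, $\xi\in R$) and defining relations: $x_\alpha(a)x_\alpha(b)=x_\alpha(a+b)$; $[x_\alpha(a),x_\beta(b)]=1$ if $\alpha+\beta\notin\Phi\cup\{0\}$; $[x_\alpha(a),x_\beta(b)]=x_{\alpha+\beta}(N_{\alpha\beta}ab)$ if $\alpha+\beta\in\Phi$. Here $N_{\alpha\beta}=\pm1$ are the structure constants of the Chevalley group (equivalently, of the corresponding simple Lie algebra in a fixed Chevalley basis). The same letters $\iota$, $\overline{\iota}$ and $\lambda_h$ denote the homomorphisms of Steinberg groups induced by $\iota$, $\overline{\iota}$ and by the localization homomorphisms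 $B\to B_h$, $A\to A_h$. *)

theory Defs
  imports "HOL-Analysis.Analysis" "HOL-Algebra.QuotRing"
begin

section \<open>Root systems\<close>

definition cartan_number :: "'v::euclidean_space \<Rightarrow> 'v \<Rightarrow> real" where
  "cartan_number \<beta> \<alpha> = 2 * (\<beta> \<bullet> \<alpha>) / (\<alpha> \<bullet> \<alpha>)"

definition reflection :: "'v::euclidean_space \<Rightarrow> 'v \<Rightarrow> 'v" where
  "reflection \<alpha> \<beta> = \<beta> - cartan_number \<beta> \<alpha> *\<^sub>R \<alpha>"

text \<open>Root systems are reduced and crystallographic, and span the ambient Euclidean space.\<close>

definition root_system :: "'v::euclidean_space set \<Rightarrow> bool" where
  "root_system \<Phi> \<longleftrightarrow>
     finite \<Phi> \<and> 0 \<notin> \<Phi> \<and> span \<Phi> = UNIV \<and>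
     (\<forall>\<alpha>\<in>\<Phi>. \<forall>c. c *\<^sub>R \<alpha> \<in> \<Phi> \<longrightarrow> c = 1 \<or> c = - 1) \<and>
     (\<forall>\<alpha>\<in>\<Phi>. \<forall>\<beta>\<in>\<Phi>. reflection \<alpha> \<beta> \<in> \<Phi>) \<and>
     (\<forall>\<alpha>\<in>\<Phi>. \<forall>\<beta>\<in>\<Phi>. cartan_number \<beta> \<alpha> \<in> \<int>)"

text \<open>The two parts of an orthogonal decomposition are disjoint, since roots are nonzero.\<close>

definition irreducible_roots :: "'v::euclidean_space set \<Rightarrow> bool" where
  "irreducible_roots \<Phi> \<longleftrightarrow> \<Phi> \<noteq> {} \<and>
     \<not> (\<exists>\<Psi> \<Psi>'. \<Psi> \<noteq> {} \<and> \<Psi>' \<noteq> {} \<and> \<Psi> \<union> \<Psi>' = \<Phi> \<and> (\<forall>\<alpha>\<in>\<Psi>. \<forall>\<beta>\<in>\<Psi>'. \<alpha> \<bullet> \<beta> = 0))"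

text \<open>For irreducible systems: all roots have the same length.\<close>

definition simply_laced :: "'v::euclidean_space set \<Rightarrow> bool" where
  "simply_laced \<Phi> \<longleftrightarrow> (\<forall>\<alpha>\<in>\<Phi>. \<forall>\<beta>\<in>\<Phi>. norm \<alpha> = norm \<beta>)"

definition simple_roots :: "'v::euclidean_space set \<Rightarrow> 'v set \<Rightarrow> bool" where
  "simple_roots \<Phi> \<Delta> \<longleftrightarrow> \<Delta> \<subseteq> \<Phi> \<and> independent \<Delta> \<and> span \<Delta> = UNIV \<and>
     (\<forall>\<beta>\<in>\<Phi>. \<exists>k :: 'v \<Rightarrow> int. \<beta> = (\<Sum>\<alpha>\<in>\<Delta>. real_of_int (k \<alpha>) *\<^sub>R \<alpha>) \<and>
        ((\<forall>\<alpha>\<in>\<Delta>. 0 \<le> k \<alpha>) \<or> (\<forall>\<alpha>\<in>\<Delta>. k \<alpha> \<le> 0)))"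


section \<open>Lie algebras and Chevalley bases\<close>

locale lie_algebra = vector_space scale
  for scale :: "'k::field \<Rightarrow> 'l::ab_group_add \<Rightarrow> 'l" +
  fixes brk :: "'l \<Rightarrow> 'l \<Rightarrow> 'l"
  assumes brk_add_left: "brk (x + y) z = brk x z + brk y z"
    and brk_add_right: "brk x (y + z) = brk x y + brk x z"
    and brk_scale_left: "brk (scale c x) y = scale c (brk x y)"
    and brk_scale_right: "brk x (scale c y) = scale c (brk x y)"
    and brk_self: "brk x x = 0"
    and jacobi: "brk x (brk y z) + brk y (brk z x) + brk z (brk x y) = 0"

locale simple_lie_algebra = lie_algebra scale brk
  for scale :: "'k::field \<Rightarrow> 'l::ab_group_add \<Rightarrow> 'l" and brk +
  assumes nonabelian: "\<exists>x y. brk x y \<noteq> 0"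
    and no_proper_ideal: "subspace I \<Longrightarrow> (\<And>x y. y \<in> I \<Longrightarrow> brk x y \<in> I) \<Longrightarrow> I = {0} \<or> I = UNIV"

text \<open>
  A Chevalley basis of a complex simple Lie algebra with root system \<open>\<Phi>\<close>: the span of
  \<open>h ` \<Delta>\<close> is the Cartan subalgebra, \<open>h \<alpha>\<close> is the coroot of \<open>\<alpha>\<close> and \<open>e \<alpha>\<close> spans the root space
  of \<open>\<alpha>\<close>. The structure constants are \<open>N \<alpha> \<beta> = \<plusminus>(p + 1)\<close>, where \<open>p\<close> is the greatest integer such
  that \<open>\<beta> - p \<alpha>\<close> is a root; for simply-laced \<open>\<Phi>\<close> this reads \<open>N \<alpha> \<beta> = \<plusminus>1\<close>. The values of
  \<open>N \<alpha> \<beta>\<close> are unconstrained if \<open>\<alpha>\<close>, \<open>\<beta>\<close> and \<open>\<alpha> + \<beta>\<close> are not all roots.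
\<close>

locale chevalley_basis = simple_lie_algebra scale brk
  for scale :: "complex \<Rightarrow> 'l::ab_group_add \<Rightarrow> 'l" and brk +
  fixes \<Phi> \<Delta> :: "'v::euclidean_space set"
    and h e :: "'v \<Rightarrow> 'l"
    and N :: "'v \<Rightarrow> 'v \<Rightarrow> int"
  assumes simple_roots: "simple_roots \<Phi> \<Delta>"
    and inj_h: "inj_on h \<Delta>"
    and inj_e: "inj_on e \<Phi>"
    and disjoint: "h ` \<Delta> \<inter> e ` \<Phi> = {}"
    and independent_basis: "independent (h ` \<Delta> \<union> e ` \<Phi>)"
    and span_basis: "span (h ` \<Delta> \<union> e ` \<Phi>) = UNIV"
    and brk_h_h: "\<lbrakk>\<alpha> \<in> \<Phi>; \<beta> \<in> \<Phi>\<rbrakk> \<Longrightarrow> brk (h \<alpha>) (h \<beta>) = 0"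
    and brk_h_e: "\<lbrakk>\<alpha> \<in> \<Phi>; \<beta> \<in> \<Phi>\<rbrakk> \<Longrightarrow>
           brk (h \<alpha>) (e \<beta>) = scale (of_real (cartan_number \<beta> \<alpha>)) (e \<beta>)"
    and brk_e_minus: "\<alpha> \<in> \<Phi> \<Longrightarrow> brk (e \<alpha>) (e (- \<alpha>)) = h \<alpha>"
    and brk_e_zero: "\<lbrakk>\<alpha> \<in> \<Phi>; \<beta> \<in> \<Phi>; \<alpha> + \<beta> \<notin> \<Phi> \<union> {0}\<rbrakk> \<Longrightarrow> brk (e \<alpha>) (e \<beta>) = 0"
    and brk_e_e: "\<lbrakk>\<alpha> \<in> \<Phi>; \<beta> \<in> \<Phi>; \<alpha> + \<beta> \<in> \<Phi>\<rbrakk> \<Longrightarrow>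
           brk (e \<alpha>) (e \<beta>) = scale (of_int (N \<alpha> \<beta>)) (e (\<alpha> + \<beta>))"
    and abs_N: "\<lbrakk>\<alpha> \<in> \<Phi>; \<beta> \<in> \<Phi>; \<alpha> + \<beta> \<in> \<Phi>\<rbrakk> \<Longrightarrow>
           \<bar>N \<alpha> \<beta>\<bar> = int (GREATEST p. \<beta> - real p *\<^sub>R \<alpha> \<in> \<Phi>) + 1"


section \<open>Groups given by generators and relations\<close>

text \<open>
  The letter \<open>(x, True)\<close> stands for the generator \<open>x\<close> and \<open>(x, False)\<close> for its formal inverse; a
  relation \<open>u = v\<close> is the pair of words \<open>(u, v)\<close>.
\<close>

type_synonym 'g word = "('g \<times> bool) list"

definition words :: "'g set \<Rightarrow> 'g word set" where
  "words X = lists (X \<times> UNIV)"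

definition gen :: "'g \<Rightarrow> 'g word" where
  "gen x = [(x, True)]"

definition gen_inv :: "'g \<Rightarrow> 'g word" where
  "gen_inv x = [(x, False)]"

inductive_set pres_rel :: "'g set \<Rightarrow> ('g word \<times> 'g word) set \<Rightarrow> ('g word \<times> 'g word) set"
  for X E where
  refl: "w \<in> words X \<Longrightarrow> (w, w) \<in> pres_rel X E"
| sym: "(u, v) \<in> pres_rel X E \<Longrightarrow> (v, u) \<in> pres_rel X E"
| trans: "(u, v) \<in> pres_rel X E \<Longrightarrow> (v, w) \<in> pres_rel X E \<Longrightarrow> (u, w) \<in> pres_rel X E"
| cancel: "\<lbrakk>u \<in> words X; v \<in> words X; x \<in> X\<rbrakk> \<Longrightarrow>
    (u @ [(x, b), (x, \<not> b)] @ v, u @ v) \<in> pres_rel X E"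
| relation: "\<lbrakk>u \<in> words X; v \<in> words X; r \<in> words X; s \<in> words X; (r, s) \<in> E\<rbrakk> \<Longrightarrow>
    (u @ r @ v, u @ s @ v) \<in> pres_rel X E"

definition presented_group :: "'g set \<Rightarrow> ('g word \<times> 'g word) set \<Rightarrow> 'g word set monoid" where
  "presented_group X E =
     \<lparr>carrier = words X // pres_rel X E,
      monoid.mult = (\<lambda>P Q. \<Union>u\<in>P. \<Union>v\<in>Q. pres_rel X E `` {u @ v}),
      one = pres_rel X E `` {[]}\<rparr>"


section \<open>Steinberg groups\<close>

text \<open>
  Commutators are \<open>x y x\<inverse> y\<inverse>\<close>. With \<open>x\<inverse> y\<inverse> x y\<close> the relations below present the same group: the
  commutators that occur are trivial or commute with both arguments, as \<open>2\<alpha> + \<beta>\<close> and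
  \<open>\<alpha> + 2\<beta>\<close> are neither roots nor zero in the simply-laced case.
\<close>

definition comm_word :: "'g \<Rightarrow> 'g \<Rightarrow> 'g word" where
  "comm_word x y = gen x @ gen y @ gen_inv x @ gen_inv y"

definition steinberg_gens :: "'v set \<Rightarrow> ('r, 'm) ring_scheme \<Rightarrow> ('v \<times> 'r) set" where
  "steinberg_gens \<Phi> R = \<Phi> \<times> carrier R"

definition steinberg_rels ::
  "'v::euclidean_space set \<Rightarrow> ('v \<Rightarrow> 'v \<Rightarrow> int) \<Rightarrow> ('r, 'm) ring_scheme
     \<Rightarrow> (('v \<times> 'r) word \<times> ('v \<times> 'r) word) set" where
  "steinberg_rels \<Phi> N R =
     {(gen (\<alpha>, a) @ gen (\<alpha>, b), gen (\<alpha>, a \<oplus>\<^bsub>R\<^esub> b)) | \<alpha> a b.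
        \<alpha> \<in> \<Phi> \<and> a \<in> carrier R \<and> b \<in> carrier R}
   \<union> {(comm_word (\<alpha>, a) (\<beta>, b), []) | \<alpha> \<beta> a b.
        \<alpha> \<in> \<Phi> \<and> \<beta> \<in> \<Phi> \<and> a \<in> carrier R \<and> b \<in> carrier R \<and> \<alpha> + \<beta> \<notin> \<Phi> \<union> {0}}
   \<union> {(comm_word (\<alpha>, a) (\<beta>, b), gen (\<alpha> + \<beta>, [N \<alpha> \<beta>] \<cdot>\<^bsub>R\<^esub> (a \<otimes>\<^bsub>R\<^esub> b))) | \<alpha> \<beta> a b.
        \<alpha> \<in> \<Phi> \<and> \<beta> \<in> \<Phi> \<and> a \<in> carrier R \<and> b \<in> carrier R \<and> \<alpha> + \<beta> \<in> \<Phi>}"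

definition steinberg ::
  "'v::euclidean_space set \<Rightarrow> ('v \<Rightarrow> 'v \<Rightarrow> int) \<Rightarrow> ('r, 'm) ring_scheme
     \<Rightarrow> ('v \<times> 'r) word set monoid" where
  "steinberg \<Phi> N R = presented_group (steinberg_gens \<Phi> R) (steinberg_rels \<Phi> N R)"

text \<open>The homomorphism induced by a ring homomorphism \<open>f\<close> into \<open>S\<close>: it sends the generator
  \<open>(\<alpha>, \<xi>)\<close> to \<open>(\<alpha>, f \<xi>)\<close>.\<close>

definition steinberg_map ::
  "'v::euclidean_space set \<Rightarrow> ('v \<Rightarrow> 'v \<Rightarrow> int) \<Rightarrow> ('s, 'm) ring_scheme \<Rightarrow> ('r \<Rightarrow> 's)
     \<Rightarrow> ('v \<times> 'r) word set \<Rightarrow> ('v \<times> 's) word set" where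
  "steinberg_map \<Phi> N S f P =
     (\<Union>w\<in>P. pres_rel (steinberg_gens \<Phi> S) (steinberg_rels \<Phi> N S) ``
               {map (\<lambda>((\<alpha>, \<xi>), s). ((\<alpha>, f \<xi>), s)) w})"


section \<open>Localization\<close>

definition loc_rel :: "('a, 'm) ring_scheme \<Rightarrow> 'a set \<Rightarrow> (('a \<times> 'a) \<times> ('a \<times> 'a)) set" where
  "loc_rel R S = {((a, s), (b, t)). a \<in> carrier R \<and> s \<in> S \<and> b \<in> carrier R \<and> t \<in> S \<and>
     (\<exists>u\<in>S. u \<otimes>\<^bsub>R\<^esub> (t \<otimes>\<^bsub>R\<^esub> a) = u \<otimes>\<^bsub>R\<^esub> (s \<otimes>\<^bsub>R\<^esub> b))}"

definition loc_frac :: "('a, 'm) ring_scheme \<Rightarrow> 'a set \<Rightarrow> 'a \<Rightarrow> 'a \<Rightarrow> ('a \<times> 'a) set" where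
  "loc_frac R S a s = loc_rel R S `` {(a, s)}"

definition localization :: "('a, 'm) ring_scheme \<Rightarrow> 'a set \<Rightarrow> ('a \<times> 'a) set ring" where
  "localization R S =
     \<lparr>carrier = (carrier R \<times> S) // loc_rel R S,
      monoid.mult = (\<lambda>P Q. \<Union>(a, s)\<in>P. \<Union>(b, t)\<in>Q. loc_frac R S (a \<otimes>\<^bsub>R\<^esub> b) (s \<otimes>\<^bsub>R\<^esub> t)),
      one = loc_frac R S \<one>\<^bsub>R\<^esub> \<one>\<^bsub>R\<^esub>,
      zero = loc_frac R S \<zero>\<^bsub>R\<^esub> \<one>\<^bsub>R\<^esub>,
      ring.add = (\<lambda>P Q. \<Union>(a, s)\<in>P. \<Union>(b, t)\<in>Q.
               loc_frac R S ((t \<otimes>\<^bsub>R\<^esub> a) \<oplus>\<^bsub>R\<^esub> (s \<otimes>\<^bsub>R\<^esub> b)) (s \<otimes>\<^bsub>R\<^esub> t))\<rparr>"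

definition powers :: "('a, 'm) ring_scheme \<Rightarrow> 'a \<Rightarrow> 'a set" where
  "powers R h = {h [^]\<^bsub>R\<^esub> n | n :: nat. True}"

definition loc_at :: "('a, 'm) ring_scheme \<Rightarrow> 'a \<Rightarrow> ('a \<times> 'a) set ring" where
  "loc_at R h = localization R (powers R h)"

definition loc_hom :: "('a, 'm) ring_scheme \<Rightarrow> 'a \<Rightarrow> 'a \<Rightarrow> ('a \<times> 'a) set" where
  "loc_hom R h a = loc_frac R (powers R h) a \<one>\<^bsub>R\<^esub>"

text \<open>For a ring homomorphism \<open>f\<close> into \<open>R'\<close>, the induced map from \<open>loc_at R h\<close> to
  \<open>loc_at R' (f h)\<close>.\<close>

definition loc_map :: "('b, 'm) ring_scheme \<Rightarrow> 'b \<Rightarrow> ('a \<Rightarrow> 'b) \<Rightarrow> ('a \<times> 'a) set \<Rightarrow> ('b \<times> 'b) set"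
  where "loc_map R' h' f P = (\<Union>(a, s)\<in>P. loc_frac R' (powers R' h') (f a) (f s))"


section \<open>Pullbacks of groups\<close>

definition pullback ::
  "('a, 'm) monoid_scheme \<Rightarrow> ('b, 'n) monoid_scheme \<Rightarrow> ('a \<Rightarrow> 'c) \<Rightarrow> ('b \<Rightarrow> 'c) \<Rightarrow> ('a \<times> 'b) monoid"
  where "pullback G H \<phi> \<psi> =
    (G \<times>\<times> H)\<lparr>carrier := {(x, y). x \<in> carrier G \<and> y \<in> carrier H \<and> \<phi> x = \<psi> y}\<rparr>"

end

theory Submission
  imports Defs "HOL-Algebra.Subrings"
begin

text \<open>
  Everything takes place inside \<open>K = A\<^sub>h\<close>: the hypothesis on \<open>B/hB\<close> and \<open>A/hA\<close> says that
  \<open>A \<inter> B\<^sub>h = B\<close> and \<open>K = B\<^sub>h + h\<^sup>n A\<close> for all \<open>n\<close>. Let \<open>St K\<close> act on the set \<open>V\<close> of the pairs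
  \<open>(g, y)\<close> in \<open>St B\<^sub>h \<times> St A\<close>, modulo \<open>(g w, y) \<sim> (g, w y)\<close> for \<open>w\<close> in \<open>St B\<close>, as follows: for
  \<open>b\<close> in \<open>B\<^sub>h\<close> and sufficiently divisible \<open>a\<close> in \<open>A\<close>, the generator \<open>x \<alpha> (b + a)\<close> sends \<open>(g, y)\<close>
  to \<open>(x \<alpha> b \<cdot> g, (g\<inverse> x \<alpha> a g) \<cdot> y)\<close>. If \<open>g\<close> in \<open>St B\<^sub>h\<close> and \<open>y\<close> in \<open>St A\<close> agree in \<open>St K\<close>, they
  send \<open>(1, 1)\<close> to the same point of \<open>V\<close>, and these two points are \<open>(g, 1)\<close> and \<open>(1, y)\<close>, so that
  both elements come from the same \<open>w\<close> in \<open>St B\<close>.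

  The conjugate \<open>g\<inverse> x \<alpha> a g\<close> has to be made sense of in \<open>St A\<close>. For this, \<open>St B\<^sub>h\<close> acts on germs of
  families \<open>y \<rho> a\<close> that satisfy the Steinberg relations for all parameters divisible by a large power
  of \<open>h\<close>. The commutator formula defines the conjugate of such a family under \<open>x \<alpha> \<xi>\<close> at all roots
  except \<open>- \<alpha>\<close>. There, the value at \<open>s t\<close> is the commutator of the values at \<open>s\<close> and \<open>t\<close> for roots
  \<open>\<beta>\<close>, \<open>\<gamma>\<close> with \<open>\<beta> + \<gamma> = - \<alpha>\<close>; in rank at least \<open>3\<close> it does not depend on \<open>\<beta>\<close> and \<open>\<gamma>\<close>.
\<close>

section \<open>Simply-laced root systems\<close>

text \<open>The conjugate has to be built in \<open>St A\<close> itself: the proof has no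
  injectivity of \<open>St A\<close> into \<open>St K\<close> at its disposal, so a computation in
  \<open>St K\<close> would not determine it. Only sufficiently deep parameters have a conjugate,
  and the depth depends on the conjugating element. Hence families count only as germs, and the
  arbitrary choices made on the way are harmless only up to equality of germs and up to the
  equivalence on \<open>V\<close>. The rank enters through one fact: every root of the plane of two
  roots is a sum of two roots outside it. So a germ is determined by its values off such a plane. A
  relation between the conjugations by \<open>x \<alpha> \<xi>\<close> and
  \<open>x \<beta> \<zeta>\<close> is therefore checked only off the plane of \<alpha> and \<beta>;
  there, adding \<alpha> and \<beta> never leads to an opposite root, and the commutator formula
  always applies. A pair \<open>(g, y)\<close> of \<open>V\<close> stands for the formal product of
  \<open>g\<close> and \<open>y\<close>, and the action is left multiplication: \<open>x \<alpha> (b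
  + a) g y = (x \<alpha> b g) (g^-1 x \<alpha> a g) y\<close>.\<close>

locale simply_laced_roots =
  fixes \<Phi> :: "'v::euclidean_space set"
  assumes root_system: "root_system \<Phi>"
    and irreducible: "irreducible_roots \<Phi>"
    and simply_laced: "simply_laced \<Phi>"
    and rank: "dim \<Phi> \<ge> 3"
begin

definition sqlen :: real where
  "sqlen = (SOME r. \<exists>\<alpha>\<in>\<Phi>. r = \<alpha> \<bullet> \<alpha>)"

text \<open>\<open>cartan_number\<close> is linear in its first argument only. Dividing by the
  common squared length gives a symmetric bilinear form on all vectors that agrees with it when the
  second argument is a root.\<close>

definition pair :: "'v \<Rightarrow> 'v \<Rightarrow> real" where
  "pair x y = 2 * (x \<bullet> y) / sqlen"

lemma zero_notin: "0 \<notin> \<Phi>"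
  using root_system by (simp add: root_system_def)

lemma inner_root_self: "\<alpha> \<in> \<Phi> \<Longrightarrow> \<alpha> \<bullet> \<alpha> = sqlen"
proof -
  assume a: "\<alpha> \<in> \<Phi>"
  have "\<exists>r. \<exists>\<alpha>\<in>\<Phi>. r = \<alpha> \<bullet> \<alpha>" using a by blast
  then have "\<exists>\<beta>\<in>\<Phi>. sqlen = \<beta> \<bullet> \<beta>" unfolding sqlen_def by (rule someI_ex)
  then obtain \<beta> where "\<beta> \<in> \<Phi>" "sqlen = \<beta> \<bullet> \<beta>" by blast
  moreover have "norm \<alpha> = norm \<beta>" using simply_laced a \<open>\<beta> \<in> \<Phi>\<close> unfolding simply_laced_def by blast
  ultimately show ?thesis by (metis dot_square_norm)
qed

lemma roots_nonempty: "\<Phi> \<noteq> {}"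
  using irreducible by (simp add: irreducible_roots_def)

lemma sqlen_pos: "sqlen > 0"
  using roots_nonempty zero_notin inner_root_self by (metis all_not_in_conv inner_gt_zero_iff)

lemma pair_add_left: "pair (x + y) z = pair x z + pair y z"
  and pair_add_right: "pair x (y + z) = pair x y + pair x z"
  and pair_diff_left: "pair (x - y) z = pair x z - pair y z"
  and pair_diff_right: "pair x (y - z) = pair x y - pair x z"
  and pair_minus_left: "pair (- x) z = - pair x z"
  and pair_minus_right: "pair x (- z) = - pair x z"
  and pair_zero_left: "pair 0 z = 0"
  and pair_zero_right: "pair x 0 = 0"
  by (simp_all add: pair_def inner_add_left inner_add_right inner_diff_left inner_diff_right
      add_divide_distrib diff_divide_distrib algebra_simps)

lemma pair_scaleR_left: "pair (c *\<^sub>R x) y = c * pair x y"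
  and pair_scaleR_right: "pair x (c *\<^sub>R y) = c * pair x y"
  by (simp_all add: pair_def)

lemmas pair_simps = pair_add_left pair_add_right pair_diff_left pair_diff_right
  pair_minus_left pair_minus_right pair_zero_left pair_zero_right

lemma pair_commute: "pair x y = pair y x"
  by (simp add: pair_def inner_commute)

lemma pair_self: "\<alpha> \<in> \<Phi> \<Longrightarrow> pair \<alpha> \<alpha> = 2"
  using sqlen_pos by (simp add: pair_def inner_root_self)

lemma pair_eq_cartan: "\<alpha> \<in> \<Phi> \<Longrightarrow> pair x \<alpha> = cartan_number x \<alpha>"
  by (simp add: pair_def cartan_number_def inner_root_self)

lemma reflection_in: "\<alpha> \<in> \<Phi> \<Longrightarrow> \<beta> \<in> \<Phi> \<Longrightarrow> \<beta> - pair \<beta> \<alpha> *\<^sub>R \<alpha> \<in> \<Phi>"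
  using root_system by (simp add: root_system_def reflection_def pair_eq_cartan)

lemma minus_in: "\<alpha> \<in> \<Phi> \<Longrightarrow> - \<alpha> \<in> \<Phi>"
  using reflection_in[of \<alpha> \<alpha>] by (simp add: pair_self scaleR_2)

lemma pair_self_zero: "pair x x = 0 \<Longrightarrow> x = 0"
  using sqlen_pos by (simp add: pair_def)

lemma pair_self_nonneg: "pair x x \<ge> 0"
  using sqlen_pos by (simp add: pair_def)

text \<open>The normalized squares of \<alpha> + \<beta> and \<alpha> - \<beta> are
  \<open>4 + 2 pair \<alpha> \<beta>\<close> and \<open>4 - 2 pair \<alpha> \<beta>\<close>. Their
  nonnegativity replaces the Cauchy-Schwarz inequality, and integrality leaves five values.\<close>

lemma pair_cases:
  assumes "\<alpha> \<in> \<Phi>" "\<beta> \<in> \<Phi>"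
  shows "pair \<alpha> \<beta> = -2 \<or> pair \<alpha> \<beta> = -1 \<or> pair \<alpha> \<beta> = 0 \<or> pair \<alpha> \<beta> = 1 \<or> pair \<alpha> \<beta> = 2"
proof -
  have "pair \<alpha> \<beta> \<in> \<int>"
    using root_system assms by (simp add: root_system_def pair_eq_cartan)
  then obtain k :: int where k: "pair \<alpha> \<beta> = of_int k" by (auto elim: Ints_cases)
  have "pair (\<alpha> + \<beta>) (\<alpha> + \<beta>) \<ge> 0" "pair (\<alpha> - \<beta>) (\<alpha> - \<beta>) \<ge> 0"
    by (rule pair_self_nonneg)+
  then have "real_of_int k \<ge> -2" "real_of_int k \<le> 2"
    using k assms by (simp_all add: pair_simps pair_self pair_commute[of \<beta> \<alpha>])
  then have "k \<ge> -2" "k \<le> 2" by linarith+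
  then have "k = -2 \<or> k = -1 \<or> k = 0 \<or> k = 1 \<or> k = 2" by presburger
  then show ?thesis using k by auto
qed

text \<open>A sum of two roots has normalized square \<open>4 + 2 pair \<alpha> \<beta>\<close>, a
  root has 2; conversely, a reflection produces the sum. From here on, linear arithmetic with
  \<open>pair\<close> decides whether a sum of roots is a root.\<close>

lemma add_root_iff:
  assumes "\<alpha> \<in> \<Phi>" "\<beta> \<in> \<Phi>"
  shows "\<alpha> + \<beta> \<in> \<Phi> \<longleftrightarrow> pair \<alpha> \<beta> = -1"
proof
  assume "\<alpha> + \<beta> \<in> \<Phi>"
  then have "pair (\<alpha> + \<beta>) (\<alpha> + \<beta>) = 2" by (rule pair_self)
  then show "pair \<alpha> \<beta> = -1"
    using assms by (simp add: pair_simps pair_self pair_commute[of \<beta> \<alpha>])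
next
  assume "pair \<alpha> \<beta> = -1"
  then show "\<alpha> + \<beta> \<in> \<Phi>" using reflection_in[OF assms(2,1)] by simp
qed

lemma add_zero_iff:
  assumes "\<alpha> \<in> \<Phi>" "\<beta> \<in> \<Phi>"
  shows "\<alpha> + \<beta> = 0 \<longleftrightarrow> pair \<alpha> \<beta> = -2"
proof
  assume "\<alpha> + \<beta> = 0"
  then have "\<beta> = - \<alpha>" by (simp add: eq_neg_iff_add_eq_0 add.commute)
  then show "pair \<alpha> \<beta> = -2" using assms by (simp add: pair_simps pair_self)
next
  assume "pair \<alpha> \<beta> = -2"
  then have "pair (\<alpha> + \<beta>) (\<alpha> + \<beta>) = 0"
    using assms by (simp add: pair_simps pair_self pair_commute[of \<beta> \<alpha>])
  then show "\<alpha> + \<beta> = 0" by (rule pair_self_zero)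
qed

lemma eq_iff_pair:
  assumes "\<alpha> \<in> \<Phi>" "\<beta> \<in> \<Phi>"
  shows "\<alpha> = \<beta> \<longleftrightarrow> pair \<alpha> \<beta> = 2"
  using add_zero_iff[OF assms(1) minus_in[OF assms(2)]] by (simp add: pair_simps)

lemma diff_root_iff:
  assumes "\<alpha> \<in> \<Phi>" "\<beta> \<in> \<Phi>"
  shows "\<alpha> - \<beta> \<in> \<Phi> \<longleftrightarrow> pair \<alpha> \<beta> = 1"
  using add_root_iff[OF assms(1) minus_in[OF assms(2)]] by (simp add: pair_simps)

lemma pair_ge_minus_one:
  assumes "\<alpha> \<in> \<Phi>" "\<beta> \<in> \<Phi>" "\<alpha> + \<beta> \<noteq> 0"
  shows "pair \<alpha> \<beta> \<ge> -1"
proof -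
  have "pair \<alpha> \<beta> \<noteq> -2" using add_zero_iff assms by blast
  then show ?thesis using pair_cases[OF assms(1,2)] by (elim disjE) simp_all
qed

lemma pair_nonneg:
  assumes "\<alpha> \<in> \<Phi>" "\<beta> \<in> \<Phi>" "\<alpha> + \<beta> \<noteq> 0" "\<alpha> + \<beta> \<notin> \<Phi>"
  shows "pair \<alpha> \<beta> \<ge> 0"
proof -
  have "pair \<alpha> \<beta> \<noteq> -2" "pair \<alpha> \<beta> \<noteq> -1" using add_zero_iff add_root_iff assms by blast+
  then show ?thesis using pair_cases[OF assms(1,2)] by (elim disjE) simp_all
qed

section \<open>Roots outside a plane\<close>

lemma connected:
  assumes "\<Psi> \<subseteq> \<Phi>" "\<Psi> \<noteq> {}" "\<Psi> \<noteq> \<Phi>"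
  obtains \<alpha> \<beta> where "\<alpha> \<in> \<Psi>" "\<beta> \<in> \<Phi> - \<Psi>" "pair \<alpha> \<beta> \<noteq> 0"
proof -
  have "\<not> (\<Psi> \<noteq> {} \<and> \<Phi> - \<Psi> \<noteq> {} \<and> \<Psi> \<union> (\<Phi> - \<Psi>) = \<Phi> \<and> (\<forall>\<alpha>\<in>\<Psi>. \<forall>\<beta>\<in>\<Phi>-\<Psi>. \<alpha> \<bullet> \<beta> = 0))"
    using irreducible unfolding irreducible_roots_def by metis
  moreover have "\<Phi> - \<Psi> \<noteq> {}" "\<Psi> \<union> (\<Phi> - \<Psi>) = \<Phi>" using assms by auto
  ultimately have "\<exists>\<alpha>\<in>\<Psi>. \<exists>\<beta>\<in>\<Phi>-\<Psi>. \<alpha> \<bullet> \<beta> \<noteq> 0" using assms(2) by simp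
  then obtain \<alpha> \<beta> where "\<alpha> \<in> \<Psi>" "\<beta> \<in> \<Phi> - \<Psi>" "\<alpha> \<bullet> \<beta> \<noteq> 0" by blast
  moreover from this(3) have "pair \<alpha> \<beta> \<noteq> 0" using sqlen_pos by (simp add: pair_def)
  ultimately show thesis by (intro that)
qed

text \<open>Irreducibility gives a root \<epsilon> other than \<delta> and -\<delta> that is not
  orthogonal to \<delta>. If \<epsilon> lies in \<open>P\<close>, then \<delta> and \<epsilon> span
  \<open>P\<close>, and irreducibility gives a root \<gamma> outside \<open>P\<close> that is not
  orthogonal to \<open>P\<close>. If \<gamma> happens to be orthogonal to \<delta>, its reflection
  along \<epsilon> is not, and it still lies outside \<open>P\<close>.\<close>

lemma exists_off_subspace_aux:
  assumes "subspace P" "dim P \<le> 2" "\<delta> \<in> \<Phi>" "\<delta> \<in> P"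
  shows "\<exists>\<beta>\<in>\<Phi>. \<beta> \<notin> P \<and> pair \<delta> \<beta> \<noteq> 0"
proof -
  have notsub: "\<not> \<Phi> \<subseteq> P"
  proof
    assume "\<Phi> \<subseteq> P"
    then have "dim \<Phi> \<le> dim P" by (rule dim_subset)
    then show False using rank assms(2) by simp
  qed
  have D: "{\<delta>, - \<delta>} \<noteq> \<Phi>"
  proof
    assume "{\<delta>, - \<delta>} = \<Phi>"
    moreover have "- \<delta> \<in> P" using assms by (simp add: subspace_neg)
    ultimately have "\<Phi> \<subseteq> P" using assms(4) by blast
    then show False using notsub by simp
  qed
  obtain \<alpha> \<epsilon> where "\<alpha> \<in> {\<delta>, - \<delta>}" "\<epsilon> \<in> \<Phi> - {\<delta>, - \<delta>}" "pair \<alpha> \<epsilon> \<noteq> 0"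
    using connected[of "{\<delta>, - \<delta>}"] D assms(3) minus_in by auto
  then have \<epsilon>: "\<epsilon> \<in> \<Phi>" "\<epsilon> \<noteq> \<delta>" "\<epsilon> \<noteq> - \<delta>" "pair \<delta> \<epsilon> \<noteq> 0"
    by (auto simp: pair_simps)
  show ?thesis
  proof (cases "\<epsilon> \<in> P")
    case False
    then show ?thesis using \<epsilon> by blast
  next
    case True
    have "\<Phi> \<inter> P \<noteq> {}" "\<Phi> \<inter> P \<noteq> \<Phi>" "\<Phi> \<inter> P \<subseteq> \<Phi>" using assms notsub by auto
    then obtain \<psi> \<gamma> where "\<psi> \<in> \<Phi> \<inter> P" "\<gamma> \<in> \<Phi> - \<Phi> \<inter> P" "pair \<psi> \<gamma> \<noteq> 0"
      by (meson connected)
    then have pg: "\<psi> \<in> P" "\<psi> \<in> \<Phi>" "\<gamma> \<in> \<Phi>" "\<gamma> \<notin> P" "pair \<psi> \<gamma> \<noteq> 0" by blast+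
    have ind: "independent {\<delta>, \<epsilon>}"
    proof -
      have "\<epsilon> \<notin> span {\<delta>}"
      proof
        assume "\<epsilon> \<in> span {\<delta>}"
        then obtain c where c: "\<epsilon> = c *\<^sub>R \<delta>" by (auto simp: span_singleton)
        then have "c *\<^sub>R \<delta> \<in> \<Phi>" using \<epsilon> by simp
        then have "c = 1 \<or> c = -1" using root_system assms(3) unfolding root_system_def by blast
        then show False using c \<epsilon> by auto
      qed
      moreover have "\<delta> \<noteq> 0" using assms(3) zero_notin by auto
      ultimately show ?thesis using \<epsilon>
        by (simp add: independent_insert insert_commute[of \<delta>])
    qed
    have "P \<subseteq> span {\<delta>, \<epsilon>}"
      by (rule card_ge_dim_independent) (use ind True assms \<epsilon> in \<open>auto\<close>)
    then have "\<psi> \<in> span {\<delta>, \<epsilon>}" using pg by blast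
    then obtain a b where "\<psi> - a *\<^sub>R \<delta> = b *\<^sub>R \<epsilon>"
      by (auto simp: span_insert span_singleton)
    then have psi: "\<psi> = a *\<^sub>R \<delta> + b *\<^sub>R \<epsilon>" by (simp add: algebra_simps)
    show ?thesis
    proof (cases "pair \<delta> \<gamma> = 0")
      case False
      then show ?thesis using pg by blast
    next
      case d0: True
      then have e: "pair \<epsilon> \<gamma> \<noteq> 0" using pg(5) psi by (auto simp: pair_simps pair_scaleR_left)
      let ?g = "\<gamma> - pair \<gamma> \<epsilon> *\<^sub>R \<epsilon>"
      have "?g \<in> \<Phi>" using reflection_in \<epsilon> pg by blast
      moreover have "?g \<notin> P"
      proof
        assume "?g \<in> P"
        then have "?g + pair \<gamma> \<epsilon> *\<^sub>R \<epsilon> \<in> P"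
          using True assms(1) by (intro subspace_add subspace_scale)
        then show False using pg(4) by simp
      qed
      moreover have "pair \<delta> ?g \<noteq> 0"
        using d0 e \<epsilon> by (simp add: pair_simps pair_scaleR_right pair_commute[of \<gamma> \<epsilon>])
      ultimately show ?thesis by blast
    qed
  qed
qed

lemma exists_off_subspace:
  assumes "subspace P" "dim P \<le> 2" "\<delta> \<in> \<Phi>" "\<delta> \<in> P"
  obtains \<beta> where "\<beta> \<in> \<Phi>" "\<beta> \<notin> P" "pair \<delta> \<beta> = -1"
proof -
  obtain \<beta> where b: "\<beta> \<in> \<Phi>" "\<beta> \<notin> P" "pair \<delta> \<beta> \<noteq> 0"
    using exists_off_subspace_aux[OF assms] by blast
  have ne: "\<beta> \<noteq> \<delta>" "\<beta> \<noteq> - \<delta>" using assms b by (auto simp: subspace_neg)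
  have "\<delta> + \<beta> \<noteq> 0" using ne(2) minus_unique[of \<delta> \<beta>] by blast
  then have "pair \<delta> \<beta> \<noteq> 2" "pair \<delta> \<beta> \<noteq> -2"
    using ne(1) eq_iff_pair[OF assms(3) b(1)] add_zero_iff[OF assms(3) b(1)] by metis+
  then consider "pair \<delta> \<beta> = -1" | "pair \<delta> \<beta> = 1"
    using pair_cases[OF assms(3) b(1)] b(3) by auto
  then show thesis
  proof cases
    case 1
    then show thesis using that b by blast
  next
    case 2
    then have 3: "pair \<delta> (- \<beta>) = -1" by (simp only: pair_minus_right)
    have 4: "- \<beta> \<notin> P"
    proof
      assume "- \<beta> \<in> P"
      then have "- (- \<beta>) \<in> P" by (rule subspace_neg[OF assms(1)])
      then show False using b(2) by simp
    qed
    show thesis by (rule that[OF minus_in[OF b(1)] 4 3])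
  qed
qed

lemma dim_span_pair: "dim (span {\<alpha>, \<beta> :: 'v}) \<le> 2"
proof -
  have "dim {\<alpha>, \<beta>} \<le> card {\<alpha>, \<beta>}" by (rule dim_le_card') simp
  also have "\<dots> \<le> 2" by (simp add: card_insert_if)
  finally show ?thesis by simp
qed

text \<open>A root \<beta> outside the plane with \<open>pair \<kappa> \<beta> = 1\<close> makes
  \<kappa> - \<beta> a root, which cannot lie in the plane either. All later uses of the rank go
  through this lemma.\<close>

lemma decomposition_off_plane:
  assumes "\<kappa> \<in> \<Phi>" "\<kappa> \<in> span {\<alpha>, \<delta>}"
  obtains \<beta> \<gamma> where "\<beta> \<in> \<Phi>" "\<gamma> \<in> \<Phi>" "\<beta> + \<gamma> = \<kappa>" "\<beta> \<notin> span {\<alpha>, \<delta>}" "\<gamma> \<notin> span {\<alpha>, \<delta>}"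
proof -
  let ?P = "span {\<alpha>, \<delta>}"
  have k: "- \<kappa> \<in> \<Phi>" "- \<kappa> \<in> ?P" using minus_in[OF assms(1)] span_neg[OF assms(2)] .
  obtain \<beta> where b: "\<beta> \<in> \<Phi>" "\<beta> \<notin> ?P" "pair (- \<kappa>) \<beta> = -1"
    using exists_off_subspace[OF subspace_span dim_span_pair k] by blast
  then have "pair \<kappa> \<beta> = 1" by (simp add: pair_simps)
  then have "\<kappa> - \<beta> \<in> \<Phi>" using diff_root_iff assms b by blast
  moreover have "\<kappa> - \<beta> \<notin> ?P" 
  proof
    assume "\<kappa> - \<beta> \<in> ?P"
    then have "\<kappa> - (\<kappa> - \<beta>) \<in> ?P" by (rule span_diff[OF assms(2)])
    then show False using b(2) by simp
  qed
  ultimately show thesis using that[of \<beta> "\<kappa> - \<beta>"] b by simp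
qed

end

section \<open>Structure constants\<close>

text \<open>These three laws are what the proof takes from the Chevalley basis. The Jacobi identity
  is stated for pairwise non-opposite roots, so that no element of the Cartan subalgebra occurs in
  it.\<close>

locale structure_constants = simply_laced_roots \<Phi>
  for \<Phi> :: "'v::euclidean_space set" +
  fixes N :: "'v \<Rightarrow> 'v \<Rightarrow> int"
  assumes N_sign: "\<lbrakk>\<alpha> \<in> \<Phi>; \<beta> \<in> \<Phi>; \<alpha> + \<beta> \<in> \<Phi>\<rbrakk> \<Longrightarrow> N \<alpha> \<beta> = 1 \<or> N \<alpha> \<beta> = -1"
    and N_antisym: "\<lbrakk>\<alpha> \<in> \<Phi>; \<beta> \<in> \<Phi>; \<alpha> + \<beta> \<in> \<Phi>\<rbrakk> \<Longrightarrow> N \<beta> \<alpha> = - N \<alpha> \<beta>"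
    and N_jacobi: "\<lbrakk>\<alpha> \<in> \<Phi>; \<beta> \<in> \<Phi>; \<gamma> \<in> \<Phi>; \<alpha> + \<beta> + \<gamma> \<in> \<Phi>;
        \<alpha> + \<beta> \<noteq> 0; \<beta> + \<gamma> \<noteq> 0; \<alpha> + \<gamma> \<noteq> 0\<rbrakk> \<Longrightarrow>
      (if \<beta> + \<gamma> \<in> \<Phi> then N \<beta> \<gamma> * N \<alpha> (\<beta> + \<gamma>) else 0)
      + (if \<alpha> + \<gamma> \<in> \<Phi> then N \<gamma> \<alpha> * N \<beta> (\<alpha> + \<gamma>) else 0)
      + (if \<alpha> + \<beta> \<in> \<Phi> then N \<alpha> \<beta> * N \<gamma> (\<alpha> + \<beta>) else 0) = 0"
begin

text \<open>Where \<alpha>, \<beta> and \<alpha> + \<beta> are not all roots, the values of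
  \<open>N\<close> are arbitrary. Putting zero there frees the Jacobi identity and the commutator
  formula from case distinctions.\<close>

definition N0 :: "'v \<Rightarrow> 'v \<Rightarrow> int" where
  "N0 \<alpha> \<beta> = (if \<alpha> \<in> \<Phi> \<and> \<beta> \<in> \<Phi> \<and> \<alpha> + \<beta> \<in> \<Phi> then N \<alpha> \<beta> else 0)"

lemma N0_eq: "\<lbrakk>\<alpha> \<in> \<Phi>; \<beta> \<in> \<Phi>; \<alpha> + \<beta> \<in> \<Phi>\<rbrakk> \<Longrightarrow> N0 \<alpha> \<beta> = N \<alpha> \<beta>"
  by (simp add: N0_def)

lemma N0_zero: "\<alpha> \<notin> \<Phi> \<or> \<beta> \<notin> \<Phi> \<or> \<alpha> + \<beta> \<notin> \<Phi> \<Longrightarrow> N0 \<alpha> \<beta> = 0"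
  by (auto simp: N0_def)

lemma N0_antisym: "N0 \<beta> \<alpha> = - N0 \<alpha> \<beta>"
  using N_antisym[of \<alpha> \<beta>] by (auto simp: N0_def add.commute)

lemma N0_sq: "\<lbrakk>\<alpha> \<in> \<Phi>; \<beta> \<in> \<Phi>; \<alpha> + \<beta> \<in> \<Phi>\<rbrakk> \<Longrightarrow> N0 \<alpha> \<beta> * N0 \<alpha> \<beta> = 1"
  using N_sign[of \<alpha> \<beta>] by (auto simp: N0_def)

text \<open>Jacobi identity in the form \<open>ad \<alpha> \<circ> ad \<beta> - ad \<beta> \<circ> ad \<alpha> = ad [\<alpha>, \<beta>]\<close>.\<close>

lemma N0_jacobi:
  assumes "\<alpha> \<in> \<Phi>" "\<beta> \<in> \<Phi>" "\<gamma> \<in> \<Phi>" "\<alpha> + \<beta> \<noteq> 0" "\<beta> + \<gamma> \<noteq> 0" "\<alpha> + \<gamma> \<noteq> 0"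
  shows "N0 \<alpha> (\<beta> + \<gamma>) * N0 \<beta> \<gamma> = N0 \<beta> (\<alpha> + \<gamma>) * N0 \<alpha> \<gamma> + N0 (\<alpha> + \<beta>) \<gamma> * N0 \<alpha> \<beta>"
proof (cases "\<alpha> + \<beta> + \<gamma> \<in> \<Phi>")
  case True
  have e: "\<alpha> + (\<beta> + \<gamma>) = \<alpha> + \<beta> + \<gamma>" "\<beta> + (\<alpha> + \<gamma>) = \<alpha> + \<beta> + \<gamma>" "\<gamma> + (\<alpha> + \<beta>) = \<alpha> + \<beta> + \<gamma>"
    by (simp_all add: algebra_simps)
  have "N0 \<beta> \<gamma> * N0 \<alpha> (\<beta> + \<gamma>) + N0 \<gamma> \<alpha> * N0 \<beta> (\<alpha> + \<gamma>) + N0 \<alpha> \<beta> * N0 \<gamma> (\<alpha> + \<beta>) = 0"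
  proof -
    have k: "N0 \<sigma> \<tau> * N0 \<rho> (\<sigma> + \<tau>) = (if \<sigma> + \<tau> \<in> \<Phi> then N \<sigma> \<tau> * N \<rho> (\<sigma> + \<tau>) else 0)"
      if "\<rho> \<in> \<Phi>" "\<sigma> \<in> \<Phi>" "\<tau> \<in> \<Phi>" "\<rho> + (\<sigma> + \<tau>) \<in> \<Phi>" for \<rho> \<sigma> \<tau>
      using that by (simp add: N0_def)
    show ?thesis
      using N_jacobi[OF assms(1-3) True assms(4-6)] k[of \<alpha> \<beta> \<gamma>] k[of \<beta> \<gamma> \<alpha>] k[of \<gamma> \<alpha> \<beta>] True assms(1-3)
      by (simp only: e add.commute[of \<gamma> \<alpha>] simp_thms if_True)
  qed
  moreover have "N0 \<gamma> \<alpha> = - N0 \<alpha> \<gamma>" "N0 \<gamma> (\<alpha> + \<beta>) = - N0 (\<alpha> + \<beta>) \<gamma>"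
    by (rule N0_antisym)+
  ultimately show ?thesis by (simp add: mult.commute)
next
  case False
  then have "N0 \<alpha> (\<beta> + \<gamma>) = 0" "N0 \<beta> (\<alpha> + \<gamma>) = 0" "N0 (\<alpha> + \<beta>) \<gamma> = 0"
    by (auto simp: N0_def algebra_simps)
  then show ?thesis by simp
qed

end

text \<open>As \<open>pair \<alpha> \<beta> = -1\<close>, the normalized square of \<beta> - r
  \<alpha> is \<open>2 + 2 r + 2 r r\<close>, and for nonnegative \<open>r\<close> this is 2 only if
  \<open>r = 0\<close>. This makes the structure constants signs.\<close>

lemma (in simply_laced_roots) no_string:
  assumes "\<alpha> \<in> \<Phi>" "\<beta> \<in> \<Phi>" "\<alpha> + \<beta> \<in> \<Phi>" "\<beta> - real p *\<^sub>R \<alpha> \<in> \<Phi>"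
  shows "p = 0"
proof -
  define r where "r = real p"
  have r0: "r \<ge> 0" by (simp add: r_def)
  have 1: "pair \<alpha> \<beta> = -1" "pair \<beta> \<alpha> = -1"
    using assms add_root_iff pair_commute by metis+
  have "pair (\<beta> - r *\<^sub>R \<alpha>) (\<beta> - r *\<^sub>R \<alpha>) = 2" unfolding r_def using assms(4) by (rule pair_self)
  then have "2 * r + 2 * r * r = 0"
    by (simp add: pair_simps pair_scaleR_left pair_scaleR_right 1 pair_self[OF assms(1)] pair_self[OF assms(2)]
        algebra_simps)
  then have "r * (1 + r) = 0" by (simp add: algebra_simps)
  then have "r = 0" using r0 by auto
  then show "p = 0" by (simp add: r_def)
qed

text \<open>Antisymmetry and the Jacobi identity of \<open>brk\<close> are compared at a single root
  vector, which is nonzero by independence of the basis, so that its coefficients can be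
  cancelled.\<close>

lemma (in chevalley_basis) structure_constants:
  assumes "simply_laced_roots \<Phi>"
  shows "structure_constants \<Phi> N"
proof -
  interpret R: simply_laced_roots \<Phi> by fact
  have brk_zero_left: "brk 0 x = 0" for x
    using brk_add_left[of 0 0 x] by (metis add_0_right add_left_cancel)
  have brk_zero_right: "brk x 0 = 0" for x
    using brk_add_right[of x 0 0] by (metis add_0_right add_left_cancel)
  have brk_anti: "brk y x = - brk x y" for x y
  proof -
    have "brk (x + y) (x + y) = 0" by (rule brk_self)
    then have "brk x y + brk y x = 0"
      unfolding brk_add_left brk_add_right by (simp add: brk_self add.commute)
    then show ?thesis by (simp only: minus_unique)
  qed
  have e_nz: "e \<alpha> \<noteq> 0" if "\<alpha> \<in> \<Phi>" for \<alpha>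
  proof
    assume "e \<alpha> = 0"
    then have "0 \<in> h ` \<Delta> \<union> e ` \<Phi>" using imageI[OF that, of e] by (metis UnI2)
    then have "dependent (h ` \<Delta> \<union> e ` \<Phi>)" by (rule dependent_zero)
    then show False using independent_basis by (rule notE[rotated])
  qed
  have e_cancel: "c = d" if "scale (of_int c) (e \<alpha>) = scale (of_int d) (e \<alpha>)" "\<alpha> \<in> \<Phi>" for c d :: int and \<alpha>
    proof -
    have "(of_int c :: complex) = of_int d" by (rule scale_right_imp_eq[OF e_nz[OF that(2)] that(1)])
    then show ?thesis by (rule of_int_eq_iff[THEN iffD1])
  qed
  show ?thesis
  proof (rule structure_constants.intro[OF R.simply_laced_roots_axioms], rule structure_constants_axioms.intro)
    fix \<alpha> \<beta> assume a: "\<alpha> \<in> \<Phi>" "\<beta> \<in> \<Phi>" "\<alpha> + \<beta> \<in> \<Phi>"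
    have "(GREATEST p. \<beta> - real p *\<^sub>R \<alpha> \<in> \<Phi>) = 0"
    proof (rule Greatest_equality)
      show "\<beta> - real 0 *\<^sub>R \<alpha> \<in> \<Phi>" using a by simp
      fix y assume "\<beta> - real y *\<^sub>R \<alpha> \<in> \<Phi>"
      then have "y = 0" by (rule R.no_string[OF a])
      then show "y \<le> 0" by simp
    qed
    then have "\<bar>N \<alpha> \<beta>\<bar> = int 0 + 1" using abs_N[OF a] by (rule subst)
    then show "N \<alpha> \<beta> = 1 \<or> N \<alpha> \<beta> = -1" by linarith
    have c: "\<beta> + \<alpha> = \<alpha> + \<beta>" by (rule add.commute)
    have "scale (of_int (N \<beta> \<alpha>)) (e (\<alpha> + \<beta>)) = brk (e \<beta>) (e \<alpha>)"
      by (rule brk_e_e[of \<beta> \<alpha>, unfolded c, OF a(2,1,3), symmetric])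
    also have "\<dots> = - brk (e \<alpha>) (e \<beta>)" by (rule brk_anti)
    also have "\<dots> = scale (of_int (- N \<alpha> \<beta>)) (e (\<alpha> + \<beta>))"
      unfolding brk_e_e[OF a] of_int_minus by (rule scale_minus_left[symmetric])
    finally show "N \<beta> \<alpha> = - N \<alpha> \<beta>" using e_cancel a(3) by blast
  next
    fix \<alpha> \<beta> \<gamma> assume a: "\<alpha> \<in> \<Phi>" "\<beta> \<in> \<Phi>" "\<gamma> \<in> \<Phi>" and s: "\<alpha> + \<beta> + \<gamma> \<in> \<Phi>"
      and n: "\<alpha> + \<beta> \<noteq> 0" "\<beta> + \<gamma> \<noteq> 0" "\<alpha> + \<gamma> \<noteq> 0"
    have k: "brk (e \<rho>) (brk (e \<sigma>) (e \<tau>)) =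
        scale (of_int (if \<sigma> + \<tau> \<in> \<Phi> then N \<sigma> \<tau> * N \<rho> (\<sigma> + \<tau>) else 0)) (e (\<alpha> + \<beta> + \<gamma>))"
      if "\<rho> \<in> \<Phi>" "\<sigma> \<in> \<Phi>" "\<tau> \<in> \<Phi>" "\<sigma> + \<tau> \<noteq> 0" "\<rho> + (\<sigma> + \<tau>) = \<alpha> + \<beta> + \<gamma>" for \<rho> \<sigma> \<tau>
    proof (cases "\<sigma> + \<tau> \<in> \<Phi>")
      case True
      then have "brk (e \<rho>) (brk (e \<sigma>) (e \<tau>)) = scale (of_int (N \<sigma> \<tau>)) (brk (e \<rho>) (e (\<sigma> + \<tau>)))"
        using brk_e_e[OF that(2,3)] by (simp only: brk_scale_right)
      also have "brk (e \<rho>) (e (\<sigma> + \<tau>)) = scale (of_int (N \<rho> (\<sigma> + \<tau>))) (e (\<alpha> + \<beta> + \<gamma>))"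
        using brk_e_e[of \<rho> "\<sigma> + \<tau>"] that True s by (simp only:)
      finally show ?thesis using True by (simp only: scale_scale of_int_mult if_True)
    next
      case False
      then have "brk (e \<sigma>) (e \<tau>) = 0" using brk_e_zero[OF that(2,3)] that(4) by blast
      then show ?thesis using False by (simp only: brk_zero_right if_False of_int_0 scale_zero_left)
    qed
    have k1: "\<alpha> + (\<beta> + \<gamma>) = \<alpha> + \<beta> + \<gamma>" "\<beta> + (\<gamma> + \<alpha>) = \<alpha> + \<beta> + \<gamma>" "\<gamma> + (\<alpha> + \<beta>) = \<alpha> + \<beta> + \<gamma>"
      "\<gamma> + \<alpha> \<noteq> 0" "\<gamma> + \<alpha> = \<alpha> + \<gamma>"
      using n by (simp_all add: ac_simps)
    have "scale (of_int ((if \<beta> + \<gamma> \<in> \<Phi> then N \<beta> \<gamma> * N \<alpha> (\<beta> + \<gamma>) else 0)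
      + (if \<alpha> + \<gamma> \<in> \<Phi> then N \<gamma> \<alpha> * N \<beta> (\<alpha> + \<gamma>) else 0)
      + (if \<alpha> + \<beta> \<in> \<Phi> then N \<alpha> \<beta> * N \<gamma> (\<alpha> + \<beta>) else 0))) (e (\<alpha> + \<beta> + \<gamma>))
      = brk (e \<alpha>) (brk (e \<beta>) (e \<gamma>)) + brk (e \<beta>) (brk (e \<gamma>) (e \<alpha>)) + brk (e \<gamma>) (brk (e \<alpha>) (e \<beta>))"
      unfolding k[OF a n(2) k1(1)] k[OF a(2,3,1) k1(4,2)] k[OF a(3,1,2) n(1) k1(3)] k1(5)
      by (simp only: scale_left_distrib of_int_add)
    also have "\<dots> = 0" by (rule jacobi)
    also have "\<dots> = scale (of_int 0) (e (\<alpha> + \<beta> + \<gamma>))" by (simp only: of_int_0 scale_zero_left)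
    finally have "scale (of_int ((if \<beta> + \<gamma> \<in> \<Phi> then N \<beta> \<gamma> * N \<alpha> (\<beta> + \<gamma>) else 0)
      + (if \<alpha> + \<gamma> \<in> \<Phi> then N \<gamma> \<alpha> * N \<beta> (\<alpha> + \<gamma>) else 0)
      + (if \<alpha> + \<beta> \<in> \<Phi> then N \<alpha> \<beta> * N \<gamma> (\<alpha> + \<beta>) else 0))) (e (\<alpha> + \<beta> + \<gamma>))
      = scale (of_int 0) (e (\<alpha> + \<beta> + \<gamma>))" .
    then show "(if \<beta> + \<gamma> \<in> \<Phi> then N \<beta> \<gamma> * N \<alpha> (\<beta> + \<gamma>) else 0)
      + (if \<alpha> + \<gamma> \<in> \<Phi> then N \<gamma> \<alpha> * N \<beta> (\<alpha> + \<gamma>) else 0)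
      + (if \<alpha> + \<beta> \<in> \<Phi> then N \<alpha> \<beta> * N \<gamma> (\<alpha> + \<beta>) else 0) = 0"
      using e_cancel s by blast
  qed
qed

section \<open>Commutators\<close>

definition cmt :: "('g, 'n) monoid_scheme \<Rightarrow> 'g \<Rightarrow> 'g \<Rightarrow> 'g" where
  "cmt G a b = a \<otimes>\<^bsub>G\<^esub> b \<otimes>\<^bsub>G\<^esub> inv\<^bsub>G\<^esub> a \<otimes>\<^bsub>G\<^esub> inv\<^bsub>G\<^esub> b"

context group
begin

lemma cancel_left: "\<lbrakk>x \<in> carrier G; y \<in> carrier G\<rbrakk> \<Longrightarrow> x \<otimes> (inv x \<otimes> y) = y"
  and cancel_left_inv: "\<lbrakk>x \<in> carrier G; y \<in> carrier G\<rbrakk> \<Longrightarrow> inv x \<otimes> (x \<otimes> y) = y"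
  by (simp_all add: m_assoc[symmetric])

lemmas group_simps = m_assoc inv_mult_group cancel_left cancel_left_inv

lemma cmt_closed [simp, intro]: "\<lbrakk>a \<in> carrier G; b \<in> carrier G\<rbrakk> \<Longrightarrow> cmt G a b \<in> carrier G"
  by (simp add: cmt_def)

lemma cmt_one_left [simp]: "b \<in> carrier G \<Longrightarrow> cmt G \<one> b = \<one>"
  and cmt_one_right [simp]: "a \<in> carrier G \<Longrightarrow> cmt G a \<one> = \<one>"
  by (simp_all add: cmt_def)

lemma inv_cmt: "\<lbrakk>a \<in> carrier G; b \<in> carrier G\<rbrakk> \<Longrightarrow> inv (cmt G a b) = cmt G b a"
  by (simp add: cmt_def group_simps)

lemma cmt_swap: "\<lbrakk>a \<in> carrier G; b \<in> carrier G\<rbrakk> \<Longrightarrow> a \<otimes> b = cmt G a b \<otimes> (b \<otimes> a)"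
  by (simp add: cmt_def group_simps)

lemma cmt_eqI:
  assumes "a \<in> carrier G" "b \<in> carrier G" "e \<in> carrier G" "a \<otimes> b = e \<otimes> (b \<otimes> a)"
  shows "cmt G a b = e"
proof -
  have "cmt G a b \<otimes> (b \<otimes> a) = e \<otimes> (b \<otimes> a)"
    using cmt_swap[OF assms(1,2)] assms(4) by (rule subst)
  then show ?thesis using assms(1-3) by (simp add: right_cancel)
qed

lemma cmt_eq_one_iff:
  assumes "a \<in> carrier G" "b \<in> carrier G"
  shows "cmt G a b = \<one> \<longleftrightarrow> a \<otimes> b = b \<otimes> a"
proof
  assume "cmt G a b = \<one>"
  then have "a \<otimes> b = \<one> \<otimes> (b \<otimes> a)" using cmt_swap[OF assms] by (rule subst)
  then show "a \<otimes> b = b \<otimes> a" using assms by simp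
next
  assume "a \<otimes> b = b \<otimes> a"
  then have "a \<otimes> b = \<one> \<otimes> (b \<otimes> a)" using assms by simp
  then show "cmt G a b = \<one>" using assms by (intro cmt_eqI) auto
qed

lemma commute_inv:
  assumes "a \<in> carrier G" "b \<in> carrier G" "a \<otimes> b = b \<otimes> a"
  shows "a \<otimes> inv b = inv b \<otimes> a"
proof -
  have "inv b \<otimes> (a \<otimes> b) \<otimes> inv b = inv b \<otimes> (b \<otimes> a) \<otimes> inv b" by (simp only: assms(3))
  then show ?thesis using assms(1,2) by (simp add: group_simps)
qed

lemma commute_mult:
  assumes "x \<in> carrier G" "a \<in> carrier G" "b \<in> carrier G" "x \<otimes> a = a \<otimes> x" "x \<otimes> b = b \<otimes> x"
  shows "x \<otimes> (a \<otimes> b) = (a \<otimes> b) \<otimes> x"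
proof -
  have "x \<otimes> (a \<otimes> b) = (x \<otimes> a) \<otimes> b" using assms(1-3) by (simp add: m_assoc)
  also have "\<dots> = a \<otimes> (x \<otimes> b)" using assms(1-3) by (simp only: assms(4)) (simp add: m_assoc)
  also have "\<dots> = (a \<otimes> b) \<otimes> x" using assms(1-3) by (simp only: assms(5)) (simp add: m_assoc)
  finally show ?thesis .
qed

lemma commute_cmt:
  assumes "x \<in> carrier G" "a \<in> carrier G" "b \<in> carrier G" "x \<otimes> a = a \<otimes> x" "x \<otimes> b = b \<otimes> x"
  shows "x \<otimes> cmt G a b = cmt G a b \<otimes> x"
  unfolding cmt_def by (intro commute_mult commute_inv) (use assms in auto)

lemma cmt_mult_right:
  assumes "a \<in> carrier G" "b \<in> carrier G" "b' \<in> carrier G" "b \<otimes> cmt G a b' = cmt G a b' \<otimes> b"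
  shows "cmt G a (b \<otimes> b') = cmt G a b \<otimes> cmt G a b'"
proof -
  have "cmt G a (b \<otimes> b') = a \<otimes> (b \<otimes> (inv a \<otimes> (cmt G a b' \<otimes> inv b)))"
    using assms(1-3) by (simp add: cmt_def group_simps)
  also have "cmt G a b' \<otimes> inv b = inv b \<otimes> cmt G a b'"
    using commute_inv[OF _ assms(2) assms(4)[symmetric]] assms(1-3) by simp
  finally show ?thesis using assms(1-3) by (simp add: cmt_def group_simps)
qed

lemma conj_cmt:
  assumes "a \<in> carrier G" "b \<in> carrier G" "c \<in> carrier G"
  shows "c \<otimes> cmt G a b \<otimes> inv c = cmt G (c \<otimes> a \<otimes> inv c) (c \<otimes> b \<otimes> inv c)"
  using assms by (simp add: cmt_def group_simps)

lemma cmt_conj: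
  assumes "e \<in> carrier G" "c \<in> carrier G"
  shows "cmt G e c = e \<otimes> inv (c \<otimes> e \<otimes> inv c)"
  using assms by (simp add: cmt_def group_simps)

text \<open>
  The next two lemmas are variants of the Hall--Witt identity for \<open>a\<close>, \<open>b\<close>, \<open>c\<close> with
  \<open>[a, c] = 1\<close>. The first one makes no assumption on \<open>[a, [b, c]]\<close>, the second one none
  on \<open>[a, b]\<close>.
\<close>

lemma cmt_cmt_conj:
  assumes "a \<in> carrier G" "b \<in> carrier G" "c \<in> carrier G"
    and "a \<otimes> c = c \<otimes> a"
  shows "c \<otimes> cmt G a b \<otimes> inv c = cmt G a (inv (cmt G b c) \<otimes> b)"
proof -
  have "c \<otimes> a \<otimes> inv c = a" using assms(1-3) by (simp only: assms(4)[symmetric]) (simp add: m_assoc)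
  moreover have "c \<otimes> b \<otimes> inv c = inv (cmt G b c) \<otimes> b"
    using assms(1-3) by (simp add: cmt_def group_simps)
  ultimately show ?thesis using conj_cmt[OF assms(1-3)] by simp
qed

lemma cmt_cmt_1:
  assumes "a \<in> carrier G" "b \<in> carrier G" "c \<in> carrier G"
    and ac: "a \<otimes> c = c \<otimes> a"
    and bd: "b \<otimes> cmt G b c = cmt G b c \<otimes> b"
    and ed: "cmt G a b \<otimes> cmt G b c = cmt G b c \<otimes> cmt G a b"
  shows "cmt G (cmt G a b) c = inv (cmt G a (inv (cmt G b c)))"
proof -
  define d where "d = cmt G b c"
  define e where "e = cmt G a b"
  have cl: "d \<in> carrier G" "e \<in> carrier G" using assms(1-3) by (simp_all add: d_def e_def)
  have "c \<otimes> e \<otimes> inv c = cmt G a (inv d \<otimes> b)"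
    unfolding d_def e_def by (rule cmt_cmt_conj[OF assms(1-4)])
  also have "\<dots> = a \<otimes> (inv d \<otimes> (inv a \<otimes> (e \<otimes> d)))"
    using assms(1-3) cl by (simp add: cmt_def e_def group_simps)
  also have "e \<otimes> d = d \<otimes> e" using ed by (simp add: d_def e_def)
  also have "a \<otimes> (inv d \<otimes> (inv a \<otimes> (d \<otimes> e))) = cmt G a (inv d) \<otimes> e"
    using assms(1-3) cl by (simp add: cmt_def group_simps)
  finally have "cmt G e c = e \<otimes> inv (cmt G a (inv d) \<otimes> e)"
    using cmt_conj[OF cl(2) assms(3)] by simp
  then have "cmt G e c = inv (cmt G a (inv d))" using assms(1-3) cl by (simp add: group_simps)
  then show ?thesis by (simp only: d_def e_def)
qed

lemma cmt_cmt_2: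
  assumes "a \<in> carrier G" "b \<in> carrier G" "c \<in> carrier G"
    and ac: "a \<otimes> c = c \<otimes> a"
    and bd: "b \<otimes> cmt G b c = cmt G b c \<otimes> b"
    and fa: "cmt G a (inv (cmt G b c)) \<otimes> a = a \<otimes> cmt G a (inv (cmt G b c))"
    and fb: "cmt G a (inv (cmt G b c)) \<otimes> b = b \<otimes> cmt G a (inv (cmt G b c))"
  shows "cmt G (cmt G a b) c = inv (cmt G a (inv (cmt G b c)))"
proof -
  define d where "d = cmt G b c"
  define e where "e = cmt G a b"
  define f where "f = cmt G a (inv d)"
  have cl: "d \<in> carrier G" "e \<in> carrier G" "f \<in> carrier G"
    using assms(1-3) by (simp_all add: d_def e_def f_def)
  have f: "f \<otimes> a = a \<otimes> f" "f \<otimes> b = b \<otimes> f" unfolding f_def d_def by (rule fa, rule fb)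
  have "b \<otimes> d = d \<otimes> b" unfolding d_def by (rule bd)
  then have "b \<otimes> inv d = inv d \<otimes> b" using commute_inv assms(2) cl(1) by blast
  then have "c \<otimes> e \<otimes> inv c = cmt G a (b \<otimes> inv d)"
    using cmt_cmt_conj[OF assms(1-4)] by (simp only: e_def d_def)
  also have "\<dots> = cmt G a b \<otimes> f"
    unfolding f_def by (rule cmt_mult_right) (use assms(1-3) cl in simp_all, simp only: f(2) flip: f_def)
  finally have "c \<otimes> e \<otimes> inv c = e \<otimes> f" by (simp only: e_def)
  then have "cmt G e c = e \<otimes> inv (e \<otimes> f)" using cmt_conj[OF cl(2) assms(3)] by simp
  also have "e \<otimes> f = f \<otimes> e" unfolding e_def using commute_cmt[OF cl(3) assms(1,2) f] by (rule HOL.sym)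
  also have "e \<otimes> inv (f \<otimes> e) = inv f" using cl by (simp add: group_simps)
  finally show ?thesis by (simp only: e_def f_def d_def)
qed

text \<open>Moving \<open>c\<close> and \<open>d\<close> across \<open>a b\<close> creates the three
  commutators; the hypotheses allow each of them to be carried to the front. The lemma serves
  conjugated root elements, which are products of two factors.\<close>

lemma cmt_mult_mult:
  assumes cl: "a \<in> carrier G" "b \<in> carrier G" "c \<in> carrier G" "d \<in> carrier G"
    and bd: "b \<otimes> d = d \<otimes> b"
    and f1: "c \<otimes> cmt G a d = cmt G a d \<otimes> c"
    and f2: "a \<otimes> cmt G b c = cmt G b c \<otimes> a"
  shows "cmt G (a \<otimes> b) (c \<otimes> d) = cmt G b c \<otimes> cmt G a c \<otimes> cmt G a d"
proof (rule cmt_eqI)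
  have "a \<otimes> b \<otimes> (c \<otimes> d) = a \<otimes> (b \<otimes> c) \<otimes> d" using cl by (simp add: m_assoc)
  also have "\<dots> = (a \<otimes> cmt G b c) \<otimes> (c \<otimes> (b \<otimes> d))"
    using cl by (subst cmt_swap[of b c]) (simp_all add: m_assoc)
  also have "\<dots> = cmt G b c \<otimes> (a \<otimes> c) \<otimes> (d \<otimes> b)"
    using cl by (subst f2, subst bd) (simp_all add: m_assoc)
  also have "\<dots> = cmt G b c \<otimes> cmt G a c \<otimes> (c \<otimes> (a \<otimes> d) \<otimes> b)"
    using cl by (subst cmt_swap[of a c]) (simp_all add: m_assoc)
  also have "c \<otimes> (a \<otimes> d) \<otimes> b = (c \<otimes> cmt G a d) \<otimes> (d \<otimes> (a \<otimes> b))"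
    using cl by (subst cmt_swap[of a d]) (simp_all add: m_assoc)
  also have "\<dots> = cmt G a d \<otimes> (c \<otimes> d \<otimes> (a \<otimes> b))" using cl by (subst f1) (simp_all add: m_assoc)
  finally show "a \<otimes> b \<otimes> (c \<otimes> d) = cmt G b c \<otimes> cmt G a c \<otimes> cmt G a d \<otimes> (c \<otimes> d \<otimes> (a \<otimes> b))"
    using cl by (simp add: m_assoc)
qed (use cl in auto)

end

lemma cmt_hom:
  assumes "group G" "group H" "f \<in> hom G H" "a \<in> carrier G" "b \<in> carrier G"
  shows "f (cmt G a b) = cmt H (f a) (f b)"
proof -
  interpret group_hom G H f using assms by (simp add: group_hom_def group_hom_axioms_def)
  show ?thesis using assms by (simp add: cmt_def)
qed

section \<open>Steinberg families\<close>

locale steinberg_ring = structure_constants \<Phi> N + cring K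
  for \<Phi> :: "'v::euclidean_space set" and N and K :: "('k, 'm) ring_scheme" (structure)
begin

lemma add_pow_add_pow: "x \<in> carrier K \<Longrightarrow> [(m::int)] \<cdot> ([(n::int)] \<cdot> x) = [(m * n)] \<cdot> x"
  using add.int_pow_pow[of x m n] by (simp add: mult.commute)

lemma add_pow_add: "x \<in> carrier K \<Longrightarrow> [(m::int)] \<cdot> x \<oplus> [(n::int)] \<cdot> x = [(m + n)] \<cdot> x"
  using add.int_pow_mult[of x m n] by simp

lemma add_pow_minus: "x \<in> carrier K \<Longrightarrow> [(- (m::int))] \<cdot> x = \<ominus> ([m] \<cdot> x)"
  using add.int_pow_neg[of x m] by (simp add: a_inv_def)

lemma add_pow_0 [simp]: "[(0::int)] \<cdot> x = \<zero>"
  by (simp add: add_pow_int_ge add_pow_def)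

lemma add_pow_closed [simp, intro]: "x \<in> carrier K \<Longrightarrow> [(m::int)] \<cdot> x \<in> carrier K"
  using add.int_pow_closed[of x m] by simp

lemma add_pow_distrib:
  "\<lbrakk>x \<in> carrier K; y \<in> carrier K\<rbrakk> \<Longrightarrow> [(m::int)] \<cdot> (x \<oplus> y) = [m] \<cdot> x \<oplus> [m] \<cdot> y"
  using add.int_pow_distrib[of x y m] by simp

lemmas pow_simps = add_pow_ldistr_int add_pow_rdistr_int add_pow_add_pow

text \<open>The parameter sets that occur are the ideals of multiples of \<open>h^n\<close>, which
  in general contain no unit. Closure under products is what the commutator relation asks of
  them.\<close>

definition nonunital_subring :: "'k set \<Rightarrow> bool" where
  "nonunital_subring I \<longleftrightarrow> I \<subseteq> carrier K \<and> \<zero> \<in> I \<and>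
     (\<forall>a\<in>I. \<ominus> a \<in> I) \<and> (\<forall>a\<in>I. \<forall>b\<in>I. a \<oplus> b \<in> I \<and> a \<otimes> b \<in> I)"

lemma nonunital_subringD:
  assumes "nonunital_subring I"
  shows "I \<subseteq> carrier K" "a \<in> I \<Longrightarrow> a \<in> carrier K" "\<zero> \<in> I" "a \<in> I \<Longrightarrow> \<ominus> a \<in> I"
    "\<lbrakk>a \<in> I; b \<in> I\<rbrakk> \<Longrightarrow> a \<oplus> b \<in> I" "\<lbrakk>a \<in> I; b \<in> I\<rbrakk> \<Longrightarrow> a \<otimes> b \<in> I"
  using assms by (auto simp: nonunital_subring_def)

lemma nonunital_subring_add_pow:
  assumes "nonunital_subring I" "a \<in> I"
  shows "[(n::int)] \<cdot> a \<in> I"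
proof -
  note I = nonunital_subringD[OF assms(1)]
  have nat: "[int k] \<cdot> a \<in> I" for k
  proof (induction k)
    case 0
    then show ?case using I by simp
  next
    case (Suc k)
    have "[int (Suc k)] \<cdot> a = [int k] \<cdot> a \<oplus> [(1::int)] \<cdot> a"
      using I(2)[OF assms(2)] by (subst add_pow_add) (simp_all add: algebra_simps)
    then show ?case using Suc I assms(2) by simp
  qed
  show ?thesis
  proof (cases "n \<ge> 0")
    case True
    then show ?thesis using nat[of "nat n"] by simp
  next
    case False
    then have "n = - int (nat (- n))" by simp
    then show ?thesis using nat[of "nat (- n)"] I add_pow_minus[of a "int (nat (- n))"] assms(2) by metis
  qed
qed

text \<open>With the value 1 at non-roots, and with \<open>N0\<close> for \<open>N\<close>, both
  kinds of commutator relations become one formula.\<close>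

definition ext :: "('g, 'n) monoid_scheme \<Rightarrow> ('v \<Rightarrow> 'k \<Rightarrow> 'g) \<Rightarrow> 'v \<Rightarrow> 'k \<Rightarrow> 'g" where
  "ext G y \<rho> a = (if \<rho> \<in> \<Phi> then y \<rho> a else \<one>\<^bsub>G\<^esub>)"

text \<open>
  Families satisfying those Steinberg relations with parameters in \<open>I\<close> that do not
  involve the root \<open>\<omega>\<close>; as \<open>0\<close> is not a root, \<open>\<omega> = 0\<close> gives all relations.
\<close>

definition pstein :: "('g, 'n) monoid_scheme \<Rightarrow> 'k set \<Rightarrow> 'v \<Rightarrow> ('v \<Rightarrow> 'k \<Rightarrow> 'g) \<Rightarrow> bool" where
  "pstein G I \<omega> y \<longleftrightarrow>
     (\<forall>\<rho>\<in>\<Phi> - {\<omega>}. \<forall>a\<in>I. y \<rho> a \<in> carrier G) \<and>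
     (\<forall>\<rho>\<in>\<Phi> - {\<omega>}. \<forall>a\<in>I. \<forall>b\<in>I. y \<rho> (a \<oplus> b) = y \<rho> a \<otimes>\<^bsub>G\<^esub> y \<rho> b) \<and>
     (\<forall>\<rho>\<in>\<Phi> - {\<omega>}. \<forall>\<sigma>\<in>\<Phi> - {\<omega>}. \<forall>a\<in>I. \<forall>b\<in>I. \<rho> + \<sigma> \<noteq> 0 \<longrightarrow> \<rho> + \<sigma> \<noteq> \<omega> \<longrightarrow>
        cmt G (y \<rho> a) (y \<sigma> b) = ext G y (\<rho> + \<sigma>) ([(N0 \<rho> \<sigma>)] \<cdot> (a \<otimes> b)))"

abbreviation stein :: "('g, 'n) monoid_scheme \<Rightarrow> 'k set \<Rightarrow> ('v \<Rightarrow> 'k \<Rightarrow> 'g) \<Rightarrow> bool" where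
  "stein G I \<equiv> pstein G I 0"

end

locale pstein_family = steinberg_ring + G: group G
  for G :: "('g, 'n) monoid_scheme" +
  fixes I \<omega> y
  assumes I: "nonunital_subring I" and pstein: "pstein G I \<omega> y" and omega: "\<omega> = 0 \<or> \<omega> \<in> \<Phi>"
begin

abbreviation e where "e \<equiv> ext G y"

lemmas ID = nonunital_subringD[OF I] nonunital_subring_add_pow[OF I]

lemma y_closed: "\<lbrakk>\<rho> \<in> \<Phi>; \<rho> \<noteq> \<omega>; a \<in> I\<rbrakk> \<Longrightarrow> y \<rho> a \<in> carrier G"
  and y_add: "\<lbrakk>\<rho> \<in> \<Phi>; \<rho> \<noteq> \<omega>; a \<in> I; b \<in> I\<rbrakk> \<Longrightarrow> y \<rho> (a \<oplus> b) = y \<rho> a \<otimes>\<^bsub>G\<^esub> y \<rho> b"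
  and y_cmt: "\<lbrakk>\<rho> \<in> \<Phi>; \<rho> \<noteq> \<omega>; \<sigma> \<in> \<Phi>; \<sigma> \<noteq> \<omega>; a \<in> I; b \<in> I; \<rho> + \<sigma> \<noteq> 0; \<rho> + \<sigma> \<noteq> \<omega>\<rbrakk> \<Longrightarrow>
     cmt G (y \<rho> a) (y \<sigma> b) = ext G y (\<rho> + \<sigma>) ([(N0 \<rho> \<sigma>)] \<cdot> (a \<otimes> b))"
  using pstein by (auto simp: pstein_def)

lemma e_root: "\<rho> \<in> \<Phi> \<Longrightarrow> e \<rho> a = y \<rho> a"
  and e_nonroot: "\<rho> \<notin> \<Phi> \<Longrightarrow> e \<rho> a = \<one>\<^bsub>G\<^esub>"
  by (simp_all add: ext_def)

lemma e_closed [simp]: "\<lbrakk>\<rho> \<noteq> \<omega>; a \<in> I\<rbrakk> \<Longrightarrow> e \<rho> a \<in> carrier G"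
  by (simp add: ext_def y_closed)

lemma e_add: "\<lbrakk>\<rho> \<noteq> \<omega>; a \<in> I; b \<in> I\<rbrakk> \<Longrightarrow> e \<rho> (a \<oplus> b) = e \<rho> a \<otimes>\<^bsub>G\<^esub> e \<rho> b"
  by (simp add: ext_def y_add)

lemma e_zero: "\<rho> \<noteq> \<omega> \<Longrightarrow> e \<rho> \<zero> = \<one>\<^bsub>G\<^esub>"
proof -
  assume a: "\<rho> \<noteq> \<omega>"
  have "e \<rho> \<zero> \<otimes>\<^bsub>G\<^esub> e \<rho> \<zero> = e \<rho> \<zero>"
    using e_add[OF a ID(3) ID(3)] by simp
  then show ?thesis using e_closed[OF a ID(3)] G.l_cancel_one' by metis
qed

lemma e_minus: "\<lbrakk>\<rho> \<noteq> \<omega>; a \<in> I\<rbrakk> \<Longrightarrow> e \<rho> (\<ominus> a) = inv\<^bsub>G\<^esub> e \<rho> a"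
proof -
  assume a: "\<rho> \<noteq> \<omega>" "a \<in> I"
  have "e \<rho> (\<ominus> a) \<otimes>\<^bsub>G\<^esub> e \<rho> a = e \<rho> (\<ominus> a \<oplus> a)"
    by (rule e_add[symmetric, OF a(1) ID(4)[OF a(2)] a(2)])
  also have "\<dots> = \<one>\<^bsub>G\<^esub>" using e_zero[OF a(1)] ID(2)[OF a(2)] by (simp add: l_neg)
  finally show ?thesis using e_closed[OF a] e_closed[OF a(1) ID(4)[OF a(2)]] G.inv_equality by metis
qed

lemma e_cmt:
  assumes "\<rho> \<noteq> \<omega>" "\<sigma> \<noteq> \<omega>" "a \<in> I" "b \<in> I" "\<rho> + \<sigma> \<noteq> 0" "\<rho> + \<sigma> \<noteq> \<omega>"
  shows "cmt G (e \<rho> a) (e \<sigma> b) = e (\<rho> + \<sigma>) ([(N0 \<rho> \<sigma>)] \<cdot> (a \<otimes> b))"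
proof (cases "\<rho> \<in> \<Phi> \<and> \<sigma> \<in> \<Phi>")
  case True
  then show ?thesis using assms by (simp add: e_root y_cmt)
next
  case False
  then have "N0 \<rho> \<sigma> = 0" using N0_zero by blast
  moreover have "cmt G (e \<rho> a) (e \<sigma> b) = \<one>\<^bsub>G\<^esub>"
    using False assms by (auto simp: e_nonroot)
  ultimately show ?thesis using assms by (simp add: e_zero)
qed

text \<open>A nonnegative pairing excludes that \<rho> + \<sigma> is 0 or a root. As \<omega> is 0
  or a root, this relation is then among those that a partial family satisfies.\<close>

lemma e_commute:
  assumes "\<rho> \<noteq> \<omega>" "\<sigma> \<noteq> \<omega>" "a \<in> I" "b \<in> I"
    and "\<rho> \<in> \<Phi> \<Longrightarrow> \<sigma> \<in> \<Phi> \<Longrightarrow> pair \<rho> \<sigma> \<ge> 0"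
  shows "e \<rho> a \<otimes>\<^bsub>G\<^esub> e \<sigma> b = e \<sigma> b \<otimes>\<^bsub>G\<^esub> e \<rho> a"
proof (cases "\<rho> \<in> \<Phi> \<and> \<sigma> \<in> \<Phi>")
  case True
  then have p: "pair \<rho> \<sigma> \<ge> 0" using assms by blast
  then have "\<rho> + \<sigma> \<noteq> 0" "\<rho> + \<sigma> \<notin> \<Phi>" using True add_zero_iff add_root_iff by force+
  moreover from this have "\<rho> + \<sigma> \<noteq> \<omega>" using omega by blast
  ultimately have "cmt G (e \<rho> a) (e \<sigma> b) = \<one>\<^bsub>G\<^esub>"
    using e_cmt[OF assms(1-4)] by (simp add: e_nonroot)
  then show ?thesis using assms by (simp add: G.cmt_eq_one_iff)
next
  case False
  then show ?thesis using assms by (auto simp: e_nonroot)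
qed

end

context steinberg_ring
begin

text \<open>The value of \<open>y\<close> at the conjugate
  \<open>x \<alpha> \<xi> x \<beta> a (x \<alpha> \<xi>)^-1\<close>, expanded by the commutator
  formula. It has this meaning for every root \<beta> except -\<alpha>.\<close>

definition twist :: "('g, 'n) monoid_scheme \<Rightarrow> 'v \<Rightarrow> 'k \<Rightarrow> ('v \<Rightarrow> 'k \<Rightarrow> 'g) \<Rightarrow> 'v \<Rightarrow> 'k \<Rightarrow> 'g" where
  "twist G \<alpha> \<xi> y \<beta> a = y \<beta> a \<otimes>\<^bsub>G\<^esub> ext G y (\<alpha> + \<beta>) ([(N0 \<alpha> \<beta>)] \<cdot> (\<xi> \<otimes> a))"

text \<open>As \<xi> need not lie in \<open>I\<close>, there is no element of the group to conjugate
  with, and the relations have to be verified on the products that define \<open>twist\<close>. The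
  level \<open>J\<close> is deep enough that \<xi> maps it into \<open>I\<close>. Relations that
  involve -\<alpha> are left out, also as a sum of two roots.\<close>

lemma twist_pstein:
  assumes G: "group G" and I: "nonunital_subring I" and y: "stein G I y"
    and J: "nonunital_subring J" "J \<subseteq> I" and xi: "\<xi> \<in> carrier K" "\<And>a. a \<in> J \<Longrightarrow> \<xi> \<otimes> a \<in> I"
    and al: "\<alpha> \<in> \<Phi>"
  shows "pstein G J (- \<alpha>) (twist G \<alpha> \<xi> y)"
proof -
  interpret Y: pstein_family \<Phi> N K G I 0 y
    using assms by (simp add: pstein_family_def pstein_family_axioms_def steinberg_ring_axioms)
  have nz: "\<rho> \<noteq> 0" if "\<rho> \<in> \<Phi>" for \<rho> using that zero_notin by blast
  note JD = nonunital_subringD[OF J(1)] nonunital_subring_add_pow[OF J(1)]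
  have JI: "a \<in> I" "a \<in> carrier K" if "a \<in> J" for a
    using that J(2) JD(2) by blast+
  have xiI: "[n] \<cdot> (\<xi> \<otimes> a) \<in> I" if "a \<in> J" for a and n :: int
    by (rule Y.ID(7)[OF xi(2)[OF that]])
  have ab0: "\<alpha> + \<beta> \<noteq> 0" if "\<beta> \<noteq> - \<alpha>" for \<beta>
    using that Groups.add_eq_0_iff[of \<alpha> \<beta>] by simp
  have tw: "twist G \<alpha> \<xi> y \<beta> a = Y.e \<beta> a \<otimes>\<^bsub>G\<^esub> Y.e (\<alpha> + \<beta>) ([(N0 \<alpha> \<beta>)] \<cdot> (\<xi> \<otimes> a))"
    if "\<beta> \<in> \<Phi>" for \<beta> a
    using that by (simp add: twist_def Y.e_root)
  show ?thesis
    unfolding pstein_def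
  proof (intro conjI ballI impI)
    fix \<beta> a assume "\<beta> \<in> \<Phi> - {- \<alpha>}" "a \<in> J"
    then show "twist G \<alpha> \<xi> y \<beta> a \<in> carrier G"
      using ab0 nz JI xiI by (simp add: tw)
  next
    fix \<beta> a b assume b: "\<beta> \<in> \<Phi> - {- \<alpha>}" "a \<in> J" "b \<in> J"
    have c: "Y.e (\<alpha> + \<beta>) ([(N0 \<alpha> \<beta>)] \<cdot> (\<xi> \<otimes> a)) \<otimes>\<^bsub>G\<^esub> Y.e \<beta> b = Y.e \<beta> b \<otimes>\<^bsub>G\<^esub> Y.e (\<alpha> + \<beta>) ([(N0 \<alpha> \<beta>)] \<cdot> (\<xi> \<otimes> a))"
    proof (rule Y.e_commute)
      assume "\<alpha> + \<beta> \<in> \<Phi>"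
      then have "pair \<alpha> \<beta> = -1" using add_root_iff al b by blast
      then show "pair (\<alpha> + \<beta>) \<beta> \<ge> 0" using b by (simp add: pair_simps pair_self)
    qed (use b nz ab0 JI xiI in auto)
    have cl: "Y.e \<beta> a \<in> carrier G" "Y.e \<beta> b \<in> carrier G"
      "Y.e (\<alpha> + \<beta>) ([(N0 \<alpha> \<beta>)] \<cdot> (\<xi> \<otimes> a)) \<in> carrier G" "Y.e (\<alpha> + \<beta>) ([(N0 \<alpha> \<beta>)] \<cdot> (\<xi> \<otimes> b)) \<in> carrier G"
      using b nz ab0 JI xiI by auto
    have "[(N0 \<alpha> \<beta>)] \<cdot> (\<xi> \<otimes> (a \<oplus> b)) = [(N0 \<alpha> \<beta>)] \<cdot> (\<xi> \<otimes> a) \<oplus> [(N0 \<alpha> \<beta>)] \<cdot> (\<xi> \<otimes> b)"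
      using xi(1) JI b by (simp add: r_distr add_pow_distrib)
    then have "twist G \<alpha> \<xi> y \<beta> (a \<oplus> b) = Y.e \<beta> a \<otimes>\<^bsub>G\<^esub> Y.e \<beta> b \<otimes>\<^bsub>G\<^esub>
        (Y.e (\<alpha> + \<beta>) ([(N0 \<alpha> \<beta>)] \<cdot> (\<xi> \<otimes> a)) \<otimes>\<^bsub>G\<^esub> Y.e (\<alpha> + \<beta>) ([(N0 \<alpha> \<beta>)] \<cdot> (\<xi> \<otimes> b)))"
      using b nz ab0 JI xiI by (simp add: tw Y.e_add)
    also have "\<dots> = Y.e \<beta> a \<otimes>\<^bsub>G\<^esub> (Y.e \<beta> b \<otimes>\<^bsub>G\<^esub> Y.e (\<alpha> + \<beta>) ([(N0 \<alpha> \<beta>)] \<cdot> (\<xi> \<otimes> a))) \<otimes>\<^bsub>G\<^esub>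
        Y.e (\<alpha> + \<beta>) ([(N0 \<alpha> \<beta>)] \<cdot> (\<xi> \<otimes> b))"
      using cl by (simp add: Y.G.m_assoc)
    also have "\<dots> = twist G \<alpha> \<xi> y \<beta> a \<otimes>\<^bsub>G\<^esub> twist G \<alpha> \<xi> y \<beta> b"
      unfolding c[symmetric] using cl b by (simp add: tw Y.G.m_assoc)
    finally show "twist G \<alpha> \<xi> y \<beta> (a \<oplus> b) = twist G \<alpha> \<xi> y \<beta> a \<otimes>\<^bsub>G\<^esub> twist G \<alpha> \<xi> y \<beta> b" .
  next
    fix \<beta> \<gamma> a b assume b: "\<beta> \<in> \<Phi> - {- \<alpha>}" and g: "\<gamma> \<in> \<Phi> - {- \<alpha>}" and ab: "a \<in> J" "b \<in> J"
      and n: "\<beta> + \<gamma> \<noteq> 0" "\<beta> + \<gamma> \<noteq> - \<alpha>"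
    have r: "\<beta> \<in> \<Phi>" "\<gamma> \<in> \<Phi>" "\<alpha> + \<beta> \<noteq> 0" "\<alpha> + \<gamma> \<noteq> 0" "\<beta> \<noteq> 0" "\<gamma> \<noteq> 0" "\<alpha> + (\<beta> + \<gamma>) \<noteq> 0"
      using b g ab0 nz n by auto
    have pbg: "pair \<beta> \<gamma> \<ge> -1" by (rule pair_ge_minus_one[OF r(1,2) n(1)])
    have assoc: "\<beta> + (\<alpha> + \<gamma>) = \<alpha> + (\<beta> + \<gamma>)" "\<alpha> + \<beta> + \<gamma> = \<alpha> + (\<beta> + \<gamma>)" by (simp_all add: ac_simps)
    define A where "A = Y.e \<beta> a"
    define B where "B = Y.e (\<alpha> + \<beta>) ([(N0 \<alpha> \<beta>)] \<cdot> (\<xi> \<otimes> a))"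
    define C where "C = Y.e \<gamma> b"
    define D where "D = Y.e (\<alpha> + \<gamma>) ([(N0 \<alpha> \<gamma>)] \<cdot> (\<xi> \<otimes> b))"
    define x where "x = \<xi> \<otimes> (a \<otimes> b)"
    have xab: "\<xi> \<in> carrier K" "a \<in> carrier K" "b \<in> carrier K" using xi JI ab by auto
    have xI: "[k] \<cdot> x \<in> I" "[k] \<cdot> (a \<otimes> b) \<in> I" for k :: int
      using Y.ID(7)[OF xi(2)[OF JD(6)[OF ab]]] Y.ID(7)[OF JI(1)[OF JD(6)[OF ab]]] by (simp_all add: x_def)
    have x1: "a \<otimes> (\<xi> \<otimes> b) = x" "\<xi> \<otimes> a \<otimes> b = x" using xab by (simp_all add: x_def m_ac)
    have xc: "x \<in> carrier K" using xab by (simp add: x_def)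
    have cl: "A \<in> carrier G" "B \<in> carrier G" "C \<in> carrier G" "D \<in> carrier G"
      unfolding A_def B_def C_def D_def using r JI ab xiI by auto
    have AC: "cmt G A C = Y.e (\<beta> + \<gamma>) ([(N0 \<beta> \<gamma>)] \<cdot> (a \<otimes> b))"
      unfolding A_def C_def by (rule Y.e_cmt) (use r n JI ab in auto)
    have AD: "cmt G A D = Y.e (\<alpha> + (\<beta> + \<gamma>)) ([(N0 \<beta> (\<alpha> + \<gamma>) * N0 \<alpha> \<gamma>)] \<cdot> x)"
      unfolding A_def D_def
      by (subst Y.e_cmt) (use r n JI ab xiI xab in \<open>auto simp: pow_simps x1 assoc xc\<close>)
    have BC: "cmt G B C = Y.e (\<alpha> + (\<beta> + \<gamma>)) ([(N0 (\<alpha> + \<beta>) \<gamma> * N0 \<alpha> \<beta>)] \<cdot> x)"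
      unfolding B_def C_def
      by (subst Y.e_cmt) (use r n JI ab xiI xab in \<open>auto simp: pow_simps x1 assoc xc\<close>)
    \<comment> \<open>If \<alpha> + \<beta> and \<alpha> + \<gamma> are roots, then \<beta> +
      \<gamma> is not: its pairing with \<alpha> would be -2, making it equal to -\<alpha>.\<close>
    have BD: "B \<otimes>\<^bsub>G\<^esub> D = D \<otimes>\<^bsub>G\<^esub> B"
      unfolding B_def D_def
    proof (rule Y.e_commute)
      assume ar: "\<alpha> + \<beta> \<in> \<Phi>" "\<alpha> + \<gamma> \<in> \<Phi>"
      then have p: "pair \<alpha> \<beta> = -1" "pair \<alpha> \<gamma> = -1"
        using add_root_iff[OF al r(1)] add_root_iff[OF al r(2)] by blast+
      have "\<beta> + \<gamma> \<notin> \<Phi>"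
      proof
        assume "\<beta> + \<gamma> \<in> \<Phi>"
        moreover have "pair \<alpha> (\<beta> + \<gamma>) = -2" using p by (simp add: pair_simps)
        ultimately show False using add_zero_iff[OF al] r(7) by blast
      qed
      then have "pair \<beta> \<gamma> \<ge> 0" by (rule pair_nonneg[OF r(1,2) n(1)])
      then show "pair (\<alpha> + \<beta>) (\<alpha> + \<gamma>) \<ge> 0"
        using p al by (simp add: pair_simps pair_self pair_commute[of \<beta> \<alpha>])
    qed (use r xiI ab in auto)
    have CAD: "C \<otimes>\<^bsub>G\<^esub> cmt G A D = cmt G A D \<otimes>\<^bsub>G\<^esub> C"
    proof (cases "\<alpha> + \<gamma> \<in> \<Phi>")
      case True
      then have p: "pair \<alpha> \<gamma> = -1" using add_root_iff[OF al r(2)] by blast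
      show ?thesis
        unfolding AD C_def
      proof (rule Y.e_commute)
        show "pair \<gamma> (\<alpha> + (\<beta> + \<gamma>)) \<ge> 0"
          using p pbg r by (simp add: pair_simps pair_self pair_commute[of \<gamma> \<alpha>] pair_commute[of \<gamma> \<beta>])
      qed (use r xI JI ab in auto)
    next
      case False
      then show ?thesis using cl by (simp add: D_def Y.e_nonroot)
    qed
    have p_ab: "pair \<alpha> \<beta> = -1" "pair (\<alpha> + \<beta>) \<beta> = 1" if "\<alpha> + \<beta> \<in> \<Phi>"
      using that add_root_iff[OF al r(1)] r by (auto simp: pair_simps pair_self)
    have ABC: "A \<otimes>\<^bsub>G\<^esub> cmt G B C = cmt G B C \<otimes>\<^bsub>G\<^esub> A"
    proof (cases "\<alpha> + \<beta> \<in> \<Phi>")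
      case True
      show ?thesis
        unfolding BC A_def
      proof (rule Y.e_commute)
        show "pair \<beta> (\<alpha> + (\<beta> + \<gamma>)) \<ge> 0"
          using p_ab(1)[OF True] pbg r by (simp add: pair_simps pair_self pair_commute[of \<beta> \<alpha>])
      qed (use r xI JI ab in auto)
    next
      case False
      then show ?thesis using cl by (simp add: B_def Y.e_nonroot)
    qed
    have ACBC: "cmt G B C \<otimes>\<^bsub>G\<^esub> cmt G A C = cmt G A C \<otimes>\<^bsub>G\<^esub> cmt G B C"
    proof (cases "\<alpha> + \<beta> \<in> \<Phi>")
      case True
      show ?thesis
        unfolding BC AC
      proof (rule Y.e_commute)
        assume "\<alpha> + (\<beta> + \<gamma>) \<in> \<Phi>" "\<beta> + \<gamma> \<in> \<Phi>"
        then have "pair \<alpha> (\<beta> + \<gamma>) = -1" "pair \<beta> \<gamma> = -1"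
          using add_root_iff[OF al, of "\<beta> + \<gamma>"] add_root_iff[OF r(1,2)] by blast+
        then show "pair (\<alpha> + (\<beta> + \<gamma>)) (\<beta> + \<gamma>) \<ge> 0"
          using r by (simp add: pair_simps pair_self pair_commute[of \<gamma> \<alpha>] pair_commute[of \<gamma> \<beta>])
      qed (use r n xI JI ab in auto)
    next
      case False
      then show ?thesis using cl by (simp add: B_def Y.e_nonroot)
    qed
    have jac: "N0 \<alpha> (\<beta> + \<gamma>) * N0 \<beta> \<gamma> = N0 (\<alpha> + \<beta>) \<gamma> * N0 \<alpha> \<beta> + N0 \<beta> (\<alpha> + \<gamma>) * N0 \<alpha> \<gamma>"
      using N0_jacobi[OF al r(1,2,3) n(1) r(4)] by simp
    have "cmt G (twist G \<alpha> \<xi> y \<beta> a) (twist G \<alpha> \<xi> y \<gamma> b) = cmt G B C \<otimes>\<^bsub>G\<^esub> cmt G A C \<otimes>\<^bsub>G\<^esub> cmt G A D"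
      using Y.G.cmt_mult_mult[OF cl BD CAD ABC] r by (simp add: tw A_def B_def C_def D_def)
    also have "\<dots> = cmt G A C \<otimes>\<^bsub>G\<^esub> (cmt G B C \<otimes>\<^bsub>G\<^esub> cmt G A D)"
      using cl by (simp add: ACBC Y.G.m_assoc)
    \<comment> \<open>Two of the three commutators sit at the root \<alpha> + \<beta> + \<gamma>.
      The Jacobi identity adds their coefficients up to that of the twist at \<beta> +
      \<gamma>.\<close>
    also have "cmt G B C \<otimes>\<^bsub>G\<^esub> cmt G A D = Y.e (\<alpha> + (\<beta> + \<gamma>)) ([(N0 \<alpha> (\<beta> + \<gamma>) * N0 \<beta> \<gamma>)] \<cdot> x)"
      unfolding BC AD jac using Y.e_add[OF r(7) xI(1) xI(1)] by (simp add: add_pow_add xc)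
    finally have main: "cmt G (twist G \<alpha> \<xi> y \<beta> a) (twist G \<alpha> \<xi> y \<gamma> b) =
        Y.e (\<beta> + \<gamma>) ([(N0 \<beta> \<gamma>)] \<cdot> (a \<otimes> b)) \<otimes>\<^bsub>G\<^esub> Y.e (\<alpha> + (\<beta> + \<gamma>)) ([(N0 \<alpha> (\<beta> + \<gamma>) * N0 \<beta> \<gamma>)] \<cdot> x)"
      by (simp add: AC)
    show "cmt G (twist G \<alpha> \<xi> y \<beta> a) (twist G \<alpha> \<xi> y \<gamma> b) =
        ext G (twist G \<alpha> \<xi> y) (\<beta> + \<gamma>) ([(N0 \<beta> \<gamma>)] \<cdot> (a \<otimes> b))"
    proof (cases "\<beta> + \<gamma> \<in> \<Phi>")
      case True
      then show ?thesis
        unfolding main by (simp add: ext_def[of G "twist G \<alpha> \<xi> y"] tw)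
          (simp add: pow_simps xab x_def)
    next
      case False
      then show ?thesis
        unfolding main using r by (simp add: ext_def[of G "twist G \<alpha> \<xi> y"] N0_zero Y.e_zero Y.e_nonroot)
    qed
  qed
qed

end

section \<open>Extending a partial Steinberg family\<close>

locale steinberg_local = steinberg_ring +
  fixes h
  assumes h_unit: "h \<in> Units K"
begin

definition lev :: "'b set \<Rightarrow> nat \<Rightarrow> 'b set" where
  "lev R n = (\<lambda>r. h [^] n \<otimes> r) ` R"

lemma h_closed [simp]: "h \<in> carrier K"
  using h_unit by auto

lemma hpow_unit: "h [^] (n::nat) \<in> Units K"
  by (induction n) (use h_unit in auto)

definition hdiv :: "nat \<Rightarrow> 'b \<Rightarrow> 'b" where
  "hdiv n c = inv (h [^] n) \<otimes> c"

lemma hdiv_mult [simp]: "c \<in> carrier K \<Longrightarrow> hdiv n (h [^] n \<otimes> c) = c"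
  using hpow_unit[of n] by (simp add: hdiv_def m_assoc[symmetric])

lemma mult_hdiv [simp]: "c \<in> carrier K \<Longrightarrow> h [^] n \<otimes> hdiv n c = c"
  using hpow_unit[of n] by (simp add: hdiv_def m_assoc[symmetric])

lemma hdiv_closed [simp]: "c \<in> carrier K \<Longrightarrow> hdiv n c \<in> carrier K"
  using hpow_unit[of n] by (simp add: hdiv_def)

lemma lev_0: "R \<subseteq> carrier K \<Longrightarrow> lev R 0 = R"
  by (force simp: lev_def)

lemma lev_mono_set: "R \<subseteq> S \<Longrightarrow> lev R n \<subseteq> lev S n"
  by (auto simp: lev_def)

lemma lev_add_iff:
  assumes "R \<subseteq> carrier K"
  shows "lev R (n + m) = (\<lambda>r. h [^] n \<otimes> r) ` lev R m"
  unfolding lev_def image_image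
  by (rule image_cong) (use assms in \<open>auto simp: nat_pow_mult[symmetric] m_assoc\<close>)

end

locale steinberg_level = steinberg_local +
  fixes R
  assumes R: "subring R K" and hR: "h \<in> R"
begin

lemmas RE = subringE[OF R]

lemma R_closed [simp]: "r \<in> R \<Longrightarrow> r \<in> carrier K"
  using RE(1) by blast

lemma hpow_R: "h [^] (n::nat) \<in> R"
  by (induction n) (use RE hR in auto)

lemma lev_nonunital_subring: "nonunital_subring (lev R n)"
  unfolding nonunital_subring_def
proof (intro conjI ballI)
  show "lev R n \<subseteq> carrier K" by (auto simp: lev_def)
  show "\<zero> \<in> lev R n" using RE(2) by (force simp: lev_def)
next
  fix a assume "a \<in> lev R n"
  then obtain r where "r \<in> R" "a = h [^] n \<otimes> r" by (auto simp: lev_def)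
  then show "\<ominus> a \<in> lev R n" using RE(5) by (force simp: lev_def r_minus)
next
  fix a b assume "a \<in> lev R n" "b \<in> lev R n"
  then obtain r s where r: "r \<in> R" "a = h [^] n \<otimes> r" "s \<in> R" "b = h [^] n \<otimes> s" by (auto simp: lev_def)
  then have "a \<oplus> b = h [^] n \<otimes> (r \<oplus> s)" by (simp add: r_distr)
  then show "a \<oplus> b \<in> lev R n" using RE(7) r by (force simp: lev_def)
  have "a \<otimes> b = h [^] n \<otimes> (r \<otimes> (h [^] n \<otimes> s))" using r by (simp add: m_assoc)
  then show "a \<otimes> b \<in> lev R n" using RE(6) hpow_R r unfolding lev_def by blast
qed

lemmas levD = nonunital_subringD[OF lev_nonunital_subring]

lemma lev_add_pow: "a \<in> lev R n \<Longrightarrow> [(k::int)] \<cdot> a \<in> lev R n"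
  by (rule nonunital_subring_add_pow[OF lev_nonunital_subring])

lemma lev_closed: "a \<in> lev R n \<Longrightarrow> a \<in> carrier K"
  using levD(1) by blast

lemma lev_mult: "a \<in> lev R n \<Longrightarrow> b \<in> lev R m \<Longrightarrow> a \<otimes> b \<in> lev R (n + m)"
proof -
  assume "a \<in> lev R n" "b \<in> lev R m"
  then obtain r s where r: "r \<in> R" "a = h [^] n \<otimes> r" "s \<in> R" "b = h [^] m \<otimes> s" by (auto simp: lev_def)
  then have "a \<otimes> b = h [^] (n + m) \<otimes> (r \<otimes> s)" by (simp add: nat_pow_mult[symmetric] m_ac)
  then show ?thesis using RE(6) r by (auto simp: lev_def)
qed

lemma lev_subset_R: "lev R n \<subseteq> R"
  using RE(6) hpow_R by (auto simp: lev_def)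

lemma lev_mono: "n \<le> m \<Longrightarrow> lev R m \<subseteq> lev R n"
  using lev_add_iff[OF RE(1), of n "m - n"] lev_subset_R[of "m - n"] by (auto simp: lev_def)

lemma hpow_lev: "h [^] n \<in> lev R n"
  using RE(3) by (force simp: lev_def)

lemma lev_hdiv: "c \<in> lev R (n + m) \<Longrightarrow> hdiv n c \<in> lev R m"
  using lev_closed by (auto simp: lev_add_iff[OF RE(1)])

lemma lev_scale:
  assumes "\<xi> \<in> carrier K" "h [^] k \<otimes> \<xi> \<in> R" "a \<in> lev R (n + k)"
  shows "\<xi> \<otimes> a \<in> lev R n"
proof -
  obtain r where r: "r \<in> R" "a = h [^] (n + k) \<otimes> r" using assms by (auto simp: lev_def)
  then have "\<xi> \<otimes> a = h [^] n \<otimes> ((h [^] k \<otimes> \<xi>) \<otimes> r)"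
    using assms(1) by (simp add: nat_pow_mult[symmetric] m_ac)
  then show ?thesis using RE(6)[OF assms(2) r(1)] by (auto simp: lev_def)
qed

end

locale extension = steinberg_level + G: group G
  for G :: "('g, 'n) monoid_scheme" +
  fixes M :: nat and \<alpha> w
  assumes alpha: "\<alpha> \<in> \<Phi>" and w: "pstein G (lev R M) (- \<alpha>) w"
begin

sublocale Y: pstein_family \<Phi> N K G "lev R M" "- \<alpha>" w
  by unfold_locales (use lev_nonunital_subring w minus_in alpha in auto)

abbreviation I where "I \<equiv> lev R M"
abbreviation H where "H \<equiv> h [^] M"

definition dec :: "'a \<Rightarrow> 'a \<Rightarrow> bool" where
  "dec \<beta> \<gamma> \<longleftrightarrow> \<beta> \<in> \<Phi> \<and> \<gamma> \<in> \<Phi> \<and> \<beta> + \<gamma> = - \<alpha>"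

text \<open>Candidate for the value of the family at the root \<open>- \<alpha>\<close> and the parameter \<open>s t\<close>.\<close>

definition Z :: "'a \<Rightarrow> 'a \<Rightarrow> 'b \<Rightarrow> 'b \<Rightarrow> 'g" where
  "Z \<beta> \<gamma> s t = cmt G (Y.e \<beta> s) (Y.e \<gamma> ([(N0 \<beta> \<gamma>)] \<cdot> t))"

lemma dec_sym: "dec \<beta> \<gamma> \<Longrightarrow> dec \<gamma> \<beta>"
  by (auto simp: dec_def add.commute)

lemma decD:
  assumes "dec \<beta> \<gamma>"
  shows "\<beta> \<in> \<Phi>" "\<gamma> \<in> \<Phi>" "\<beta> + \<gamma> = - \<alpha>" "pair \<beta> \<gamma> = -1" "pair \<alpha> \<beta> = -1" "pair \<alpha> \<gamma> = -1"
    "\<beta> \<noteq> - \<alpha>" "\<gamma> \<noteq> - \<alpha>" "N0 \<beta> \<gamma> * N0 \<beta> \<gamma> = 1"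
proof -
  show 1: "\<beta> \<in> \<Phi>" "\<gamma> \<in> \<Phi>" "\<beta> + \<gamma> = - \<alpha>" using assms by (auto simp: dec_def)
  have s: "\<beta> + \<gamma> \<in> \<Phi>" using 1 minus_in alpha by metis
  show 2: "pair \<beta> \<gamma> = -1" using add_root_iff[OF 1(1,2)] s by blast
  have a: "\<alpha> = - (\<beta> + \<gamma>)" using 1(3) by simp
  show 3: "pair \<alpha> \<beta> = -1" "pair \<alpha> \<gamma> = -1"
    using 1 2 by (simp_all add: a pair_simps pair_self pair_commute[of \<gamma> \<beta>])
  show "\<beta> \<noteq> - \<alpha>" "\<gamma> \<noteq> - \<alpha>" using 1 zero_notin by auto
  show "N0 \<beta> \<gamma> * N0 \<beta> \<gamma> = 1" using N0_sq 1 s by blast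
qed

lemma Z_closed: "dec \<beta> \<gamma> \<Longrightarrow> s \<in> I \<Longrightarrow> t \<in> I \<Longrightarrow> Z \<beta> \<gamma> s t \<in> carrier G"
  using decD[of \<beta> \<gamma>] by (simp add: Z_def lev_add_pow)

text \<open>The difference \<epsilon> = \<beta> - \<beta>' is then a root orthogonal to \<alpha>,
  and \<beta>', \<epsilon>, \<gamma> are simple roots of a subsystem of type \<open>A_3\<close> with
  highest root -\<alpha>. The two decompositions are the two ways to cut this chain.\<close>

definition linked :: "'a \<Rightarrow> 'a \<Rightarrow> 'a \<Rightarrow> 'a \<Rightarrow> bool" where
  "linked \<beta> \<gamma> \<beta>' \<gamma>' \<longleftrightarrow> dec \<beta> \<gamma> \<and> dec \<beta>' \<gamma>' \<and> pair \<beta> \<beta>' = 1"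

lemma linkedD:
  assumes "linked \<beta> \<gamma> \<beta>' \<gamma>'"
  shows "dec \<beta> \<gamma>" "dec \<beta>' \<gamma>'" "pair \<beta> \<beta>' = 1" "pair \<gamma> \<beta>' = 0" "pair \<beta> \<gamma>' = 0" "pair \<gamma> \<gamma>' = 1"
    "linked \<beta>' \<gamma>' \<beta> \<gamma>"
proof -
  show 1: "dec \<beta> \<gamma>" "dec \<beta>' \<gamma>'" "pair \<beta> \<beta>' = 1" using assms by (auto simp: linked_def)
  note d = decD[OF 1(1)] and d' = decD[OF 1(2)]
  have "\<gamma> = - \<alpha> - \<beta>" "\<gamma>' = - \<alpha> - \<beta>'" using d(3) d'(3) by (simp_all add: algebra_simps)
  then show "pair \<gamma> \<beta>' = 0" "pair \<beta> \<gamma>' = 0" "pair \<gamma> \<gamma>' = 1" "linked \<beta>' \<gamma>' \<beta> \<gamma>"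
    using 1 d d' alpha by (simp_all add: linked_def pair_simps pair_self pair_commute[of \<beta> \<alpha>]
        pair_commute[of \<beta>' \<alpha>] pair_commute[of \<beta>' \<beta>])
qed

text \<open>The pairings of \<beta> with \<beta>' and \<gamma>' add up to 1, because \<beta>' +
  \<gamma>' = -\<alpha>. Outside the plane of \<alpha> and \<beta> neither of them is 2 or -2, so
  one of them is 1; if it is the one with \<gamma>', the new decomposition is swapped.\<close>

lemma exists_linked:
  assumes "dec \<beta> \<gamma>"
  obtains \<beta>' \<gamma>' where "linked \<beta> \<gamma> \<beta>' \<gamma>'"
proof -
  note d = decD[OF assms]
  obtain \<beta>' \<gamma>' where b: "\<beta>' \<in> \<Phi>" "\<gamma>' \<in> \<Phi>" "\<beta>' + \<gamma>' = - \<alpha>" "\<beta>' \<notin> span {\<alpha>, \<beta>}" "\<gamma>' \<notin> span {\<alpha>, \<beta>}"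
    using decomposition_off_plane[of "- \<alpha>" \<alpha> \<beta>] minus_in alpha
    by (metis insertI1 span_base span_neg)
  then have dec': "dec \<beta>' \<gamma>'" by (simp add: dec_def)
  have "pair \<beta> (\<beta>' + \<gamma>') = 1" using b(3) d by (simp add: pair_simps pair_commute[of \<beta> \<alpha>])
  then have s: "pair \<beta> \<beta>' + pair \<beta> \<gamma>' = 1" by (simp only: pair_simps)
  have off: "\<beta> \<noteq> \<beta>'" "\<beta> \<noteq> \<gamma>'" "\<beta> + \<beta>' \<noteq> 0" "\<beta> + \<gamma>' \<noteq> 0"
    using b(4,5) span_base[of \<beta> "{\<alpha>, \<beta>}"] span_neg[of \<beta> "{\<alpha>, \<beta>}"]
    by (auto simp: Groups.add_eq_0_iff)
  have "pair \<beta> \<beta>' \<noteq> 2" "pair \<beta> \<gamma>' \<noteq> 2"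
    using eq_iff_pair d(1) b(1,2) off by blast+
  moreover have "pair \<beta> \<beta>' \<ge> -1" "pair \<beta> \<gamma>' \<ge> -1"
    using pair_ge_minus_one d(1) b(1,2) off by blast+
  ultimately have "pair \<beta> \<beta>' = 1 \<or> pair \<beta> \<gamma>' = 1"
    using pair_cases[OF d(1) b(1)] s by auto
  then show thesis using that assms dec' dec_sym unfolding linked_def by blast
qed

text \<open>This is the Hall-Witt identity for root elements at the ends and the middle of the chain
  \<beta>', \<epsilon>, \<gamma>, where the elements at the ends commute. The inner commutators sit
  at \<beta> = \<beta>' + \<epsilon> and at \<gamma>' = \<epsilon> + \<gamma>. The middle parameter
  \<open>u\<close> thereby changes from the first argument to the second.\<close>

lemma Z_linked:
  assumes l: "linked \<beta> \<gamma> \<beta>' \<gamma>'" and I: "s \<in> I" "u \<in> I" "t \<in> I"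
  shows "Z \<beta> \<gamma> (s \<otimes> u) t = inv\<^bsub>G\<^esub> Z \<beta>' \<gamma>' s (\<ominus> (u \<otimes> t))"
proof -
  note L = linkedD[OF l]
  note d = decD[OF L(1)] and d' = decD[OF L(2)]
  define \<epsilon> where "\<epsilon> = \<beta> - \<beta>'"
  have eps: "\<epsilon> \<in> \<Phi>" unfolding \<epsilon>_def using diff_root_iff[OF d(1) d'(1)] L(3) by blast
  have s1: "\<beta>' + \<epsilon> = \<beta>" "\<epsilon> + \<gamma> = \<gamma>'"
    using d(3) d'(3) by (simp_all add: \<epsilon>_def algebra_simps)
  have pe: "pair \<alpha> \<epsilon> = 0" "pair \<beta> \<epsilon> = 1" "pair \<epsilon> \<gamma>' = 1" "pair \<gamma> \<epsilon> = -1"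
    using L d d' by (simp_all add: \<epsilon>_def pair_simps pair_self pair_commute[of \<gamma> \<beta>])
  have ne: "\<epsilon> \<noteq> - \<alpha>" "\<epsilon> + \<gamma> \<noteq> 0" "\<beta>' + \<epsilon> \<noteq> 0" "\<beta> \<noteq> 0" "\<gamma>' \<noteq> 0" "- \<alpha> \<noteq> 0"
    using pe(1) alpha d d' zero_notin s1 by (auto simp: pair_simps pair_self)
  let ?\<sigma> = "N0 \<beta>' \<epsilon>"
  have sg: "?\<sigma> * ?\<sigma> = 1" using N0_sq[OF d'(1) eps] s1 d(1) by simp
  have jac: "N0 \<beta>' \<gamma>' * N0 \<epsilon> \<gamma> = N0 \<beta> \<gamma> * ?\<sigma>"
  proof -
    have "\<beta>' + \<gamma> \<notin> \<Phi>" "\<beta>' + \<gamma> \<noteq> 0"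
      using add_root_iff[OF d'(1) d(2)] add_zero_iff[OF d'(1) d(2)] L(4) by (auto simp: pair_commute)
    then show ?thesis using N0_jacobi[OF d'(1) eps d(2)] ne s1 by (simp add: N0_zero)
  qed
  have Ic: "s \<in> carrier K" "u \<in> carrier K" "t \<in> carrier K" using I lev_closed by auto
  have I2: "[k] \<cdot> u \<in> I" "[k] \<cdot> t \<in> I" "u \<otimes> t \<in> I" "[k] \<cdot> (u \<otimes> t) \<in> I" "s \<otimes> u \<in> I" for k :: int
    using I levD lev_add_pow by simp_all
  \<comment> \<open>The sign in \<open>?b\<close> makes the coefficient of \<open>[?a, ?b]\<close>
    equal to the square of \<open>N0 \<beta>' \<epsilon>\<close>, which is 1.\<close>
  let ?a = "Y.e \<beta>' s" and ?b = "Y.e \<epsilon> ([?\<sigma>] \<cdot> u)" and ?c = "Y.e \<gamma> ([(N0 \<beta> \<gamma>)] \<cdot> t)"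
  have ab: "cmt G ?a ?b = Y.e \<beta> (s \<otimes> u)"
    by (subst Y.e_cmt) (use I I2 Ic d d' ne s1 sg in \<open>auto simp: pow_simps\<close>)
  define k where "k = N0 \<epsilon> \<gamma> * (N0 \<beta> \<gamma> * ?\<sigma>)"
  have bc: "cmt G ?b ?c = Y.e \<gamma>' ([k] \<cdot> (u \<otimes> t))"
    by (subst Y.e_cmt) (use I I2 Ic d d' ne s1 in \<open>auto simp: pow_simps k_def mult.assoc\<close>)
  have kN: "k = N0 \<beta>' \<gamma>'"
  proof -
    have "k = (N0 \<beta>' \<gamma>' * N0 \<beta>' \<gamma>') * N0 \<epsilon> \<gamma> * ?\<sigma> * N0 \<beta> \<gamma>" using d'(9) by (simp add: k_def)
    also have "\<dots> = N0 \<beta>' \<gamma>' * (N0 \<beta>' \<gamma>' * N0 \<epsilon> \<gamma>) * ?\<sigma> * N0 \<beta> \<gamma>" by (simp only: ac_simps)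
    also have "\<dots> = N0 \<beta>' \<gamma>' * (N0 \<beta> \<gamma> * N0 \<beta> \<gamma>) * (?\<sigma> * ?\<sigma>)" by (simp only: jac ac_simps)
    finally show ?thesis using d(9) sg by simp
  qed
  have "cmt G (cmt G ?a ?b) ?c = inv\<^bsub>G\<^esub> cmt G ?a (inv\<^bsub>G\<^esub> cmt G ?b ?c)"
  proof (rule G.cmt_cmt_1)
    show "?a \<otimes>\<^bsub>G\<^esub> ?c = ?c \<otimes>\<^bsub>G\<^esub> ?a"
      by (rule Y.e_commute) (use I I2 d d' L in \<open>auto simp: pair_commute[of \<beta>' \<gamma>]\<close>)
    show "?b \<otimes>\<^bsub>G\<^esub> cmt G ?b ?c = cmt G ?b ?c \<otimes>\<^bsub>G\<^esub> ?b"
      unfolding bc by (rule Y.e_commute) (use I I2 d d' ne pe in auto)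
    show "cmt G ?a ?b \<otimes>\<^bsub>G\<^esub> cmt G ?b ?c = cmt G ?b ?c \<otimes>\<^bsub>G\<^esub> cmt G ?a ?b"
      unfolding bc ab by (rule Y.e_commute) (use I I2 d d' L in auto)
  qed (use I I2 d d' ne in auto)
  also have "inv\<^bsub>G\<^esub> cmt G ?b ?c = Y.e \<gamma>' ([(N0 \<beta>' \<gamma>')] \<cdot> (\<ominus> (u \<otimes> t)))"
    unfolding bc kN using I2(4) d'(8) Ic
    by (simp add: Y.e_minus[symmetric] add.int_pow_inv[of "u \<otimes> t", folded a_inv_def])
  finally show ?thesis unfolding Z_def ab .
qed

text \<open>By \<open>Z_linked\<close> the same element is, up to inversion, a commutator of root
  elements at \<beta>' and \<gamma>'. Each of these commutes with those at \<beta> and \<gamma>,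
  since the pairings are 0 or 1. The rewriting requires a first argument that is a product.\<close>

lemma Z_commute:
  assumes d: "dec \<beta> \<gamma>" and I: "s \<in> I" "u \<in> I" "t \<in> I" "r \<in> I"
  shows "Y.e \<gamma> r \<otimes>\<^bsub>G\<^esub> Z \<beta> \<gamma> (s \<otimes> u) t = Z \<beta> \<gamma> (s \<otimes> u) t \<otimes>\<^bsub>G\<^esub> Y.e \<gamma> r"
    and "Y.e \<beta> r \<otimes>\<^bsub>G\<^esub> Z \<beta> \<gamma> (s \<otimes> u) t = Z \<beta> \<gamma> (s \<otimes> u) t \<otimes>\<^bsub>G\<^esub> Y.e \<beta> r"
proof -
  obtain \<beta>' \<gamma>' where l: "linked \<beta> \<gamma> \<beta>' \<gamma>'" using exists_linked[OF d] .
  note L = linkedD[OF l]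
  note d = decD[OF L(1)] and d' = decD[OF L(2)]
  have I2: "\<ominus> (u \<otimes> t) \<in> I" using I levD by simp
  have c: "x \<otimes>\<^bsub>G\<^esub> Z \<beta> \<gamma> (s \<otimes> u) t = Z \<beta> \<gamma> (s \<otimes> u) t \<otimes>\<^bsub>G\<^esub> x"
    if x: "x \<in> carrier G" "\<And>r. r \<in> I \<Longrightarrow> x \<otimes>\<^bsub>G\<^esub> Y.e \<beta>' r = Y.e \<beta>' r \<otimes>\<^bsub>G\<^esub> x"
      "\<And>r. r \<in> I \<Longrightarrow> x \<otimes>\<^bsub>G\<^esub> Y.e \<gamma>' r = Y.e \<gamma>' r \<otimes>\<^bsub>G\<^esub> x" for x
    unfolding Z_linked[OF l I(1-3)]
    by (rule G.commute_inv[OF x(1) Z_closed[OF L(2) I(1) I2]])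
      (unfold Z_def, rule G.commute_cmt, use x I I2 lev_add_pow d' in auto)
  show "Y.e \<gamma> r \<otimes>\<^bsub>G\<^esub> Z \<beta> \<gamma> (s \<otimes> u) t = Z \<beta> \<gamma> (s \<otimes> u) t \<otimes>\<^bsub>G\<^esub> Y.e \<gamma> r"
    by (rule c; (rule Y.e_commute)?) (use d d' L I in auto)
  show "Y.e \<beta> r \<otimes>\<^bsub>G\<^esub> Z \<beta> \<gamma> (s \<otimes> u) t = Z \<beta> \<gamma> (s \<otimes> u) t \<otimes>\<^bsub>G\<^esub> Y.e \<beta> r"
    by (rule c; (rule Y.e_commute)?) (use d d' L I in auto)
qed

text \<open>A commutator is multiplicative in its second argument as soon as its value commutes with
  the factors of that argument.\<close>

lemma Z_add:
  assumes d: "dec \<beta> \<gamma>" and I: "s \<in> I" "u \<in> I" "t \<in> I" "t' \<in> I"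
  shows "Z \<beta> \<gamma> (s \<otimes> u) (t \<oplus> t') = Z \<beta> \<gamma> (s \<otimes> u) t \<otimes>\<^bsub>G\<^esub> Z \<beta> \<gamma> (s \<otimes> u) t'"
proof -
  note dd = decD[OF d]
  have Ic: "t \<in> carrier K" "t' \<in> carrier K" using I lev_closed by auto
  have su: "s \<otimes> u \<in> I" using I levD by simp
  have "Y.e \<gamma> ([(N0 \<beta> \<gamma>)] \<cdot> (t \<oplus> t')) = Y.e \<gamma> ([(N0 \<beta> \<gamma>)] \<cdot> t) \<otimes>\<^bsub>G\<^esub> Y.e \<gamma> ([(N0 \<beta> \<gamma>)] \<cdot> t')"
    using I dd Ic lev_add_pow by (simp add: add_pow_distrib Y.e_add)
  then show ?thesis
    unfolding Z_def
    using G.cmt_mult_right[of "Y.e \<beta> (s \<otimes> u)" "Y.e \<gamma> ([(N0 \<beta> \<gamma>)] \<cdot> t)" "Y.e \<gamma> ([(N0 \<beta> \<gamma>)] \<cdot> t')"]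
      Z_commute(1)[OF d I(1,2,4) lev_add_pow[OF I(3)], unfolded Z_def] su I dd lev_add_pow
    by simp
qed

lemma Z_minus:
  assumes d: "dec \<beta> \<gamma>" and I: "s \<in> I" "u \<in> I" "t \<in> I"
  shows "Z \<beta> \<gamma> (s \<otimes> u) (\<ominus> t) = inv\<^bsub>G\<^esub> Z \<beta> \<gamma> (s \<otimes> u) t"
proof -
  have su: "s \<otimes> u \<in> I" and mt: "\<ominus> t \<in> I" using I levD by simp_all
  have "Z \<beta> \<gamma> (s \<otimes> u) (\<ominus> t) \<otimes>\<^bsub>G\<^esub> Z \<beta> \<gamma> (s \<otimes> u) t = Z \<beta> \<gamma> (s \<otimes> u) (\<ominus> t \<oplus> t)"
    by (rule Z_add[OF d I(1,2) mt I(3), symmetric])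
  also have "\<ominus> t \<oplus> t = \<zero>" using lev_closed[OF I(3)] by (simp add: l_neg)
  also have "Z \<beta> \<gamma> (s \<otimes> u) \<zero> = \<one>\<^bsub>G\<^esub>"
    using decD[OF d] su by (simp add: Z_def Y.e_zero)
  finally show ?thesis
    using Z_closed[OF d su mt] Z_closed[OF d su I(3)] by (metis G.inv_equality)
qed

text \<open>The sign and the inverse in \<open>Z_linked\<close> cancel by \<open>Z_minus\<close>;
  this costs one more factor in the first argument.\<close>

lemma Z_linked_pos:
  assumes l: "linked \<beta> \<gamma> \<beta>' \<gamma>'" and I: "s \<in> I" "u \<in> I" "v \<in> I" "t \<in> I"
  shows "Z \<beta> \<gamma> (s \<otimes> u \<otimes> v) t = Z \<beta>' \<gamma>' (s \<otimes> u) (v \<otimes> t)"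
proof -
  have su: "s \<otimes> u \<in> I" and vt: "v \<otimes> t \<in> I" using I levD by simp_all
  note d' = linkedD(2)[OF l]
  show ?thesis
    unfolding Z_linked[OF l su I(3,4)] Z_minus[OF d' I(1,2) vt]
    using Z_closed[OF d' su vt] by simp
qed

text \<open>Passing to a linked decomposition and back moves a factor from left to right both times.
  The two signs and the two inverses cancel.\<close>

lemma Z_shift:
  assumes d: "dec \<beta> \<gamma>" and I: "s \<in> I" "u \<in> I" "v \<in> I" "t \<in> I"
  shows "Z \<beta> \<gamma> (s \<otimes> u \<otimes> v) t = Z \<beta> \<gamma> s (u \<otimes> v \<otimes> t)"
proof -
  obtain \<beta>' \<gamma>' where l: "linked \<beta> \<gamma> \<beta>' \<gamma>'" using exists_linked[OF d] .
  have vt: "v \<otimes> t \<in> I" "\<ominus> (v \<otimes> t) \<in> I" "u \<otimes> v \<otimes> t \<in> I" "s \<otimes> u \<in> I" using I levD by simp_all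
  have Ic: "s \<in> carrier K" "u \<in> carrier K" "v \<in> carrier K" "t \<in> carrier K" using I lev_closed by auto
  have "\<ominus> (u \<otimes> \<ominus> (v \<otimes> t)) = u \<otimes> v \<otimes> t" using Ic by (simp add: r_minus m_assoc)
  then show ?thesis
    unfolding Z_linked[OF l vt(4) I(3,4)] Z_linked[OF linkedD(7)[OF l] I(1,2) vt(2)]
    using Z_closed[OF d I(1) vt(3)] by simp
qed

text \<open>Exchanging \<beta> and \<gamma> inverts the commutator and changes the sign of
  \<open>N0\<close>. \<open>Z_shift\<close> carries that sign to the second argument, where
  \<open>Z_minus\<close> turns it into another inverse.\<close>

lemma Z_swap:
  assumes d: "dec \<beta> \<gamma>" and I: "s \<in> I" "u \<in> I" "v \<in> I" "t \<in> I"
  shows "Z \<gamma> \<beta> t (s \<otimes> u \<otimes> v) = Z \<beta> \<gamma> (s \<otimes> u \<otimes> v) t"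
proof -
  note dd = decD[OF d]
  let ?n = "N0 \<beta> \<gamma>" and ?x = "s \<otimes> u \<otimes> v"
  have Ic: "s \<in> carrier K" "u \<in> carrier K" "v \<in> carrier K" "t \<in> carrier K" using I lev_closed by auto
  have J: "?x \<in> I" "[(- ?n)] \<cdot> u \<in> I" "[?n] \<cdot> t \<in> I" "\<ominus> t \<in> I" "s \<otimes> u \<in> I" using I levD lev_add_pow by simp_all
  have x: "[(- ?n)] \<cdot> ?x = s \<otimes> [(- ?n)] \<cdot> u \<otimes> v" using Ic by (simp add: pow_simps)
  have m: "[(- (1::int))] \<cdot> z = \<ominus> z" if "z \<in> carrier K" for z
    using that by (simp add: add_pow_minus)
  have "Z \<gamma> \<beta> t ?x = cmt G (Y.e \<gamma> t) (Y.e \<beta> ([(- ?n)] \<cdot> ?x))"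
    by (simp only: Z_def N0_antisym[of \<gamma> \<beta>])
  also have "\<dots> = inv\<^bsub>G\<^esub> cmt G (Y.e \<beta> ([(- ?n)] \<cdot> ?x)) (Y.e \<gamma> t)"
    using dd J lev_add_pow I by (simp add: G.inv_cmt)
  also have "cmt G (Y.e \<beta> ([(- ?n)] \<cdot> ?x)) (Y.e \<gamma> t) = Z \<beta> \<gamma> (s \<otimes> [(- ?n)] \<cdot> u \<otimes> v) ([?n] \<cdot> t)"
    using Ic dd(9) by (simp add: Z_def x add_pow_add_pow)
  also have "\<dots> = Z \<beta> \<gamma> s ([(- ?n)] \<cdot> u \<otimes> v \<otimes> [?n] \<cdot> t)"
    by (rule Z_shift[OF d I(1) J(2) I(3) J(3)])
  also have "[(- ?n)] \<cdot> u \<otimes> v \<otimes> [?n] \<cdot> t = u \<otimes> v \<otimes> \<ominus> t"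
    using Ic dd(9) by (simp add: pow_simps m r_minus)
  also have "Z \<beta> \<gamma> s (u \<otimes> v \<otimes> \<ominus> t) = Z \<beta> \<gamma> ?x (\<ominus> t)"
    by (rule Z_shift[OF d I(1-3) J(4), symmetric])
  also have "\<dots> = inv\<^bsub>G\<^esub> Z \<beta> \<gamma> ?x t" by (rule Z_minus[OF d J(5) I(3,4)])
  finally show ?thesis using Z_closed[OF d J(1) I(4)] by simp
qed

text \<open>The candidate as a function of the product alone, by means of the fixed factorization of
  \<open>c\<close> with first factor \<open>H\<close>. \<open>Z_eq_F\<close> shows that other
  factorizations give the same value.\<close>

definition F :: "'a \<Rightarrow> 'a \<Rightarrow> 'b \<Rightarrow> 'g" where
  "F \<beta> \<gamma> c = Z \<beta> \<gamma> H (hdiv M c)"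

lemma H_I: "H \<in> I"
  by (rule hpow_lev)

lemma lev_cubeE:
  assumes "s \<in> lev R (3 * M)"
  obtains s' where "s' \<in> I" "s = H \<otimes> H \<otimes> s'"
proof -
  have "s \<in> lev R ((M + M) + M)" using assms by (simp add: numeral_3_eq_3 add.assoc)
  then have "hdiv (M + M) s \<in> I" by (rule lev_hdiv)
  moreover have "s = h [^] (M + M) \<otimes> hdiv (M + M) s" using lev_closed[OF assms] by simp
  ultimately show thesis using that by (simp add: nat_pow_mult[symmetric])
qed

text \<open>\<open>Z_shift\<close> takes a first argument with three factors from \<open>I\<close>.
  At level \<open>3 M\<close> it is \<open>H H s'\<close>, and the last two factors are moved to the
  right, leaving \<open>H\<close> on the left as in \<open>F\<close>.\<close>

lemma Z_eq_F:
  assumes d: "dec \<beta> \<gamma>" and s: "s \<in> lev R (3 * M)" and t: "t \<in> I"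
  shows "Z \<beta> \<gamma> s t = F \<beta> \<gamma> (s \<otimes> t)"
proof -
  obtain s' where s': "s' \<in> I" "s = H \<otimes> H \<otimes> s'" using lev_cubeE[OF s] .
  have c: "s' \<in> carrier K" "t \<in> carrier K" using s' t lev_closed by auto
  have "hdiv M (s \<otimes> t) = H \<otimes> s' \<otimes> t"
    using hdiv_mult[of "H \<otimes> s' \<otimes> t" M] c by (simp add: s'(2) m_assoc)
  then show ?thesis using Z_shift[OF d H_I H_I s'(1) t] by (simp add: F_def s'(2))
qed

text \<open>Writing \<open>c\<close> as four factors \<open>H\<close> times \<open>t\<close>,
  \<open>Z_linked_pos\<close> moves the fourth \<open>H\<close> to the second argument. The three
  that stay keep the first argument deep enough for \<open>Z_eq_F\<close> on both sides.\<close>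

lemma F_linked:
  assumes l: "linked \<beta> \<gamma> \<beta>' \<gamma>'" and c: "c \<in> lev R (6 * M)"
  shows "F \<beta> \<gamma> c = F \<beta>' \<gamma>' c"
proof -
  note L = linkedD[OF l]
  have "6 * M = (M + (M + M) + M) + 2 * M" by simp
  then have "hdiv (M + (M + M) + M) c \<in> lev R (2 * M)" using lev_hdiv c by metis
  then have t: "hdiv (M + (M + M) + M) c \<in> I" using lev_mono[of M "2 * M"] by auto
  define t where "t = hdiv (M + (M + M) + M) c"
  have tI: "t \<in> I" "t \<in> carrier K" using t lev_closed by (auto simp: t_def)
  have ct: "c = H \<otimes> (H \<otimes> H) \<otimes> H \<otimes> t"
    using mult_hdiv[of c "M + (M + M) + M"] lev_closed[OF c] by (simp add: t_def nat_pow_mult)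
  have HH: "H \<otimes> H \<in> I" "H \<otimes> t \<in> I" using H_I levD tI by auto
  have s3: "H \<otimes> (H \<otimes> H) \<in> lev R (3 * M)"
    using hpow_lev[of "3 * M"] by (simp add: nat_pow_mult numeral_3_eq_3 add.assoc)
  then have s4: "H \<otimes> (H \<otimes> H) \<otimes> H \<in> lev R (3 * M)" using levD(6) H_I s3
      lev_mult[OF s3 H_I] lev_mono[of "3 * M" "3 * M + M"] by auto
  have "F \<beta> \<gamma> c = Z \<beta> \<gamma> (H \<otimes> (H \<otimes> H) \<otimes> H) t"
    unfolding ct by (rule Z_eq_F[OF L(1) s4 tI(1), symmetric])
  also have "\<dots> = Z \<beta>' \<gamma>' (H \<otimes> (H \<otimes> H)) (H \<otimes> t)"
    by (rule Z_linked_pos[OF l H_I HH(1) H_I tI(1)])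
  also have "\<dots> = F \<beta>' \<gamma>' (H \<otimes> (H \<otimes> H) \<otimes> (H \<otimes> t))" by (rule Z_eq_F[OF L(2) s3 HH(2)])
  also have "H \<otimes> (H \<otimes> H) \<otimes> (H \<otimes> t) = c" using tI by (simp add: ct m_assoc)
  finally show ?thesis .
qed

lemma F_swap:
  assumes d: "dec \<beta> \<gamma>" and c: "c \<in> lev R (6 * M)"
  shows "F \<gamma> \<beta> c = F \<beta> \<gamma> c"
proof -
  define s where "s = h [^] (3 * M)"
  define t where "t = hdiv (3 * M) c"
  have "6 * M = 3 * M + 3 * M" by simp
  then have t: "t \<in> lev R (3 * M)" using lev_hdiv c unfolding t_def by metis
  have s: "s \<in> lev R (3 * M)" unfolding s_def by (rule hpow_lev)
  have I: "s \<in> I" "t \<in> I" using s t lev_mono[of M "3 * M"] by auto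
  have cl: "s \<in> carrier K" "t \<in> carrier K" using I lev_closed by auto
  have ct: "c = s \<otimes> t" using lev_closed[OF c] by (simp add: s_def t_def)
  obtain s' where s': "s' \<in> I" "s = H \<otimes> H \<otimes> s'" using lev_cubeE[OF s] .
  have "F \<gamma> \<beta> c = Z \<gamma> \<beta> t s"
    using Z_eq_F[OF dec_sym[OF d] t I(1)] cl by (simp add: ct m_comm)
  also have "\<dots> = Z \<beta> \<gamma> s t" unfolding s'(2) by (rule Z_swap[OF d H_I H_I s'(1) I(2)])
  also have "\<dots> = F \<beta> \<gamma> c" unfolding ct by (rule Z_eq_F[OF d s I(2)])
  finally show ?thesis .
qed

text \<open>The pairings of \<beta> and \<gamma> with \<beta>' add up to 1. Hence \<beta>' is one of
  \<beta> and \<gamma>, or it is linked to one of them, and \<open>F_swap\<close> exchanges their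
  roles.\<close>

lemma F_unique:
  assumes d: "dec \<beta> \<gamma>" and d': "dec \<beta>' \<gamma>'" and c: "c \<in> lev R (6 * M)"
  shows "F \<beta> \<gamma> c = F \<beta>' \<gamma>' c"
proof -
  note dd = decD[OF d] and dd' = decD[OF d']
  have "pair (\<beta> + \<gamma>) \<beta>' = 1" unfolding dd(3) using dd' by (simp add: pair_simps)
  then have s: "pair \<beta> \<beta>' + pair \<gamma> \<beta>' = 1" by (simp only: pair_simps)
  have eq: "\<gamma> = - \<alpha> - \<beta>" "\<gamma>' = - \<alpha> - \<beta>'" using dd dd' by (simp_all add: algebra_simps)
  consider "pair \<beta> \<beta>' = 2" | "pair \<gamma> \<beta>' = 2" | "pair \<beta> \<beta>' = 1" | "pair \<gamma> \<beta>' = 1"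
    using pair_cases[OF dd(1) dd'(1)] pair_cases[OF dd(2) dd'(1)] s by (elim disjE) simp_all
  then show ?thesis
  proof cases
    case 1
    then have "\<beta> = \<beta>'" using eq_iff_pair dd dd' by blast
    then show ?thesis using eq by simp
  next
    case 2
    then have e: "\<gamma> = \<beta>'" using eq_iff_pair dd dd' by blast
    have "\<gamma>' = \<beta>" using dd(3) dd'(3) e by (metis Groups.add_ac(2) Groups.add_left_cancel)
    then show ?thesis using F_swap[OF d c] e by simp
  next
    case 3
    then show ?thesis using F_linked c d d' by (simp add: linked_def)
  next
    case 4
    then have "F \<gamma> \<beta> c = F \<beta>' \<gamma>' c" using F_linked[OF _ c] d d' dec_sym by (simp add: linked_def)
    then show ?thesis using F_swap[OF d c] by simp
  qed
qed

end

section \<open>The extended family satisfies all Steinberg relations\<close>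

context extension
begin

text \<open>The factor 6 comes from \<open>F_swap\<close>: there \<open>c\<close> is split into two
  factors that both have to be at level \<open>3 M\<close>.\<close>

abbreviation J where "J \<equiv> lev R (6 * M)"

lemma J_I: "c \<in> J \<Longrightarrow> c \<in> I"
  using lev_mono[of M "6 * M"] by auto

lemma exists_dec: obtains \<beta> \<gamma> where "dec \<beta> \<gamma>"
proof -
  have "- \<alpha> \<in> span {\<alpha>, \<alpha>}" by (intro span_neg span_base) simp
  then show thesis
    using decomposition_off_plane[of "- \<alpha>" \<alpha> \<alpha>] minus_in[OF alpha] that unfolding dec_def by metis
qed

definition extended :: "'a \<Rightarrow> 'b \<Rightarrow> 'g" where
  "extended \<rho> c = (if \<rho> = - \<alpha> then (let (\<beta>, \<gamma>) = SOME (\<beta>, \<gamma>). dec \<beta> \<gamma> in F \<beta> \<gamma> c) else w \<rho> c)"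

lemma extended_other: "\<rho> \<noteq> - \<alpha> \<Longrightarrow> extended \<rho> c = w \<rho> c"
  by (simp add: extended_def)

lemma extended_minus:
  assumes "dec \<beta> \<gamma>" "c \<in> J"
  shows "extended (- \<alpha>) c = F \<beta> \<gamma> c"
proof -
  obtain \<beta>' \<gamma>' where s: "(SOME (\<beta>, \<gamma>). dec \<beta> \<gamma>) = (\<beta>', \<gamma>')" by (meson surj_pair)
  have "case (SOME (\<beta>, \<gamma>). dec \<beta> \<gamma>) of (\<beta>, \<gamma>) \<Rightarrow> dec \<beta> \<gamma>"
    by (rule someI[of _ "(\<beta>, \<gamma>)"]) (use assms in simp)
  then have "dec \<beta>' \<gamma>'" by (simp add: s)
  then show ?thesis using F_unique[OF assms(1) _ assms(2)] by (simp add: extended_def s)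
qed

text \<open>The first argument \<open>H (H H)\<close> is at level \<open>3 M\<close>, as
  \<open>Z_eq_F\<close> demands, and is a product of two elements of \<open>I\<close>, the form in
  which \<open>Z_add\<close> and \<open>Z_commute\<close> apply.\<close>

lemma extended_Z:
  assumes "dec \<beta> \<gamma>" "c \<in> J"
  obtains t where "t \<in> I" "hdiv (3 * M) c = t" "extended (- \<alpha>) c = Z \<beta> \<gamma> (H \<otimes> (H \<otimes> H)) t"
    "c = H \<otimes> (H \<otimes> H) \<otimes> t"
proof -
  define t where "t = hdiv (3 * M) c"
  have H3: "H \<otimes> (H \<otimes> H) = h [^] (3 * M)" by (simp add: nat_pow_mult numeral_3_eq_3 add.assoc)
  have "6 * M = 3 * M + 3 * M" by simp
  then have "t \<in> lev R (3 * M)" using lev_hdiv assms(2) unfolding t_def by metis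
  then have t: "t \<in> I" using lev_mono[of M "3 * M"] by auto
  have c: "c = H \<otimes> (H \<otimes> H) \<otimes> t" unfolding H3 t_def using lev_closed[OF assms(2)] by simp
  have "H \<otimes> (H \<otimes> H) \<in> lev R (3 * M)" unfolding H3 by (rule hpow_lev)
  then have "Z \<beta> \<gamma> (H \<otimes> (H \<otimes> H)) t = extended (- \<alpha>) c"
    using Z_eq_F[OF assms(1) _ t] extended_minus[OF assms] c by simp
  then show thesis using that t c t_def by metis
qed

lemma HH_I: "H \<otimes> H \<in> I" "H \<otimes> (H \<otimes> H) \<in> I"
  using H_I levD by auto

lemma extended_closed:
  assumes "\<rho> \<in> \<Phi>" "c \<in> J"
  shows "extended \<rho> c \<in> carrier G"
proof (cases "\<rho> = - \<alpha>")
  case True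
  obtain \<beta> \<gamma> where d: "dec \<beta> \<gamma>" using exists_dec .
  obtain t where "t \<in> I" "extended (- \<alpha>) c = Z \<beta> \<gamma> (H \<otimes> (H \<otimes> H)) t"
    using extended_Z[OF d assms(2)] by metis
  then show ?thesis using True Z_closed[OF d HH_I(2)] by simp
next
  case False
  then show ?thesis using assms J_I Y.y_closed by (simp add: extended_other)
qed

lemma extended_add:
  assumes "\<rho> \<in> \<Phi>" "a \<in> J" "b \<in> J"
  shows "extended \<rho> (a \<oplus> b) = extended \<rho> a \<otimes>\<^bsub>G\<^esub> extended \<rho> b"
proof (cases "\<rho> = - \<alpha>")
  case True
  have ab: "a \<oplus> b \<in> J" using assms levD by simp
  have cl: "a \<in> carrier K" "b \<in> carrier K" using assms lev_closed by auto
  obtain \<beta> \<gamma> where d: "dec \<beta> \<gamma>" using exists_dec .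
  obtain s where s: "s \<in> I" "hdiv (3 * M) a = s" "extended (- \<alpha>) a = Z \<beta> \<gamma> (H \<otimes> (H \<otimes> H)) s"
    using extended_Z[OF d assms(2)] by metis
  obtain t where t: "t \<in> I" "hdiv (3 * M) b = t" "extended (- \<alpha>) b = Z \<beta> \<gamma> (H \<otimes> (H \<otimes> H)) t"
    using extended_Z[OF d assms(3)] by metis
  have "hdiv (3 * M) (a \<oplus> b) = s \<oplus> t"
    using cl hpow_unit[of "3 * M"] by (simp add: hdiv_def r_distr flip: s(2) t(2))
  then have "extended (- \<alpha>) (a \<oplus> b) = Z \<beta> \<gamma> (H \<otimes> (H \<otimes> H)) (s \<oplus> t)"
    using extended_Z[OF d ab] by metis
  then show ?thesis using Z_add[OF d H_I HH_I(1) s(1) t(1)] s(3) t(3) True by simp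
next
  case False
  then show ?thesis using assms J_I Y.y_add by (simp add: extended_other)
qed

lemma extended_commute:
  assumes d: "dec \<beta> \<gamma>" and c: "c \<in> J" and x: "x \<in> carrier G"
    and b: "\<And>r. r \<in> I \<Longrightarrow> x \<otimes>\<^bsub>G\<^esub> Y.e \<beta> r = Y.e \<beta> r \<otimes>\<^bsub>G\<^esub> x"
    and g: "\<And>r. r \<in> I \<Longrightarrow> x \<otimes>\<^bsub>G\<^esub> Y.e \<gamma> r = Y.e \<gamma> r \<otimes>\<^bsub>G\<^esub> x"
  shows "x \<otimes>\<^bsub>G\<^esub> extended (- \<alpha>) c = extended (- \<alpha>) c \<otimes>\<^bsub>G\<^esub> x"
proof -
  obtain t where t: "t \<in> I" "extended (- \<alpha>) c = Z \<beta> \<gamma> (H \<otimes> (H \<otimes> H)) t"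
    using extended_Z[OF d c] by metis
  show ?thesis
    unfolding t(2) Z_def by (rule G.commute_cmt) (use x b g t HH_I lev_add_pow decD[OF d] in auto)
qed

lemma extended_cmt_opposite:
  assumes d: "dec \<beta> \<gamma>" and st: "s \<in> J" "t \<in> J"
  shows "cmt G (w \<beta> s) (w \<gamma> t) = extended (- \<alpha>) ([(N0 \<beta> \<gamma>)] \<cdot> (s \<otimes> t))"
proof -
  note dd = decD[OF d]
  have cl: "s \<in> carrier K" "t \<in> carrier K" using st lev_closed by auto
  have s: "s \<in> lev R (3 * M)" using st lev_mono[of "3 * M" "6 * M"] by auto
  have J: "[(N0 \<beta> \<gamma>)] \<cdot> (s \<otimes> t) \<in> J" using st levD lev_add_pow by simp
  have "cmt G (w \<beta> s) (w \<gamma> t) = Z \<beta> \<gamma> s ([(N0 \<beta> \<gamma>)] \<cdot> t)"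
    using dd cl by (simp add: Z_def add_pow_add_pow Y.e_root)
  also have "\<dots> = F \<beta> \<gamma> (s \<otimes> [(N0 \<beta> \<gamma>)] \<cdot> t)"
    by (rule Z_eq_F[OF d s]) (use st J_I lev_add_pow in simp)
  also have "s \<otimes> [(N0 \<beta> \<gamma>)] \<cdot> t = [(N0 \<beta> \<gamma>)] \<cdot> (s \<otimes> t)" using cl by (simp add: pow_simps)
  finally show ?thesis using extended_minus[OF d J] by simp
qed

text \<open>The value at -\<alpha> is a commutator for any decomposition, here one off the plane of
  \<alpha> and \<delta> with \<open>pair \<beta> \<delta> \<ge> 0\<close>. Then the elements at
  \<beta> and \<delta> commute, and Hall-Witt reduces the claim to commutators that avoid -\<alpha>.
  The second form \<open>cmt_cmt_2\<close> is needed, because nothing is known yet about how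
  \<open>[?a, ?b]\<close>, which sits at -\<alpha>, commutes with other elements.\<close>

lemma extended_cmt_minus:
  assumes del: "\<delta> \<in> \<Phi>" "\<delta> \<noteq> \<alpha>" "\<delta> \<noteq> - \<alpha>" and c: "c \<in> J" and u: "u \<in> J"
  shows "cmt G (extended (- \<alpha>) c) (w \<delta> u) = Y.e (- \<alpha> + \<delta>) ([(N0 (- \<alpha>) \<delta>)] \<cdot> (c \<otimes> u))"
proof -
  have "- \<alpha> \<in> span {\<alpha>, \<delta>}" by (intro span_neg span_base) simp
  then obtain \<beta>1 \<gamma>1 where b1: "dec \<beta>1 \<gamma>1" "\<beta>1 \<notin> span {\<alpha>, \<delta>}" "\<gamma>1 \<notin> span {\<alpha>, \<delta>}"
    using decomposition_off_plane[of "- \<alpha>" \<alpha> \<delta>] minus_in[OF alpha] unfolding dec_def by metis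
  have off: "\<rho> \<noteq> \<delta>" "\<rho> + \<delta> \<noteq> 0" "\<rho> + \<delta> \<noteq> - \<alpha>" if "\<rho> \<notin> span {\<alpha>, \<delta>}" for \<rho>
  proof -
    have P: "\<alpha> \<in> span {\<alpha>, \<delta>}" "\<delta> \<in> span {\<alpha>, \<delta>}" by (auto intro: span_base)
    then show "\<rho> \<noteq> \<delta>" using that by blast
    have Q: "- \<delta> \<in> span {\<alpha>, \<delta>}" "- \<alpha> - \<delta> \<in> span {\<alpha>, \<delta>}"
      using P by (auto intro: span_neg span_diff)
    show "\<rho> + \<delta> \<noteq> 0" using that Q(1) eq_neg_iff_add_eq_0[of \<rho> \<delta>] by auto
    show "\<rho> + \<delta> \<noteq> - \<alpha>" using that Q(2) eq_diff_eq[of \<rho> "- \<alpha>" \<delta>] by auto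
  qed
  have pd: "pair \<alpha> \<delta> \<noteq> 2" "- \<alpha> + \<delta> \<noteq> 0" using eq_iff_pair[OF alpha del(1)] del(2) by auto
  have "\<exists>\<beta> \<gamma>. dec \<beta> \<gamma> \<and> \<beta> \<notin> span {\<alpha>, \<delta>} \<and> \<gamma> \<notin> span {\<alpha>, \<delta>} \<and> pair \<beta> \<delta> \<ge> 0"
  proof (cases "pair \<beta>1 \<delta> \<ge> 0")
    case False
    note d1 = decD[OF b1(1)]
    have "pair (\<beta>1 + \<gamma>1) \<delta> = - pair \<alpha> \<delta>" unfolding d1(3) by (simp add: pair_simps)
    then have s: "pair \<beta>1 \<delta> + pair \<gamma>1 \<delta> = - pair \<alpha> \<delta>" by (simp only: pair_simps)
    have g: "pair \<beta>1 \<delta> \<ge> -1" "pair \<gamma>1 \<delta> \<ge> -1"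
      using pair_ge_minus_one[OF d1(1) del(1)] pair_ge_minus_one[OF d1(2) del(1)] off b1(2,3) by blast+
    \<comment> \<open>If \<delta> had pairing -1 with both parts of -\<alpha>, its pairing with
      \<alpha> would be 2 and \<delta> would be \<alpha>. So at least one of the two parts can serve
      as \<beta>.\<close>
    have "pair \<gamma>1 \<delta> \<noteq> -1"
    proof
      assume "pair \<gamma>1 \<delta> = -1"
      moreover have "pair \<beta>1 \<delta> = -1" using False g(1) pair_cases[OF d1(1) del(1)] by (elim disjE) simp_all
      ultimately show False using s pd(1) by simp
    qed
    then have "pair \<gamma>1 \<delta> \<ge> 0" using g(2) pair_cases[OF d1(2) del(1)] by (elim disjE) simp_all
    then show ?thesis using dec_sym[OF b1(1)] b1(2,3) by blast
  qed (use b1 in blast)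
  then obtain \<beta> \<gamma> where d: "dec \<beta> \<gamma>" and P: "\<beta> \<notin> span {\<alpha>, \<delta>}" "\<gamma> \<notin> span {\<alpha>, \<delta>}"
    and pb: "pair \<beta> \<delta> \<ge> 0" by blast
  note dd = decD[OF d]
  have ne: "\<gamma> + \<delta> \<noteq> 0" "\<gamma> + \<delta> \<noteq> - \<alpha>" "\<beta> + \<delta> \<noteq> 0" using off P by auto
  have sum: "\<beta> + (\<gamma> + \<delta>) = - \<alpha> + \<delta>" using dd(3) by (simp add: add.assoc[symmetric])
  have dne: "- \<alpha> + \<delta> \<noteq> - \<alpha>" using del zero_notin by auto
  have sumne: "\<beta> + (\<gamma> + \<delta>) \<noteq> 0" "\<beta> + (\<gamma> + \<delta>) \<noteq> - \<alpha>"
    unfolding sum by (rule pd(2), rule dne)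
  obtain t where t: "t \<in> I" "extended (- \<alpha>) c = Z \<beta> \<gamma> (H \<otimes> (H \<otimes> H)) t" "c = H \<otimes> (H \<otimes> H) \<otimes> t"
    using extended_Z[OF d c] by metis
  define s where "s = H \<otimes> (H \<otimes> H)"
  define n where "n = N0 \<beta> \<gamma>"
  have cl: "s \<in> carrier K" "t \<in> carrier K" "u \<in> carrier K" "c \<in> carrier K"
    using t(1) c u lev_closed by (auto simp: s_def)
  have st: "s \<in> I" "u \<in> I" "[n] \<cdot> t \<in> I" using HH_I J_I u t lev_add_pow by (auto simp: s_def)
  have tu: "[k] \<cdot> (t \<otimes> u) \<in> I" "[k] \<cdot> (s \<otimes> (t \<otimes> u)) \<in> I" for k :: int
    using t st levD lev_add_pow by auto
  let ?a = "Y.e \<beta> s" and ?b = "Y.e \<gamma> ([n] \<cdot> t)" and ?c = "Y.e \<delta> u"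
  define k where "k = N0 \<gamma> \<delta> * n"
  have bc: "cmt G ?b ?c = Y.e (\<gamma> + \<delta>) ([k] \<cdot> (t \<otimes> u))"
    by (subst Y.e_cmt) (use dd del st ne cl in \<open>auto simp: pow_simps k_def\<close>)
  then have ibc: "inv\<^bsub>G\<^esub> cmt G ?b ?c = Y.e (\<gamma> + \<delta>) (\<ominus> ([k] \<cdot> (t \<otimes> u)))"
    using tu ne by (simp add: Y.e_minus)
  define f where "f = N0 \<beta> (\<gamma> + \<delta>) * k"
  have mI: "\<ominus> ([k] \<cdot> (t \<otimes> u)) \<in> I" using tu levD by simp
  have mf: "[f] \<cdot> (s \<otimes> (t \<otimes> u)) \<in> I" "\<ominus> ([f] \<cdot> (s \<otimes> (t \<otimes> u))) \<in> I" using tu levD by simp_all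
  have "cmt G ?a (inv\<^bsub>G\<^esub> cmt G ?b ?c) = Y.e (- \<alpha> + \<delta>) ([(N0 \<beta> (\<gamma> + \<delta>))] \<cdot> (s \<otimes> \<ominus> ([k] \<cdot> (t \<otimes> u))))"
    unfolding ibc sum[symmetric] by (rule Y.e_cmt) (use dd ne st mI sumne in auto)
  also have "[(N0 \<beta> (\<gamma> + \<delta>))] \<cdot> (s \<otimes> \<ominus> ([k] \<cdot> (t \<otimes> u))) = \<ominus> ([f] \<cdot> (s \<otimes> (t \<otimes> u)))"
  proof -
    have "s \<otimes> \<ominus> ([k] \<cdot> (t \<otimes> u)) = [(- k)] \<cdot> (s \<otimes> (t \<otimes> u))"
      using cl by (simp add: pow_simps add_pow_minus r_minus)
    then show ?thesis using cl by (simp add: pow_simps f_def add_pow_minus[symmetric])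
  qed
  finally have ff: "cmt G ?a (inv\<^bsub>G\<^esub> cmt G ?b ?c) = Y.e (- \<alpha> + \<delta>) (\<ominus> ([f] \<cdot> (s \<otimes> (t \<otimes> u))))" .
  have "cmt G (cmt G ?a ?b) ?c = inv\<^bsub>G\<^esub> cmt G ?a (inv\<^bsub>G\<^esub> cmt G ?b ?c)"
  proof (rule G.cmt_cmt_2)
    show "?a \<otimes>\<^bsub>G\<^esub> ?c = ?c \<otimes>\<^bsub>G\<^esub> ?a"
      by (rule Y.e_commute) (use dd del st pb in auto)
    show "?b \<otimes>\<^bsub>G\<^esub> cmt G ?b ?c = cmt G ?b ?c \<otimes>\<^bsub>G\<^esub> ?b"
      unfolding bc
    proof (rule Y.e_commute)
      assume "\<gamma> + \<delta> \<in> \<Phi>"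
      then have "pair \<gamma> \<delta> = -1" using add_root_iff[OF dd(2) del(1)] by blast
      then show "pair \<gamma> (\<gamma> + \<delta>) \<ge> 0" using dd by (simp add: pair_simps pair_self)
    qed (use dd st ne tu in auto)
    have pg: "pair \<gamma> \<delta> \<ge> -1" by (rule pair_ge_minus_one[OF dd(2) del(1) ne(1)])
    show "cmt G ?a (inv\<^bsub>G\<^esub> cmt G ?b ?c) \<otimes>\<^bsub>G\<^esub> ?a = ?a \<otimes>\<^bsub>G\<^esub> cmt G ?a (inv\<^bsub>G\<^esub> cmt G ?b ?c)"
      unfolding ff by (rule Y.e_commute)
        (use dd dne st mf pb in \<open>auto simp: pair_simps pair_commute[of \<delta> \<beta>]\<close>)
    show "cmt G ?a (inv\<^bsub>G\<^esub> cmt G ?b ?c) \<otimes>\<^bsub>G\<^esub> ?b = ?b \<otimes>\<^bsub>G\<^esub> cmt G ?a (inv\<^bsub>G\<^esub> cmt G ?b ?c)"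
      unfolding ff by (rule Y.e_commute)
        (use dd dne st mf pg in \<open>auto simp: pair_simps pair_commute[of \<delta> \<gamma>]\<close>)
  qed (use dd del st in auto)
  also have "\<dots> = Y.e (- \<alpha> + \<delta>) ([f] \<cdot> (s \<otimes> (t \<otimes> u)))"
    unfolding ff using mf dne by (simp add: Y.e_minus)
  also have "[f] \<cdot> (s \<otimes> (t \<otimes> u)) = [(N0 (- \<alpha>) \<delta>)] \<cdot> (c \<otimes> u)"
  proof -
    have "\<beta> + \<delta> \<notin> \<Phi>" using pb add_root_iff[OF dd(1) del(1)] by auto
    moreover have "\<beta> + \<gamma> \<noteq> 0" using dd(4) add_zero_iff[OF dd(1,2)] by auto
    ultimately have "N0 \<beta> (\<gamma> + \<delta>) * N0 \<gamma> \<delta> = N0 (- \<alpha>) \<delta> * n"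
      using N0_jacobi[OF dd(1,2) del(1) _ ne(1,3)] dd(3) by (simp add: N0_zero n_def)
    then have "f = N0 (- \<alpha>) \<delta> * (n * n)" by (simp add: f_def k_def)
    then have "f = N0 (- \<alpha>) \<delta>" using dd(9) by (simp add: n_def)
    moreover have "c \<otimes> u = s \<otimes> (t \<otimes> u)" unfolding t(3) using cl by (simp add: m_assoc s_def)
    ultimately show ?thesis by simp
  qed
  finally show ?thesis using del unfolding t(2) Z_def s_def[symmetric] n_def[symmetric] by (simp add: Y.e_root)
qed

lemma extended_stein: "stein G J extended"
  unfolding pstein_def
proof (intro conjI ballI impI)
  fix \<rho> a assume "\<rho> \<in> \<Phi> - {0}" "a \<in> J"
  then show "extended \<rho> a \<in> carrier G" using extended_closed by blast
next
  fix \<rho> a b assume "\<rho> \<in> \<Phi> - {0}" "a \<in> J" "b \<in> J"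
  then show "extended \<rho> (a \<oplus> b) = extended \<rho> a \<otimes>\<^bsub>G\<^esub> extended \<rho> b" using extended_add by blast
next
  fix \<rho> \<sigma> a b assume r: "\<rho> \<in> \<Phi> - {0}" "\<sigma> \<in> \<Phi> - {0}" and ab: "a \<in> J" "b \<in> J" and n: "\<rho> + \<sigma> \<noteq> 0"
  have cl: "a \<in> carrier K" "b \<in> carrier K" using ab lev_closed by auto
  have minus: "cmt G (extended (- \<alpha>) a) (extended \<delta> b) = ext G extended (- \<alpha> + \<delta>) ([(N0 (- \<alpha>) \<delta>)] \<cdot> (a \<otimes> b))"
    if \<delta>: "\<delta> \<in> \<Phi>" "\<delta> \<noteq> \<alpha>" and ab: "a \<in> J" "b \<in> J" for \<delta> a b
  proof (cases "\<delta> = - \<alpha>")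
    case True
    obtain \<beta> \<gamma> where d: "dec \<beta> \<gamma>" using exists_dec .
    have c: "extended (- \<alpha>) b \<in> carrier G" "extended (- \<alpha>) a \<in> carrier G"
      using extended_closed[OF minus_in[OF alpha]] ab by auto
    obtain t where t: "t \<in> I" "extended (- \<alpha>) a = Z \<beta> \<gamma> (H \<otimes> (H \<otimes> H)) t"
      using extended_Z[OF d ab(1)] by metis
    \<comment> \<open>The element at -\<alpha> with parameter \<open>a\<close> commutes with all
      elements at \<beta> and \<gamma> by \<open>Z_commute\<close>, hence also with their
      commutators, such as the value at \<open>b\<close>.\<close>
    have "extended (- \<alpha>) a \<otimes>\<^bsub>G\<^esub> extended (- \<alpha>) b = extended (- \<alpha>) b \<otimes>\<^bsub>G\<^esub> extended (- \<alpha>) a"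
      by (rule extended_commute[OF d ab(2) c(2)])
        (use Z_commute[OF d H_I HH_I(1) t(1)] t(2) in simp_all)
    moreover have "- \<alpha> + - \<alpha> \<notin> \<Phi>"
      using add_root_iff[OF minus_in[OF alpha] minus_in[OF alpha]] alpha by (simp add: pair_simps pair_self)
    ultimately show ?thesis using True c by (simp add: G.cmt_eq_one_iff ext_def)
  next
    case False
    have "- \<alpha> + \<delta> \<noteq> - \<alpha>" using \<delta> zero_notin by auto
    then show ?thesis
      using extended_cmt_minus[OF \<delta> False ab] False by (simp add: extended_other ext_def)
  qed
  show "cmt G (extended \<rho> a) (extended \<sigma> b) = ext G extended (\<rho> + \<sigma>) ([(N0 \<rho> \<sigma>)] \<cdot> (a \<otimes> b))"
  proof (cases "\<rho> = - \<alpha>")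
    case True
    then show ?thesis using minus[of \<sigma>] r n ab by auto
  next
    case r1: False
    show ?thesis
    proof (cases "\<sigma> = - \<alpha>")
      case True
      have n2: "\<rho> \<noteq> \<alpha>" using n True by auto
      have x: "[(N0 \<rho> (- \<alpha>))] \<cdot> (a \<otimes> b) \<in> J" "[(N0 (- \<alpha>) \<rho>)] \<cdot> (b \<otimes> a) \<in> J"
        using ab levD lev_add_pow by simp_all
      have "[(N0 \<rho> (- \<alpha>))] \<cdot> (a \<otimes> b) \<oplus> [(N0 (- \<alpha>) \<rho>)] \<cdot> (b \<otimes> a) = \<zero>"
        using cl by (simp add: m_comm[of b a] add_pow_add N0_antisym[of "- \<alpha>" \<rho>])
      moreover have "- \<alpha> + \<rho> \<noteq> - \<alpha>" using r zero_notin by auto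
      ultimately have inv: "ext G extended (- \<alpha> + \<rho>) ([(N0 \<rho> (- \<alpha>))] \<cdot> (a \<otimes> b)) \<otimes>\<^bsub>G\<^esub>
          ext G extended (- \<alpha> + \<rho>) ([(N0 (- \<alpha>) \<rho>)] \<cdot> (b \<otimes> a)) = \<one>\<^bsub>G\<^esub>"
        using extended_add[OF _ x, of "- \<alpha> + \<rho>"] Y.e_zero[of "- \<alpha> + \<rho>"]
        by (auto simp: ext_def extended_other)
      have c: "extended (- \<alpha>) b \<in> carrier G" "extended \<rho> a \<in> carrier G"
        using extended_closed[OF minus_in[OF alpha]] extended_closed[of \<rho>] r ab by auto
      have "cmt G (extended \<rho> a) (extended (- \<alpha>) b) = inv\<^bsub>G\<^esub> cmt G (extended (- \<alpha>) b) (extended \<rho> a)"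
        using c by (simp add: G.inv_cmt)
      also have "\<dots> = inv\<^bsub>G\<^esub> ext G extended (- \<alpha> + \<rho>) ([(N0 (- \<alpha>) \<rho>)] \<cdot> (b \<otimes> a))"
        using minus[of \<rho> b a] r n2 ab by simp
      also have "\<dots> = ext G extended (- \<alpha> + \<rho>) ([(N0 \<rho> (- \<alpha>))] \<cdot> (a \<otimes> b))"
        by (rule G.inv_equality[OF _ _ _]) (use inv x extended_closed in \<open>auto simp: ext_def\<close>)
      finally show ?thesis using True by (simp add: add.commute)
    next
      case s1: False
      show ?thesis
      proof (cases "\<rho> + \<sigma> = - \<alpha>")
        case True
        then have "dec \<rho> \<sigma>" using r by (simp add: dec_def)
        then show ?thesis
          using extended_cmt_opposite ab r1 s1 True minus_in[OF alpha] by (simp add: extended_other ext_def)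
      next
        case False
        then show ?thesis using Y.y_cmt[of \<rho> \<sigma> a b] r r1 s1 n ab J_I by (simp add: extended_other ext_def)
      qed
    qed
  qed
qed

end

section \<open>Germs of Steinberg families\<close>

context steinberg_local
begin

definition germ :: "('g, 'n) monoid_scheme \<Rightarrow> 'b set \<Rightarrow> ('a \<Rightarrow> 'b \<Rightarrow> 'g) \<Rightarrow> bool" where
  "germ G R y \<longleftrightarrow> (\<exists>n. stein G (lev R n) y)"

definition germ_eq :: "'b set \<Rightarrow> ('a \<Rightarrow> 'b \<Rightarrow> 'g) \<Rightarrow> ('a \<Rightarrow> 'b \<Rightarrow> 'g) \<Rightarrow> bool" where
  "germ_eq R y y' \<longleftrightarrow> (\<exists>n. \<forall>\<rho>\<in>\<Phi>. \<forall>a\<in>lev R n. y \<rho> a = y' \<rho> a)"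

text \<open>The germ \<open>y'\<close> is \<open>y\<close> precomposed with the conjugation by \<open>x \<alpha> \<xi>\<close>.\<close>

definition step :: "('g, 'n) monoid_scheme \<Rightarrow> 'b set \<Rightarrow> 'a \<Rightarrow> 'b \<Rightarrow> ('a \<Rightarrow> 'b \<Rightarrow> 'g) \<Rightarrow> ('a \<Rightarrow> 'b \<Rightarrow> 'g) \<Rightarrow> bool" where
  "step G R \<alpha> \<xi> y y' \<longleftrightarrow> germ G R y \<and> germ G R y' \<and>
     (\<exists>n. \<forall>\<beta>\<in>\<Phi> - {- \<alpha>}. \<forall>a\<in>lev R n. y' \<beta> a = twist G \<alpha> \<xi> y \<beta> a)"

definition fractions :: "'b set \<Rightarrow> 'b set" where
  "fractions R = {\<xi> \<in> carrier K. \<exists>k. h [^] (k::nat) \<otimes> \<xi> \<in> R}"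

lemma germ_eq_refl: "germ_eq R y y"
  by (simp add: germ_eq_def)

lemma germ_eq_sym: "germ_eq R y y' \<Longrightarrow> germ_eq R y' y"
  by (force simp: germ_eq_def)

lemma pstein_mono: "pstein G I \<omega> y \<Longrightarrow> J \<subseteq> I \<Longrightarrow> pstein G J \<omega> y"
  unfolding pstein_def by (blast dest: subsetD)

lemma pstein_cong:
  assumes "pstein G I \<omega> y" "nonunital_subring I" "\<And>\<rho> a. \<rho> \<in> \<Phi> \<Longrightarrow> a \<in> I \<Longrightarrow> y \<rho> a = y' \<rho> a"
  shows "pstein G I \<omega> y'"
proof -
  note D = nonunital_subringD[OF assms(2)] nonunital_subring_add_pow[OF assms(2)]
  have "ext G y \<rho> a = ext G y' \<rho> a" if "a \<in> I" for \<rho> a using assms(3) that by (simp add: ext_def)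
  then show ?thesis
    using assms(1) D unfolding pstein_def by (simp flip: assms(3))
qed

lemma ext_hom:
  assumes "group G" "group G'" "f \<in> hom G G'"
  shows "ext G' (\<lambda>\<rho> a. f (y \<rho> a)) \<rho> a = f (ext G y \<rho> a)"
  using assms by (simp add: ext_def hom_one)

lemma pstein_hom:
  assumes G: "group G" "group G'" and f: "f \<in> hom G G'" and y: "pstein G I \<omega> y"
  shows "pstein G' I \<omega> (\<lambda>\<rho> a. f (y \<rho> a))"
  using y unfolding pstein_def ext_hom[OF G f]
  by (auto simp: hom_in_carrier[OF f] hom_mult[OF f] cmt_hom[OF G f, symmetric])

end

context steinberg_level
begin

lemma stein_deeper: "stein G (lev R n) y \<Longrightarrow> n \<le> m \<Longrightarrow> stein G (lev R m) y"
  using pstein_mono lev_mono by blast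

lemma fractions_lev:
  assumes "\<xi> \<in> fractions R"
  shows "\<exists>k. \<forall>n. \<forall>a\<in>lev R (n + k). \<xi> \<otimes> a \<in> lev R n"
proof -
  obtain k :: nat where "\<xi> \<in> carrier K" "h [^] k \<otimes> \<xi> \<in> R" using assms by (auto simp: fractions_def)
  then show ?thesis using lev_scale by blast
qed

lemma fractions_carrier: "\<xi> \<in> fractions R \<Longrightarrow> \<xi> \<in> carrier K"
  by (simp add: fractions_def)

lemma germ_eq_trans:
  assumes "germ_eq R x y" "germ_eq R y z"
  shows "germ_eq R x z"
proof -
  obtain n m where "\<forall>\<rho>\<in>\<Phi>. \<forall>a\<in>lev R n. x \<rho> a = y \<rho> a" "\<forall>\<rho>\<in>\<Phi>. \<forall>a\<in>lev R m. y \<rho> a = z \<rho> a"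
    using assms by (auto simp: germ_eq_def)
  then have "\<forall>\<rho>\<in>\<Phi>. \<forall>a\<in>lev R (max n m). x \<rho> a = z \<rho> a"
    using lev_mono[of n "max n m"] lev_mono[of m "max n m"] by (metis max.cobounded1 max.cobounded2 subsetD)
  then show ?thesis unfolding germ_eq_def by blast
qed

lemma pstein_familyI: "group G \<Longrightarrow> stein G (lev R n) y \<Longrightarrow> pstein_family \<Phi> N K G (lev R n) 0 y"
  using lev_nonunital_subring
  by (simp add: pstein_family_def pstein_family_axioms_def steinberg_ring_axioms)

text \<open>The exponent \<open>k\<close> absorbs the denominator of \<xi>: the twisted family makes
  sense at level \<open>n + k\<close>, and \<open>extension\<close> fills in the values at -\<alpha>
  at six times that level.\<close>

lemma exists_step:
  assumes G: "group G" and y: "germ G R y" and al: "\<alpha> \<in> \<Phi>" and xi: "\<xi> \<in> fractions R"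
  obtains y' where "step G R \<alpha> \<xi> y y'"
proof -
  obtain n where n: "stein G (lev R n) y" using y by (auto simp: germ_def)
  obtain k where k: "\<And>n a. a \<in> lev R (n + k) \<Longrightarrow> \<xi> \<otimes> a \<in> lev R n" using fractions_lev[OF xi] by blast
  have "pstein G (lev R (n + k)) (- \<alpha>) (twist G \<alpha> \<xi> y)"
    by (rule twist_pstein[OF G lev_nonunital_subring n lev_nonunital_subring lev_mono _ k al])
      (use fractions_carrier[OF xi] in auto)
  then interpret E: extension \<Phi> N K h R G "n + k" \<alpha> "twist G \<alpha> \<xi> y"
    using G al by (simp add: extension_def extension_axioms_def steinberg_level_axioms)
  have "step G R \<alpha> \<xi> y E.extended"
    unfolding step_def germ_def using n E.extended_stein E.extended_other by blast
  then show thesis by (rule that)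
qed

text \<open>Every root of the plane is the sum of two roots outside, and \<open>[x \<beta> s, x \<gamma> t] = x (\<beta> + \<gamma>) (\<plusminus>s t)\<close>.\<close>

lemma germ_eq_off_plane:
  assumes G: "group G" and y: "germ G R y" "germ G R y'"
    and eq: "\<And>\<rho> a. \<rho> \<in> \<Phi> \<Longrightarrow> \<rho> \<notin> span {\<alpha>, \<beta>} \<Longrightarrow> a \<in> lev R n \<Longrightarrow> y \<rho> a = y' \<rho> a"
  shows "germ_eq R y y'"
proof -
  obtain i j where ij: "stein G (lev R i) y" "stein G (lev R j) y'" using y by (auto simp: germ_def)
  define m where "m = max n (max i j)"
  have le: "n \<le> m" "i \<le> m" "j \<le> m" by (auto simp: m_def)
  interpret Y: pstein_family \<Phi> N K G "lev R m" 0 y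
    using pstein_familyI[OF G] stein_deeper ij le by blast
  interpret Y': pstein_family \<Phi> N K G "lev R m" 0 y'
    using pstein_familyI[OF G] stein_deeper ij le by blast
  have eqm: "y \<rho> a = y' \<rho> a" if "\<rho> \<in> \<Phi>" "\<rho> \<notin> span {\<alpha>, \<beta>}" "a \<in> lev R m" for \<rho> a
    using eq that lev_mono[OF le(1)] by blast
  have "y \<rho> a = y' \<rho> a" if r: "\<rho> \<in> \<Phi>" and a: "a \<in> lev R (m + m)" for \<rho> a
  proof (cases "\<rho> \<in> span {\<alpha>, \<beta>}")
    case True
    obtain \<sigma> \<tau> where s: "\<sigma> \<in> \<Phi>" "\<tau> \<in> \<Phi>" "\<sigma> + \<tau> = \<rho>" "\<sigma> \<notin> span {\<alpha>, \<beta>}" "\<tau> \<notin> span {\<alpha>, \<beta>}"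
      using decomposition_off_plane[OF r True] by metis
    have nz: "\<sigma> \<noteq> 0" "\<tau> \<noteq> 0" "\<sigma> + \<tau> \<noteq> 0" using s r zero_notin by auto
    define t where "t = [(N0 \<sigma> \<tau>)] \<cdot> hdiv m a"
    have cl: "hdiv m a \<in> carrier K" "a \<in> carrier K" using lev_closed[OF a] by auto
    have t: "t \<in> lev R m" unfolding t_def by (intro lev_add_pow lev_hdiv a)
    have "[(N0 \<sigma> \<tau>)] \<cdot> (h [^] m \<otimes> t) = h [^] m \<otimes> ([(N0 \<sigma> \<tau> * N0 \<sigma> \<tau>)] \<cdot> hdiv m a)"
      using cl by (simp add: t_def pow_simps)
    then have at: "[(N0 \<sigma> \<tau>)] \<cdot> (h [^] m \<otimes> t) = a" using N0_sq s r cl by simp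
    have "y \<rho> a = cmt G (y \<sigma> (h [^] m)) (y \<tau> t)"
      using Y.y_cmt[of \<sigma> \<tau> "h [^] m" t] s nz t hpow_lev r by (simp add: at ext_def)
    also have "\<dots> = cmt G (y' \<sigma> (h [^] m)) (y' \<tau> t)" using eqm s t hpow_lev by simp
    also have "\<dots> = y' \<rho> a"
      using Y'.y_cmt[of \<sigma> \<tau> "h [^] m" t] s nz t hpow_lev r by (simp add: at ext_def)
    finally show ?thesis .
  next
    case False
    then show ?thesis using eqm r a lev_mono[of m "m + m"] by auto
  qed
  then show ?thesis unfolding germ_eq_def by blast
qed

lemma step_formula:
  assumes "step G R \<alpha> \<xi> y y'"
  shows "\<exists>n. \<forall>\<beta> a m. \<beta> \<in> \<Phi> \<longrightarrow> \<beta> \<noteq> - \<alpha> \<longrightarrow> a \<in> lev R m \<longrightarrow> n \<le> m \<longrightarrow> y' \<beta> a = twist G \<alpha> \<xi> y \<beta> a"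
proof -
  obtain n where n: "\<forall>\<beta>\<in>\<Phi> - {- \<alpha>}. \<forall>a\<in>lev R n. y' \<beta> a = twist G \<alpha> \<xi> y \<beta> a"
    using assms by (auto simp: step_def)
  show ?thesis using n lev_mono by (intro exI[of _ n]) blast
qed

lemma stepD: "step G R \<alpha> \<xi> y y' \<Longrightarrow> germ G R y" "step G R \<alpha> \<xi> y y' \<Longrightarrow> germ G R y'"
  by (simp_all add: step_def)

lemma twist_germ_eq:
  assumes xi: "\<xi> \<in> fractions R" and eq: "germ_eq R y z"
  shows "\<exists>n. \<forall>\<beta>\<in>\<Phi>. \<forall>a\<in>lev R n. twist G \<alpha> \<xi> y \<beta> a = twist G \<alpha> \<xi> z \<beta> a"
proof -
  obtain n where n: "\<And>\<rho> a. \<rho> \<in> \<Phi> \<Longrightarrow> a \<in> lev R n \<Longrightarrow> y \<rho> a = z \<rho> a" using eq by (auto simp: germ_eq_def)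
  obtain k where k: "\<And>n a. a \<in> lev R (n + k) \<Longrightarrow> \<xi> \<otimes> a \<in> lev R n" using fractions_lev[OF xi] by blast
  have "twist G \<alpha> \<xi> y \<beta> a = twist G \<alpha> \<xi> z \<beta> a" if "\<beta> \<in> \<Phi>" "a \<in> lev R (n + k)" for \<beta> a
    using n that k lev_add_pow lev_mono[of n "n + k"] by (auto simp: twist_def ext_def)
  then show ?thesis by blast
qed

text \<open>The formula for a step leaves the values at -\<alpha> open, but the values off the line
  of \<alpha> determine the germ.\<close>

lemma step_unique:
  assumes G: "group G" and al: "\<alpha> \<in> \<Phi>" and xi: "\<xi> \<in> fractions R"
    and s: "step G R \<alpha> \<xi> y y'" and t: "step G R \<alpha> \<xi> z z'" and eq: "germ_eq R y z"
  shows "germ_eq R y' z'"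
proof -
  obtain n where n: "\<And>\<beta> a. \<beta> \<in> \<Phi> \<Longrightarrow> a \<in> lev R n \<Longrightarrow> twist G \<alpha> \<xi> y \<beta> a = twist G \<alpha> \<xi> z \<beta> a"
    using twist_germ_eq[OF xi eq] by blast
  obtain i where i: "\<And>\<beta> a m. \<lbrakk>\<beta> \<in> \<Phi>; \<beta> \<noteq> - \<alpha>; a \<in> lev R m; i \<le> m\<rbrakk> \<Longrightarrow> y' \<beta> a = twist G \<alpha> \<xi> y \<beta> a"
    using step_formula[OF s] by blast
  obtain j where j: "\<And>\<beta> a m. \<lbrakk>\<beta> \<in> \<Phi>; \<beta> \<noteq> - \<alpha>; a \<in> lev R m; j \<le> m\<rbrakk> \<Longrightarrow> z' \<beta> a = twist G \<alpha> \<xi> z \<beta> a"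
    using step_formula[OF t] by blast
  define m where "m = max n (max i j)"
  have le: "n \<le> m" "i \<le> m" "j \<le> m" by (auto simp: m_def)
  show ?thesis
  proof (rule germ_eq_off_plane[OF G stepD(2)[OF s] stepD(2)[OF t], of \<alpha> \<alpha> m])
    fix \<rho> a assume r: "\<rho> \<in> \<Phi>" "\<rho> \<notin> span {\<alpha>, \<alpha>}" "a \<in> lev R m"
    then have "\<rho> \<noteq> - \<alpha>" using span_neg[OF span_base[of \<alpha> "{\<alpha>, \<alpha>}"]] by auto
    then show "y' \<rho> a = z' \<rho> a" using n i j r le lev_mono[OF le(1)] by (metis subsetD)
  qed
qed

lemma step_ext:
  assumes Y: "pstein_family \<Phi> N K G (lev R n) 0 y"
    and xi: "\<xi> \<in> carrier K" and al: "\<alpha> \<in> \<Phi>"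
    and s: "\<And>\<beta>. \<lbrakk>\<beta> \<in> \<Phi>; \<beta> \<noteq> - \<alpha>\<rbrakk> \<Longrightarrow> y' \<beta> a = twist G \<alpha> \<xi> y \<beta> a"
    and a: "a \<in> lev R n" "\<xi> \<otimes> a \<in> lev R n" and r: "\<rho> \<noteq> - \<alpha>" "\<rho> \<noteq> 0"
  shows "ext G y' \<rho> a = ext G y \<rho> a \<otimes>\<^bsub>G\<^esub> ext G y (\<alpha> + \<rho>) ([(N0 \<alpha> \<rho>)] \<cdot> (\<xi> \<otimes> a))"
proof -
  interpret Y: pstein_family \<Phi> N K G "lev R n" 0 y by fact
  have "\<alpha> + \<rho> \<noteq> 0" using r by (simp add: Groups.add_eq_0_iff)
  then show ?thesis
    using s r a al by (cases "\<rho> \<in> \<Phi>") (simp_all add: ext_def[of G y'] twist_def Y.e_root N0_zero Y.e_zero Y.e_nonroot)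
qed

lemma step_add:
  assumes G: "group G" and al: "\<alpha> \<in> \<Phi>" and xi: "\<xi> \<in> fractions R" "\<zeta> \<in> fractions R"
    and s: "step G R \<alpha> \<xi> y y1" and t: "step G R \<alpha> \<zeta> y1 y2"
  shows "step G R \<alpha> (\<xi> \<oplus> \<zeta>) y y2"
proof -
  obtain l where l: "stein G (lev R l) y" using s by (auto simp: step_def germ_def)
  obtain i where i: "\<And>\<beta> a m. \<lbrakk>\<beta> \<in> \<Phi>; \<beta> \<noteq> - \<alpha>; a \<in> lev R m; i \<le> m\<rbrakk> \<Longrightarrow> y1 \<beta> a = twist G \<alpha> \<xi> y \<beta> a"
    using step_formula[OF s] by blast
  obtain j where j: "\<And>\<beta> a m. \<lbrakk>\<beta> \<in> \<Phi>; \<beta> \<noteq> - \<alpha>; a \<in> lev R m; j \<le> m\<rbrakk> \<Longrightarrow> y2 \<beta> a = twist G \<alpha> \<zeta> y1 \<beta> a"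
    using step_formula[OF t] by blast
  obtain k where k: "\<And>n a. a \<in> lev R (n + k) \<Longrightarrow> \<xi> \<otimes> a \<in> lev R n" using fractions_lev[OF xi(1)] by blast
  obtain k' where k': "\<And>n a. a \<in> lev R (n + k') \<Longrightarrow> \<zeta> \<otimes> a \<in> lev R n" using fractions_lev[OF xi(2)] by blast
  define m where "m = max l (max i j)"
  have le: "l \<le> m" "i \<le> m" "j \<le> m" by (auto simp: m_def)
  have Yf: "pstein_family \<Phi> N K G (lev R m) 0 y" using pstein_familyI[OF G] stein_deeper l le by blast
  interpret Y: pstein_family \<Phi> N K G "lev R m" 0 y by fact
  have xc: "\<xi> \<in> carrier K" "\<zeta> \<in> carrier K" using xi fractions_carrier by auto
  have "y2 \<beta> a = twist G \<alpha> (\<xi> \<oplus> \<zeta>) y \<beta> a" if b: "\<beta> \<in> \<Phi> - {- \<alpha>}" and a: "a \<in> lev R (m + k + k')" for \<beta> a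
  proof -
    have "lev R (m + k + k') \<subseteq> lev R (m + k)" "lev R (m + k) \<subseteq> lev R m" "lev R (m + k + k') \<subseteq> lev R (m + k')"
      by (rule lev_mono; simp)+
    then have a1: "a \<in> lev R m" "\<xi> \<otimes> a \<in> lev R m" "\<zeta> \<otimes> a \<in> lev R (m + k)" "\<zeta> \<otimes> a \<in> lev R m"
      using a k k' by blast+
    then have a2: "\<xi> \<otimes> (\<zeta> \<otimes> a) \<in> lev R m" using k by blast
    have cl: "a \<in> carrier K" using a lev_closed by blast
    let ?d = "[(N0 \<alpha> \<beta>)] \<cdot> (\<zeta> \<otimes> a)"
    have d: "?d \<in> lev R m" "\<xi> \<otimes> ?d \<in> lev R m"
      using a1 a2 lev_add_pow xc cl by (simp_all add: pow_simps)
    have nz: "\<alpha> + \<beta> \<noteq> 0" "\<beta> \<noteq> 0" using b zero_notin by (auto simp: Groups.add_eq_0_iff)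
    have e1: "ext G y1 \<beta> a = Y.e \<beta> a \<otimes>\<^bsub>G\<^esub> Y.e (\<alpha> + \<beta>) ([(N0 \<alpha> \<beta>)] \<cdot> (\<xi> \<otimes> a))"
      by (rule step_ext[OF Yf xc(1) al i]) (use b a1 le nz in auto)
    \<comment> \<open>The first twist does not change values at \<alpha> + \<beta>, since 2 \<alpha>
      + \<beta> is not a root. The formula for \<open>y1\<close> is missing at -\<alpha>, but
      \<alpha> + \<beta> = -\<alpha> would make \<beta> = -2 \<alpha>, which is no root.\<close>
    have e2: "ext G y1 (\<alpha> + \<beta>) ?d = Y.e (\<alpha> + \<beta>) ?d"
    proof (cases "\<alpha> + \<beta> = - \<alpha> \<or> \<alpha> + \<beta> \<notin> \<Phi>")
      case True
      then have "\<alpha> + \<beta> \<notin> \<Phi>"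
      proof
        assume "\<alpha> + \<beta> = - \<alpha>"
        then have "\<beta> = (-2) *\<^sub>R \<alpha>" by (simp add: scaleR_2 algebra_simps)
        then have "pair \<beta> \<beta> = 8" using pair_self[OF al] by (simp only: pair_scaleR_left pair_scaleR_right)
        then show ?thesis using b pair_self[of \<beta>] by simp
      qed
      then show ?thesis by (simp add: ext_def)
    next
      case False
      then have "pair \<alpha> \<beta> = -1" using add_root_iff[OF al] b by blast
      then have "pair \<alpha> (\<alpha> + \<beta>) = 1" using pair_self[OF al] by (simp add: pair_simps)
      then have "\<alpha> + (\<alpha> + \<beta>) \<notin> \<Phi>" using add_root_iff[OF al] False by auto
      then have "N0 \<alpha> (\<alpha> + \<beta>) = 0" using N0_zero by blast
      moreover have "\<alpha> + (\<alpha> + \<beta>) \<noteq> 0" using False by (metis Groups.add_eq_0_iff)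
      moreover have "ext G y1 (\<alpha> + \<beta>) ?d = Y.e (\<alpha> + \<beta>) ?d \<otimes>\<^bsub>G\<^esub>
          Y.e (\<alpha> + (\<alpha> + \<beta>)) ([(N0 \<alpha> (\<alpha> + \<beta>))] \<cdot> (\<xi> \<otimes> ?d))"
        by (rule step_ext[OF Yf xc(1) al i]) (use d le nz False in auto)
      ultimately show ?thesis using Y.e_zero d nz by simp
    qed
    have "y2 \<beta> a = twist G \<alpha> \<zeta> y1 \<beta> a" using j b a1 le by blast
    also have "\<dots> = ext G y1 \<beta> a \<otimes>\<^bsub>G\<^esub> ext G y1 (\<alpha> + \<beta>) ?d" using b by (simp add: twist_def ext_def)
    also have "\<dots> = Y.e \<beta> a \<otimes>\<^bsub>G\<^esub> (Y.e (\<alpha> + \<beta>) ([(N0 \<alpha> \<beta>)] \<cdot> (\<xi> \<otimes> a)) \<otimes>\<^bsub>G\<^esub> Y.e (\<alpha> + \<beta>) ?d)"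
      using a1 d nz lev_add_pow by (simp add: e1 e2 Y.G.m_assoc)
    also have "\<dots> = Y.e \<beta> a \<otimes>\<^bsub>G\<^esub> Y.e (\<alpha> + \<beta>) ([(N0 \<alpha> \<beta>)] \<cdot> ((\<xi> \<oplus> \<zeta>) \<otimes> a))"
      using a1 d nz lev_add_pow xc cl
      by (simp add: Y.e_add[symmetric] l_distr add_pow_distrib)
    finally show ?thesis using b by (simp add: twist_def Y.e_root)
  qed
  then show ?thesis using stepD(1)[OF s] stepD(2)[OF t] unfolding step_def by blast
qed

lemma step_zero:
  assumes G: "group G" and y: "germ G R y"
  shows "step G R \<alpha> \<zero> y y"
proof -
  obtain n where n: "stein G (lev R n) y" using y by (auto simp: germ_def)
  interpret Y: pstein_family \<Phi> N K G "lev R n" 0 y using pstein_familyI[OF G n] .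
  have "y \<beta> a = twist G \<alpha> \<zero> y \<beta> a" if "\<beta> \<in> \<Phi> - {- \<alpha>}" "a \<in> lev R n" for \<beta> a
  proof -
    have "\<alpha> + \<beta> \<noteq> 0" "\<beta> \<noteq> 0" using that zero_notin by (auto simp: Groups.add_eq_0_iff)
    then show ?thesis using that Y.y_closed lev_closed by (simp add: twist_def Y.e_zero)
  qed
  then show ?thesis using y unfolding step_def by blast
qed

end

section \<open>Steinberg relations between conjugation steps\<close>

context steinberg_level
begin

lemma germ_family:
  assumes "group G" "germ G R y"
  shows "\<exists>n. \<forall>m\<ge>n. pstein_family \<Phi> N K G (lev R m) 0 y"
  using assms pstein_familyI stein_deeper unfolding germ_def by blast

text \<open>Adding \<alpha> and \<beta> to a root \<gamma> outside their plane never leads to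
  -\<alpha> or -\<beta>, so both double twists can be expanded. They contain the same commuting
  factors at \<alpha> + \<gamma> and \<beta> + \<gamma>, and the coefficients at \<alpha> + \<beta>
  + \<gamma> differ by the remaining term of the Jacobi identity. The minus sign reflects that
  precomposition reverses the order of the conjugations.\<close>

lemma step_steinberg_off_plane:
  assumes G: "group G" and al: "\<alpha> \<in> \<Phi>" and be: "\<beta> \<in> \<Phi>" and ab: "\<alpha> + \<beta> \<noteq> 0"
    and xi: "\<xi> \<in> fractions R" and ze: "\<zeta> \<in> fractions R"
    and q1: "step G R \<beta> \<zeta> q q1" and q2: "step G R \<alpha> \<xi> q1 q2"
    and r1: "step G R \<alpha> \<xi> q r1" and r2: "step G R \<beta> \<zeta> r1 r2"
  shows "\<exists>n. \<forall>\<gamma>\<in>\<Phi>. \<gamma> \<notin> span {\<alpha>, \<beta>} \<longrightarrow> (\<forall>a\<in>lev R n.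
    q2 \<gamma> a = twist G (\<alpha> + \<beta>) ([(- N0 \<alpha> \<beta>)] \<cdot> (\<xi> \<otimes> \<zeta>)) r2 \<gamma> a)"
proof -
  obtain n0 where n0: "\<forall>m\<ge>n0. pstein_family \<Phi> N K G (lev R m) 0 q" using germ_family[OF G stepD(1)[OF q1]] by blast
  obtain n1 where n1: "\<forall>m\<ge>n1. pstein_family \<Phi> N K G (lev R m) 0 q1" using germ_family[OF G stepD(2)[OF q1]] by blast
  obtain n3 where n3: "\<forall>m\<ge>n3. pstein_family \<Phi> N K G (lev R m) 0 r1" using germ_family[OF G stepD(2)[OF r1]] by blast
  obtain n4 where n4: "\<forall>m\<ge>n4. pstein_family \<Phi> N K G (lev R m) 0 r2" using germ_family[OF G stepD(2)[OF r2]] by blast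
  obtain i1 where i1: "\<forall>\<rho> a m. \<rho> \<in> \<Phi> \<longrightarrow> \<rho> \<noteq> - \<beta> \<longrightarrow> a \<in> lev R m \<longrightarrow> i1 \<le> m \<longrightarrow> q1 \<rho> a = twist G \<beta> \<zeta> q \<rho> a"
    using step_formula[OF q1] by blast
  obtain i2 where i2: "\<forall>\<rho> a m. \<rho> \<in> \<Phi> \<longrightarrow> \<rho> \<noteq> - \<alpha> \<longrightarrow> a \<in> lev R m \<longrightarrow> i2 \<le> m \<longrightarrow> q2 \<rho> a = twist G \<alpha> \<xi> q1 \<rho> a"
    using step_formula[OF q2] by blast
  obtain i3 where i3: "\<forall>\<rho> a m. \<rho> \<in> \<Phi> \<longrightarrow> \<rho> \<noteq> - \<alpha> \<longrightarrow> a \<in> lev R m \<longrightarrow> i3 \<le> m \<longrightarrow> r1 \<rho> a = twist G \<alpha> \<xi> q \<rho> a"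
    using step_formula[OF r1] by blast
  obtain i4 where i4: "\<forall>\<rho> a m. \<rho> \<in> \<Phi> \<longrightarrow> \<rho> \<noteq> - \<beta> \<longrightarrow> a \<in> lev R m \<longrightarrow> i4 \<le> m \<longrightarrow> r2 \<rho> a = twist G \<beta> \<zeta> r1 \<rho> a"
    using step_formula[OF r2] by blast
  obtain k where k: "\<forall>n. \<forall>a\<in>lev R (n + k). \<xi> \<otimes> a \<in> lev R n" using fractions_lev[OF xi] by blast
  obtain k' where k': "\<forall>n. \<forall>a\<in>lev R (n + k'). \<zeta> \<otimes> a \<in> lev R n" using fractions_lev[OF ze] by blast
  define m where "m = n0 + n1 + n3 + n4 + i1 + i2 + i3 + i4"
  have le: "n0 \<le> m" "n1 \<le> m" "n3 \<le> m" "n4 \<le> m" "i1 \<le> m" "i2 \<le> m" "i3 \<le> m" "i4 \<le> m"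
    by (auto simp: m_def)
  have fam: "pstein_family \<Phi> N K G (lev R m) 0 q" "pstein_family \<Phi> N K G (lev R m) 0 q1"
    "pstein_family \<Phi> N K G (lev R m) 0 r1" "pstein_family \<Phi> N K G (lev R m) 0 r2"
    using n0 n1 n3 n4 le by blast+
  interpret Q: pstein_family \<Phi> N K G "lev R m" 0 q by (rule fam)
  interpret Q1: pstein_family \<Phi> N K G "lev R m" 0 q1 by (rule fam)
  interpret R1: pstein_family \<Phi> N K G "lev R m" 0 r1 by (rule fam)
  interpret R2: pstein_family \<Phi> N K G "lev R m" 0 r2 by (rule fam)
  have xc: "\<xi> \<in> carrier K" "\<zeta> \<in> carrier K" using xi ze fractions_carrier by auto
  have "q2 \<gamma> a = twist G (\<alpha> + \<beta>) ([(- N0 \<alpha> \<beta>)] \<cdot> (\<xi> \<otimes> \<zeta>)) r2 \<gamma> a"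
    if g: "\<gamma> \<in> \<Phi>" "\<gamma> \<notin> span {\<alpha>, \<beta>}" and a: "a \<in> lev R (m + k + k')" for \<gamma> a
  proof -
    let ?P = "span {\<alpha>, \<beta>}"
    have P: "\<alpha> \<in> ?P" "\<beta> \<in> ?P" "0 \<in> ?P" "- \<alpha> \<in> ?P" "- \<beta> \<in> ?P"
      by (auto intro: span_base span_neg span_zero)
    have shift: "x + \<rho> \<notin> ?P" if "x \<in> ?P" "\<rho> \<notin> ?P" for x \<rho> :: 'a
    proof
      assume "x + \<rho> \<in> ?P"
      then have "x + \<rho> - x \<in> ?P" by (rule span_diff) (rule that)
      then show False using that(2) by simp
    qed
    have off: "\<rho> \<noteq> 0" "\<rho> \<noteq> - \<alpha>" "\<rho> \<noteq> - \<beta>" if "\<rho> \<notin> ?P" for \<rho> using that P by auto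
    let ?d = "\<alpha> + (\<beta> + \<gamma>)"
    have o: "\<gamma> \<notin> ?P" "\<alpha> + \<gamma> \<notin> ?P" "\<beta> + \<gamma> \<notin> ?P" "?d \<notin> ?P" using g(2) P shift by blast+
    have od: "\<alpha> + ?d \<notin> ?P" "\<beta> + ?d \<notin> ?P" using o P shift by blast+
    have nz: "\<gamma> \<noteq> 0" "\<alpha> + \<gamma> \<noteq> 0" "\<beta> + \<gamma> \<noteq> 0" "?d \<noteq> 0" using off(1) o by blast+
    have dd: "\<beta> + (\<alpha> + \<gamma>) = ?d" "\<alpha> + \<beta> + \<gamma> = ?d" by (simp_all add: ac_simps)
    have "lev R (m + k + k') \<subseteq> lev R (m + k)" "lev R (m + k) \<subseteq> lev R m" "lev R (m + k + k') \<subseteq> lev R (m + k')"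
      by (rule lev_mono; simp)+
    then have a1: "a \<in> lev R m" "\<xi> \<otimes> a \<in> lev R m" "\<zeta> \<otimes> a \<in> lev R (m + k)" "\<zeta> \<otimes> a \<in> lev R m"
      using a k k' by blast+
    then have a2: "\<xi> \<otimes> (\<zeta> \<otimes> a) \<in> lev R m" using k by blast
    have cl: "a \<in> carrier K" using a lev_closed by blast
    define z where "z = \<xi> \<otimes> (\<zeta> \<otimes> a)"
    have zc: "z \<in> carrier K" using xc cl by (simp add: z_def)
    have zI: "[j] \<cdot> z \<in> lev R m" for j :: int unfolding z_def by (rule lev_add_pow[OF a2])
    have z': "\<zeta> \<otimes> (\<xi> \<otimes> a) = z" using xc cl by (simp add: z_def m_ac)
    define c where "c = [(N0 \<alpha> \<gamma>)] \<cdot> (\<xi> \<otimes> a)"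
    define c' where "c' = [(N0 \<beta> \<gamma>)] \<cdot> (\<zeta> \<otimes> a)"
    have cI: "c \<in> lev R m" "c' \<in> lev R m" unfolding c_def c'_def by (intro lev_add_pow a1)+
    have zcc: "\<zeta> \<otimes> c = [(N0 \<alpha> \<gamma>)] \<cdot> z" "\<xi> \<otimes> c' = [(N0 \<beta> \<gamma>)] \<cdot> z"
      using xc cl by (simp_all add: c_def c'_def pow_simps z' z_def)
    have zccI: "\<zeta> \<otimes> c \<in> lev R m" "\<xi> \<otimes> c' \<in> lev R m" using zcc zI by auto
    define A where "A = Q.e \<gamma> a"
    define B where "B = Q.e (\<beta> + \<gamma>) c'"
    define C where "C = Q.e (\<alpha> + \<gamma>) c"
    define D where "D j = Q.e ?d ([j] \<cdot> z)" for j :: int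
    have clG: "A \<in> carrier G" "B \<in> carrier G" "C \<in> carrier G" "\<And>j. D j \<in> carrier G"
      unfolding A_def B_def C_def D_def using a1 cI nz zI by auto
    have q1g: "Q1.e \<gamma> a = A \<otimes>\<^bsub>G\<^esub> B"
      unfolding A_def B_def c'_def
      by (rule step_ext[OF fam(1) xc(2) be]) (use i1 le a1 off[OF o(1)] in auto)
    have q1c: "Q1.e (\<alpha> + \<gamma>) c = C \<otimes>\<^bsub>G\<^esub> D (N0 \<beta> (\<alpha> + \<gamma>) * N0 \<alpha> \<gamma>)"
    proof -
      have "Q1.e (\<alpha> + \<gamma>) c = Q.e (\<alpha> + \<gamma>) c \<otimes>\<^bsub>G\<^esub> Q.e (\<beta> + (\<alpha> + \<gamma>)) ([(N0 \<beta> (\<alpha> + \<gamma>))] \<cdot> (\<zeta> \<otimes> c))"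
        by (rule step_ext[OF fam(1) xc(2) be]) (use i1 le cI zccI off[OF o(2)] in auto)
      then show ?thesis unfolding zcc dd C_def D_def using zc by (simp add: add_pow_add_pow)
    qed
    have "q2 \<gamma> a = twist G \<alpha> \<xi> q1 \<gamma> a" using i2 g(1) off(2)[OF o(1)] a1(1) le by blast
    also have "\<dots> = Q1.e \<gamma> a \<otimes>\<^bsub>G\<^esub> Q1.e (\<alpha> + \<gamma>) c" using g by (simp add: twist_def Q1.e_root c_def)
    finally have q2g: "q2 \<gamma> a = A \<otimes>\<^bsub>G\<^esub> B \<otimes>\<^bsub>G\<^esub> (C \<otimes>\<^bsub>G\<^esub> D (N0 \<beta> (\<alpha> + \<gamma>) * N0 \<alpha> \<gamma>))"
      by (simp only: q1g q1c)
    have r1g: "R1.e \<gamma> a = A \<otimes>\<^bsub>G\<^esub> C"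
      unfolding A_def C_def c_def
      by (rule step_ext[OF fam(1) xc(1) al]) (use i3 le a1 off[OF o(1)] in auto)
    have r1c: "R1.e (\<beta> + \<gamma>) c' = B \<otimes>\<^bsub>G\<^esub> D (N0 \<alpha> (\<beta> + \<gamma>) * N0 \<beta> \<gamma>)"
    proof -
      have "R1.e (\<beta> + \<gamma>) c' = Q.e (\<beta> + \<gamma>) c' \<otimes>\<^bsub>G\<^esub> Q.e (\<alpha> + (\<beta> + \<gamma>)) ([(N0 \<alpha> (\<beta> + \<gamma>))] \<cdot> (\<xi> \<otimes> c'))"
        by (rule step_ext[OF fam(1) xc(1) al]) (use i3 le cI zccI off[OF o(3)] in auto)
      then show ?thesis unfolding zcc B_def D_def using zc by (simp add: add_pow_add_pow)
    qed
    have "r2 \<gamma> a = twist G \<beta> \<zeta> r1 \<gamma> a" using i4 g(1) off(3)[OF o(1)] a1(1) le by blast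
    also have "\<dots> = R1.e \<gamma> a \<otimes>\<^bsub>G\<^esub> R1.e (\<beta> + \<gamma>) c'" using g by (simp add: twist_def R1.e_root c'_def)
    finally have r2g: "r2 \<gamma> a = A \<otimes>\<^bsub>G\<^esub> C \<otimes>\<^bsub>G\<^esub> (B \<otimes>\<^bsub>G\<^esub> D (N0 \<alpha> (\<beta> + \<gamma>) * N0 \<beta> \<gamma>))"
      by (simp only: r1g r1c)
    define j where "j = N0 (\<alpha> + \<beta>) \<gamma> * (- N0 \<alpha> \<beta>)"
    \<comment> \<open>Unless the coefficient \<open>j\<close> vanishes, \<alpha> + \<beta> and
      \<open>?d\<close> are roots. Then \<alpha> and \<beta> have nonnegative pairing with
      \<open>?d\<close>, so neither twist changes the value there, and it can be read off from
      \<open>q\<close>.\<close>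
    have r2d: "R2.e ?d ([j] \<cdot> z) = D j"
    proof (cases "j = 0")
      case True
      then show ?thesis using nz by (simp add: D_def R2.e_zero Q.e_zero)
    next
      case False
      then have "N0 (\<alpha> + \<beta>) \<gamma> \<noteq> 0" by (auto simp: j_def)
      then have ro: "\<alpha> + \<beta> \<in> \<Phi>" "\<alpha> + \<beta> + \<gamma> \<in> \<Phi>" by (auto simp: N0_def split: if_splits)
      then have d: "?d \<in> \<Phi>" unfolding dd by simp
      have pab: "pair \<alpha> \<beta> = -1" "pair \<beta> \<alpha> = -1" using add_root_iff[OF al be] ro pair_commute by metis+
      have "pair (\<alpha> + \<beta>) \<gamma> = -1" using add_root_iff[OF ro(1) g(1)] ro by blast
      then have s: "pair \<alpha> \<gamma> + pair \<beta> \<gamma> = -1" by (simp add: pair_simps)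
      have "\<alpha> + \<gamma> \<noteq> 0" "\<beta> + \<gamma> \<noteq> 0" using nz by auto
      then have "pair \<alpha> \<gamma> \<ge> -1" "pair \<beta> \<gamma> \<ge> -1"
        using pair_ge_minus_one[OF al g(1)] pair_ge_minus_one[OF be g(1)] by blast+
      then have "pair \<alpha> ?d \<ge> 0" "pair \<beta> ?d \<ge> 0"
        using pab al be by (simp_all add: pair_simps pair_self)
      then have "\<alpha> + ?d \<notin> \<Phi>" "\<beta> + ?d \<notin> \<Phi>" using add_root_iff[OF al d] add_root_iff[OF be d] by auto
      then have N: "N0 \<alpha> ?d = 0" "N0 \<beta> ?d = 0" using N0_zero by blast+
      have jz: "\<xi> \<otimes> ([j] \<cdot> z) \<in> carrier K" "\<zeta> \<otimes> ([j] \<cdot> z) \<in> carrier K" using xc zc by auto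
      have nzd: "\<alpha> + ?d \<noteq> 0" "\<beta> + ?d \<noteq> 0" using off(1) od by blast+
      have T: "r1 ?d ([j] \<cdot> z) = D j"
      proof -
        have "r1 ?d ([j] \<cdot> z) = twist G \<alpha> \<xi> q ?d ([j] \<cdot> z)" using i3 d off(2)[OF o(4)] zI le by blast
        then show ?thesis using clG nzd d by (simp add: twist_def N Q.e_zero Q.e_root D_def)
      qed
      have "r2 ?d ([j] \<cdot> z) = twist G \<beta> \<zeta> r1 ?d ([j] \<cdot> z)" using i4 d off(3)[OF o(4)] zI le by blast
      then show ?thesis using clG nzd d by (simp add: twist_def N R1.e_zero R2.e_root T)
    qed
    have tw: "twist G (\<alpha> + \<beta>) ([(- N0 \<alpha> \<beta>)] \<cdot> (\<xi> \<otimes> \<zeta>)) r2 \<gamma> a = r2 \<gamma> a \<otimes>\<^bsub>G\<^esub> D j"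
    proof -
      have "[(N0 (\<alpha> + \<beta>) \<gamma>)] \<cdot> ([(- N0 \<alpha> \<beta>)] \<cdot> (\<xi> \<otimes> \<zeta>) \<otimes> a) = [j] \<cdot> z"
        using xc cl by (simp add: pow_simps j_def z_def m_assoc)
      then show ?thesis by (simp add: twist_def dd r2d)
    qed
    have BC: "B \<otimes>\<^bsub>G\<^esub> C = C \<otimes>\<^bsub>G\<^esub> B"
      unfolding B_def C_def
    proof (rule Q.e_commute)
      assume ro: "\<beta> + \<gamma> \<in> \<Phi>" "\<alpha> + \<gamma> \<in> \<Phi>"
      then have p: "pair \<beta> \<gamma> = -1" "pair \<alpha> \<gamma> = -1"
        using add_root_iff[OF be g(1)] add_root_iff[OF al g(1)] by blast+
      have "\<alpha> + \<beta> \<notin> \<Phi>"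
      proof
        assume "\<alpha> + \<beta> \<in> \<Phi>"
        then have "pair \<alpha> (\<beta> + \<gamma>) = -2" using add_root_iff[OF al be] p by (simp add: pair_simps)
        then show False using add_zero_iff[OF al ro(1)] nz(4) by blast
      qed
      then have "pair \<alpha> \<beta> \<ge> 0" by (rule pair_nonneg[OF al be ab])
      then show "pair (\<beta> + \<gamma>) (\<alpha> + \<gamma>) \<ge> 0"
        using p g by (simp add: pair_simps pair_self pair_commute[of \<beta> \<alpha>] pair_commute[of \<gamma> \<alpha>])
    qed (use nz cI in auto)
    have "\<beta> + \<gamma> \<noteq> 0" "\<alpha> + \<gamma> \<noteq> 0" using nz by auto
    then have jac: "N0 \<beta> (\<alpha> + \<gamma>) * N0 \<alpha> \<gamma> = N0 \<alpha> (\<beta> + \<gamma>) * N0 \<beta> \<gamma> + j"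
      using N0_jacobi[OF al be g(1) ab] by (simp add: j_def)
    have Dadd: "D (i + j) = D i \<otimes>\<^bsub>G\<^esub> D j" for i j
      unfolding D_def using Q.e_add[OF nz(4) zI zI, of i j] by (simp add: add_pow_add zc)
    have "q2 \<gamma> a = A \<otimes>\<^bsub>G\<^esub> (B \<otimes>\<^bsub>G\<^esub> C) \<otimes>\<^bsub>G\<^esub> D (N0 \<beta> (\<alpha> + \<gamma>) * N0 \<alpha> \<gamma>)"
      using clG by (simp add: q2g Q.G.m_assoc)
    also have "\<dots> = r2 \<gamma> a \<otimes>\<^bsub>G\<^esub> D j"
      unfolding BC jac Dadd r2g using clG by (simp add: Q.G.m_assoc)
    finally show ?thesis unfolding tw .
  qed
  then show ?thesis by blast
qed

text \<open>As \<alpha> + \<beta> is not a root, the correcting twist is trivial, and agreement off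
  the plane suffices for germs.\<close>

lemma step_commute:
  assumes G: "group G" and al: "\<alpha> \<in> \<Phi>" and be: "\<beta> \<in> \<Phi>" and ab: "\<alpha> + \<beta> \<notin> \<Phi> \<union> {0}"
    and xi: "\<xi> \<in> fractions R" and ze: "\<zeta> \<in> fractions R"
    and q1: "step G R \<beta> \<zeta> q q1" and q2: "step G R \<alpha> \<xi> q1 q2"
    and r1: "step G R \<alpha> \<xi> q r1" and r2: "step G R \<beta> \<zeta> r1 r2"
  shows "germ_eq R q2 r2"
proof -
  have ab0: "\<alpha> + \<beta> \<noteq> 0" "\<alpha> + \<beta> \<notin> \<Phi>" using ab by auto
  obtain n where n: "\<forall>\<gamma>\<in>\<Phi>. \<gamma> \<notin> span {\<alpha>, \<beta>} \<longrightarrow> (\<forall>a\<in>lev R n.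
    q2 \<gamma> a = twist G (\<alpha> + \<beta>) ([(- N0 \<alpha> \<beta>)] \<cdot> (\<xi> \<otimes> \<zeta>)) r2 \<gamma> a)"
    using step_steinberg_off_plane[OF G al be ab0(1) xi ze q1 q2 r1 r2] by blast
  obtain n' where n': "\<forall>m\<ge>n'. pstein_family \<Phi> N K G (lev R m) 0 r2"
    using germ_family[OF G stepD(2)[OF r2]] by blast
  define m where "m = max n n'"
  have le: "n \<le> m" "n' \<le> m" by (auto simp: m_def)
  interpret R2: pstein_family \<Phi> N K G "lev R m" 0 r2 using n' le by blast
  have N: "N0 (\<alpha> + \<beta>) \<gamma> = 0" for \<gamma> using ab0 N0_zero by blast
  have xc: "\<xi> \<in> carrier K" "\<zeta> \<in> carrier K" using xi ze fractions_carrier by auto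
  show ?thesis
  proof (rule germ_eq_off_plane[OF G stepD(2)[OF q2] stepD(2)[OF r2], of \<alpha> \<beta> m])
    fix \<gamma> a assume g: "\<gamma> \<in> \<Phi>" "\<gamma> \<notin> span {\<alpha>, \<beta>}" "a \<in> lev R m"
    then have "q2 \<gamma> a = twist G (\<alpha> + \<beta>) ([(- N0 \<alpha> \<beta>)] \<cdot> (\<xi> \<otimes> \<zeta>)) r2 \<gamma> a"
      using n lev_mono[OF le(1)] by blast
    moreover have "\<alpha> + \<beta> + \<gamma> \<noteq> 0"
    proof
      assume "\<alpha> + \<beta> + \<gamma> = 0"
      then have "\<gamma> = - (\<alpha> + \<beta>)" by (simp add: Groups.add_eq_0_iff)
      moreover have "- (\<alpha> + \<beta>) \<in> span {\<alpha>, \<beta>}" by (intro span_neg span_add span_base) auto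
      ultimately show False using g by simp
    qed
    moreover have "\<gamma> \<noteq> 0" using g zero_notin by auto
    ultimately show "q2 \<gamma> a = r2 \<gamma> a" using g R2.y_closed[of \<gamma> a] by (simp add: twist_def N R2.e_zero)
  qed
qed

lemma step_commutator:
  assumes G: "group G" and al: "\<alpha> \<in> \<Phi>" and be: "\<beta> \<in> \<Phi>" and ab: "\<alpha> + \<beta> \<in> \<Phi>"
    and xi: "\<xi> \<in> fractions R" and ze: "\<zeta> \<in> fractions R"
    and q1: "step G R \<beta> \<zeta> q q1" and q2: "step G R \<alpha> \<xi> q1 q2"
    and r1: "step G R \<alpha> \<xi> q r1" and r2: "step G R \<beta> \<zeta> r1 r2"
    and r3: "step G R (\<alpha> + \<beta>) ([(- N \<alpha> \<beta>)] \<cdot> (\<xi> \<otimes> \<zeta>)) r2 r3"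
  shows "germ_eq R q2 r3"
proof -
  have ab0: "\<alpha> + \<beta> \<noteq> 0" using ab zero_notin by metis
  obtain n where n: "\<forall>\<gamma>\<in>\<Phi>. \<gamma> \<notin> span {\<alpha>, \<beta>} \<longrightarrow> (\<forall>a\<in>lev R n.
    q2 \<gamma> a = twist G (\<alpha> + \<beta>) ([(- N0 \<alpha> \<beta>)] \<cdot> (\<xi> \<otimes> \<zeta>)) r2 \<gamma> a)"
    using step_steinberg_off_plane[OF G al be ab0(1) xi ze q1 q2 r1 r2] by blast
  obtain i where i: "\<forall>\<rho> a m. \<rho> \<in> \<Phi> \<longrightarrow> \<rho> \<noteq> - (\<alpha> + \<beta>) \<longrightarrow> a \<in> lev R m \<longrightarrow> i \<le> m \<longrightarrow>
      r3 \<rho> a = twist G (\<alpha> + \<beta>) ([(- N \<alpha> \<beta>)] \<cdot> (\<xi> \<otimes> \<zeta>)) r2 \<rho> a"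
    using step_formula[OF r3] by blast
  define m where "m = max n i"
  have le: "n \<le> m" "i \<le> m" by (auto simp: m_def)
  have P: "- (\<alpha> + \<beta>) \<in> span {\<alpha>, \<beta>}" by (intro span_neg span_add span_base) auto
  show ?thesis
  proof (rule germ_eq_off_plane[OF G stepD(2)[OF q2] stepD(2)[OF r3], of \<alpha> \<beta> m])
    fix \<gamma> a assume g: "\<gamma> \<in> \<Phi>" "\<gamma> \<notin> span {\<alpha>, \<beta>}" "a \<in> lev R m"
    then have "\<gamma> \<noteq> - (\<alpha> + \<beta>)" using P by auto
    then have "r3 \<gamma> a = twist G (\<alpha> + \<beta>) ([(- N \<alpha> \<beta>)] \<cdot> (\<xi> \<otimes> \<zeta>)) r2 \<gamma> a" using i g le by blast
    moreover have "q2 \<gamma> a = twist G (\<alpha> + \<beta>) ([(- N0 \<alpha> \<beta>)] \<cdot> (\<xi> \<otimes> \<zeta>)) r2 \<gamma> a"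
      using n g lev_mono[OF le(1)] by blast
    ultimately show "q2 \<gamma> a = r3 \<gamma> a" using N0_eq[OF al be ab] by simp
  qed
qed

end

context steinberg_local
begin

lemma step_hom:
  assumes G: "group G" "group G'" and f: "f \<in> hom G G'" and R: "steinberg_level \<Phi> N K h R"
    and xi: "\<xi> \<in> fractions R" and s: "step G R \<alpha> \<xi> y y'"
  shows "step G' R \<alpha> \<xi> (\<lambda>\<rho> a. f (y \<rho> a)) (\<lambda>\<rho> a. f (y' \<rho> a))"
proof -
  interpret L: steinberg_level \<Phi> N K h R by fact
  obtain n where n: "stein G (lev R n) y" using s by (auto simp: step_def germ_def)
  obtain i where i: "\<forall>\<rho> a m. \<rho> \<in> \<Phi> \<longrightarrow> \<rho> \<noteq> - \<alpha> \<longrightarrow> a \<in> lev R m \<longrightarrow> i \<le> m \<longrightarrow> y' \<rho> a = twist G \<alpha> \<xi> y \<rho> a"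
    using L.step_formula[OF s] by blast
  obtain k where k: "\<forall>n. \<forall>a\<in>lev R (n + k). \<xi> \<otimes> a \<in> lev R n" using L.fractions_lev[OF xi] by blast
  interpret Y: pstein_family \<Phi> N K G "lev R n" 0 y by (rule L.pstein_familyI[OF G(1) n])
  have "f (y' \<beta> a) = twist G' \<alpha> \<xi> (\<lambda>\<rho> a. f (y \<rho> a)) \<beta> a" if b: "\<beta> \<in> \<Phi> - {- \<alpha>}" and a: "a \<in> lev R (n + k + i)" for \<beta> a
  proof -
    have a1: "a \<in> lev R n" "a \<in> lev R (n + k)"
      using a L.lev_mono[of n "n + k + i"] L.lev_mono[of "n + k" "n + k + i"] by auto
    have "\<beta> \<noteq> 0" "\<alpha> + \<beta> \<noteq> 0" using b zero_notin by (auto simp: Groups.add_eq_0_iff)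
    then have "y \<beta> a \<in> carrier G" "Y.e (\<alpha> + \<beta>) ([(N0 \<alpha> \<beta>)] \<cdot> (\<xi> \<otimes> a)) \<in> carrier G"
      using Y.y_closed b a1 k L.lev_add_pow by auto
    moreover have "y' \<beta> a = twist G \<alpha> \<xi> y \<beta> a" using i b a by auto
    ultimately show ?thesis by (simp add: twist_def ext_hom[OF G f] hom_mult[OF f])
  qed
  then show ?thesis
    using s pstein_hom[OF G f] unfolding step_def germ_def by blast
qed

lemma step_restrict:
  assumes "R \<subseteq> S" "step G S \<alpha> \<xi> y y'"
  shows "step G R \<alpha> \<xi> y y'"
proof -
  have l: "lev R n \<subseteq> lev S n" for n by (rule lev_mono_set[OF assms(1)])
  have "germ G S y \<Longrightarrow> germ G R y" for y unfolding germ_def using pstein_mono l by blast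
  moreover have "(\<exists>n. \<forall>\<beta>\<in>\<Phi> - {- \<alpha>}. \<forall>a\<in>lev S n. P \<beta> a) \<Longrightarrow> \<exists>n. \<forall>\<beta>\<in>\<Phi> - {- \<alpha>}. \<forall>a\<in>lev R n. P \<beta> a" for P
    using l by blast
  ultimately show ?thesis using assms(2) unfolding step_def by simp
qed

end

section \<open>Presented groups\<close>

definition word_inv :: "'g word \<Rightarrow> 'g word" where
  "word_inv w = rev (map (\<lambda>(x, b). (x, \<not> b)) w)"

definition cls :: "'g set \<Rightarrow> ('g word \<times> 'g word) set \<Rightarrow> 'g word \<Rightarrow> 'g word set" where
  "cls X E w = pres_rel X E `` {w}"

lemma words_Nil [simp]: "[] \<in> words X"
  and words_Cons [simp]: "(x, b) # w \<in> words X \<longleftrightarrow> x \<in> X \<and> w \<in> words X"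
  and words_append [simp]: "u @ v \<in> words X \<longleftrightarrow> u \<in> words X \<and> v \<in> words X"
  by (auto simp: words_def)

lemma words_mono: "X \<subseteq> Y \<Longrightarrow> words X \<subseteq> words Y"
  unfolding words_def by (intro lists_mono Sigma_mono) auto

lemma word_inv_words [simp]: "w \<in> words X \<Longrightarrow> word_inv w \<in> words X"
  by (auto simp: words_def word_inv_def)

lemma word_inv_Cons: "word_inv ((x, b) # w) = word_inv w @ [(x, \<not> b)]"
  by (simp add: word_inv_def)

lemma pres_rel_words: "(u, v) \<in> pres_rel X E \<Longrightarrow> u \<in> words X \<and> v \<in> words X"
  by (induction rule: pres_rel.induct) auto

lemma pres_rel_append:
  assumes "(u, v) \<in> pres_rel X E" "p \<in> words X" "q \<in> words X"
  shows "(p @ u @ q, p @ v @ q) \<in> pres_rel X E"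
  using assms(1)
proof (induction rule: pres_rel.induct)
  case (refl w)
  then show ?case using assms by (simp add: pres_rel.refl)
next
  case (sym u v)
  show ?case by (rule pres_rel.sym[OF sym.IH])
next
  case (trans u v w)
  show ?case by (rule pres_rel.trans[OF trans.IH])
next
  case (cancel u v x b)
  then show ?case using pres_rel.cancel[of "p @ u" X "v @ q" x b E] assms by simp
next
  case (relation u v r s)
  then show ?case using pres_rel.relation[of "p @ u" X "v @ q" r s E] assms by simp
qed

lemma pres_rel_append2:
  assumes "(u, u') \<in> pres_rel X E" "(v, v') \<in> pres_rel X E"
  shows "(u @ v, u' @ v') \<in> pres_rel X E"
proof -
  have "(u @ v, u' @ v) \<in> pres_rel X E"
    using pres_rel_append[OF assms(1), of "[]" v] pres_rel_words[OF assms(2)] by simp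
  moreover have "(u' @ v, u' @ v') \<in> pres_rel X E"
    using pres_rel_append[OF assms(2), of u' "[]"] pres_rel_words[OF assms(1)] by simp
  ultimately show ?thesis by (rule pres_rel.trans)
qed

lemma equiv_pres_rel: "equiv (words X) (pres_rel X E)"
proof (rule equivI)
  show "pres_rel X E \<subseteq> words X \<times> words X" by (rule subrelI) (auto dest: pres_rel_words)
  show "refl_on (words X) (pres_rel X E)" by (rule refl_onI) (rule pres_rel.refl)
  show "Relation.sym (pres_rel X E)" by (rule symI) (rule pres_rel.sym)
  show "Relation.trans (pres_rel X E)" by (rule transI) (rule pres_rel.trans)
qed

lemma cls_eq_iff: "u \<in> words X \<Longrightarrow> v \<in> words X \<Longrightarrow> cls X E u = cls X E v \<longleftrightarrow> (u, v) \<in> pres_rel X E"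
  unfolding cls_def by (rule eq_equiv_class_iff[OF equiv_pres_rel])

lemma cls_self: "w \<in> words X \<Longrightarrow> w \<in> cls X E w"
  unfolding cls_def by (simp add: pres_rel.refl)

lemma pres_rel_word_inv: "w \<in> words X \<Longrightarrow> (word_inv w @ w, []) \<in> pres_rel X E"
proof (induction w)
  case Nil
  then show ?case by (simp add: word_inv_def pres_rel.refl)
next
  case (Cons l w)
  obtain x b where l: "l = (x, b)" by (cases l)
  then have x: "x \<in> X" "w \<in> words X" using Cons.prems by auto
  have "(word_inv w @ [(x, \<not> b), (x, \<not> \<not> b)] @ w, word_inv w @ w) \<in> pres_rel X E"
    by (rule pres_rel.cancel) (use x in auto)
  then show ?case using Cons.IH x by (simp add: l word_inv_Cons) (blast intro: pres_rel.trans)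
qed

lemma presented_group_carrier: "carrier (presented_group X E) = cls X E ` words X"
  by (auto simp: presented_group_def quotient_def cls_def)

lemma presented_group_one: "\<one>\<^bsub>presented_group X E\<^esub> = cls X E []"
  by (simp add: presented_group_def cls_def)

lemma presented_group_mult:
  assumes "u \<in> words X" "v \<in> words X"
  shows "cls X E u \<otimes>\<^bsub>presented_group X E\<^esub> cls X E v = cls X E (u @ v)"
proof -
  have c: "cls X E (u' @ v') = cls X E (u @ v)" if "u' \<in> cls X E u" "v' \<in> cls X E v" for u' v'
  proof -
    have "(u, u') \<in> pres_rel X E" "(v, v') \<in> pres_rel X E" using that by (auto simp: cls_def)
    then have uv: "(u @ v, u' @ v') \<in> pres_rel X E" by (rule pres_rel_append2)
    then show ?thesis using cls_eq_iff[of "u @ v" X "u' @ v'" E] pres_rel_words[OF uv] by simp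
  qed
  have "u \<in> cls X E u" "v \<in> cls X E v" using assms by (simp_all add: cls_self)
  then have "(\<Union>u'\<in>cls X E u. \<Union>v'\<in>cls X E v. cls X E (u' @ v')) = cls X E (u @ v)"
    using c by blast
  then show ?thesis by (simp add: presented_group_def cls_def)
qed

lemma presented_group_group: "group (presented_group X E)"
proof (rule groupI)
  fix P Q assume "P \<in> carrier (presented_group X E)" "Q \<in> carrier (presented_group X E)"
  then show "P \<otimes>\<^bsub>presented_group X E\<^esub> Q \<in> carrier (presented_group X E)"
    unfolding presented_group_carrier by (auto simp: presented_group_mult)
next
  show "\<one>\<^bsub>presented_group X E\<^esub> \<in> carrier (presented_group X E)"
    unfolding presented_group_carrier presented_group_one by simp
next
  fix P Q S
  assume "P \<in> carrier (presented_group X E)" "Q \<in> carrier (presented_group X E)"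
    "S \<in> carrier (presented_group X E)"
  then show "P \<otimes>\<^bsub>presented_group X E\<^esub> Q \<otimes>\<^bsub>presented_group X E\<^esub> S =
      P \<otimes>\<^bsub>presented_group X E\<^esub> (Q \<otimes>\<^bsub>presented_group X E\<^esub> S)"
    unfolding presented_group_carrier by (auto simp: presented_group_mult)
next
  fix P assume "P \<in> carrier (presented_group X E)"
  then show "\<one>\<^bsub>presented_group X E\<^esub> \<otimes>\<^bsub>presented_group X E\<^esub> P = P"
    unfolding presented_group_carrier presented_group_one by (auto simp: presented_group_mult)
next
  fix P assume "P \<in> carrier (presented_group X E)"
  then obtain w where w: "w \<in> words X" "P = cls X E w" unfolding presented_group_carrier by auto
  have "cls X E (word_inv w) \<otimes>\<^bsub>presented_group X E\<^esub> P = \<one>\<^bsub>presented_group X E\<^esub>"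
    using w pres_rel_word_inv[OF w(1)] by (simp add: presented_group_mult presented_group_one cls_eq_iff)
  then show "\<exists>Q\<in>carrier (presented_group X E). Q \<otimes>\<^bsub>presented_group X E\<^esub> P = \<one>\<^bsub>presented_group X E\<^esub>"
    using w unfolding presented_group_carrier by (intro bexI) auto
qed

lemma presented_group_inv:
  assumes "w \<in> words X"
  shows "inv\<^bsub>presented_group X E\<^esub> cls X E w = cls X E (word_inv w)"
proof -
  interpret group "presented_group X E" by (rule presented_group_group)
  show ?thesis
    by (rule inv_equality)
      (use assms pres_rel_word_inv[OF assms] in
        \<open>simp_all add: presented_group_mult presented_group_one presented_group_carrier cls_eq_iff\<close>)
qed

abbreviation map_word :: "('g \<Rightarrow> 'h) \<Rightarrow> 'g word \<Rightarrow> 'h word" where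
  "map_word f \<equiv> map (\<lambda>(x, b). (f x, b))"

lemma map_word_words: "w \<in> words X \<Longrightarrow> f ` X \<subseteq> Y \<Longrightarrow> map_word f w \<in> words Y"
  by (fastforce simp: words_def)

lemma pres_rel_map:
  assumes f: "f ` X \<subseteq> Y"
    and E: "\<And>r s. (r, s) \<in> E \<Longrightarrow> r \<in> words X \<Longrightarrow> s \<in> words X \<Longrightarrow> (map_word f r, map_word f s) \<in> E'"
    and uv: "(u, v) \<in> pres_rel X E"
  shows "(map_word f u, map_word f v) \<in> pres_rel Y E'"
  using uv
proof (induction rule: pres_rel.induct)
  case (refl w)
  then show ?case using f by (intro pres_rel.refl map_word_words)
next
  case (sym u v)
  show ?case by (rule pres_rel.sym[OF sym.IH])
next
  case (trans u v w)
  show ?case by (rule pres_rel.trans[OF trans.IH])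
next
  case (cancel u v x b)
  then show ?case
    using pres_rel.cancel[of "map_word f u" Y "map_word f v" "f x" b E'] map_word_words[OF _ f] f by auto
next
  case (relation u v r s)
  then show ?case
    using pres_rel.relation[OF _ _ _ _ E, of "map_word f u" Y "map_word f v" r s] map_word_words[OF _ f] by auto
qed

lemma cls_Union_map:
  assumes "w \<in> words X" "\<And>v. (w, v) \<in> pres_rel X E \<Longrightarrow> (map_word f w, map_word f v) \<in> pres_rel Y E'"
  shows "(\<Union>v\<in>cls X E w. cls Y E' (map_word f v)) = cls Y E' (map_word f w)"
proof -
  have "cls Y E' (map_word f v) = cls Y E' (map_word f w)" if "v \<in> cls X E w" for v
  proof -
    have m: "(map_word f w, map_word f v) \<in> pres_rel Y E'" using that assms(2) by (simp add: cls_def)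
    then show ?thesis using cls_eq_iff[of "map_word f w" Y "map_word f v" E'] pres_rel_words[OF m] by simp
  qed
  moreover have "w \<in> cls X E w" by (rule cls_self[OF assms(1)])
  ultimately show ?thesis by blast
qed

text \<open>Letters act up to the partial equivalence \<open>eq\<close>; only its reflexive points count.\<close>

lemma pres_rel_act:
  fixes eq :: "'p \<Rightarrow> 'p \<Rightarrow> bool"
  assumes sym: "\<And>p q. eq p q \<Longrightarrow> eq q p" and trans: "\<And>p q r. eq p q \<Longrightarrow> eq q r \<Longrightarrow> eq p r"
    and cong: "\<And>x b p q. x \<in> X \<Longrightarrow> eq p q \<Longrightarrow> eq (F (x, b) p) (F (x, b) q)"
    and cancel: "\<And>x b p. x \<in> X \<Longrightarrow> eq p p \<Longrightarrow> eq (F (x, b) (F (x, \<not> b) p)) p"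
    and rel: "\<And>r s p. (r, s) \<in> E \<Longrightarrow> r \<in> words X \<Longrightarrow> s \<in> words X \<Longrightarrow> eq p p \<Longrightarrow> eq (foldr F r p) (foldr F s p)"
    and uv: "(u, v) \<in> pres_rel X E" and p: "eq p p"
  shows "eq (foldr F u p) (foldr F v p)"
proof -
  have cong_word: "eq (foldr F w p) (foldr F w q)" if "w \<in> words X" "eq p q" for w p q
    using that(1)
  proof (induction w)
    case Nil
    then show ?case using that by simp
  next
    case (Cons l w)
    then show ?case using cong by (cases l) simp
  qed
  show ?thesis
    using uv p
  proof (induction arbitrary: p rule: pres_rel.induct)
    case (refl w)
    then show ?case using cong_word by blast
  next
    case (sym u v)
    then show ?case using assms(1) by blast
  next
    case (trans u v w)
    then show ?case using assms(2) by blast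
  next
    case (cancel u v x b)
    then have "eq (foldr F v p) (foldr F v p)" using cong_word by blast
    then have "eq (F (x, b) (F (x, \<not> b) (foldr F v p))) (foldr F v p)" using assms(4) cancel by blast
    then show ?case using cong_word cancel by simp
  next
    case (relation u v r s)
    then have "eq (foldr F v p) (foldr F v p)" using cong_word by blast
    then have "eq (foldr F r (foldr F v p)) (foldr F s (foldr F v p))" using rel relation by blast
    then show ?case using cong_word relation by simp
  qed
qed

section \<open>Steinberg groups over subsets of a ring and their actions\<close>

lemma pres_rel_mono:
  assumes "X \<subseteq> Y" "E \<subseteq> E'"
  shows "pres_rel X E \<subseteq> pres_rel Y E'"
proof (rule subrelI)
  fix u v assume "(u, v) \<in> pres_rel X E"
  then show "(u, v) \<in> pres_rel Y E'"
  proof (induction rule: pres_rel.induct)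
    case (refl w)
    then show ?case using words_mono[OF assms(1)] by (intro pres_rel.refl) blast
  next
    case (sym u v)
    show ?case by (rule pres_rel.sym[OF sym.IH])
  next
    case (trans u v w)
    show ?case by (rule pres_rel.trans[OF trans.IH])
  next
    case (cancel u v x b)
    then show ?case using words_mono[OF assms(1)] assms by (intro pres_rel.cancel) blast+
  next
    case (relation u v r s)
    then show ?case using words_mono[OF assms(1)] assms by (intro pres_rel.relation) blast+
  qed
qed

context steinberg_ring
begin

text \<open>The parameters range over a subset of the one ring \<open>K\<close>. All Steinberg
  groups in play thus share their words, and the homomorphisms between them are induced by
  inclusions and do not change words.\<close>

definition srel :: "'k set \<Rightarrow> (('v \<times> 'k) word \<times> ('v \<times> 'k) word) set" where
  "srel X =
     {(gen (\<alpha>, a) @ gen (\<alpha>, b), gen (\<alpha>, a \<oplus> b)) | \<alpha> a b. \<alpha> \<in> \<Phi> \<and> a \<in> X \<and> b \<in> X}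
   \<union> {(comm_word (\<alpha>, a) (\<beta>, b), []) | \<alpha> \<beta> a b.
        \<alpha> \<in> \<Phi> \<and> \<beta> \<in> \<Phi> \<and> a \<in> X \<and> b \<in> X \<and> \<alpha> + \<beta> \<notin> \<Phi> \<union> {0}}
   \<union> {(comm_word (\<alpha>, a) (\<beta>, b), gen (\<alpha> + \<beta>, [(N \<alpha> \<beta>)] \<cdot> (a \<otimes> b))) | \<alpha> \<beta> a b.
        \<alpha> \<in> \<Phi> \<and> \<beta> \<in> \<Phi> \<and> a \<in> X \<and> b \<in> X \<and> \<alpha> + \<beta> \<in> \<Phi>}"

abbreviation wd :: "'k set \<Rightarrow> ('v \<times> 'k) word set" where "wd X \<equiv> words (\<Phi> \<times> X)"
abbreviation pr :: "'k set \<Rightarrow> (('v \<times> 'k) word \<times> ('v \<times> 'k) word) set" where "pr X \<equiv> pres_rel (\<Phi> \<times> X) (srel X)"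
abbreviation St :: "'k set \<Rightarrow> ('v \<times> 'k) word set monoid" where "St X \<equiv> presented_group (\<Phi> \<times> X) (srel X)"
abbreviation cl :: "'k set \<Rightarrow> ('v \<times> 'k) word \<Rightarrow> ('v \<times> 'k) word set" where "cl X \<equiv> cls (\<Phi> \<times> X) (srel X)"

definition root_elt :: "'k set \<Rightarrow> 'v \<Rightarrow> 'k \<Rightarrow> ('v \<times> 'k) word set" where
  "root_elt X \<alpha> a = cl X [((\<alpha>, a), True)]"

lemma srel_mono: "X \<subseteq> Y \<Longrightarrow> srel X \<subseteq> srel Y"
  unfolding srel_def by (intro Un_mono) blast+

lemma pr_mono: "X \<subseteq> Y \<Longrightarrow> pr X \<subseteq> pr Y"
  by (intro pres_rel_mono srel_mono Sigma_mono) auto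

lemma wd_mono: "X \<subseteq> Y \<Longrightarrow> wd X \<subseteq> wd Y"
  by (intro words_mono Sigma_mono) auto

lemma pr_srel: "(r, s) \<in> srel X \<Longrightarrow> r \<in> wd X \<Longrightarrow> s \<in> wd X \<Longrightarrow> (r, s) \<in> pr X"
  using pres_rel.relation[of "[]" "\<Phi> \<times> X" "[]" r s "srel X"] by simp

lemma root_elt_closed [simp]: "\<alpha> \<in> \<Phi> \<Longrightarrow> a \<in> X \<Longrightarrow> root_elt X \<alpha> a \<in> carrier (St X)"
  by (simp add: root_elt_def presented_group_carrier)

lemma root_elt_stein:
  assumes X: "nonunital_subring X"
  shows "stein (St X) X (root_elt X)"
  unfolding pstein_def
proof (intro conjI ballI impI)
  note XD = nonunital_subringD[OF X] nonunital_subring_add_pow[OF X]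
  interpret G: group "St X" by (rule presented_group_group)
  fix \<rho> a assume "\<rho> \<in> \<Phi> - {0}" "a \<in> X"
  then show "root_elt X \<rho> a \<in> carrier (St X)" by simp
next
  fix \<rho> a b assume "\<rho> \<in> \<Phi> - {0}" "a \<in> X" "b \<in> X"
  then have "(gen (\<rho>, a) @ gen (\<rho>, b), gen (\<rho>, a \<oplus> b)) \<in> pr X"
    using nonunital_subringD[OF X] by (intro pr_srel) (auto simp: srel_def gen_def)
  then show "root_elt X \<rho> (a \<oplus> b) = root_elt X \<rho> a \<otimes>\<^bsub>St X\<^esub> root_elt X \<rho> b"
    using \<open>\<rho> \<in> \<Phi> - {0}\<close> \<open>a \<in> X\<close> \<open>b \<in> X\<close> nonunital_subringD(5)[OF X]
    by (simp add: root_elt_def presented_group_mult gen_def cls_eq_iff[symmetric])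
next
  note XD = nonunital_subringD[OF X] nonunital_subring_add_pow[OF X]
  fix \<rho> \<sigma> a b assume r: "\<rho> \<in> \<Phi> - {0}" "\<sigma> \<in> \<Phi> - {0}" "a \<in> X" "b \<in> X" "\<rho> + \<sigma> \<noteq> 0"
  have w: "comm_word (\<rho>, a) (\<sigma>, b) \<in> wd X" using r by (simp add: comm_word_def gen_def gen_inv_def)
  have "cmt (St X) (root_elt X \<rho> a) (root_elt X \<sigma> b) = cl X (comm_word (\<rho>, a) (\<sigma>, b))"
    using r by (simp add: cmt_def root_elt_def presented_group_mult presented_group_inv word_inv_def
        comm_word_def gen_def gen_inv_def)
  also have "\<dots> = ext (St X) (root_elt X) (\<rho> + \<sigma>) ([(N0 \<rho> \<sigma>)] \<cdot> (a \<otimes> b))"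
  proof (cases "\<rho> + \<sigma> \<in> \<Phi>")
    case True
    have ab: "[(N \<rho> \<sigma>)] \<cdot> (a \<otimes> b) \<in> X" using r XD by simp
    have "(comm_word (\<rho>, a) (\<sigma>, b), gen (\<rho> + \<sigma>, [(N \<rho> \<sigma>)] \<cdot> (a \<otimes> b))) \<in> pr X"
      by (rule pr_srel[OF _ w]) (use r True ab in \<open>auto simp: srel_def gen_def\<close>)
    then show ?thesis using True r w ab
      by (simp add: ext_def N0_eq root_elt_def gen_def cls_eq_iff)
  next
    case False
    have "(comm_word (\<rho>, a) (\<sigma>, b), []) \<in> pr X"
      by (rule pr_srel[OF _ w]) (use r False in \<open>auto simp: srel_def\<close>)
    then show ?thesis using False w by (simp add: ext_def presented_group_one cls_eq_iff)
  qed
  finally show "cmt (St X) (root_elt X \<rho> a) (root_elt X \<sigma> b) =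
      ext (St X) (root_elt X) (\<rho> + \<sigma>) ([(N0 \<rho> \<sigma>)] \<cdot> (a \<otimes> b))" .
qed

definition incl :: "'k set \<Rightarrow> ('v \<times> 'k) word set \<Rightarrow> ('v \<times> 'k) word set" where
  "incl Y P = (\<Union>w\<in>P. cl Y w)"

lemma incl_cl:
  assumes "X \<subseteq> Y" "w \<in> wd X"
  shows "incl Y (cl X w) = cl Y w"
proof -
  have "cl Y v = cl Y w" if "v \<in> cl X w" for v
  proof -
    have "(w, v) \<in> pr X" using that by (simp add: cls_def)
    then have m: "(w, v) \<in> pr Y" using pr_mono[OF assms(1)] by blast
    then show ?thesis using cls_eq_iff[of w "\<Phi> \<times> Y" v "srel Y"] pres_rel_words[OF m] by simp
  qed
  moreover have "w \<in> cl X w" by (rule cls_self[OF assms(2)])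
  ultimately show ?thesis unfolding incl_def by blast
qed

lemma incl_hom:
  assumes "X \<subseteq> Y"
  shows "incl Y \<in> hom (St X) (St Y)"
proof (rule homI)
  have w: "w \<in> wd X \<Longrightarrow> w \<in> wd Y" for w using wd_mono[OF assms] by blast
  fix P assume "P \<in> carrier (St X)"
  then show "incl Y P \<in> carrier (St Y)"
    using w by (auto simp: presented_group_carrier incl_cl[OF assms])
  fix Q assume "Q \<in> carrier (St X)"
  then show "incl Y (P \<otimes>\<^bsub>St X\<^esub> Q) = incl Y P \<otimes>\<^bsub>St Y\<^esub> incl Y Q"
    using w \<open>P \<in> carrier (St X)\<close>
    by (auto simp: presented_group_carrier presented_group_mult incl_cl[OF assms])
qed

definition act_letter :: "('v \<Rightarrow> 'k \<Rightarrow> 'p \<Rightarrow> 'p) \<Rightarrow> ('v \<times> 'k) \<times> bool \<Rightarrow> 'p \<Rightarrow> 'p" where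
  "act_letter T l p = T (fst (fst l)) (if snd l then snd (fst l) else \<ominus> snd (fst l)) p"

text \<open>The commutator relation is required in the form \<open>a b = c b a\<close>, where no
  inverses occur; inverse letters are handled by additivity and the action of zero. Only a partial
  equivalence is available, because the operators are meaningful on valid points alone.\<close>

lemma steinberg_act:
  fixes eq :: "'p \<Rightarrow> 'p \<Rightarrow> bool" and T
  assumes X: "nonunital_subring X"
    and sym: "\<And>p q. eq p q \<Longrightarrow> eq q p" and trans: "\<And>p q r. eq p q \<Longrightarrow> eq q r \<Longrightarrow> eq p r"
    and cong: "\<And>\<alpha> a p q. \<lbrakk>\<alpha> \<in> \<Phi>; a \<in> X; eq p q\<rbrakk> \<Longrightarrow> eq (T \<alpha> a p) (T \<alpha> a q)"
    and zero: "\<And>\<alpha> p. \<lbrakk>\<alpha> \<in> \<Phi>; eq p p\<rbrakk> \<Longrightarrow> eq (T \<alpha> \<zero> p) p"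
    and add: "\<And>\<alpha> a b p. \<lbrakk>\<alpha> \<in> \<Phi>; a \<in> X; b \<in> X; eq p p\<rbrakk> \<Longrightarrow> eq (T \<alpha> a (T \<alpha> b p)) (T \<alpha> (a \<oplus> b) p)"
    and comm: "\<And>\<alpha> \<beta> a b p. \<lbrakk>\<alpha> \<in> \<Phi>; \<beta> \<in> \<Phi>; \<alpha> + \<beta> \<notin> \<Phi> \<union> {0}; a \<in> X; b \<in> X; eq p p\<rbrakk> \<Longrightarrow>
      eq (T \<alpha> a (T \<beta> b p)) (T \<beta> b (T \<alpha> a p))"
    and cmt: "\<And>\<alpha> \<beta> a b p. \<lbrakk>\<alpha> \<in> \<Phi>; \<beta> \<in> \<Phi>; \<alpha> + \<beta> \<in> \<Phi>; a \<in> X; b \<in> X; eq p p\<rbrakk> \<Longrightarrow>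
      eq (T \<alpha> a (T \<beta> b p)) (T (\<alpha> + \<beta>) ([(N \<alpha> \<beta>)] \<cdot> (a \<otimes> b)) (T \<beta> b (T \<alpha> a p)))"
    and uv: "(u, v) \<in> pr X" and p: "eq p p"
  shows "eq (foldr (act_letter T) u p) (foldr (act_letter T) v p)"
proof -
  note XD = nonunital_subringD[OF X] nonunital_subring_add_pow[OF X]
  have left: "eq (T \<alpha> a (T \<alpha> (\<ominus> a) q)) q" if "\<alpha> \<in> \<Phi>" "a \<in> X" "eq q q" for \<alpha> a q
  proof -
    have "eq (T \<alpha> a (T \<alpha> (\<ominus> a) q)) (T \<alpha> (a \<oplus> \<ominus> a) q)" by (rule add) (use that XD in auto)
    moreover have "a \<oplus> \<ominus> a = \<zero>" using XD that by (simp add: r_neg)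
    ultimately show ?thesis using zero[OF that(1,3)] trans by simp
  qed
  have right: "eq (T \<alpha> (\<ominus> a) (T \<alpha> a q)) q" if "\<alpha> \<in> \<Phi>" "a \<in> X" "eq q q" for \<alpha> a q
    using left[of \<alpha> "\<ominus> a" q] that XD by simp
  have self: "eq (T \<alpha> a q) (T \<alpha> a q)" if "\<alpha> \<in> \<Phi>" "a \<in> X" "eq q q" for \<alpha> a q
    using cong that by blast
  have com: "eq (foldr (act_letter T) (comm_word (\<alpha>, a) (\<beta>, b)) q) (S q)"
    if ab: "\<alpha> \<in> \<Phi>" "a \<in> X" "\<beta> \<in> \<Phi>" "b \<in> X" and q: "eq q q"
      and S: "\<And>r. eq r r \<Longrightarrow> eq (T \<alpha> a (T \<beta> b r)) (S (T \<beta> b (T \<alpha> a r)))"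
      and Sc: "\<And>r s. eq r s \<Longrightarrow> eq (S r) (S s)" for \<alpha> \<beta> a b q S
  proof -
    \<comment> \<open>The relation is applied at the point that \<open>a^-1 b^-1\<close> makes of
      \<open>q\<close>, where \<open>b a\<close> cancels and \<open>S\<close> is applied to
      \<open>q\<close> itself.\<close>
    let ?r = "T \<beta> (\<ominus> b) q"
    have r: "eq ?r ?r" by (rule self) (use ab q XD in auto)
    have r': "eq (T \<alpha> (\<ominus> a) ?r) (T \<alpha> (\<ominus> a) ?r)" by (rule self) (use ab r XD in auto)
    have "eq (T \<beta> b (T \<alpha> a (T \<alpha> (\<ominus> a) ?r))) (T \<beta> b ?r)"
      by (rule cong[OF ab(3,4)], rule left[OF ab(1,2) r])
    then have "eq (T \<beta> b (T \<alpha> a (T \<alpha> (\<ominus> a) ?r))) q" by (rule trans) (rule left[OF ab(3,4) q])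
    then have "eq (T \<alpha> a (T \<beta> b (T \<alpha> (\<ominus> a) ?r))) (S q)" using S[OF r'] Sc trans by blast
    then show ?thesis by (simp add: comm_word_def gen_def gen_inv_def act_letter_def)
  qed
  show ?thesis
  proof (rule pres_rel_act[where eq = eq, OF _ _ _ _ _ uv p])
    fix x b p q assume "x \<in> \<Phi> \<times> X" "eq p q"
    then show "eq (act_letter T (x, b) p) (act_letter T (x, b) q)"
      using cong XD by (auto simp: act_letter_def)
  next
    fix x b p assume "x \<in> \<Phi> \<times> X" "eq p p"
    then show "eq (act_letter T (x, b) (act_letter T (x, \<not> b) p)) p"
      using left right by (auto simp: act_letter_def)
  next
    fix r s p assume rs: "(r, s) \<in> srel X" and p: "eq p p"
    from rs consider
      (1) \<alpha> a b where "\<alpha> \<in> \<Phi>" "a \<in> X" "b \<in> X" "r = gen (\<alpha>, a) @ gen (\<alpha>, b)" "s = gen (\<alpha>, a \<oplus> b)"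
    | (2) \<alpha> \<beta> a b where "\<alpha> \<in> \<Phi>" "\<beta> \<in> \<Phi>" "a \<in> X" "b \<in> X" "\<alpha> + \<beta> \<notin> \<Phi> \<union> {0}" "r = comm_word (\<alpha>, a) (\<beta>, b)" "s = []"
    | (3) \<alpha> \<beta> a b where "\<alpha> \<in> \<Phi>" "\<beta> \<in> \<Phi>" "a \<in> X" "b \<in> X" "\<alpha> + \<beta> \<in> \<Phi>" "r = comm_word (\<alpha>, a) (\<beta>, b)"
        "s = gen (\<alpha> + \<beta>, [(N \<alpha> \<beta>)] \<cdot> (a \<otimes> b))"
      unfolding srel_def by blast
    then show "eq (foldr (act_letter T) r p) (foldr (act_letter T) s p)"
    proof cases
      case 1
      then show ?thesis using add p by (simp add: gen_def act_letter_def)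
    next
      case 2
      have "eq (foldr (act_letter T) (comm_word (\<alpha>, a) (\<beta>, b)) p) ((\<lambda>q. q) p)"
        by (rule com) (use 2 p comm in auto)
      then show ?thesis using 2 by simp
    next
      case 3
      have x: "[(N \<alpha> \<beta>)] \<cdot> (a \<otimes> b) \<in> X" using 3 XD by simp
      have "eq (foldr (act_letter T) (comm_word (\<alpha>, a) (\<beta>, b)) p) (T (\<alpha> + \<beta>) ([(N \<alpha> \<beta>)] \<cdot> (a \<otimes> b)) p)"
        by (rule com) (use 3 p cmt cong x in auto)
      then show ?thesis using 3 by (simp add: gen_def act_letter_def)
    qed
  qed (use sym trans in blast)+
qed

end

section \<open>The Steinberg group of the fractions acting on germs\<close>

context steinberg_local
begin

text \<open>The negated parameter makes this precomposition with the conjugation by the inverse of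
  \<open>x \<alpha> \<xi>\<close>. A word \<open>w\<close> then sends the germ \<open>y\<close> to
  \<open>y (w^-1 g w)\<close> as a function of \<open>g\<close>, and this is a left action although
  precomposition reverses the order.\<close>

definition germ_act :: "('g, 'n) monoid_scheme \<Rightarrow> 'b set \<Rightarrow> 'a \<Rightarrow> 'b \<Rightarrow> ('a \<Rightarrow> 'b \<Rightarrow> 'g) \<Rightarrow> 'a \<Rightarrow> 'b \<Rightarrow> 'g" where
  "germ_act G R \<alpha> \<xi> y = (SOME y'. step G R \<alpha> (\<ominus> \<xi>) y y')"

abbreviation germ_word where
  "germ_word G R w y \<equiv> foldr (act_letter (germ_act G R)) w y"

text \<open>Equality of germs with validity built in: its reflexive points are exactly the germs, as
  \<open>steinberg_act\<close> expects.\<close>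

definition germ_equiv :: "('g, 'n) monoid_scheme \<Rightarrow> 'b set \<Rightarrow> ('a \<Rightarrow> 'b \<Rightarrow> 'g) \<Rightarrow> ('a \<Rightarrow> 'b \<Rightarrow> 'g) \<Rightarrow> bool" where
  "germ_equiv G R y z \<longleftrightarrow> germ G R y \<and> germ G R z \<and> germ_eq R y z"

end

context steinberg_level
begin

lemma fractions_nonunital_subring: "nonunital_subring (fractions R)"
  unfolding nonunital_subring_def
proof (intro conjI ballI)
  show "fractions R \<subseteq> carrier K" by (auto simp: fractions_def)
  show "\<zero> \<in> fractions R" using RE(2) by (auto simp: fractions_def)
next
  fix a assume "a \<in> fractions R"
  then obtain k :: nat where k: "a \<in> carrier K" "h [^] k \<otimes> a \<in> R" by (auto simp: fractions_def)
  then have "h [^] k \<otimes> \<ominus> a \<in> R" using RE(5)[OF k(2)] by (simp add: r_minus)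
  then show "\<ominus> a \<in> fractions R" using k by (auto simp: fractions_def)
next
  fix a b assume "a \<in> fractions R" "b \<in> fractions R"
  then obtain k l :: nat where k: "a \<in> carrier K" "h [^] k \<otimes> a \<in> R" "b \<in> carrier K" "h [^] l \<otimes> b \<in> R"
    by (auto simp: fractions_def)
  have "h [^] (k + l) \<otimes> (a \<oplus> b) = h [^] l \<otimes> (h [^] k \<otimes> a) \<oplus> h [^] k \<otimes> (h [^] l \<otimes> b)"
    using k by (simp add: nat_pow_mult[symmetric] r_distr m_ac)
  also have "\<dots> \<in> R" using RE(6)[OF hpow_R k(2)] RE(6)[OF hpow_R k(4)] RE(7) by simp
  finally show "a \<oplus> b \<in> fractions R" using k by (auto simp: fractions_def)
  have "h [^] (k + l) \<otimes> (a \<otimes> b) = (h [^] k \<otimes> a) \<otimes> (h [^] l \<otimes> b)"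
    using k by (simp add: nat_pow_mult[symmetric] m_ac)
  also have "\<dots> \<in> R" by (rule RE(6)[OF k(2,4)])
  finally show "a \<otimes> b \<in> fractions R" using k by (auto simp: fractions_def)
qed

lemmas frD = nonunital_subringD[OF fractions_nonunital_subring]
  nonunital_subring_add_pow[OF fractions_nonunital_subring]

lemma R_fractions: "R \<subseteq> fractions R"
proof
  fix r assume "r \<in> R"
  then have "r \<in> carrier K" "h [^] (0::nat) \<otimes> r \<in> R" by auto
  then show "r \<in> fractions R" unfolding fractions_def by blast
qed

lemma R_nonunital_subring: "nonunital_subring R"
  using lev_nonunital_subring[of 0] lev_0[OF RE(1)] by simp

lemma germ_act_step:
  assumes "group G" "germ G R y" "\<alpha> \<in> \<Phi>" "\<xi> \<in> fractions R"
  shows "step G R \<alpha> (\<ominus> \<xi>) y (germ_act G R \<alpha> \<xi> y)"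
  unfolding germ_act_def using exists_step[OF assms(1-3), of "\<ominus> \<xi>"] frD(4)[OF assms(4)] by (metis someI)

lemma germ_equiv_sym: "germ_equiv G R y z \<Longrightarrow> germ_equiv G R z y"
  by (auto simp: germ_equiv_def germ_eq_sym)

lemma germ_equiv_trans: "germ_equiv G R x y \<Longrightarrow> germ_equiv G R y z \<Longrightarrow> germ_equiv G R x z"
  unfolding germ_equiv_def using germ_eq_trans by blast

lemma germ_equiv_refl: "germ_equiv G R y y \<longleftrightarrow> germ G R y"
  by (simp add: germ_equiv_def germ_eq_refl)

lemma germ_equiv_pointwise:
  assumes "germ G R y" "\<And>\<rho> a. \<rho> \<in> \<Phi> \<Longrightarrow> a \<in> R \<Longrightarrow> y \<rho> a = z \<rho> a"
  shows "germ_equiv G R y z"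
proof -
  obtain n where n: "stein G (lev R n) y" using assms(1) by (auto simp: germ_def)
  have eq: "y \<rho> a = z \<rho> a" if "\<rho> \<in> \<Phi>" "a \<in> lev R n" for \<rho> a using that assms(2) lev_subset_R by blast
  have "stein G (lev R n) z" by (rule pstein_cong[OF n lev_nonunital_subring eq])
  then show ?thesis using n eq unfolding germ_equiv_def germ_def germ_eq_def by blast
qed

lemma step_equiv:
  assumes "group G" "\<alpha> \<in> \<Phi>" "\<xi> \<in> fractions R" "step G R \<alpha> \<xi> y y'" "step G R \<alpha> \<xi> z z'" "germ_eq R y z"
  shows "germ_equiv G R y' z'"
  using step_unique[OF assms] stepD assms unfolding germ_equiv_def by blast

lemma germ_act_cong:
  assumes "group G" "\<alpha> \<in> \<Phi>" "\<xi> \<in> fractions R" "germ_equiv G R y z"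
  shows "germ_equiv G R (germ_act G R \<alpha> \<xi> y) (germ_act G R \<alpha> \<xi> z)"
  using step_equiv[OF assms(1,2) frD(4)[OF assms(3)] germ_act_step germ_act_step] assms
  unfolding germ_equiv_def by blast

lemma germ_act_germ:
  assumes "group G" "\<alpha> \<in> \<Phi>" "\<xi> \<in> fractions R" "germ G R y"
  shows "germ G R (germ_act G R \<alpha> \<xi> y)"
  using germ_act_cong[OF assms(1-3), of y y] assms(4) by (simp add: germ_equiv_refl)

lemma germ_word_germ:
  assumes "group G" "w \<in> wd (fractions R)" "germ G R y"
  shows "germ G R (germ_word G R w y)"
  using assms(2)
proof (induction w)
  case Nil
  then show ?case using assms by simp
next
  case (Cons l w)
  obtain \<alpha> \<xi> b where l: "l = ((\<alpha>, \<xi>), b)" by (metis surj_pair)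
  then show ?case using Cons germ_act_germ[OF assms(1)] frD(4) by (simp add: act_letter_def)
qed

lemma germ_word_pres:
  assumes G: "group G" and X: "nonunital_subring X" "X \<subseteq> fractions R"
    and uv: "(u, v) \<in> pr X" and y: "germ G R y"
  shows "germ_equiv G R (germ_word G R u y) (germ_word G R v y)"
proof (rule steinberg_act[where eq = "germ_equiv G R" and X = X, OF X(1) germ_equiv_sym germ_equiv_trans _ _ _ _ _ uv])
  note XD = nonunital_subringD[OF X(1)]
  have fr: "a \<in> fractions R" "\<ominus> a \<in> fractions R" if "a \<in> X" for a using X(2) frD(4) that by blast+
  note act = germ_act_step[OF G] and germ = germ_act_germ[OF G]
  show "germ_equiv G R y y" using y by (simp add: germ_equiv_refl)
  fix \<alpha> p assume al: "\<alpha> \<in> \<Phi>" and "germ_equiv G R p p"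
  then have p: "germ G R p" by (simp add: germ_equiv_refl)
  show "germ_equiv G R (germ_act G R \<alpha> \<zero> p) p"
    using step_equiv[OF G al frD(3) _ step_zero[OF G p]] act[OF p al frD(3)] by (simp add: germ_eq_refl)
next
  note XD = nonunital_subringD[OF X(1)]
  have fr: "a \<in> fractions R" "\<ominus> a \<in> fractions R" if "a \<in> X" for a using X(2) frD(4) that by blast+
  note act = germ_act_step[OF G] and germ = germ_act_germ[OF G]
  fix \<alpha> a p q assume "\<alpha> \<in> \<Phi>" "a \<in> X" "germ_equiv G R p q"
  then show "germ_equiv G R (germ_act G R \<alpha> a p) (germ_act G R \<alpha> a q)"
    using germ_act_cong[OF G] fr by blast
next
  note XD = nonunital_subringD[OF X(1)]
  have fr: "a \<in> fractions R" "\<ominus> a \<in> fractions R" if "a \<in> X" for a using X(2) frD(4) that by blast+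
  note act = germ_act_step[OF G] and germ = germ_act_germ[OF G]
  fix \<alpha> a b p assume al: "\<alpha> \<in> \<Phi>" and ab: "a \<in> X" "b \<in> X" and "germ_equiv G R p p"
  then have p: "germ G R p" by (simp add: germ_equiv_refl)
  let ?p1 = "germ_act G R \<alpha> b p"
  have "germ G R ?p1" using germ al ab p fr by blast
  then have "step G R \<alpha> (\<ominus> b \<oplus> \<ominus> a) p (germ_act G R \<alpha> a ?p1)"
    using step_add[OF G al fr(2)[OF ab(2)] fr(2)[OF ab(1)]] act[OF p al fr(1)[OF ab(2)]] act[OF _ al fr(1)[OF ab(1)]]
    by blast
  moreover have "\<ominus> b \<oplus> \<ominus> a = \<ominus> (a \<oplus> b)" using XD(2)[OF ab(1)] XD(2)[OF ab(2)] by (simp add: minus_add a_comm)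
  ultimately have s: "step G R \<alpha> (\<ominus> (a \<oplus> b)) p (germ_act G R \<alpha> a ?p1)" by simp
  show "germ_equiv G R (germ_act G R \<alpha> a ?p1) (germ_act G R \<alpha> (a \<oplus> b) p)"
    by (rule step_equiv[OF G al fr(2)[OF XD(5)[OF ab]] s act[OF p al fr(1)[OF XD(5)[OF ab]]] germ_eq_refl])
next
  note XD = nonunital_subringD[OF X(1)]
  have fr: "a \<in> fractions R" "\<ominus> a \<in> fractions R" if "a \<in> X" for a using X(2) frD(4) that by blast+
  note act = germ_act_step[OF G] and germ = germ_act_germ[OF G]
  fix \<alpha> \<beta> a b p assume r: "\<alpha> \<in> \<Phi>" "\<beta> \<in> \<Phi>" and ab: "a \<in> X" "b \<in> X" and "germ_equiv G R p p"
  then have p: "germ G R p" by (simp add: germ_equiv_refl)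
  note fa = fr[OF ab(1)] and fb = fr[OF ab(2)]
  let ?q1 = "germ_act G R \<beta> b p"
  let ?q2 = "germ_act G R \<alpha> a ?q1"
  let ?r1 = "germ_act G R \<alpha> a p"
  let ?r2 = "germ_act G R \<beta> b ?r1"
  have g1: "germ G R ?q1" "germ G R ?r1" using germ r p fa fb by blast+
  have g2: "germ G R ?q2" "germ G R ?r2" using germ r g1 fa fb by blast+
  note steps = act[OF p r(2) fb(1)] act[OF g1(1) r(1) fa(1)] act[OF p r(1) fa(1)] act[OF g1(2) r(2) fb(1)]
  show "germ_equiv G R ?q2 ?r2" if "\<alpha> + \<beta> \<notin> \<Phi> \<union> {0}"
    using step_commute[OF G r that fa(2) fb(2) steps] g2 by (simp add: germ_equiv_def)
  show "germ_equiv G R ?q2 (germ_act G R (\<alpha> + \<beta>) ([(N \<alpha> \<beta>)] \<cdot> (a \<otimes> b)) ?r2)" if s: "\<alpha> + \<beta> \<in> \<Phi>"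
  proof -
    let ?n = "[(N \<alpha> \<beta>)] \<cdot> (a \<otimes> b)"
    have n: "?n \<in> fractions R" by (rule frD(7)[OF frD(6)[OF fa(1) fb(1)]])
    have cl: "a \<in> carrier K" "b \<in> carrier K" using XD(2) ab by blast+
    \<comment> \<open>The signs of the two parameters cancel in the product. The sign that
      \<open>step_commutator\<close> attaches to \<open>N\<close> is the one that
      \<open>germ_act\<close> attaches to its parameter.\<close>
    have "\<ominus> ?n = [(- N \<alpha> \<beta>)] \<cdot> (\<ominus> a \<otimes> \<ominus> b)"
      using cl by (simp add: add_pow_minus l_minus r_minus)
    then have "step G R (\<alpha> + \<beta>) ([(- N \<alpha> \<beta>)] \<cdot> (\<ominus> a \<otimes> \<ominus> b)) ?r2 (germ_act G R (\<alpha> + \<beta>) ?n ?r2)"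
      using act[OF g2(2) s n] by simp
    then show ?thesis
      using step_commutator[OF G r s fa(2) fb(2) steps] g2 germ[OF s n g2(2)] by (simp add: germ_equiv_def)
  qed
qed

text \<open>If \<xi> is itself a parameter of the family, then \<open>y \<alpha> \<xi>\<close>
  exists in the group, and a genuine conjugation has the values that a step prescribes.\<close>

lemma step_conj:
  assumes G: "group G" and X: "nonunital_subring X" and y: "stein G X y"
    and RX: "R \<subseteq> X" and xi: "\<xi> \<in> X" "\<xi> \<in> fractions R" and al: "\<alpha> \<in> \<Phi>"
  shows "step G R \<alpha> \<xi> y (\<lambda>\<rho> a. y \<alpha> \<xi> \<otimes>\<^bsub>G\<^esub> y \<rho> a \<otimes>\<^bsub>G\<^esub> inv\<^bsub>G\<^esub> y \<alpha> \<xi>)"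
proof -
  interpret Y: pstein_family \<Phi> N K G X 0 y
    using assms by (simp add: pstein_family_def pstein_family_axioms_def steinberg_ring_axioms)
  have lX: "lev R n \<subseteq> X" for n using lev_subset_R RX by blast
  have g: "germ G R y" unfolding germ_def using pstein_mono[OF y lX] by blast
  let ?x = "y \<alpha> \<xi>"
  have an: "\<alpha> \<noteq> 0" using al zero_notin by auto
  have x: "?x \<in> carrier G" by (rule Y.y_closed[OF al an xi(1)])
  have "(\<lambda>g. ?x \<otimes>\<^bsub>G\<^esub> g \<otimes>\<^bsub>G\<^esub> inv\<^bsub>G\<^esub> ?x) \<in> hom G G"
    by (rule homI) (use x in \<open>auto simp: Y.G.group_simps\<close>)
  then have g': "germ G R (\<lambda>\<rho> a. ?x \<otimes>\<^bsub>G\<^esub> y \<rho> a \<otimes>\<^bsub>G\<^esub> inv\<^bsub>G\<^esub> ?x)"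
    using g pstein_hom[OF G G] unfolding germ_def by blast
  have "?x \<otimes>\<^bsub>G\<^esub> y \<beta> a \<otimes>\<^bsub>G\<^esub> inv\<^bsub>G\<^esub> ?x = twist G \<alpha> \<xi> y \<beta> a" if b: "\<beta> \<in> \<Phi> - {- \<alpha>}" and a: "a \<in> lev R 0" for \<beta> a
  proof -
    have aX: "a \<in> X" using a lX by blast
    have nz: "\<beta> \<noteq> 0" "\<alpha> + \<beta> \<noteq> 0" using b zero_notin by (auto simp: Groups.add_eq_0_iff)
    have z: "[(N0 \<alpha> \<beta>)] \<cdot> (\<xi> \<otimes> a) \<in> X" using Y.ID xi aX by simp
    have cl: "y \<beta> a \<in> carrier G" "Y.e (\<alpha> + \<beta>) ([(N0 \<alpha> \<beta>)] \<cdot> (\<xi> \<otimes> a)) \<in> carrier G"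
      using Y.y_closed b nz aX z by auto
    have "cmt G ?x (y \<beta> a) = Y.e (\<alpha> + \<beta>) ([(N0 \<alpha> \<beta>)] \<cdot> (\<xi> \<otimes> a))"
      using Y.y_cmt[OF al an _ nz(1) xi(1) aX nz(2,2)] b by simp
    moreover have "Y.e (\<alpha> + \<beta>) ([(N0 \<alpha> \<beta>)] \<cdot> (\<xi> \<otimes> a)) \<otimes>\<^bsub>G\<^esub> Y.e \<beta> a = Y.e \<beta> a \<otimes>\<^bsub>G\<^esub> Y.e (\<alpha> + \<beta>) ([(N0 \<alpha> \<beta>)] \<cdot> (\<xi> \<otimes> a))"
    proof (rule Y.e_commute)
      assume "\<alpha> + \<beta> \<in> \<Phi>" "\<beta> \<in> \<Phi>"
      then have "pair \<alpha> \<beta> = -1" using add_root_iff al by blast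
      then show "pair (\<alpha> + \<beta>) \<beta> \<ge> 0" using b by (simp add: pair_simps pair_self)
    qed (use nz z aX in auto)
    moreover have "?x \<otimes>\<^bsub>G\<^esub> y \<beta> a \<otimes>\<^bsub>G\<^esub> inv\<^bsub>G\<^esub> ?x = cmt G ?x (y \<beta> a) \<otimes>\<^bsub>G\<^esub> y \<beta> a"
      using x cl by (simp add: cmt_def Y.G.m_assoc)
    ultimately show ?thesis using b by (simp add: twist_def Y.e_root)
  qed
  then show ?thesis unfolding step_def using g g' by blast
qed

text \<open>For letters with parameters in \<open>X\<close> the abstract action is conjugation
  inside \<open>St X\<close>. In the induction, the family conjugated by the shorter word is the
  image of the canonical family under an inner automorphism, so that \<open>step_hom\<close> carries
  \<open>step_conj\<close> over to it.\<close>

lemma germ_word_conj: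
  assumes X: "nonunital_subring X" "R \<subseteq> X" "X \<subseteq> fractions R" and w: "w \<in> wd X"
  shows "germ_equiv (St X) R (germ_word (St X) R w (root_elt X))
    (\<lambda>\<rho> a. inv\<^bsub>St X\<^esub> cl X w \<otimes>\<^bsub>St X\<^esub> root_elt X \<rho> a \<otimes>\<^bsub>St X\<^esub> cl X w)"
  using w
proof (induction w)
  interpret G: group "St X" by (rule presented_group_group)
  have lX: "lev R n \<subseteq> X" for n using lev_subset_R X(2) by blast
  have g0: "germ (St X) R (root_elt X)"
    unfolding germ_def using pstein_mono[OF root_elt_stein[OF X(1)] lX] by blast
  {
    case Nil
    have "germ_equiv (St X) R (root_elt X)
        (\<lambda>\<rho> a. inv\<^bsub>St X\<^esub> cl X [] \<otimes>\<^bsub>St X\<^esub> root_elt X \<rho> a \<otimes>\<^bsub>St X\<^esub> cl X [])"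
    proof (rule germ_equiv_pointwise[OF g0])
      fix \<rho> a assume "\<rho> \<in> \<Phi>" "a \<in> R"
      then have "root_elt X \<rho> a \<in> carrier (St X)" using X(2) by auto
      then show "root_elt X \<rho> a = inv\<^bsub>St X\<^esub> cl X [] \<otimes>\<^bsub>St X\<^esub> root_elt X \<rho> a \<otimes>\<^bsub>St X\<^esub> cl X []"
        by (simp flip: presented_group_one)
    qed
    then show ?case by simp
  next
    case (Cons l w)
    obtain \<alpha> \<zeta> b where l: "l = ((\<alpha>, \<zeta>), b)" by (metis surj_pair)
    define \<xi> where "\<xi> = (if b then \<zeta> else \<ominus> \<zeta>)"
    have letter: "act_letter T l p = T \<alpha> \<xi> p" for T :: "'a \<Rightarrow> 'b \<Rightarrow> 'p \<Rightarrow> 'p" and p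
      by (simp add: l act_letter_def \<xi>_def)
    have al: "\<alpha> \<in> \<Phi>" "\<zeta> \<in> X" and w: "w \<in> wd X" using Cons.prems l by auto
    have xi: "\<xi> \<in> X" "\<ominus> \<xi> \<in> X" 
      using al(2) nonunital_subringD(2,4)[OF X(1) al(2)] unfolding \<xi>_def by (cases b; simp)+
    have xf: "\<xi> \<in> fractions R" "\<ominus> \<xi> \<in> fractions R" using xi X(3) by auto
    interpret Y: pstein_family \<Phi> N K "St X" X 0 "root_elt X"
      using X root_elt_stein G.is_group by (simp add: pstein_family_def pstein_family_axioms_def steinberg_ring_axioms)
    have an: "\<alpha> \<noteq> 0" using al zero_notin by auto
    have inv: "root_elt X \<alpha> (\<ominus> z) = inv\<^bsub>St X\<^esub> root_elt X \<alpha> z" if "z \<in> X" for z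
      using Y.e_minus[OF an that] al by (simp add: Y.e_root)
    have "cl X (l # w) = cl X [l] \<otimes>\<^bsub>St X\<^esub> cl X w"
      using l al w by (simp add: presented_group_mult)
    also have "cl X [l] = root_elt X \<alpha> \<xi>"
    proof (cases b)
      case False
      have "inv\<^bsub>St X\<^esub> cl X [((\<alpha>, \<zeta>), True)] = cl X [((\<alpha>, \<zeta>), False)]"
        using al by (simp add: presented_group_inv word_inv_def)
      then show ?thesis using inv[OF al(2)] False by (simp add: l \<xi>_def root_elt_def)
    qed (simp add: l \<xi>_def root_elt_def)
    finally have clw: "cl X (l # w) = root_elt X \<alpha> \<xi> \<otimes>\<^bsub>St X\<^esub> cl X w" .
    let ?f = "\<lambda>g. inv\<^bsub>St X\<^esub> cl X w \<otimes>\<^bsub>St X\<^esub> g \<otimes>\<^bsub>St X\<^esub> cl X w"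
    have wc: "cl X w \<in> carrier (St X)" using w by (simp add: presented_group_carrier)
    have f: "?f \<in> hom (St X) (St X)"
      by (rule homI) (use wc in \<open>auto simp: G.group_simps\<close>)
    let ?x = "root_elt X \<alpha> (\<ominus> \<xi>)"
    have s1: "step (St X) R \<alpha> (\<ominus> \<xi>) (root_elt X) (\<lambda>\<rho> a. ?x \<otimes>\<^bsub>St X\<^esub> root_elt X \<rho> a \<otimes>\<^bsub>St X\<^esub> inv\<^bsub>St X\<^esub> ?x)"
      by (rule step_conj[OF G.is_group X(1) root_elt_stein[OF X(1)] X(2) xi(2) xf(2) al(1)])
    have s2: "step (St X) R \<alpha> (\<ominus> \<xi>) (\<lambda>\<rho> a. ?f (root_elt X \<rho> a))
        (\<lambda>\<rho> a. ?f (?x \<otimes>\<^bsub>St X\<^esub> root_elt X \<rho> a \<otimes>\<^bsub>St X\<^esub> inv\<^bsub>St X\<^esub> ?x))"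
      by (rule step_hom[OF G.is_group G.is_group f steinberg_level_axioms xf(2) s1])
    have IH: "germ_equiv (St X) R (germ_word (St X) R w (root_elt X)) (\<lambda>\<rho> a. ?f (root_elt X \<rho> a))"
      by (rule Cons.IH[OF w])
    have s3: "step (St X) R \<alpha> (\<ominus> \<xi>) (germ_word (St X) R w (root_elt X)) (germ_word (St X) R (l # w) (root_elt X))"
      using germ_act_step[OF G.is_group _ al(1) xf(1)] IH by (simp add: letter germ_equiv_def)
    have E: "germ_equiv (St X) R (germ_word (St X) R (l # w) (root_elt X))
        (\<lambda>\<rho> a. ?f (?x \<otimes>\<^bsub>St X\<^esub> root_elt X \<rho> a \<otimes>\<^bsub>St X\<^esub> inv\<^bsub>St X\<^esub> ?x))"
      using step_equiv[OF G.is_group al(1) xf(2) s3 s2] IH by (simp add: germ_equiv_def)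
    let ?y = "\<lambda>\<rho> a. inv\<^bsub>St X\<^esub> cl X (l # w) \<otimes>\<^bsub>St X\<^esub> root_elt X \<rho> a \<otimes>\<^bsub>St X\<^esub> cl X (l # w)"
    have eq: "?f (?x \<otimes>\<^bsub>St X\<^esub> root_elt X \<rho> a \<otimes>\<^bsub>St X\<^esub> inv\<^bsub>St X\<^esub> ?x) = ?y \<rho> a" if "\<rho> \<in> \<Phi>" "a \<in> X" for \<rho> a
      using that wc al(1) xi(1) by (simp add: clw inv G.group_simps)
    have "germ_equiv (St X) R (\<lambda>\<rho> a. ?f (?x \<otimes>\<^bsub>St X\<^esub> root_elt X \<rho> a \<otimes>\<^bsub>St X\<^esub> inv\<^bsub>St X\<^esub> ?x)) ?y"
      by (rule germ_equiv_pointwise[OF stepD(2)[OF s2]], rule eq) (use X(2) in auto)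
    then show ?case using E germ_equiv_trans by blast
  }
qed

end

context steinberg_local
begin

text \<open>Homomorphisms and passage to a smaller ring both preserve steps, and a step is unique as
  a germ; so the two transports agree letter by letter.\<close>

lemma germ_word_natural:
  assumes G: "group G" "group G'" and f: "f \<in> hom G G'"
    and R: "steinberg_level \<Phi> N K h R" and S: "steinberg_level \<Phi> N K h S" and RS: "R \<subseteq> S"
    and y: "germ G R y" "germ G' S y'" "germ_eq R (\<lambda>\<rho> a. f (y \<rho> a)) y'"
    and w: "w \<in> wd (fractions R)"
  shows "germ_eq R (\<lambda>\<rho> a. f (germ_word G R w y \<rho> a)) (germ_word G' S w y')"
proof -
  interpret R: steinberg_level \<Phi> N K h R by fact
  interpret S: steinberg_level \<Phi> N K h S by fact
  have fr: "fractions R \<subseteq> fractions S" using RS by (auto simp: fractions_def)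
  then have wS: "wd (fractions R) \<subseteq> wd (fractions S)" by (rule wd_mono)
  show ?thesis
    using w
  proof (induction w)
    case Nil
    then show ?case using y by simp
  next
    case (Cons l w)
    obtain \<alpha> \<zeta> b where l: "l = ((\<alpha>, \<zeta>), b)" by (metis surj_pair)
    define \<xi> where "\<xi> = (if b then \<zeta> else \<ominus> \<zeta>)"
    have letter: "act_letter T l p = T \<alpha> \<xi> p" for T :: "'a \<Rightarrow> 'b \<Rightarrow> 'p \<Rightarrow> 'p" and p
      by (simp add: l act_letter_def \<xi>_def)
    have al: "\<alpha> \<in> \<Phi>" "\<zeta> \<in> fractions R" and w: "w \<in> wd (fractions R)" using Cons.prems l by auto
    have xi: "\<xi> \<in> fractions R" "\<ominus> \<xi> \<in> fractions R" using al R.frD by (auto simp: \<xi>_def)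
    have "step G R \<alpha> (\<ominus> \<xi>) (germ_word G R w y) (germ_word G R (l # w) y)"
      using R.germ_act_step[OF G(1) _ al(1) xi(1)] R.germ_word_germ[OF G(1) w y(1)]
      by (simp add: letter)
    then have s1: "step G' R \<alpha> (\<ominus> \<xi>) (\<lambda>\<rho> a. f (germ_word G R w y \<rho> a)) (\<lambda>\<rho> a. f (germ_word G R (l # w) y \<rho> a))"
      by (rule step_hom[OF G f R xi(2)])
    have "step G' S \<alpha> (\<ominus> \<xi>) (germ_word G' S w y') (germ_word G' S (l # w) y')"
      using S.germ_act_step[OF G(2) S.germ_word_germ[OF G(2) subsetD[OF wS w] y(2)] al(1) subsetD[OF fr xi(1)]]
      by (simp add: letter)
    then have s2: "step G' R \<alpha> (\<ominus> \<xi>) (germ_word G' S w y') (germ_word G' S (l # w) y')"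
      by (rule step_restrict[OF RS])
    show ?case by (rule R.step_unique[OF G(2) al(1) xi(2) s1 s2 Cons.IH[OF w]])
  qed
qed

end

section \<open>The action of the big Steinberg group\<close>

text \<open>Both \<open>RA\<close> and \<open>RB\<close> are subrings of \<open>K\<close>, in which
  \<open>h\<close> is invertible. The assumption \<open>split\<close> says that \<open>RB\<close>
  maps onto \<open>RA\<close> modulo \<open>h\<close>. The assumption \<open>inter\<close> is the
  form that injectivity modulo \<open>h\<close> takes after iteration.\<close>

locale gluing = A: steinberg_level \<Phi> N K h RA + B: steinberg_level \<Phi> N K h RB
  for \<Phi> :: "'v::euclidean_space set" and N and K :: "('k, 'm) ring_scheme" (structure) and h and RA and RB +
  assumes BA: "RB \<subseteq> RA"
    and frac_A: "carrier K \<subseteq> A.fractions RA"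
    and inter: "RA \<inter> A.fractions RB \<subseteq> RB"
    and split: "r \<in> RA \<Longrightarrow> \<exists>b\<in>RB. \<exists>s\<in>RA. r = b \<oplus> h \<otimes> s"
begin

abbreviation "SB \<equiv> A.fractions RB"

lemma SB_carrier: "SB \<subseteq> carrier K"
  by (auto simp: A.fractions_def)

lemma frac_A_eq: "A.fractions RA = carrier K"
  using frac_A by (auto simp: A.fractions_def)

lemma split_power: "r \<in> RA \<Longrightarrow> \<exists>b\<in>RB. \<exists>s\<in>RA. r = b \<oplus> h [^] (n::nat) \<otimes> s"
proof (induction n arbitrary: r)
  case 0
  have "r = \<zero> \<oplus> h [^] (0::nat) \<otimes> r" using 0 by simp
  then show ?case using 0 B.RE(2) by blast
next
  case (Suc n)
  obtain b s where b: "b \<in> RB" "s \<in> RA" "r = b \<oplus> h [^] n \<otimes> s" using Suc.IH[OF Suc.prems] by blast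
  obtain b' s' where b': "b' \<in> RB" "s' \<in> RA" "s = b' \<oplus> h \<otimes> s'" using split[OF b(2)] by blast
  have "r = (b \<oplus> h [^] n \<otimes> b') \<oplus> h [^] Suc n \<otimes> s'"
    using b b' BA by (simp add: A.r_distr A.m_assoc A.a_assoc)
  moreover have "b \<oplus> h [^] n \<otimes> b' \<in> RB" using b b' B.RE(6,7) B.hpow_R by blast
  ultimately show ?case using b'(2) by blast
qed

lemma decompose:
  assumes "\<xi> \<in> carrier K"
  shows "\<exists>b\<in>SB. \<exists>a\<in>A.lev RA n. \<xi> = b \<oplus> a"
proof -
  obtain k :: nat where k: "h [^] k \<otimes> \<xi> \<in> RA" using assms frac_A by (auto simp: A.fractions_def)
  \<comment> \<open>The exponent is \<open>k + n\<close>, so that a multiple of \<open>h^n\<close>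
    is left after the denominator \<open>h^k\<close> is divided out again.\<close>
  obtain b s where b: "b \<in> RB" "s \<in> RA" "h [^] k \<otimes> \<xi> = b \<oplus> h [^] (k + n) \<otimes> s" using split_power[OF k] by blast
  have "\<xi> = A.hdiv k (h [^] k \<otimes> \<xi>)" using assms by simp
  also have "\<dots> = A.hdiv k b \<oplus> h [^] n \<otimes> s"
  proof -
    have "b = h [^] k \<otimes> A.hdiv k b" using b by simp
    then have "h [^] k \<otimes> \<xi> = h [^] k \<otimes> (A.hdiv k b \<oplus> h [^] n \<otimes> s)"
      using b by (simp add: A.r_distr A.nat_pow_mult[symmetric] A.m_assoc)
    then show ?thesis using b by simp
  qed
  finally have "\<xi> = A.hdiv k b \<oplus> h [^] n \<otimes> s" .
  moreover have hb: "h [^] k \<otimes> A.hdiv k b \<in> RB" using b by simp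
  have "A.hdiv k b \<in> SB" unfolding A.fractions_def using b by (intro CollectI conjI exI[of _ k] hb) simp
  moreover have "h [^] n \<otimes> s \<in> A.lev RA n" using b by (auto simp: A.lev_def)
  ultimately show ?thesis by blast
qed

text \<open>Dividing by \<open>h^n\<close> leads into \<open>RA\<close> and stays in
  \<open>SB\<close>, hence into \<open>RB\<close>. This controls the ambiguity of the splittings in
  \<open>decompose\<close>: two of them differ by such an element.\<close>

lemma lev_inter: "a \<in> A.lev RA n \<Longrightarrow> a \<in> SB \<Longrightarrow> a \<in> A.lev RB n"
proof -
  assume a: "a \<in> A.lev RA n" "a \<in> SB"
  then obtain r where r: "r \<in> RA" "a = h [^] n \<otimes> r" by (auto simp: A.lev_def)
  obtain k :: nat where "h [^] k \<otimes> a \<in> RB" using a by (auto simp: A.fractions_def)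
  then have "h [^] (k + n) \<otimes> r \<in> RB" using r by (simp add: A.nat_pow_mult[symmetric] A.m_assoc)
  then have "r \<in> SB" using r A.R_closed[OF r(1)] unfolding A.fractions_def by blast
  then show ?thesis using r inter by (auto simp: A.lev_def)
qed

lemma lev_BA: "A.lev RB n \<subseteq> A.lev RA n"
  by (rule A.lev_mono_set[OF BA])

lemma lev_SB: "A.lev RB n \<subseteq> SB"
  using B.lev_subset_R B.R_fractions by blast

sublocale GA: group "A.St RA" by (rule presented_group_group)
sublocale GB: group "A.St RB" by (rule presented_group_group)
sublocale GS: group "A.St SB" by (rule presented_group_group)

lemma RB_SB: "RB \<subseteq> SB"
  by (rule B.R_fractions)

lemma wd_RB: "w \<in> A.wd RB \<Longrightarrow> w \<in> A.wd RA" "w \<in> A.wd RB \<Longrightarrow> w \<in> A.wd SB"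
  using A.wd_mono[OF BA] A.wd_mono[OF RB_SB] by blast+

lemma wd_SB_frac: "w \<in> A.wd SB \<Longrightarrow> w \<in> A.wd (A.fractions RA)"
  using A.wd_mono[of SB "A.fractions RA"] SB_carrier frac_A_eq by blast

text \<open>For deep \<open>a\<close>, \<open>eta u \<alpha> a\<close> takes the role of
  \<open>u^-1 x \<alpha> a u\<close> in \<open>St RA\<close>.\<close>

definition eta :: "('v \<times> 'k) word \<Rightarrow> 'v \<Rightarrow> 'k \<Rightarrow> ('v \<times> 'k) word set" where
  "eta u = A.germ_word (A.St RA) RA u (A.root_elt RA)"

lemma germ_root_A: "A.germ (A.St RA) RA (A.root_elt RA)"
  unfolding A.germ_def using A.pstein_mono[OF A.root_elt_stein[OF A.R_nonunital_subring] A.lev_subset_R] by blast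

lemma germ_eta: "u \<in> A.wd SB \<Longrightarrow> A.germ (A.St RA) RA (eta u)"
  unfolding eta_def by (rule A.germ_word_germ[OF GA.is_group wd_SB_frac germ_root_A])

lemma eta_step:
  assumes "u \<in> A.wd SB" "\<alpha> \<in> \<Phi>" "b \<in> SB"
  shows "A.step (A.St RA) RA \<alpha> (\<ominus> b) (eta u) (eta (((\<alpha>, b), True) # u))"
  using A.germ_act_step[OF GA.is_group germ_eta[OF assms(1)] assms(2), of b] assms(3) SB_carrier frac_A_eq
  by (auto simp: eta_def A.act_letter_def)

text \<open>The second condition says that for deep \<open>c\<close> in \<open>RB\<close> the
  conjugate of \<open>x \<alpha> c\<close> comes from \<open>St RB\<close>: the word
  \<open>w\<close> represents the genuine conjugate by \<open>u\<close> in \<open>St SB\<close> and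
  the value of \<open>eta u\<close> in \<open>St RA\<close>. This is what allows such a factor to
  pass from one component of a pair to the other.\<close>

definition good :: "('v \<times> 'k) word \<Rightarrow> nat \<Rightarrow> bool" where
  "good u n \<longleftrightarrow> A.stein (A.St RA) (A.lev RA n) (eta u) \<and>
    (\<forall>\<alpha>\<in>\<Phi>. \<forall>c\<in>A.lev RB n. \<exists>w\<in>A.wd RB.
       A.cl SB (((\<alpha>, c), True) # u) = A.cl SB (u @ w) \<and> A.cl RA w = eta u \<alpha> c)"

lemma good_mono: "good u n \<Longrightarrow> n \<le> m \<Longrightarrow> good u m"
  unfolding good_def using A.stein_deeper B.lev_mono by blast

lemma cl_Cons:
  assumes "\<alpha> \<in> \<Phi>" "a \<in> SB" "u \<in> A.wd SB"
  shows "A.cl SB (((\<alpha>, a), True) # u) = A.root_elt SB \<alpha> a \<otimes>\<^bsub>A.St SB\<^esub> A.cl SB u"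
  using assms by (simp add: A.root_elt_def presented_group_mult)

lemma cl_closed [simp]: "w \<in> A.wd X \<Longrightarrow> A.cl X w \<in> carrier (A.St X)"
  by (simp add: presented_group_carrier)

text \<open>
  Transporting the canonical family of \<open>St RB\<close> along the word \<open>u\<close> inside \<open>St RB\<close> gives elements
  that map to \<open>eta u\<close> in \<open>St RA\<close> and to the family conjugated by \<open>u\<close> in \<open>St SB\<close>.
\<close>

lemma exists_good:
  assumes u: "u \<in> A.wd SB"
  shows "\<exists>n. good u n"
proof -
  let ?B = "A.St RB" and ?y = "A.root_elt RB"
  have gB: "A.germ ?B RB ?y"
    unfolding A.germ_def using A.pstein_mono[OF A.root_elt_stein[OF B.R_nonunital_subring] B.lev_subset_R] by blast
  have gS: "A.germ (A.St SB) RB (A.root_elt SB)"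
    unfolding A.germ_def using A.pstein_mono[OF A.root_elt_stein[OF B.fractions_nonunital_subring] lev_SB] by blast
  have inc: "A.incl X (A.root_elt RB \<rho> a) = A.root_elt X \<rho> a" if "RB \<subseteq> X" "\<rho> \<in> \<Phi>" "a \<in> RB" for X \<rho> a
    using A.incl_cl[OF that(1), of "[((\<rho>, a), True)]"] that by (simp add: A.root_elt_def)
  have eq0: "A.germ_eq RB (\<lambda>\<rho> a. A.incl X (A.root_elt RB \<rho> a)) (A.root_elt X)" if "RB \<subseteq> X" for X
    unfolding A.germ_eq_def using inc[OF that] B.lev_subset_R by blast
  define z where "z = A.germ_word ?B RB u ?y"
  have eqA: "A.germ_eq RB (\<lambda>\<rho> a. A.incl RA (z \<rho> a)) (eta u)"
    unfolding z_def eta_def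
    by (rule A.germ_word_natural[OF GB.is_group GA.is_group A.incl_hom[OF BA] B.steinberg_level_axioms
          A.steinberg_level_axioms BA gB germ_root_A eq0[OF BA] u])
  have "A.germ_eq RB (\<lambda>\<rho> a. A.incl SB (z \<rho> a)) (A.germ_word (A.St SB) RB u (A.root_elt SB))"
    unfolding z_def
    by (rule A.germ_word_natural[OF GB.is_group GS.is_group A.incl_hom[OF RB_SB] B.steinberg_level_axioms
          B.steinberg_level_axioms subset_refl gB gS eq0[OF RB_SB] u])
  moreover have "A.germ_equiv (A.St SB) RB (A.germ_word (A.St SB) RB u (A.root_elt SB))
      (\<lambda>\<rho> a. inv\<^bsub>A.St SB\<^esub> A.cl SB u \<otimes>\<^bsub>A.St SB\<^esub> A.root_elt SB \<rho> a \<otimes>\<^bsub>A.St SB\<^esub> A.cl SB u)"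
    by (rule B.germ_word_conj[OF B.fractions_nonunital_subring RB_SB subset_refl u])
  ultimately have eqS: "A.germ_eq RB (\<lambda>\<rho> a. A.incl SB (z \<rho> a))
      (\<lambda>\<rho> a. inv\<^bsub>A.St SB\<^esub> A.cl SB u \<otimes>\<^bsub>A.St SB\<^esub> A.root_elt SB \<rho> a \<otimes>\<^bsub>A.St SB\<^esub> A.cl SB u)"
    unfolding A.germ_equiv_def using B.germ_eq_trans by blast
  obtain i where i: "\<And>\<rho> a. \<rho> \<in> \<Phi> \<Longrightarrow> a \<in> A.lev RB i \<Longrightarrow> A.incl RA (z \<rho> a) = eta u \<rho> a"
    using eqA by (auto simp: A.germ_eq_def)
  obtain j where j: "\<And>\<rho> a. \<rho> \<in> \<Phi> \<Longrightarrow> a \<in> A.lev RB j \<Longrightarrow> A.incl SB (z \<rho> a) =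
      inv\<^bsub>A.St SB\<^esub> A.cl SB u \<otimes>\<^bsub>A.St SB\<^esub> A.root_elt SB \<rho> a \<otimes>\<^bsub>A.St SB\<^esub> A.cl SB u"
    using eqS by (auto simp: A.germ_eq_def)
  have "A.germ ?B RB z" unfolding z_def by (rule B.germ_word_germ[OF GB.is_group u gB])
  then obtain k where k: "A.stein ?B (A.lev RB k) z" by (auto simp: A.germ_def)
  obtain l where l: "A.stein (A.St RA) (A.lev RA l) (eta u)" using germ_eta[OF u] by (auto simp: A.germ_def)
  define n where "n = i + j + k + l"
  have le: "i \<le> n" "j \<le> n" "k \<le> n" "l \<le> n" by (auto simp: n_def)
  have "\<exists>w\<in>A.wd RB. A.cl SB (((\<alpha>, c), True) # u) = A.cl SB (u @ w) \<and> A.cl RA w = eta u \<alpha> c"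
    if al: "\<alpha> \<in> \<Phi>" and c: "c \<in> A.lev RB n" for \<alpha> c
  proof -
    have cc: "c \<in> A.lev RB i" "c \<in> A.lev RB j" "c \<in> A.lev RB k"
      using c B.lev_mono le by blast+
    have "\<alpha> \<noteq> 0" using al A.zero_notin by auto
    then have "z \<alpha> c \<in> carrier ?B" using k cc(3) al by (simp add: A.pstein_def)
    then obtain w where w: "w \<in> A.wd RB" "z \<alpha> c = A.cl RB w" by (auto simp: presented_group_carrier)
    have 1: "A.cl RA w = eta u \<alpha> c"
      using i[OF al cc(1)] A.incl_cl[OF BA w(1)] w(2) by simp
    have cSB: "c \<in> SB" using c lev_SB by blast
    have 2: "A.cl SB w = inv\<^bsub>A.St SB\<^esub> A.cl SB u \<otimes>\<^bsub>A.St SB\<^esub> A.root_elt SB \<alpha> c \<otimes>\<^bsub>A.St SB\<^esub> A.cl SB u"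
      using j[OF al cc(2)] A.incl_cl[OF RB_SB w(1)] w(2) by simp
    have "A.cl SB (u @ w) = A.cl SB u \<otimes>\<^bsub>A.St SB\<^esub> A.cl SB w"
      using u wd_RB(2)[OF w(1)] by (simp add: presented_group_mult)
    also have "\<dots> = A.cl SB (((\<alpha>, c), True) # u)"
      unfolding 2 cl_Cons[OF al cSB u] using u al cSB by (simp add: GS.group_simps)
    finally show ?thesis using w(1) 1 by auto
  qed
  then have "good u n" using A.stein_deeper[OF l le(4)] by (simp add: good_def)
  then show ?thesis ..
qed

text \<open>Validity of the pairs is built in, so only valid pairs are equivalent to themselves. The
  first component is a word and not an element of \<open>St SB\<close>, because \<open>eta u\<close>
  is chosen for each word and depends on the element only up to equality of germs.\<close>

definition eqv :: "('v \<times> 'k) word \<times> ('v \<times> 'k) word set \<Rightarrow> ('v \<times> 'k) word \<times> ('v \<times> 'k) word set \<Rightarrow> bool" where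
  "eqv p q \<longleftrightarrow> fst p \<in> A.wd SB \<and> fst q \<in> A.wd SB \<and> snd p \<in> carrier (A.St RA) \<and> snd q \<in> carrier (A.St RA) \<and>
     (\<exists>w\<in>A.wd RB. A.cl SB (fst p) = A.cl SB (fst q @ w) \<and> snd q = A.cl RA w \<otimes>\<^bsub>A.St RA\<^esub> snd p)"

lemma eqvI:
  assumes "u \<in> A.wd SB" "u' \<in> A.wd SB" "y \<in> carrier (A.St RA)" "w \<in> A.wd RB"
    "A.cl SB u = A.cl SB (u' @ w)" "y' = A.cl RA w \<otimes>\<^bsub>A.St RA\<^esub> y"
  shows "eqv (u, y) (u', y')"
  using assms wd_RB(1)[OF assms(4)] unfolding eqv_def by auto

lemma eqvI_same:
  assumes "u \<in> A.wd SB" "u' \<in> A.wd SB" "y \<in> carrier (A.St RA)" "A.cl SB u = A.cl SB u'"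
  shows "eqv (u, y) (u', y)"
  by (rule eqvI[of _ _ _ "[]"]) (use assms in \<open>auto simp flip: presented_group_one\<close>)

lemma eqv_sym:
  assumes "eqv p q"
  shows "eqv q p"
proof -
  obtain u y u' y' where pq: "p = (u, y)" "q = (u', y')" by (metis surj_pair)
  obtain w where w: "w \<in> A.wd RB" "A.cl SB u = A.cl SB (u' @ w)" "y' = A.cl RA w \<otimes>\<^bsub>A.St RA\<^esub> y"
    and c: "u \<in> A.wd SB" "u' \<in> A.wd SB" "y \<in> carrier (A.St RA)" "y' \<in> carrier (A.St RA)"
    using assms pq by (auto simp: eqv_def)
  note wS = wd_RB[OF w(1)]
  have "A.cl SB (u @ word_inv w) = A.cl SB u \<otimes>\<^bsub>A.St SB\<^esub> inv\<^bsub>A.St SB\<^esub> A.cl SB w"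
    using c wS by (simp add: presented_group_mult presented_group_inv)
  also have "\<dots> = A.cl SB u'"
    unfolding w(2) using c wS by (simp add: presented_group_mult[symmetric] GS.group_simps)
  finally have 1: "A.cl SB u' = A.cl SB (u @ word_inv w)" ..
  have 2: "y = A.cl RA (word_inv w) \<otimes>\<^bsub>A.St RA\<^esub> y'"
    using w(3) c wS by (simp add: presented_group_inv[symmetric] GA.group_simps)
  show ?thesis unfolding pq by (rule eqvI[OF c(2,1,4) _ 1 2]) (use w in simp)
qed

lemma eqv_trans:
  assumes "eqv p q" "eqv q r"
  shows "eqv p r"
proof -
  obtain u y u' y' u'' y'' where pq: "p = (u, y)" "q = (u', y')" "r = (u'', y'')" by (metis surj_pair)
  obtain w where w: "w \<in> A.wd RB" "A.cl SB u = A.cl SB (u' @ w)" "y' = A.cl RA w \<otimes>\<^bsub>A.St RA\<^esub> y"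
    and c: "u \<in> A.wd SB" "u' \<in> A.wd SB" "y \<in> carrier (A.St RA)" "y' \<in> carrier (A.St RA)"
    using assms pq by (auto simp: eqv_def)
  obtain w' where w': "w' \<in> A.wd RB" "A.cl SB u' = A.cl SB (u'' @ w')" "y'' = A.cl RA w' \<otimes>\<^bsub>A.St RA\<^esub> y'"
    and c': "u'' \<in> A.wd SB" using assms pq by (auto simp: eqv_def)
  note wS = wd_RB[OF w(1)] and wS' = wd_RB[OF w'(1)]
  have "A.cl SB u = A.cl SB u' \<otimes>\<^bsub>A.St SB\<^esub> A.cl SB w" using w(2) c wS by (simp add: presented_group_mult)
  also have "\<dots> = A.cl SB (u'' @ (w' @ w))" unfolding w'(2) using c' wS wS' by (simp add: presented_group_mult)
  finally have 1: "A.cl SB u = A.cl SB (u'' @ (w' @ w))" .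
  have "A.cl RA (w' @ w) = A.cl RA w' \<otimes>\<^bsub>A.St RA\<^esub> A.cl RA w" using wS wS' by (simp add: presented_group_mult)
  then have 2: "y'' = A.cl RA (w' @ w) \<otimes>\<^bsub>A.St RA\<^esub> y" using w w' c wS wS' by (simp add: GA.m_assoc)
  show ?thesis unfolding pq by (rule eqvI[OF c(1) c' c(3) _ 1 2]) (use w w' in simp)
qed

lemma eqv_refl: "u \<in> A.wd SB \<Longrightarrow> y \<in> carrier (A.St RA) \<Longrightarrow> eqv (u, y) (u, y)"
  by (rule eqvI_same) auto

definition depth :: "('v \<times> 'k) word \<Rightarrow> nat" where
  "depth u = (SOME n. good u n)"

definition act :: "'v \<Rightarrow> 'k \<Rightarrow> ('v \<times> 'k) word \<times> ('v \<times> 'k) word set \<Rightarrow> ('v \<times> 'k) word \<times> ('v \<times> 'k) word set" where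
  "act \<alpha> \<xi> p = (let (b, a) = (SOME (b, a). b \<in> SB \<and> a \<in> A.lev RA (depth (fst p)) \<and> \<xi> = b \<oplus> a)
     in (((\<alpha>, b), True) # fst p, eta (fst p) \<alpha> a \<otimes>\<^bsub>A.St RA\<^esub> snd p))"

lemma eta_closed: "good u n \<Longrightarrow> \<alpha> \<in> \<Phi> \<Longrightarrow> a \<in> A.lev RA n \<Longrightarrow> eta u \<alpha> a \<in> carrier (A.St RA)"
  using A.zero_notin unfolding good_def A.pstein_def by blast

lemma good_family: "good u n \<Longrightarrow> pstein_family \<Phi> N K (A.St RA) (A.lev RA n) 0 (eta u)"
  unfolding good_def using A.pstein_familyI[OF GA.is_group] by blast

text \<open>In \<open>St SB\<close> the element \<open>x \<alpha> c u\<close> equals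
  \<open>u w\<close> for a word \<open>w\<close> over \<open>RB\<close>. The factor \<open>w\<close>
  crosses over to the second component, where it is \<open>eta u \<alpha> c\<close>.\<close>

lemma shift_eqv:
  assumes g: "good u n" and u: "u \<in> A.wd SB" and y: "y \<in> carrier (A.St RA)" and al: "\<alpha> \<in> \<Phi>"
    and b: "b \<in> SB" and c: "c \<in> A.lev RB n" and a: "a \<in> A.lev RA n"
  shows "eqv (((\<alpha>, b \<oplus> c), True) # u, eta u \<alpha> a \<otimes>\<^bsub>A.St RA\<^esub> y)
    (((\<alpha>, b), True) # u, eta u \<alpha> (c \<oplus> a) \<otimes>\<^bsub>A.St RA\<^esub> y)"
proof -
  interpret Y: pstein_family \<Phi> N K "A.St RA" "A.lev RA n" 0 "eta u" by (rule good_family[OF g])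
  interpret X: pstein_family \<Phi> N K "A.St SB" SB 0 "A.root_elt SB"
    using A.root_elt_stein[OF B.fractions_nonunital_subring] B.fractions_nonunital_subring GS.is_group
    by (simp add: pstein_family_def pstein_family_axioms_def A.steinberg_ring_axioms)
  have an: "\<alpha> \<noteq> 0" using al A.zero_notin by auto
  have cS: "c \<in> SB" "c \<in> A.lev RA n" using c lev_SB lev_BA by blast+
  have bc: "b \<oplus> c \<in> SB" using b cS B.frD(5) by blast
  obtain w where w: "w \<in> A.wd RB" "A.cl SB (((\<alpha>, c), True) # u) = A.cl SB (u @ w)" "A.cl RA w = eta u \<alpha> c"
    using g al c unfolding good_def by blast
  have "A.cl SB (((\<alpha>, b \<oplus> c), True) # u) = A.root_elt SB \<alpha> b \<otimes>\<^bsub>A.St SB\<^esub> A.cl SB (((\<alpha>, c), True) # u)"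
    using X.y_add[OF al an b cS(1)] u al b cS bc by (simp add: cl_Cons GS.m_assoc)
  also have "\<dots> = A.cl SB ((((\<alpha>, b), True) # u) @ w)"
    unfolding w(2) using cl_Cons[of \<alpha> b "u @ w"] al b u wd_RB(2)[OF w(1)] by simp
  finally have 1: "A.cl SB (((\<alpha>, b \<oplus> c), True) # u) = A.cl SB ((((\<alpha>, b), True) # u) @ w)" .
  have 2: "eta u \<alpha> (c \<oplus> a) \<otimes>\<^bsub>A.St RA\<^esub> y = A.cl RA w \<otimes>\<^bsub>A.St RA\<^esub> (eta u \<alpha> a \<otimes>\<^bsub>A.St RA\<^esub> y)"
    using Y.y_add[OF al an cS(2) a] Y.y_closed[OF al an cS(2)] Y.y_closed[OF al an a] y
    by (simp add: w(3) GA.m_assoc)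
  show ?thesis
    by (rule eqvI[OF _ _ _ w(1) 1 2]) (use u al b bc y Y.y_closed[OF al an a] in auto)
qed

text \<open>If the chosen splitting is \<open>b1 \<oplus> a1\<close>, then
  \<open>c = b1 \<ominus> b = a \<ominus> a1\<close> lies in \<open>SB\<close> and is deep in
  \<open>RA\<close>, hence deep in \<open>RB\<close>. So \<open>shift_eqv\<close> leads from one
  splitting to the other.\<close>

lemma act_eqv:
  assumes g: "good u n" and u: "u \<in> A.wd SB" and y: "y \<in> carrier (A.St RA)" and al: "\<alpha> \<in> \<Phi>"
    and b: "b \<in> SB" and a: "a \<in> A.lev RA n"
  shows "eqv (act \<alpha> (b \<oplus> a) (u, y)) (((\<alpha>, b), True) # u, eta u \<alpha> a \<otimes>\<^bsub>A.St RA\<^esub> y)"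
proof -
  define \<xi> where "\<xi> = b \<oplus> a"
  have cl: "b \<in> carrier K" "a \<in> carrier K" using b a SB_carrier A.lev_closed by auto
  have gd: "good u (depth u)" unfolding depth_def using exists_good[OF u] by (rule someI_ex)
  define pick where "pick = (SOME (b, a). b \<in> SB \<and> a \<in> A.lev RA (depth u) \<and> \<xi> = b \<oplus> a)"
  obtain b1 a1 where s: "pick = (b1, a1)" by (cases pick)
  have "\<exists>x. case x of (b, a) \<Rightarrow> b \<in> SB \<and> a \<in> A.lev RA (depth u) \<and> \<xi> = b \<oplus> a"
  proof -
    have "\<xi> \<in> carrier K" using cl by (simp add: \<xi>_def)
    then obtain b' a' where "b' \<in> SB" "a' \<in> A.lev RA (depth u)" "\<xi> = b' \<oplus> a'" using decompose by blast
    then show ?thesis by (intro exI[of _ "(b', a')"]) simp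
  qed
  then have "case (b1, a1) of (b, a) \<Rightarrow> b \<in> SB \<and> a \<in> A.lev RA (depth u) \<and> \<xi> = b \<oplus> a"
    unfolding s[symmetric] pick_def by (rule someI_ex)
  then have b1: "b1 \<in> SB" "a1 \<in> A.lev RA (depth u)" "\<xi> = b1 \<oplus> a1" by auto
  have cl1: "b1 \<in> carrier K" "a1 \<in> carrier K" using b1 SB_carrier A.lev_closed by auto
  \<comment> \<open>The smaller index gives the larger ideal, which contains both \<open>a\<close>
    and \<open>a1\<close>; either level is good for \<open>u\<close>, so this one is as
    well.\<close>
  define m where "m = min n (depth u)"
  have gm: "good u m" using g gd by (simp add: m_def min_def)
  have lm: "a \<in> A.lev RA m" "a1 \<in> A.lev RA m"
    using a b1 A.lev_mono[of m n] A.lev_mono[of m "depth u"] by (auto simp: m_def)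
  define c where "c = b1 \<ominus> b"
  have "b1 \<oplus> a1 = b \<oplus> a" using b1(3) by (simp add: \<xi>_def)
  then have "b1 \<oplus> a1 \<oplus> \<ominus> a1 = b \<oplus> a \<oplus> \<ominus> a1" by (rule arg_cong)
  then have "b1 = b \<oplus> a \<oplus> \<ominus> a1" using cl cl1 by (simp add: A.a_assoc A.r_neg)
  then have "c = b \<oplus> a \<oplus> \<ominus> a1 \<oplus> \<ominus> b" by (simp only: c_def A.minus_eq)
  also have "\<dots> = (b \<oplus> \<ominus> b) \<oplus> (a \<oplus> \<ominus> a1)" using cl cl1 by (simp add: A.a_ac)
  finally have c2: "c = a \<ominus> a1" using cl cl1 by (simp add: A.r_neg A.minus_eq)
  have "c \<in> SB" unfolding c_def A.minus_eq using b b1 B.frD(4,5) by blast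
  moreover have "c \<in> A.lev RA m" unfolding c2 A.minus_eq using lm A.levD(4,5) by blast
  ultimately have c: "c \<in> A.lev RB m" using lev_inter by blast
  have bc: "b \<oplus> c = b1" unfolding c_def A.minus_eq 
  proof -
    have "b \<oplus> (b1 \<oplus> \<ominus> b) = b1 \<oplus> (b \<oplus> \<ominus> b)" using cl cl1 by (simp add: A.a_ac)
    then show "b \<oplus> (b1 \<oplus> \<ominus> b) = b1" using cl cl1 by (simp add: A.r_neg)
  qed
  have ca: "c \<oplus> a1 = a" unfolding c2 A.minus_eq using cl cl1 by (simp add: A.a_assoc A.l_neg)
  have "act \<alpha> \<xi> (u, y) = (((\<alpha>, b1), True) # u, eta u \<alpha> a1 \<otimes>\<^bsub>A.St RA\<^esub> y)"
    using s by (simp add: act_def pick_def)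
  then show ?thesis using shift_eqv[OF gm u y al b c lm(2)] by (simp add: bc ca \<xi>_def)
qed

end

section \<open>Well-definedness and additivity of the action, and commutators of special
  parameters\<close>

context gluing
begin

lemma eqv_valid: "eqv p q \<Longrightarrow> eqv p p" "eqv p q \<Longrightarrow> eqv q q"
  using eqv_sym eqv_trans by blast+

lemma eqv_pairE:
  assumes "eqv p p"
  obtains u y where "p = (u, y)" "u \<in> A.wd SB" "y \<in> carrier (A.St RA)"
  using assms by (cases p) (auto simp: eqv_def)

text \<open>If \<open>u\<close> equals \<open>u' w\<close> in \<open>St SB\<close>, the germ
  \<open>eta u\<close> must be \<open>eta u'\<close> conjugated by the image \<open>?W\<close> of
  \<open>w\<close> in \<open>St RA\<close>. \<open>germ_word_pres\<close> replaces \<open>u\<close>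
  by \<open>u' @ w\<close>, \<open>germ_word_conj\<close> turns the transport along \<open>w\<close>
  into a genuine conjugation, and naturality under this inner automorphism carries it outside of
  \<open>eta u'\<close>.\<close>

lemma act_cong:
  assumes pq: "eqv p q" and al: "\<alpha> \<in> \<Phi>" and xi: "\<xi> \<in> carrier K"
  shows "eqv (act \<alpha> \<xi> p) (act \<alpha> \<xi> q)"
proof -
  obtain u y where p: "p = (u, y)" "u \<in> A.wd SB" "y \<in> carrier (A.St RA)"
    using eqv_pairE eqv_valid(1)[OF pq] by blast
  obtain u' y' where q: "q = (u', y')" "u' \<in> A.wd SB" "y' \<in> carrier (A.St RA)"
    using eqv_pairE eqv_valid(2)[OF pq] by blast
  obtain w where w: "w \<in> A.wd RB" "A.cl SB u = A.cl SB (u' @ w)" "y' = A.cl RA w \<otimes>\<^bsub>A.St RA\<^esub> y"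
    using pq p(1) q(1) by (auto simp: eqv_def)
  note wS = wd_RB[OF w(1)]
  let ?W = "A.cl RA w"
  let ?f = "\<lambda>g. inv\<^bsub>A.St RA\<^esub> ?W \<otimes>\<^bsub>A.St RA\<^esub> g \<otimes>\<^bsub>A.St RA\<^esub> ?W"
  have Wc: "?W \<in> carrier (A.St RA)" using wS by simp
  have f: "?f \<in> hom (A.St RA) (A.St RA)"
    by (rule homI) (use Wc in \<open>auto simp: GA.group_simps\<close>)
  have RAf: "RA \<subseteq> A.fractions RA" by (rule A.R_fractions)
  have conj: "A.germ_equiv (A.St RA) RA (A.germ_word (A.St RA) RA w (A.root_elt RA)) (\<lambda>\<rho> a. ?f (A.root_elt RA \<rho> a))"
    by (rule A.germ_word_conj[OF A.R_nonunital_subring subset_refl RAf wS(1)])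
  have "A.germ_eq RA (\<lambda>\<rho> a. ?f (eta u' \<rho> a)) (A.germ_word (A.St RA) RA u' (A.germ_word (A.St RA) RA w (A.root_elt RA)))"
    unfolding eta_def
    by (rule A.germ_word_natural[OF GA.is_group GA.is_group f A.steinberg_level_axioms A.steinberg_level_axioms
          subset_refl germ_root_A _ _ wd_SB_frac[OF q(2)]])
      (use conj in \<open>auto simp: A.germ_equiv_def A.germ_eq_sym\<close>)
  then have e1: "A.germ_eq RA (\<lambda>\<rho> a. ?f (eta u' \<rho> a)) (eta (u' @ w))" by (simp add: eta_def)
  have "(u, u' @ w) \<in> A.pr SB" using w(2) p(2) q(2) wS by (simp add: cls_eq_iff)
  then have "A.germ_equiv (A.St RA) RA (eta u) (eta (u' @ w))"
    unfolding eta_def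
    by (rule A.germ_word_pres[OF GA.is_group B.fractions_nonunital_subring _ _ germ_root_A, rotated])
      (use SB_carrier frac_A_eq in blast)
  then have "A.germ_eq RA (eta u) (\<lambda>\<rho> a. ?f (eta u' \<rho> a))"
    using e1 A.germ_eq_trans A.germ_eq_sym unfolding A.germ_equiv_def by blast
  then obtain i where i: "\<And>\<rho> a. \<rho> \<in> \<Phi> \<Longrightarrow> a \<in> A.lev RA i \<Longrightarrow> eta u \<rho> a = ?f (eta u' \<rho> a)"
    by (auto simp: A.germ_eq_def)
  obtain j where j: "good u j" using exists_good[OF p(2)] by blast
  obtain k where k: "good u' k" using exists_good[OF q(2)] by blast
  define n where "n = i + j + k"
  have g: "good u n" "good u' n" using good_mono[OF j] good_mono[OF k] by (auto simp: n_def)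
  obtain b a where ba: "b \<in> SB" "a \<in> A.lev RA n" "\<xi> = b \<oplus> a" using decompose[OF xi] by blast
  have ai: "a \<in> A.lev RA i" using ba(2) A.lev_mono[of i n] by (auto simp: n_def)
  have ec: "eta u \<alpha> a \<in> carrier (A.St RA)" "eta u' \<alpha> a \<in> carrier (A.St RA)"
    using eta_closed g al ba(2) by blast+
  have 1: "A.cl SB (((\<alpha>, b), True) # u) = A.cl SB ((((\<alpha>, b), True) # u') @ w)"
    using p(2) q(2) wS al ba(1) w(2) cl_Cons[of \<alpha> b "u' @ w"] by (simp add: cl_Cons)
  have 2: "eta u' \<alpha> a \<otimes>\<^bsub>A.St RA\<^esub> y' = ?W \<otimes>\<^bsub>A.St RA\<^esub> (eta u \<alpha> a \<otimes>\<^bsub>A.St RA\<^esub> y)"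
    using i[OF al ai] ec Wc p(3) by (simp add: w(3) GA.group_simps)
  have "eqv (((\<alpha>, b), True) # u, eta u \<alpha> a \<otimes>\<^bsub>A.St RA\<^esub> y) (((\<alpha>, b), True) # u', eta u' \<alpha> a \<otimes>\<^bsub>A.St RA\<^esub> y')"
    by (rule eqvI[OF _ _ _ w(1) 1 2]) (use p q al ba ec in auto)
  then show ?thesis
    using act_eqv[OF g(1) p(2,3) al ba(1,2)] act_eqv[OF g(2) q(2,3) al ba(1,2)] eqv_trans eqv_sym
    unfolding p(1) q(1) ba(3) by blast
qed

lemma act_valid: "eqv p p \<Longrightarrow> \<alpha> \<in> \<Phi> \<Longrightarrow> \<xi> \<in> carrier K \<Longrightarrow> eqv (act \<alpha> \<xi> p) (act \<alpha> \<xi> p)"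
  by (rule act_cong)

lemma root_elt_SB_zero: "\<alpha> \<in> \<Phi> \<Longrightarrow> A.root_elt SB \<alpha> \<zero> = \<one>\<^bsub>A.St SB\<^esub>"
proof -
  assume al: "\<alpha> \<in> \<Phi>"
  interpret X: pstein_family \<Phi> N K "A.St SB" SB 0 "A.root_elt SB"
    using A.root_elt_stein[OF B.fractions_nonunital_subring] B.fractions_nonunital_subring GS.is_group
    by (simp add: pstein_family_def pstein_family_axioms_def A.steinberg_ring_axioms)
  show ?thesis using X.e_zero[of \<alpha>] al A.zero_notin by (simp add: X.e_root) blast
qed

lemma act_SB:
  assumes u: "u \<in> A.wd SB" and y: "y \<in> carrier (A.St RA)" and al: "\<alpha> \<in> \<Phi>" and b: "b \<in> SB"
  shows "eqv (act \<alpha> b (u, y)) (((\<alpha>, b), True) # u, y)"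
proof -
  obtain n where g: "good u n" using exists_good[OF u] by blast
  interpret Y: pstein_family \<Phi> N K "A.St RA" "A.lev RA n" 0 "eta u" by (rule good_family[OF g])
  have "eta u \<alpha> \<zero> = \<one>\<^bsub>A.St RA\<^esub>"
    using Y.e_zero[of \<alpha>] al A.zero_notin by (simp add: Y.e_root) blast
  moreover have "b \<oplus> \<zero> = b" using b SB_carrier by auto
  ultimately show ?thesis using act_eqv[OF g u y al b A.levD(3)] y by simp
qed

lemma act_lev:
  assumes g: "good u n" and u: "u \<in> A.wd SB" and y: "y \<in> carrier (A.St RA)" and al: "\<alpha> \<in> \<Phi>"
    and a: "a \<in> A.lev RA n"
  shows "eqv (act \<alpha> a (u, y)) (u, eta u \<alpha> a \<otimes>\<^bsub>A.St RA\<^esub> y)"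
proof -
  have z: "\<zero> \<in> SB" by (rule B.frD(3))
  have ec: "eta u \<alpha> a \<in> carrier (A.St RA)" by (rule eta_closed[OF g al a])
  have "A.cl SB (((\<alpha>, \<zero>), True) # u) = A.cl SB u"
    using u al z by (simp add: cl_Cons root_elt_SB_zero)
  then have 1: "eqv (((\<alpha>, \<zero>), True) # u, eta u \<alpha> a \<otimes>\<^bsub>A.St RA\<^esub> y) (u, eta u \<alpha> a \<otimes>\<^bsub>A.St RA\<^esub> y)"
    by (intro eqvI_same) (use u al z ec y in auto)
  have 2: "eqv (act \<alpha> (\<zero> \<oplus> a) (u, y)) (((\<alpha>, \<zero>), True) # u, eta u \<alpha> a \<otimes>\<^bsub>A.St RA\<^esub> y)"
    by (rule act_eqv[OF g u y al z a])
  have "\<zero> \<oplus> a = a" using a A.lev_closed by simp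
  then show ?thesis using eqv_trans[OF 2 1] by simp
qed

lemma act_zero:
  assumes "eqv p p" "\<alpha> \<in> \<Phi>"
  shows "eqv (act \<alpha> \<zero> p) p"
proof -
  obtain u y where p: "p = (u, y)" "u \<in> A.wd SB" "y \<in> carrier (A.St RA)" using eqv_pairE[OF assms(1)] .
  have z: "\<zero> \<in> SB" by (rule B.frD(3))
  have "A.cl SB (((\<alpha>, \<zero>), True) # u) = A.cl SB u"
    using p assms z by (simp add: cl_Cons root_elt_SB_zero)
  then have "eqv (((\<alpha>, \<zero>), True) # u, y) (u, y)" by (intro eqvI_same) (use p assms z in auto)
  then show ?thesis unfolding p(1) using act_SB[OF p(2,3) assms(2) z] eqv_trans by blast
qed

lemma eta_Cons:
  assumes u: "u \<in> A.wd SB" and be: "\<beta> \<in> \<Phi>" and b: "b \<in> SB"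
  shows "\<exists>n. \<forall>\<rho>\<in>\<Phi>. \<forall>a\<in>A.lev RA n. \<rho> \<noteq> - \<beta> \<longrightarrow>
    eta (((\<beta>, b), True) # u) \<rho> a = eta u \<rho> a \<otimes>\<^bsub>A.St RA\<^esub> A.ext (A.St RA) (eta u) (\<beta> + \<rho>) ([(A.N0 \<beta> \<rho>)] \<cdot> (\<ominus> b \<otimes> a))"
  using A.step_formula[OF eta_step[OF u be b]] unfolding A.twist_def by blast

lemma act_add:
  assumes p: "eqv p p" and al: "\<alpha> \<in> \<Phi>" and xi: "\<xi> \<in> carrier K" and ze: "\<zeta> \<in> carrier K"
  shows "eqv (act \<alpha> \<xi> (act \<alpha> \<zeta> p)) (act \<alpha> (\<xi> \<oplus> \<zeta>) p)"
proof -
  obtain u y where p: "p = (u, y)" "u \<in> A.wd SB" "y \<in> carrier (A.St RA)" using eqv_pairE[OF assms(1)] .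
  obtain n where g: "good u n" using exists_good[OF p(2)] by blast
  obtain b' a' where z: "b' \<in> SB" "a' \<in> A.lev RA n" "\<zeta> = b' \<oplus> a'" using decompose[OF ze] by blast
  let ?u = "((\<alpha>, b'), True) # u" and ?y = "eta u \<alpha> a' \<otimes>\<^bsub>A.St RA\<^esub> y"
  have u1: "?u \<in> A.wd SB" using p z al by simp
  obtain i where i: "\<forall>\<rho>\<in>\<Phi>. \<forall>a\<in>A.lev RA i. \<rho> \<noteq> - \<alpha> \<longrightarrow> eta ?u \<rho> a =
      eta u \<rho> a \<otimes>\<^bsub>A.St RA\<^esub> A.ext (A.St RA) (eta u) (\<alpha> + \<rho>) ([(A.N0 \<alpha> \<rho>)] \<cdot> (\<ominus> b' \<otimes> a))"
    using eta_Cons[OF p(2) al z(1)] by blast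
  obtain j where j: "good ?u j" using exists_good[OF u1] by blast
  define m where "m = n + i + j"
  have gm: "good u m" "good ?u m" using good_mono[OF g] good_mono[OF j] by (auto simp: m_def)
  interpret Y: pstein_family \<Phi> N K "A.St RA" "A.lev RA n" 0 "eta u" by (rule good_family[OF g])
  \<comment> \<open>Only now is \<xi> split: the level \<open>m\<close> has to be good for the word
    \<open>?u\<close>, which contains \<open>b'\<close>.\<close>
  obtain b a where x: "b \<in> SB" "a \<in> A.lev RA m" "\<xi> = b \<oplus> a" using decompose[OF xi] by blast
  have aa: "a \<in> A.lev RA n" "a \<in> A.lev RA i" using x(2) A.lev_mono[of n m] A.lev_mono[of i m] by (auto simp: m_def)
  have "\<alpha> + \<alpha> \<noteq> 0" using A.add_zero_iff[OF al al] A.pair_self[OF al] by simp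
  then have an: "\<alpha> \<noteq> 0" "\<alpha> \<noteq> - \<alpha>" using Groups.add_eq_0_iff[of \<alpha> \<alpha>] by auto
  \<comment> \<open>As 2 \<alpha> is not a root, a new letter at \<alpha> leaves the values of
    \<open>eta\<close> at \<alpha> unchanged.\<close>
  have "\<alpha> + \<alpha> \<notin> \<Phi>" using A.add_root_iff[OF al al] A.pair_self[OF al] by simp
  then have e: "eta ?u \<alpha> a = eta u \<alpha> a"
    using i al aa an Y.y_closed[OF al an(1) aa(1)] by (simp add: A.ext_def)
  have cl: "b \<in> carrier K" "a \<in> carrier K" "b' \<in> carrier K" "a' \<in> carrier K"
    using x z SB_carrier A.lev_closed by auto
  have bb: "b \<oplus> b' \<in> SB" using x z B.frD(5) by blast
  have ec: "eta u \<alpha> a \<in> carrier (A.St RA)" "eta u \<alpha> a' \<in> carrier (A.St RA)"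
    using Y.y_closed[OF al an(1)] aa z by auto
  have y1: "?y \<in> carrier (A.St RA)" using ec p by simp
  have "eqv (act \<alpha> \<zeta> p) (?u, ?y)" unfolding p(1) z(3) by (rule act_eqv[OF g p(2,3) al z(1,2)])
  then have "eqv (act \<alpha> \<xi> (act \<alpha> \<zeta> p)) (act \<alpha> \<xi> (?u, ?y))" by (rule act_cong[OF _ al xi])
  moreover have "eqv (act \<alpha> \<xi> (?u, ?y)) (((\<alpha>, b), True) # ?u, eta ?u \<alpha> a \<otimes>\<^bsub>A.St RA\<^esub> ?y)"
    unfolding x(3) by (rule act_eqv[OF gm(2) u1 y1 al x(1,2)])
  ultimately have 1: "eqv (act \<alpha> \<xi> (act \<alpha> \<zeta> p)) (((\<alpha>, b), True) # ?u, eta u \<alpha> a \<otimes>\<^bsub>A.St RA\<^esub> ?y)"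
    unfolding e by (rule eqv_trans)
  have s: "\<xi> \<oplus> \<zeta> = (b \<oplus> b') \<oplus> (a \<oplus> a')" unfolding x(3) z(3) using cl by (simp add: A.a_ac)
  have aI: "a \<oplus> a' \<in> A.lev RA n" using aa z A.levD(5) by blast
  have 2: "eqv (act \<alpha> (\<xi> \<oplus> \<zeta>) p) (((\<alpha>, b \<oplus> b'), True) # u, eta u \<alpha> (a \<oplus> a') \<otimes>\<^bsub>A.St RA\<^esub> y)"
    unfolding p(1) s by (rule act_eqv[OF g p(2,3) al bb aI])
  have 3: "eta u \<alpha> (a \<oplus> a') \<otimes>\<^bsub>A.St RA\<^esub> y = eta u \<alpha> a \<otimes>\<^bsub>A.St RA\<^esub> ?y"
    using Y.y_add[OF al an(1) aa(1) z(2)] ec p by (simp add: GA.m_assoc)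
  interpret X: pstein_family \<Phi> N K "A.St SB" SB 0 "A.root_elt SB"
    using A.root_elt_stein[OF B.fractions_nonunital_subring] B.fractions_nonunital_subring GS.is_group
    by (simp add: pstein_family_def pstein_family_axioms_def A.steinberg_ring_axioms)
  have "A.cl SB (((\<alpha>, b \<oplus> b'), True) # u) = A.cl SB (((\<alpha>, b), True) # ?u)"
    using X.y_add[OF al an(1) x(1) z(1)] al x z bb p u1 by (simp add: cl_Cons GS.m_assoc)
  then have "eqv (((\<alpha>, b), True) # ?u, eta u \<alpha> a \<otimes>\<^bsub>A.St RA\<^esub> ?y) (((\<alpha>, b \<oplus> b'), True) # u, eta u \<alpha> (a \<oplus> a') \<otimes>\<^bsub>A.St RA\<^esub> y)"
    unfolding 3 by (intro eqvI_same) (use u1 p al x bb ec in auto)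
  then show ?thesis using 1 2 eqv_trans eqv_sym by blast
qed

text \<open>The action of the commutator, with \<nu> for the product of the two parameters. Covering
  the case of a non-root, and being additive in \<nu>, it lets both kinds of commutator relations be
  treated at once.\<close>

definition comm_act :: "'v \<Rightarrow> 'v \<Rightarrow> 'k \<Rightarrow> ('v \<times> 'k) word \<times> ('v \<times> 'k) word set \<Rightarrow> ('v \<times> 'k) word \<times> ('v \<times> 'k) word set" where
  "comm_act \<alpha> \<beta> \<nu> p = (if \<alpha> + \<beta> \<in> \<Phi> then act (\<alpha> + \<beta>) ([(N \<alpha> \<beta>)] \<cdot> \<nu>) p else p)"

text \<open>The relation is stated at a single point, since how deep a parameter has to be depends
  on the point.\<close>

definition rel_at :: "'v \<Rightarrow> 'v \<Rightarrow> 'k \<Rightarrow> 'k \<Rightarrow> ('v \<times> 'k) word \<times> ('v \<times> 'k) word set \<Rightarrow> bool" where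
  "rel_at \<alpha> \<beta> \<xi> \<zeta> p \<longleftrightarrow> eqv (act \<alpha> \<xi> (act \<beta> \<zeta> p)) (comm_act \<alpha> \<beta> (\<xi> \<otimes> \<zeta>) (act \<beta> \<zeta> (act \<alpha> \<xi> p)))"

lemma comm_act_cong: "eqv p q \<Longrightarrow> \<nu> \<in> carrier K \<Longrightarrow> eqv (comm_act \<alpha> \<beta> \<nu> p) (comm_act \<alpha> \<beta> \<nu> q)"
  by (simp add: comm_act_def act_cong)

lemma comm_act_add:
  assumes "eqv p p" "\<nu> \<in> carrier K" "\<mu> \<in> carrier K"
  shows "eqv (comm_act \<alpha> \<beta> \<nu> (comm_act \<alpha> \<beta> \<mu> p)) (comm_act \<alpha> \<beta> (\<nu> \<oplus> \<mu>) p)"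
  using assms act_add by (simp add: comm_act_def A.add_pow_distrib)

lemma comm_act_swap:
  assumes "\<alpha> \<in> \<Phi>" "\<beta> \<in> \<Phi>" "\<nu> \<in> carrier K"
  shows "comm_act \<beta> \<alpha> \<nu> p = comm_act \<alpha> \<beta> (\<ominus> \<nu>) p"
proof (cases "\<alpha> + \<beta> \<in> \<Phi>")
  case True
  have "[(N \<beta> \<alpha>)] \<cdot> \<nu> = [(N \<alpha> \<beta>)] \<cdot> (\<ominus> \<nu>)"
  proof -
    have "\<ominus> \<nu> = [(- 1 :: int)] \<cdot> \<nu>" using assms(3) by (simp add: A.add_pow_minus)
    then show ?thesis using A.N_antisym[OF assms(1,2) True] assms(3) by (simp add: A.add_pow_add_pow)
  qed
  then show ?thesis using True by (simp add: comm_act_def add.commute)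
next
  case False
  then show ?thesis by (simp add: comm_act_def add.commute)
qed

lemma rel_SB:
  assumes r: "\<alpha> \<in> \<Phi>" "\<beta> \<in> \<Phi>" "\<alpha> + \<beta> \<noteq> 0" and b: "b \<in> SB" "b' \<in> SB" and p: "eqv p p"
  shows "rel_at \<alpha> \<beta> b b' p"
proof -
  obtain u y where p: "p = (u, y)" "u \<in> A.wd SB" "y \<in> carrier (A.St RA)" using eqv_pairE[OF p] .
  interpret X: pstein_family \<Phi> N K "A.St SB" SB 0 "A.root_elt SB"
    using A.root_elt_stein[OF B.fractions_nonunital_subring] B.fractions_nonunital_subring GS.is_group
    by (simp add: pstein_family_def pstein_family_axioms_def A.steinberg_ring_axioms)
  have bK: "b \<in> carrier K" "b' \<in> carrier K" using b SB_carrier by auto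
  have nz: "\<alpha> \<noteq> 0" "\<beta> \<noteq> 0" using r A.zero_notin by auto
  let ?ua = "((\<alpha>, b), True) # u" and ?ub = "((\<beta>, b'), True) # u"
  let ?c = "[(N \<alpha> \<beta>)] \<cdot> (b \<otimes> b')"
  have w: "?ua \<in> A.wd SB" "?ub \<in> A.wd SB" using p r b by auto
  then have w2: "((\<alpha>, b), True) # ?ub \<in> A.wd SB" "((\<beta>, b'), True) # ?ua \<in> A.wd SB" using r b by auto
  have c: "?c \<in> SB" using b B.frD(6,7) by blast
  have L: "eqv (act \<alpha> b (act \<beta> b' p)) (((\<alpha>, b), True) # ?ub, y)"
    unfolding p(1)
    by (rule eqv_trans[OF act_cong[OF act_SB[OF p(2,3) r(2) b(2)] r(1) bK(1)] act_SB[OF w(2) p(3) r(1) b(1)]])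
  have M: "eqv (act \<beta> b' (act \<alpha> b p)) (((\<beta>, b'), True) # ?ua, y)"
    unfolding p(1)
    by (rule eqv_trans[OF act_cong[OF act_SB[OF p(2,3) r(1) b(1)] r(2) bK(2)] act_SB[OF w(1) p(3) r(2) b(2)]])
  have cc: "A.root_elt SB \<alpha> b \<in> carrier (A.St SB)" "A.root_elt SB \<beta> b' \<in> carrier (A.St SB)" "A.cl SB u \<in> carrier (A.St SB)"
    using r b p by auto
  have cmt: "cmt (A.St SB) (A.root_elt SB \<alpha> b) (A.root_elt SB \<beta> b') = X.e (\<alpha> + \<beta>) ([(A.N0 \<alpha> \<beta>)] \<cdot> (b \<otimes> b'))"
    by (rule X.y_cmt[OF r(1) nz(1) r(2) nz(2) b r(3) r(3)])
  have "A.cl SB (((\<alpha>, b), True) # ?ub) = A.root_elt SB \<alpha> b \<otimes>\<^bsub>A.St SB\<^esub> A.root_elt SB \<beta> b' \<otimes>\<^bsub>A.St SB\<^esub> A.cl SB u"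
    using w w2 p r b cc by (simp add: cl_Cons GS.m_assoc)
  also have "\<dots> = X.e (\<alpha> + \<beta>) ([(A.N0 \<alpha> \<beta>)] \<cdot> (b \<otimes> b')) \<otimes>\<^bsub>A.St SB\<^esub> A.cl SB (((\<beta>, b'), True) # ?ua)"
  proof -
    have "X.e (\<alpha> + \<beta>) ([(A.N0 \<alpha> \<beta>)] \<cdot> (b \<otimes> b')) \<in> carrier (A.St SB)"
      unfolding cmt[symmetric] using cc by simp
    then show ?thesis
      using w w2 p r b cc by (simp add: GS.cmt_swap[OF cc(1,2)] cmt cl_Cons GS.m_assoc)
  qed
  finally have e: "A.cl SB (((\<alpha>, b), True) # ?ub) =
      X.e (\<alpha> + \<beta>) ([(A.N0 \<alpha> \<beta>)] \<cdot> (b \<otimes> b')) \<otimes>\<^bsub>A.St SB\<^esub> A.cl SB (((\<beta>, b'), True) # ?ua)" .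
  show ?thesis
  proof (cases "\<alpha> + \<beta> \<in> \<Phi>")
    case True
    have "A.cl SB (((\<alpha>, b), True) # ?ub) = A.cl SB (((\<alpha> + \<beta>, ?c), True) # ((\<beta>, b'), True) # ?ua)"
      unfolding e cl_Cons[OF True c w2(2)] using True r by (simp add: X.e_root A.N0_eq)
    then have E: "eqv (((\<alpha>, b), True) # ?ub, y) (((\<alpha> + \<beta>, ?c), True) # ((\<beta>, b'), True) # ?ua, y)"
      by (intro eqvI_same) (use w2 p True c in auto)
    have X: "eqv (act (\<alpha> + \<beta>) ?c (act \<beta> b' (act \<alpha> b p))) (((\<alpha> + \<beta>, ?c), True) # ((\<beta>, b'), True) # ?ua, y)"
      by (rule eqv_trans[OF act_cong[OF M True subsetD[OF SB_carrier c]] act_SB[OF w2(2) p(3) True c]])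
    show ?thesis
      unfolding rel_at_def comm_act_def if_P[OF True] by (rule eqv_trans[OF L eqv_trans[OF E eqv_sym[OF X]]])
  next
    case False
    then have "A.cl SB (((\<alpha>, b), True) # ?ub) = A.cl SB (((\<beta>, b'), True) # ?ua)"
      unfolding e using w2 by (simp add: X.e_nonroot)
    then have E: "eqv (((\<alpha>, b), True) # ?ub, y) (((\<beta>, b'), True) # ?ua, y)"
      by (intro eqvI_same) (use w2 p in auto)
    show ?thesis
      unfolding rel_at_def comm_act_def if_not_P[OF False] by (rule eqv_trans[OF L eqv_trans[OF E eqv_sym[OF M]]])
  qed
qed

text \<open>Deep parameters keep the word \<open>u\<close> and multiply the second component by
  values of \<open>eta u\<close>, so the relation is the one of this Steinberg family. The level
  depends on \<open>u\<close>, but not on \<open>y\<close>.\<close>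

lemma rel_lev:
  assumes r: "\<alpha> \<in> \<Phi>" "\<beta> \<in> \<Phi>" "\<alpha> + \<beta> \<noteq> 0" and u: "u \<in> A.wd SB"
  shows "\<exists>n. \<forall>a\<in>A.lev RA n. \<forall>a'\<in>A.lev RA n. \<forall>y\<in>carrier (A.St RA). rel_at \<alpha> \<beta> a a' (u, y)"
proof -
  obtain n where g: "good u n" using exists_good[OF u] by blast
  interpret Y: pstein_family \<Phi> N K "A.St RA" "A.lev RA n" 0 "eta u" by (rule good_family[OF g])
  have nz: "\<alpha> \<noteq> 0" "\<beta> \<noteq> 0" using r A.zero_notin by auto
  have "rel_at \<alpha> \<beta> a a' (u, y)" if a: "a \<in> A.lev RA n" "a' \<in> A.lev RA n" and y: "y \<in> carrier (A.St RA)" for a a' y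
  proof -
    let ?x = "eta u \<alpha> a" and ?z = "eta u \<beta> a'" and ?c = "[(N \<alpha> \<beta>)] \<cdot> (a \<otimes> a')"
    have cc: "?x \<in> carrier (A.St RA)" "?z \<in> carrier (A.St RA)" using eta_closed g r a by blast+
    have aK: "a \<in> carrier K" "a' \<in> carrier K" using a A.lev_closed by auto
    have c: "?c \<in> A.lev RA n" using a Y.ID(6,7) by blast
    have cmt: "cmt (A.St RA) ?x ?z = Y.e (\<alpha> + \<beta>) ([(A.N0 \<alpha> \<beta>)] \<cdot> (a \<otimes> a'))"
      by (rule Y.y_cmt[OF r(1) nz(1) r(2) nz(2) a r(3) r(3)])
    have L: "eqv (act \<alpha> a (act \<beta> a' (u, y))) (u, ?x \<otimes>\<^bsub>A.St RA\<^esub> (?z \<otimes>\<^bsub>A.St RA\<^esub> y))"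
      by (rule eqv_trans[OF act_cong[OF act_lev[OF g u y r(2) a(2)] r(1) aK(1)] act_lev[OF g u GA.m_closed[OF cc(2) y] r(1) a(1)]])
    have M: "eqv (act \<beta> a' (act \<alpha> a (u, y))) (u, ?z \<otimes>\<^bsub>A.St RA\<^esub> (?x \<otimes>\<^bsub>A.St RA\<^esub> y))"
      by (rule eqv_trans[OF act_cong[OF act_lev[OF g u y r(1) a(1)] r(2) aK(2)] act_lev[OF g u GA.m_closed[OF cc(1) y] r(2) a(2)]])
    have e: "?x \<otimes>\<^bsub>A.St RA\<^esub> (?z \<otimes>\<^bsub>A.St RA\<^esub> y) = Y.e (\<alpha> + \<beta>) ([(A.N0 \<alpha> \<beta>)] \<cdot> (a \<otimes> a')) \<otimes>\<^bsub>A.St RA\<^esub> (?z \<otimes>\<^bsub>A.St RA\<^esub> (?x \<otimes>\<^bsub>A.St RA\<^esub> y))"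
    proof -
      have "?x \<otimes>\<^bsub>A.St RA\<^esub> ?z \<otimes>\<^bsub>A.St RA\<^esub> y = cmt (A.St RA) ?x ?z \<otimes>\<^bsub>A.St RA\<^esub> (?z \<otimes>\<^bsub>A.St RA\<^esub> ?x) \<otimes>\<^bsub>A.St RA\<^esub> y"
        using GA.cmt_swap[OF cc] by (rule arg_cong)
      then show ?thesis using cc y GA.cmt_closed[OF cc] unfolding cmt by (simp add: GA.m_assoc)
    qed
    show ?thesis
    proof (cases "\<alpha> + \<beta> \<in> \<Phi>")
      case True
      have "eqv (act (\<alpha> + \<beta>) ?c (act \<beta> a' (act \<alpha> a (u, y))))
          (u, eta u (\<alpha> + \<beta>) ?c \<otimes>\<^bsub>A.St RA\<^esub> (?z \<otimes>\<^bsub>A.St RA\<^esub> (?x \<otimes>\<^bsub>A.St RA\<^esub> y)))"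
        by (rule eqv_trans[OF act_cong[OF M True A.lev_closed[OF c]]
              act_lev[OF g u GA.m_closed[OF cc(2) GA.m_closed[OF cc(1) y]] True c]])
      moreover have "eta u (\<alpha> + \<beta>) ?c = Y.e (\<alpha> + \<beta>) ([(A.N0 \<alpha> \<beta>)] \<cdot> (a \<otimes> a'))"
        using True r by (simp add: Y.e_root A.N0_eq)
      ultimately have F: "eqv (act (\<alpha> + \<beta>) ?c (act \<beta> a' (act \<alpha> a (u, y))))
          (u, ?x \<otimes>\<^bsub>A.St RA\<^esub> (?z \<otimes>\<^bsub>A.St RA\<^esub> y))" by (simp only: e)
      show ?thesis
        unfolding rel_at_def comm_act_def if_P[OF True] by (rule eqv_trans[OF L eqv_sym[OF F]])
    next
      case False
      then have e': "?x \<otimes>\<^bsub>A.St RA\<^esub> (?z \<otimes>\<^bsub>A.St RA\<^esub> y) = ?z \<otimes>\<^bsub>A.St RA\<^esub> (?x \<otimes>\<^bsub>A.St RA\<^esub> y)"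
        using e cc y by (simp add: Y.e_nonroot)
      show ?thesis
        unfolding rel_at_def comm_act_def if_not_P[OF False] by (rule eqv_trans[OF L[unfolded e'] eqv_sym[OF M]])
    qed
  qed
  then show ?thesis by blast
qed

text \<open>When \<open>x \<beta> b\<close> has been applied first, \<open>x \<alpha> a\<close> acts
  through \<open>eta\<close> of the longer word \<open>?u\<close>. By the formula for a step this
  value is the one of \<open>eta u\<close> times a factor at \<alpha> + \<beta>, which is the
  commutator. The extra exponent \<open>l\<close> keeps the parameter \<open>a b\<close>
  deep.\<close>

lemma rel_mixed:
  assumes r: "\<alpha> \<in> \<Phi>" "\<beta> \<in> \<Phi>" "\<alpha> + \<beta> \<noteq> 0" and u: "u \<in> A.wd SB" and b: "b \<in> SB"
  shows "\<exists>n. \<forall>a\<in>A.lev RA n. \<forall>y\<in>carrier (A.St RA). rel_at \<alpha> \<beta> a b (u, y)"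
proof -
  let ?u = "((\<beta>, b), True) # u"
  have u1: "?u \<in> A.wd SB" using u r b by simp
  obtain i where i: "\<forall>\<rho>\<in>\<Phi>. \<forall>a\<in>A.lev RA i. \<rho> \<noteq> - \<beta> \<longrightarrow> eta ?u \<rho> a =
      eta u \<rho> a \<otimes>\<^bsub>A.St RA\<^esub> A.ext (A.St RA) (eta u) (\<beta> + \<rho>) ([(A.N0 \<beta> \<rho>)] \<cdot> (\<ominus> b \<otimes> a))"
    using eta_Cons[OF u r(2) b] by blast
  obtain j where j: "good u j" using exists_good[OF u] by blast
  obtain k where k: "good ?u k" using exists_good[OF u1] by blast
  have bK: "b \<in> carrier K" and bf: "b \<in> A.fractions RA" using b SB_carrier frac_A_eq by auto
  obtain l where l: "\<forall>n. \<forall>a\<in>A.lev RA (n + l). b \<otimes> a \<in> A.lev RA n" using A.fractions_lev[OF bf] by blast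
  define m where "m = i + j + k"
  have g: "good u m" "good ?u m" using good_mono[OF j] good_mono[OF k] by (auto simp: m_def)
  interpret Y: pstein_family \<Phi> N K "A.St RA" "A.lev RA m" 0 "eta u" by (rule good_family[OF g(1)])
  have nz: "\<alpha> \<noteq> 0" "\<beta> \<noteq> 0" "\<alpha> \<noteq> - \<beta>" using r A.zero_notin by auto
  have "rel_at \<alpha> \<beta> a b (u, y)" if a: "a \<in> A.lev RA (m + l)" and y: "y \<in> carrier (A.St RA)" for a y
  proof -
    have am: "a \<in> A.lev RA m" "a \<in> A.lev RA i" "b \<otimes> a \<in> A.lev RA m"
      using a l A.lev_mono[of m "m + l"] A.lev_mono[of i "m + l"] by (auto simp: m_def)
    have aK: "a \<in> carrier K" using a A.lev_closed by blast
    let ?x = "eta u \<alpha> a" and ?c = "[(A.N0 \<alpha> \<beta>)] \<cdot> (a \<otimes> b)"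
    have ab: "a \<otimes> b \<in> A.lev RA m" using am(3) aK bK by (simp add: A.m_comm)
    have c: "?c \<in> A.lev RA m" by (rule A.lev_add_pow[OF ab])
    have ci: "?c \<in> A.lev RA i" using c A.lev_mono[of i m] by (auto simp: m_def)
    have cc: "?x \<in> carrier (A.St RA)" by (rule eta_closed[OF g(1) r(1) am(1)])
    have ec: "Y.e (\<alpha> + \<beta>) ?c \<in> carrier (A.St RA)" using r c by simp
    have "\<ominus> b \<otimes> a = [(- 1 :: int)] \<cdot> (a \<otimes> b)"
      using aK bK by (simp add: A.add_pow_minus A.l_minus A.r_minus A.m_comm)
    then have "[(A.N0 \<beta> \<alpha>)] \<cdot> (\<ominus> b \<otimes> a) = ?c"
      using aK bK by (simp add: A.N0_antisym[of \<beta> \<alpha>] A.add_pow_add_pow)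
    then have x1: "eta ?u \<alpha> a = ?x \<otimes>\<^bsub>A.St RA\<^esub> Y.e (\<alpha> + \<beta>) ?c"
      using i[rule_format, OF r(1) am(2) nz(3)] by (simp add: add.commute[of \<beta> \<alpha>])
    have com: "?x \<otimes>\<^bsub>A.St RA\<^esub> Y.e (\<alpha> + \<beta>) ?c = Y.e (\<alpha> + \<beta>) ?c \<otimes>\<^bsub>A.St RA\<^esub> ?x"
    proof -
      have "Y.e \<alpha> a \<otimes>\<^bsub>A.St RA\<^esub> Y.e (\<alpha> + \<beta>) ?c = Y.e (\<alpha> + \<beta>) ?c \<otimes>\<^bsub>A.St RA\<^esub> Y.e \<alpha> a"
      proof (rule Y.e_commute)
        assume "\<alpha> + \<beta> \<in> \<Phi>"
        then have "A.pair \<alpha> \<beta> = -1" using A.add_root_iff[OF r(1,2)] by blast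
        then show "A.pair \<alpha> (\<alpha> + \<beta>) \<ge> 0" using r by (simp add: A.pair_simps A.pair_self)
      qed (use nz r am c in auto)
      then show ?thesis using r by (simp add: Y.e_root)
    qed
    have y1: "?x \<otimes>\<^bsub>A.St RA\<^esub> y \<in> carrier (A.St RA)" using cc y by simp
    have x3: "eta ?u \<alpha> a \<otimes>\<^bsub>A.St RA\<^esub> y = Y.e (\<alpha> + \<beta>) ?c \<otimes>\<^bsub>A.St RA\<^esub> (?x \<otimes>\<^bsub>A.St RA\<^esub> y)"
      unfolding x1 com by (rule GA.m_assoc[OF ec cc y])
    have L: "eqv (act \<alpha> a (act \<beta> b (u, y))) (?u, Y.e (\<alpha> + \<beta>) ?c \<otimes>\<^bsub>A.St RA\<^esub> (?x \<otimes>\<^bsub>A.St RA\<^esub> y))"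
      unfolding x3[symmetric]
      by (rule eqv_trans[OF act_cong[OF act_SB[OF u y r(2) b] r(1) aK] act_lev[OF g(2) u1 y r(1) am(1)]])
    have M: "eqv (act \<beta> b (act \<alpha> a (u, y))) (?u, ?x \<otimes>\<^bsub>A.St RA\<^esub> y)"
      by (rule eqv_trans[OF act_cong[OF act_lev[OF g(1) u y r(1) am(1)] r(2) bK] act_SB[OF u y1 r(2) b]])
    show ?thesis
    proof (cases "\<alpha> + \<beta> \<in> \<Phi>")
      case True
      \<comment> \<open>Since \<alpha> + 2 \<beta> is neither a root nor zero, the letter at \<beta>
        does not affect the values of \<open>eta\<close> at \<alpha> + \<beta>.\<close>
      have p1: "A.pair \<beta> (\<alpha> + \<beta>) = 1"
        using True A.add_root_iff[OF r(1,2)] r by (simp add: A.pair_simps A.pair_self A.pair_commute[of \<beta> \<alpha>])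
      have z: "\<beta> + (\<alpha> + \<beta>) \<noteq> 0" using A.add_zero_iff[OF r(2) True] p1 by simp
      have "\<beta> + (\<alpha> + \<beta>) \<notin> \<Phi>" using A.add_root_iff[OF r(2) True] p1 by simp
      then have "A.N0 \<beta> (\<alpha> + \<beta>) = 0" using A.N0_zero by blast
      moreover have "\<alpha> + \<beta> \<noteq> - \<beta>" using z Groups.add_eq_0_iff[of \<beta> "\<alpha> + \<beta>"] by blast
      ultimately have x2: "eta ?u (\<alpha> + \<beta>) ?c = Y.e (\<alpha> + \<beta>) ?c"
        using i[rule_format, OF True ci] z ec True by (simp add: Y.e_zero Y.e_root)
      have F: "eqv (act (\<alpha> + \<beta>) ?c (act \<beta> b (act \<alpha> a (u, y))))
          (?u, Y.e (\<alpha> + \<beta>) ?c \<otimes>\<^bsub>A.St RA\<^esub> (?x \<otimes>\<^bsub>A.St RA\<^esub> y))"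
        unfolding x2[symmetric]
        by (rule eqv_trans[OF act_cong[OF M True A.lev_closed[OF c]] act_lev[OF g(2) u1 y1 True c]])
      show ?thesis
        unfolding rel_at_def comm_act_def if_P[OF True] A.N0_eq[OF r(1,2) True, symmetric]
        by (rule eqv_trans[OF L eqv_sym[OF F]])
    next
      case False
      then have L': "eqv (act \<alpha> a (act \<beta> b (u, y))) (?u, ?x \<otimes>\<^bsub>A.St RA\<^esub> y)"
        using L y1 by (simp add: Y.e_nonroot)
      show ?thesis
        unfolding rel_at_def comm_act_def if_not_P[OF False] by (rule eqv_trans[OF L' eqv_sym[OF M]])
    qed
  qed
  then show ?thesis by blast
qed

end

section \<open>Commutators of arbitrary parameters, and the orbit of the base point\<close>

context gluing
begin

lemma act_split:
  assumes "eqv p p" "\<alpha> \<in> \<Phi>" "b \<in> carrier K" "a \<in> carrier K" "\<xi> = b \<oplus> a"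
  shows "eqv (act \<alpha> \<xi> p) (act \<alpha> b (act \<alpha> a p))"
  unfolding assms(5) by (rule eqv_sym[OF act_add[OF assms(1-4)]])

text \<open>Commutators are additive in the first entry if they commute with the elements at
  \<alpha>. The relation for \<open>a\<close> is used at \<open>p\<close>, but the one for
  \<open>b\<close> at the point to which \<open>x \<alpha> a\<close> has moved \<open>p\<close>; so
  it is assumed everywhere.\<close>

lemma rel_add_left:
  assumes r: "\<alpha> \<in> \<Phi>" "\<beta> \<in> \<Phi>" and c: "b \<in> carrier K" "a \<in> carrier K" "\<zeta> \<in> carrier K" and p: "eqv p p"
    and central: "\<And>\<xi> \<nu> p. \<lbrakk>\<xi> \<in> carrier K; \<nu> \<in> carrier K; eqv p p\<rbrakk> \<Longrightarrow>
      eqv (act \<alpha> \<xi> (comm_act \<alpha> \<beta> \<nu> p)) (comm_act \<alpha> \<beta> \<nu> (act \<alpha> \<xi> p))"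
    and ra: "rel_at \<alpha> \<beta> a \<zeta> p" and rb: "\<And>q. eqv q q \<Longrightarrow> rel_at \<alpha> \<beta> b \<zeta> q"
  shows "rel_at \<alpha> \<beta> (b \<oplus> a) \<zeta> p"
proof -
  note v = act_valid
  have ap: "eqv (act \<alpha> a p) (act \<alpha> a p)" by (rule v[OF p r(1) c(2)])
  have zp: "eqv (act \<beta> \<zeta> p) (act \<beta> \<zeta> p)" by (rule v[OF p r(2) c(3)])
  have zap: "eqv (act \<beta> \<zeta> (act \<alpha> a p)) (act \<beta> \<zeta> (act \<alpha> a p))" by (rule v[OF ap r(2) c(3)])
  have az: "a \<otimes> \<zeta> \<in> carrier K" and bz: "b \<otimes> \<zeta> \<in> carrier K" using c by auto
  have ba: "b \<oplus> a \<in> carrier K" using c by simp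
  have 1: "eqv (act \<alpha> (b \<oplus> a) (act \<beta> \<zeta> p)) (act \<alpha> b (act \<alpha> a (act \<beta> \<zeta> p)))"
    by (rule act_split[OF zp r(1) c(1,2) HOL.refl])
  have 2: "eqv (act \<alpha> b (act \<alpha> a (act \<beta> \<zeta> p))) (act \<alpha> b (comm_act \<alpha> \<beta> (a \<otimes> \<zeta>) (act \<beta> \<zeta> (act \<alpha> a p))))"
    using ra unfolding rel_at_def by (rule act_cong[OF _ r(1) c(1)])
  have 3: "eqv (act \<alpha> b (comm_act \<alpha> \<beta> (a \<otimes> \<zeta>) (act \<beta> \<zeta> (act \<alpha> a p))))
      (comm_act \<alpha> \<beta> (a \<otimes> \<zeta>) (act \<alpha> b (act \<beta> \<zeta> (act \<alpha> a p))))"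
    by (rule central[OF c(1) az zap])
  have 4: "eqv (comm_act \<alpha> \<beta> (a \<otimes> \<zeta>) (act \<alpha> b (act \<beta> \<zeta> (act \<alpha> a p))))
      (comm_act \<alpha> \<beta> (a \<otimes> \<zeta>) (comm_act \<alpha> \<beta> (b \<otimes> \<zeta>) (act \<beta> \<zeta> (act \<alpha> b (act \<alpha> a p)))))"
    using rb[OF ap] unfolding rel_at_def by (rule comm_act_cong[OF _ az])
  have bap: "eqv (act \<alpha> b (act \<alpha> a p)) (act \<alpha> (b \<oplus> a) p)" by (rule act_add[OF p r(1) c(1,2)])
  have z5: "eqv (act \<beta> \<zeta> (act \<alpha> b (act \<alpha> a p))) (act \<beta> \<zeta> (act \<alpha> (b \<oplus> a) p))" by (rule act_cong[OF bap r(2) c(3)])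
  have 5: "eqv (comm_act \<alpha> \<beta> (a \<otimes> \<zeta>) (comm_act \<alpha> \<beta> (b \<otimes> \<zeta>) (act \<beta> \<zeta> (act \<alpha> b (act \<alpha> a p)))))
      (comm_act \<alpha> \<beta> (a \<otimes> \<zeta>) (comm_act \<alpha> \<beta> (b \<otimes> \<zeta>) (act \<beta> \<zeta> (act \<alpha> (b \<oplus> a) p))))"
    by (rule comm_act_cong[OF comm_act_cong[OF z5 bz] az])
  have 6: "eqv (comm_act \<alpha> \<beta> (a \<otimes> \<zeta>) (comm_act \<alpha> \<beta> (b \<otimes> \<zeta>) (act \<beta> \<zeta> (act \<alpha> (b \<oplus> a) p))))
      (comm_act \<alpha> \<beta> (a \<otimes> \<zeta> \<oplus> b \<otimes> \<zeta>) (act \<beta> \<zeta> (act \<alpha> (b \<oplus> a) p)))"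
    by (rule comm_act_add[OF eqv_valid(2)[OF z5] az bz])
  have "a \<otimes> \<zeta> \<oplus> b \<otimes> \<zeta> = (b \<oplus> a) \<otimes> \<zeta>" using c by (simp add: A.l_distr A.a_comm)
  then show ?thesis
    unfolding rel_at_def using eqv_trans[OF 1 eqv_trans[OF 2 eqv_trans[OF 3 eqv_trans[OF 4 eqv_trans[OF 5 6]]]]] by simp
qed

text \<open>The two relations express inverse commutators; by additivity of \<open>comm_act\<close>
  these cancel on the left of the other relation.\<close>

lemma rel_swap:
  assumes r: "\<alpha> \<in> \<Phi>" "\<beta> \<in> \<Phi>" and c: "\<xi> \<in> carrier K" "\<zeta> \<in> carrier K" and p: "eqv p p"
    and rel: "rel_at \<beta> \<alpha> \<zeta> \<xi> p"
  shows "rel_at \<alpha> \<beta> \<xi> \<zeta> p"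
proof -
  have xz: "\<xi> \<otimes> \<zeta> \<in> carrier K" using c by simp
  have q: "eqv (act \<alpha> \<xi> (act \<beta> \<zeta> p)) (act \<alpha> \<xi> (act \<beta> \<zeta> p))"
    by (rule act_valid[OF act_valid[OF p r(2) c(2)] r(1) c(1)])
  have "eqv (act \<beta> \<zeta> (act \<alpha> \<xi> p)) (comm_act \<alpha> \<beta> (\<ominus> (\<xi> \<otimes> \<zeta>)) (act \<alpha> \<xi> (act \<beta> \<zeta> p)))"
    using rel comm_act_swap[OF r, of "\<zeta> \<otimes> \<xi>"] c unfolding rel_at_def by (simp add: A.m_comm)
  then have "eqv (comm_act \<alpha> \<beta> (\<xi> \<otimes> \<zeta>) (act \<beta> \<zeta> (act \<alpha> \<xi> p)))
      (comm_act \<alpha> \<beta> (\<xi> \<otimes> \<zeta>) (comm_act \<alpha> \<beta> (\<ominus> (\<xi> \<otimes> \<zeta>)) (act \<alpha> \<xi> (act \<beta> \<zeta> p))))"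
    by (rule comm_act_cong[OF _ xz])
  moreover have "eqv (comm_act \<alpha> \<beta> (\<xi> \<otimes> \<zeta>) (comm_act \<alpha> \<beta> (\<ominus> (\<xi> \<otimes> \<zeta>)) (act \<alpha> \<xi> (act \<beta> \<zeta> p))))
      (comm_act \<alpha> \<beta> (\<xi> \<otimes> \<zeta> \<oplus> \<ominus> (\<xi> \<otimes> \<zeta>)) (act \<alpha> \<xi> (act \<beta> \<zeta> p)))"
    by (rule comm_act_add[OF q xz]) (use xz in simp)
  moreover have "\<xi> \<otimes> \<zeta> \<oplus> \<ominus> (\<xi> \<otimes> \<zeta>) = \<zero>" using xz by (simp add: A.r_neg)
  moreover have "eqv (comm_act \<alpha> \<beta> \<zero> (act \<alpha> \<xi> (act \<beta> \<zeta> p))) (act \<alpha> \<xi> (act \<beta> \<zeta> p))"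
    using act_zero[OF q] q by (simp add: comm_act_def)
  ultimately show ?thesis unfolding rel_at_def using eqv_trans eqv_sym by metis
qed

text \<open>Here \<open>b\<close> is fixed before \<xi> is split, so \<open>rel_mixed\<close>
  provides a level for the \<open>RA\<close>-part of \<xi>, and \<open>rel_SB\<close> treats the
  rest.\<close>

lemma rel_frac_left:
  assumes r: "\<alpha> \<in> \<Phi>" "\<beta> \<in> \<Phi>" "\<alpha> + \<beta> \<noteq> 0" and xi: "\<xi> \<in> carrier K" and b: "b \<in> SB" and p: "eqv p p"
    and central: "\<And>\<xi> \<nu> p. \<lbrakk>\<xi> \<in> carrier K; \<nu> \<in> carrier K; eqv p p\<rbrakk> \<Longrightarrow>
      eqv (act \<alpha> \<xi> (comm_act \<alpha> \<beta> \<nu> p)) (comm_act \<alpha> \<beta> \<nu> (act \<alpha> \<xi> p))"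
  shows "rel_at \<alpha> \<beta> \<xi> b p"
proof -
  obtain u y where uy: "p = (u, y)" "u \<in> A.wd SB" "y \<in> carrier (A.St RA)" using eqv_pairE[OF p] .
  obtain n where n: "\<forall>a\<in>A.lev RA n. \<forall>y\<in>carrier (A.St RA). rel_at \<alpha> \<beta> a b (u, y)"
    using rel_mixed[OF r uy(2) b] by blast
  obtain b' a where x: "b' \<in> SB" "a \<in> A.lev RA n" "\<xi> = b' \<oplus> a" using decompose[OF xi] by blast
  have bK: "b' \<in> carrier K" "b \<in> carrier K" using x(1) b SB_carrier by auto
  have ra: "rel_at \<alpha> \<beta> a b p" unfolding uy(1) using n x(2) uy(3) by blast
  show ?thesis
    unfolding x(3)
    by (rule rel_add_left[OF r(1,2) bK(1) A.lev_closed[OF x(2)] bK(2) p central ra])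
      (auto intro: rel_SB[OF r x(1) b])
qed

text \<open>
  The order of the reductions matters: the depth needed for the \<open>RA\<close>-part of one parameter
  depends on the \<open>SB\<close>-part of the other one, so both parameters cannot be split at once.
\<close>

lemma rel_all:
  assumes r: "\<alpha> \<in> \<Phi>" "\<beta> \<in> \<Phi>" "\<alpha> + \<beta> \<noteq> 0" and xi: "\<xi> \<in> carrier K" and ze: "\<zeta> \<in> carrier K" and p: "eqv p p"
    and central: "\<And>\<xi> \<nu> p. \<lbrakk>\<xi> \<in> carrier K; \<nu> \<in> carrier K; eqv p p\<rbrakk> \<Longrightarrow>
      eqv (act \<alpha> \<xi> (comm_act \<alpha> \<beta> \<nu> p)) (comm_act \<alpha> \<beta> \<nu> (act \<alpha> \<xi> p))"
    and central': "\<And>\<xi> \<nu> p. \<lbrakk>\<xi> \<in> carrier K; \<nu> \<in> carrier K; eqv p p\<rbrakk> \<Longrightarrow>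
      eqv (act \<beta> \<xi> (comm_act \<alpha> \<beta> \<nu> p)) (comm_act \<alpha> \<beta> \<nu> (act \<beta> \<xi> p))"
  shows "rel_at \<alpha> \<beta> \<xi> \<zeta> p"
proof -
  have r': "\<beta> + \<alpha> \<noteq> 0" using r(3) by (simp add: add.commute)
  have c2: "eqv (act \<beta> \<xi> (comm_act \<beta> \<alpha> \<nu> p)) (comm_act \<beta> \<alpha> \<nu> (act \<beta> \<xi> p))"
    if "\<xi> \<in> carrier K" "\<nu> \<in> carrier K" "eqv p p" for \<xi> \<nu> p
    unfolding comm_act_swap[OF r(1,2) that(2)] by (rule central') (use that in auto)
  have right: "rel_at \<alpha> \<beta> b \<zeta> q" if b: "b \<in> SB" and ze: "\<zeta> \<in> carrier K" and q: "eqv q q" for b \<zeta> q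
    using rel_swap[OF r(1,2) _ ze q rel_frac_left[OF r(2,1) r' ze b q c2]] b SB_carrier by blast
  obtain u y where uy: "p = (u, y)" "u \<in> A.wd SB" "y \<in> carrier (A.St RA)" using eqv_pairE[OF p] .
  obtain n where n: "\<forall>a\<in>A.lev RA n. \<forall>a'\<in>A.lev RA n. \<forall>y\<in>carrier (A.St RA). rel_at \<alpha> \<beta> a a' (u, y)"
    using rel_lev[OF r uy(2)] by blast
  obtain b a where x: "b \<in> SB" "a \<in> A.lev RA n" "\<xi> = b \<oplus> a" using decompose[OF xi] by blast
  obtain b' a' where z: "b' \<in> SB" "a' \<in> A.lev RA n" "\<zeta> = b' \<oplus> a'" using decompose[OF ze] by blast
  have cl: "b \<in> carrier K" "b' \<in> carrier K" "a \<in> carrier K" "a' \<in> carrier K"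
    using x z SB_carrier A.lev_closed by blast+
  have aa: "rel_at \<alpha> \<beta> a a' p" unfolding uy(1) using n x(2) z(2) uy(3) by blast
  \<comment> \<open>The relation holds for the deep parts \<open>a\<close> and \<open>a'\<close> by
    \<open>rel_lev\<close>. Each of the two remaining parts is then added while the other parameter
    is kept, which only takes an element of \<open>SB\<close> against an arbitrary
    parameter.\<close>
  have 1: "rel_at \<alpha> \<beta> \<xi> a' p"
    unfolding x(3) by (rule rel_add_left[OF r(1,2) cl(1,3,4) p central aa]) (auto intro: right[OF x(1) cl(4)])
  have sw: "rel_at \<beta> \<alpha> a' \<xi> p" by (rule rel_swap[OF r(2,1) cl(4) xi p 1])
  have "rel_at \<beta> \<alpha> \<zeta> \<xi> p"
    unfolding z(3)
  proof (rule rel_add_left[OF r(2,1) cl(2,4) xi p c2 sw])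
    fix q assume q: "eqv q q"
    show "rel_at \<beta> \<alpha> b' \<xi> q"
      by (rule rel_swap[OF r(2,1) cl(2) xi q rel_frac_left[OF r xi z(1) q central]])
  qed auto
  then show ?thesis by (rule rel_swap[OF r(1,2) xi ze p])
qed

text \<open>For a non-root \<alpha> + \<beta> the operator \<open>comm_act\<close> is the identity,
  so that the centrality assumptions of \<open>rel_all\<close> are trivial. This case has to come
  first.\<close>

lemma act_commute:
  assumes r: "\<alpha> \<in> \<Phi>" "\<beta> \<in> \<Phi>" "\<alpha> + \<beta> \<notin> \<Phi> \<union> {0}" and c: "\<xi> \<in> carrier K" "\<zeta> \<in> carrier K" and p: "eqv p p"
  shows "eqv (act \<alpha> \<xi> (act \<beta> \<zeta> p)) (act \<beta> \<zeta> (act \<alpha> \<xi> p))"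
proof -
  have n: "\<alpha> + \<beta> \<notin> \<Phi>" "\<alpha> + \<beta> \<noteq> 0" using r(3) by auto
  have "rel_at \<alpha> \<beta> \<xi> \<zeta> p"
    by (rule rel_all[OF r(1,2) n(2) c p]) (use n r act_valid in \<open>auto simp: comm_act_def\<close>)
  then show ?thesis using n by (simp add: rel_at_def comm_act_def)
qed

text \<open>Neither 2 \<alpha> + \<beta> nor \<alpha> + 2 \<beta> is a root or zero; so
  \<open>act_commute\<close> provides the centrality that \<open>rel_all\<close> asks for.\<close>

lemma act_commutator:
  assumes r: "\<alpha> \<in> \<Phi>" "\<beta> \<in> \<Phi>" "\<alpha> + \<beta> \<in> \<Phi>" and c: "\<xi> \<in> carrier K" "\<zeta> \<in> carrier K" and p: "eqv p p"
  shows "eqv (act \<alpha> \<xi> (act \<beta> \<zeta> p)) (act (\<alpha> + \<beta>) ([(N \<alpha> \<beta>)] \<cdot> (\<xi> \<otimes> \<zeta>)) (act \<beta> \<zeta> (act \<alpha> \<xi> p)))"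
proof -
  have nz: "\<alpha> + \<beta> \<noteq> 0" using r A.zero_notin by metis
  have pab: "A.pair \<alpha> \<beta> = -1" using A.add_root_iff[OF r(1,2)] r(3) by blast
  have "A.pair \<alpha> (\<alpha> + \<beta>) = 1" "A.pair \<beta> (\<alpha> + \<beta>) = 1"
    using pab r by (simp_all add: A.pair_simps A.pair_self A.pair_commute[of \<beta> \<alpha>])
  then have o: "\<alpha> + (\<alpha> + \<beta>) \<notin> \<Phi> \<union> {0}" "\<beta> + (\<alpha> + \<beta>) \<notin> \<Phi> \<union> {0}"
    using A.add_root_iff[OF r(1,3)] A.add_zero_iff[OF r(1,3)] A.add_root_iff[OF r(2,3)] A.add_zero_iff[OF r(2,3)]
    by auto
  have "rel_at \<alpha> \<beta> \<xi> \<zeta> p"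
  proof (rule rel_all[OF r(1,2) nz c p])
    fix \<xi> \<nu> p assume a: "\<xi> \<in> carrier K" "\<nu> \<in> carrier K" "eqv p p"
    then have n: "[(N \<alpha> \<beta>)] \<cdot> \<nu> \<in> carrier K" by simp
    show "eqv (act \<alpha> \<xi> (comm_act \<alpha> \<beta> \<nu> p)) (comm_act \<alpha> \<beta> \<nu> (act \<alpha> \<xi> p))"
      unfolding comm_act_def if_P[OF r(3)] by (rule act_commute[OF r(1,3) o(1) a(1) n a(3)])
    show "eqv (act \<beta> \<xi> (comm_act \<alpha> \<beta> \<nu> p)) (comm_act \<alpha> \<beta> \<nu> (act \<beta> \<xi> p))"
      unfolding comm_act_def if_P[OF r(3)] by (rule act_commute[OF r(2,3) o(2) a(1) n a(3)])
  qed
  then show ?thesis using r by (simp add: rel_at_def comm_act_def)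
qed

lemma carrier_nonunital_subring: "A.nonunital_subring (carrier K)"
  unfolding A.nonunital_subring_def by auto

abbreviation "act_word \<equiv> foldr (A.act_letter act)"

lemma act_word_pr:
  assumes "(u, v) \<in> A.pr (carrier K)" "eqv p p"
  shows "eqv (act_word u p) (act_word v p)"
  by (rule A.steinberg_act[where eq = eqv and X = "carrier K", OF carrier_nonunital_subring eqv_sym eqv_trans
        act_cong act_zero act_add act_commute act_commutator assms])

lemma act_word_SB:
  assumes "u \<in> A.wd SB" "y \<in> carrier (A.St RA)"
  shows "eqv (act_word u ([], y)) (u, y)"
  using assms(1)
proof (induction u)
  case Nil
  then show ?case using assms by (simp add: eqv_refl)
next
  case (Cons l u)
  obtain \<alpha> \<zeta> s where l: "l = ((\<alpha>, \<zeta>), s)" by (metis surj_pair)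
  define b where "b = (if s then \<zeta> else \<ominus> \<zeta>)"
  have al: "\<alpha> \<in> \<Phi>" "\<zeta> \<in> SB" and u: "u \<in> A.wd SB" using Cons.prems l by auto
  have b: "b \<in> SB" using al(2) B.frD(4)[OF al(2)] unfolding b_def by simp
  have w: "((\<alpha>, b), True) # u \<in> A.wd SB" "l # u \<in> A.wd SB" using al b u l by auto
  interpret X: pstein_family \<Phi> N K "A.St SB" SB 0 "A.root_elt SB"
    using A.root_elt_stein[OF B.fractions_nonunital_subring] B.fractions_nonunital_subring GS.is_group
    by (simp add: pstein_family_def pstein_family_axioms_def A.steinberg_ring_axioms)
  have "A.cl SB [((\<alpha>, b), True)] = A.cl SB [l]"
  proof (cases s)
    case False
    have "\<alpha> \<noteq> 0" using al A.zero_notin by auto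
    then have "A.root_elt SB \<alpha> (\<ominus> \<zeta>) = inv\<^bsub>A.St SB\<^esub> A.root_elt SB \<alpha> \<zeta>"
      using X.e_minus[OF \<open>\<alpha> \<noteq> 0\<close> al(2)] al(1) by (simp add: X.e_root)
    also have "\<dots> = A.cl SB [l]" using al False by (simp add: A.root_elt_def presented_group_inv word_inv_def l)
    finally show ?thesis using False by (simp add: b_def A.root_elt_def)
  qed (simp add: b_def l)
  then have "A.cl SB [((\<alpha>, b), True)] \<otimes>\<^bsub>A.St SB\<^esub> A.cl SB u = A.cl SB [l] \<otimes>\<^bsub>A.St SB\<^esub> A.cl SB u" by simp
  then have "A.cl SB (((\<alpha>, b), True) # u) = A.cl SB (l # u)"
    using al b u by (simp add: presented_group_mult l)
  then have 3: "eqv (((\<alpha>, b), True) # u, y) (l # u, y)" by (intro eqvI_same w assms(2))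
  have 1: "eqv (act \<alpha> b (act_word u ([], y))) (act \<alpha> b (u, y))"
    by (rule act_cong[OF Cons.IH[OF u] al(1)]) (use b SB_carrier in blast)
  have 2: "eqv (act \<alpha> b (u, y)) (((\<alpha>, b), True) # u, y)" by (rule act_SB[OF u assms(2) al(1) b])
  have "act_word (l # u) ([], y) = act \<alpha> b (act_word u ([], y))" by (simp add: A.act_letter_def l b_def)
  then show ?case using eqv_trans[OF 1 eqv_trans[OF 2 3]] by simp
qed

text \<open>At the empty word \<open>eta\<close> is the canonical family. In a splitting of
  \<open>a\<close> in \<open>RA\<close>, the part \<open>b\<close> lies both in \<open>RA\<close>
  and in \<open>SB\<close>, hence in \<open>RB\<close>, so the letter with parameter
  \<open>b\<close> can be moved to the second component.\<close>

lemma act_RA: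
  assumes y: "y \<in> carrier (A.St RA)" and al: "\<alpha> \<in> \<Phi>" and a: "a \<in> RA"
  shows "eqv (act \<alpha> a ([], y)) ([], A.root_elt RA \<alpha> a \<otimes>\<^bsub>A.St RA\<^esub> y)"
proof -
  have N: "[] \<in> A.wd SB" by simp
  obtain n where g: "good [] n" using exists_good[OF N] by blast
  have aK: "a \<in> carrier K" using a by simp
  obtain b c where x: "b \<in> SB" "c \<in> A.lev RA n" "a = b \<oplus> c" using decompose[OF aK] by blast
  interpret Y: pstein_family \<Phi> N K "A.St RA" RA 0 "A.root_elt RA"
    using A.root_elt_stein[OF A.R_nonunital_subring] A.R_nonunital_subring GA.is_group
    by (simp add: pstein_family_def pstein_family_axioms_def A.steinberg_ring_axioms)
  have an: "\<alpha> \<noteq> 0" using al A.zero_notin by auto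
  have cl: "b \<in> carrier K" "c \<in> carrier K" using x SB_carrier A.lev_closed by blast+
  have cA: "c \<in> RA" using x(2) A.lev_subset_R by blast
  have "b \<oplus> c \<oplus> \<ominus> c = b" using cl by (simp add: A.a_assoc A.r_neg)
  then have "b = a \<oplus> \<ominus> c" using x(3) by simp
  then have "b \<in> RA" using a cA A.RE(5,7) by simp
  then have b: "b \<in> RB" using x(1) inter by blast
  have "eta [] = A.root_elt RA" by (simp add: eta_def)
  then have 1: "eqv (act \<alpha> a ([], y)) ([((\<alpha>, b), True)], A.root_elt RA \<alpha> c \<otimes>\<^bsub>A.St RA\<^esub> y)"
    unfolding x(3) using act_eqv[OF g N y al x(1,2)] by simp
  have w: "[((\<alpha>, b), True)] \<in> A.wd RB" using al b by simp
  have cc: "A.root_elt RA \<alpha> c \<in> carrier (A.St RA)" "A.root_elt RA \<alpha> b \<in> carrier (A.St RA)"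
    using al cA b BA by auto
  have "A.root_elt RA \<alpha> a \<otimes>\<^bsub>A.St RA\<^esub> y = A.cl RA [((\<alpha>, b), True)] \<otimes>\<^bsub>A.St RA\<^esub> (A.root_elt RA \<alpha> c \<otimes>\<^bsub>A.St RA\<^esub> y)"
    using Y.y_add[OF al an \<open>b \<in> RA\<close> cA] cc y by (simp add: x(3) GA.m_assoc flip: A.root_elt_def)
  then have "eqv ([((\<alpha>, b), True)], A.root_elt RA \<alpha> c \<otimes>\<^bsub>A.St RA\<^esub> y) ([], A.root_elt RA \<alpha> a \<otimes>\<^bsub>A.St RA\<^esub> y)"
    by (intro eqvI[OF _ _ _ w]) (use al x cc y in auto)
  then show ?thesis using 1 eqv_trans by blast
qed

lemma act_word_RA:
  assumes "v \<in> A.wd RA"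
  shows "eqv (act_word v ([], \<one>\<^bsub>A.St RA\<^esub>)) ([], A.cl RA v)"
  using assms
proof (induction v)
  case Nil
  then show ?case using eqv_refl[of "[]"] by (simp add: presented_group_one)
next
  case (Cons l v)
  obtain \<alpha> \<zeta> s where l: "l = ((\<alpha>, \<zeta>), s)" by (metis surj_pair)
  define a where "a = (if s then \<zeta> else \<ominus> \<zeta>)"
  have al: "\<alpha> \<in> \<Phi>" "\<zeta> \<in> RA" and v: "v \<in> A.wd RA" using Cons.prems l by auto
  have a: "a \<in> RA" using al(2) A.RE(5)[OF al(2)] unfolding a_def by simp
  interpret Y: pstein_family \<Phi> N K "A.St RA" RA 0 "A.root_elt RA"
    using A.root_elt_stein[OF A.R_nonunital_subring] A.R_nonunital_subring GA.is_group
    by (simp add: pstein_family_def pstein_family_axioms_def A.steinberg_ring_axioms)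
  have "A.root_elt RA \<alpha> a = A.cl RA [l]"
  proof (cases s)
    case False
    have "\<alpha> \<noteq> 0" using al A.zero_notin by auto
    then have "A.root_elt RA \<alpha> (\<ominus> \<zeta>) = inv\<^bsub>A.St RA\<^esub> A.root_elt RA \<alpha> \<zeta>"
      using Y.e_minus[OF \<open>\<alpha> \<noteq> 0\<close> al(2)] al(1) by (simp add: Y.e_root)
    also have "\<dots> = A.cl RA [l]" using al False by (simp add: A.root_elt_def presented_group_inv word_inv_def l)
    finally show ?thesis using False by (simp add: a_def)
  qed (simp add: a_def l A.root_elt_def)
  then have e: "A.root_elt RA \<alpha> a \<otimes>\<^bsub>A.St RA\<^esub> A.cl RA v = A.cl RA (l # v)"
    using presented_group_mult[of "[l]" "\<Phi> \<times> RA" v "A.srel RA"] al v l by simp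
  have 1: "eqv (act \<alpha> a (act_word v ([], \<one>\<^bsub>A.St RA\<^esub>))) (act \<alpha> a ([], A.cl RA v))"
    by (rule act_cong[OF Cons.IH[OF v] al(1)]) (use a in simp)
  have 2: "eqv (act \<alpha> a ([], A.cl RA v)) ([], A.cl RA (l # v))"
    using act_RA[OF _ al(1) a, of "A.cl RA v"] v e by simp
  have "act_word (l # v) ([], \<one>\<^bsub>A.St RA\<^esub>) = act \<alpha> a (act_word v ([], \<one>\<^bsub>A.St RA\<^esub>))"
    by (simp add: A.act_letter_def l a_def)
  then show ?case using eqv_trans[OF 1 2] by simp
qed

theorem gluing_words:
  assumes u: "u \<in> A.wd SB" and v: "v \<in> A.wd RA" and uv: "(u, v) \<in> A.pr (carrier K)"
  shows "\<exists>w\<in>A.wd RB. (u, w) \<in> A.pr SB \<and> (v, w) \<in> A.pr RA"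
proof -
  let ?p = "([], \<one>\<^bsub>A.St RA\<^esub>) :: ('v \<times> 'k) word \<times> ('v \<times> 'k) word set"
  have p: "eqv ?p ?p" by (rule eqv_refl) auto
  have "eqv (u, \<one>\<^bsub>A.St RA\<^esub>) (act_word u ?p)" by (rule eqv_sym[OF act_word_SB[OF u]]) simp
  from eqv_trans[OF this act_word_pr[OF uv p]] have "eqv (u, \<one>\<^bsub>A.St RA\<^esub>) (act_word v ?p)" .
  from eqv_trans[OF this act_word_RA[OF v]] have "eqv (u, \<one>\<^bsub>A.St RA\<^esub>) ([], A.cl RA v)" .
  then obtain w where w: "w \<in> A.wd RB" "A.cl SB u = A.cl SB w" "A.cl RA v = A.cl RA w \<otimes>\<^bsub>A.St RA\<^esub> \<one>\<^bsub>A.St RA\<^esub>"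
    by (auto simp: eqv_def)
  then have "A.cl RA v = A.cl RA w" using wd_RB(1)[OF w(1)] by simp
  then show ?thesis
    using w u v wd_RB[OF w(1)] cls_eq_iff[of v "\<Phi> \<times> RA" w] cls_eq_iff[of u "\<Phi> \<times> SB" w] by blast
qed

end

section \<open>Localization of a domain at the powers of an element\<close>

lemma ring_hom_nat_pow:
  assumes "f \<in> ring_hom R S" "x \<in> carrier R" "monoid R"
  shows "f x [^]\<^bsub>S\<^esub> (n::nat) = f (x [^]\<^bsub>R\<^esub> n)"
  by (induction n) (use assms in \<open>auto simp: ring_hom_one ring_hom_mult monoid.nat_pow_closed\<close>)

locale localized_domain = domain R for R :: "('a, 'm) ring_scheme" (structure) +
  fixes h :: 'a
  assumes h_closed [simp, intro]: "h \<in> carrier R" and h_nonzero: "h \<noteq> \<zero>"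
begin

abbreviation S where "S \<equiv> powers R h"
abbreviation frac where "frac \<equiv> loc_frac R S"
abbreviation L where "L \<equiv> loc_at R h"
abbreviation j where "j \<equiv> loc_hom R h"

lemma pow_nonzero: "h [^] (n::nat) \<noteq> \<zero>"
  by (induction n) (use h_nonzero integral in auto)

lemma S_iff: "s \<in> S \<longleftrightarrow> (\<exists>n::nat. s = h [^] n)"
  by (auto simp: powers_def)

lemma S_closed: "s \<in> S \<Longrightarrow> s \<in> carrier R"
  and S_nonzero: "s \<in> S \<Longrightarrow> s \<noteq> \<zero>"
  and S_pow [simp]: "h [^] (n::nat) \<in> S"
  using pow_nonzero by (auto simp: S_iff)

lemma S_one [simp]: "\<one> \<in> S"
  using S_pow[of 0] by simp

lemma S_mult [simp]: "s \<in> S \<Longrightarrow> t \<in> S \<Longrightarrow> s \<otimes> t \<in> S"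
  by (auto simp: S_iff nat_pow_mult)

text \<open>The auxiliary factor \<open>u\<close> of the general definition is nonzero and cancels
  in a domain.\<close>

lemma loc_rel_iff:
  "((a, s), (b, t)) \<in> loc_rel R S \<longleftrightarrow>
    a \<in> carrier R \<and> s \<in> S \<and> b \<in> carrier R \<and> t \<in> S \<and> t \<otimes> a = s \<otimes> b"
proof -
  have "t \<otimes> a = s \<otimes> b" if "u \<in> S" "u \<otimes> (t \<otimes> a) = u \<otimes> (s \<otimes> b)"
      "a \<in> carrier R" "s \<in> S" "b \<in> carrier R" "t \<in> S" for u
    using that m_lcancel[of u "t \<otimes> a" "s \<otimes> b"] by (simp add: S_nonzero S_closed)
  then have "(\<exists>u\<in>S. u \<otimes> (t \<otimes> a) = u \<otimes> (s \<otimes> b)) \<longleftrightarrow> t \<otimes> a = s \<otimes> b"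
    if "a \<in> carrier R" "s \<in> S" "b \<in> carrier R" "t \<in> S" using that S_one by metis
  then show ?thesis by (auto simp: loc_rel_def)
qed

lemma equiv_loc_rel: "equiv (carrier R \<times> S) (loc_rel R S)"
proof (rule equivI)
  show "loc_rel R S \<subseteq> (carrier R \<times> S) \<times> (carrier R \<times> S)" unfolding loc_rel_def by blast
  show "refl_on (carrier R \<times> S) (loc_rel R S)" by (rule refl_onI) (auto simp: loc_rel_iff)
  show "Relation.sym (loc_rel R S)" by (rule symI) (auto simp: loc_rel_iff)
  show "Relation.trans (loc_rel R S)"
  proof (rule transI)
    fix p q r assume "(p, q) \<in> loc_rel R S" "(q, r) \<in> loc_rel R S"
    then obtain a s b t c u where pqr: "p = (a, s)" "q = (b, t)" "r = (c, u)"
      and c: "a \<in> carrier R" "s \<in> S" "b \<in> carrier R" "t \<in> S" "c \<in> carrier R" "u \<in> S"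
      and e: "t \<otimes> a = s \<otimes> b" "u \<otimes> b = t \<otimes> c"
      by (cases p; cases q; cases r) (auto simp: loc_rel_iff)
    note c' = c S_closed[OF c(2)] S_closed[OF c(4)] S_closed[OF c(6)]
    have "t \<otimes> (u \<otimes> a) = u \<otimes> (t \<otimes> a)" using c' by (simp add: m_lcomm)
    also have "\<dots> = s \<otimes> (u \<otimes> b)" using c' e by (simp add: m_lcomm)
    also have "\<dots> = t \<otimes> (s \<otimes> c)" using c' e by (simp add: m_lcomm)
    finally have "u \<otimes> a = s \<otimes> c" using c' S_nonzero[OF c(4)] m_lcancel[of t "u \<otimes> a" "s \<otimes> c"] by simp
    then show "(p, r) \<in> loc_rel R S" using c by (simp add: pqr loc_rel_iff)
  qed
qed

lemma frac_eq_iff: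
  "a \<in> carrier R \<Longrightarrow> s \<in> S \<Longrightarrow> b \<in> carrier R \<Longrightarrow> t \<in> S \<Longrightarrow> frac a s = frac b t \<longleftrightarrow> t \<otimes> a = s \<otimes> b"
  unfolding loc_frac_def using eq_equiv_class_iff[OF equiv_loc_rel, of "(a, s)" "(b, t)"] by (simp add: loc_rel_iff)

lemma frac_memD: "(b, t) \<in> frac a s \<Longrightarrow> b \<in> carrier R \<and> t \<in> S \<and> frac b t = frac a s \<and> t \<otimes> a = s \<otimes> b"
  using frac_eq_iff[of a s b t] by (auto simp: loc_frac_def loc_rel_iff)

lemma frac_self: "a \<in> carrier R \<Longrightarrow> s \<in> S \<Longrightarrow> (a, s) \<in> frac a s"
  by (simp add: loc_frac_def loc_rel_iff)

lemma L_carrier: "carrier L = {frac a s | a s. a \<in> carrier R \<and> s \<in> S}"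
  by (auto simp: loc_at_def localization_def quotient_def loc_frac_def)

lemma frac_closed [simp]: "a \<in> carrier R \<Longrightarrow> s \<in> S \<Longrightarrow> frac a s \<in> carrier L"
  by (auto simp: L_carrier)

lemma L_cases:
  assumes "x \<in> carrier L"
  obtains a s where "x = frac a s" "a \<in> carrier R" "s \<in> S"
  using assms by (auto simp: L_carrier)

lemma Union_frac:
  assumes "a \<in> carrier R" "s \<in> S" "b \<in> carrier R" "t \<in> S"
    and "\<And>a' s' b' t'. (a', s') \<in> frac a s \<Longrightarrow> (b', t') \<in> frac b t \<Longrightarrow> F a' s' b' t' = F a s b t"
  shows "(\<Union>(a', s')\<in>frac a s. \<Union>(b', t')\<in>frac b t. F a' s' b' t') = F a s b t"
proof -
  have "(a, s) \<in> frac a s" "(b, t) \<in> frac b t" using assms frac_self by auto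
  then show ?thesis using assms(5) by blast
qed

lemma frac_mult [simp]:
  assumes "a \<in> carrier R" "s \<in> S" "b \<in> carrier R" "t \<in> S"
  shows "frac a s \<otimes>\<^bsub>L\<^esub> frac b t = frac (a \<otimes> b) (s \<otimes> t)"
proof -
  have "frac (a' \<otimes> b') (s' \<otimes> t') = frac (a \<otimes> b) (s \<otimes> t)"
    if m: "(a', s') \<in> frac a s" "(b', t') \<in> frac b t" for a' s' b' t'
  proof -
    note d = frac_memD[OF m(1)] frac_memD[OF m(2)]
    have c: "a' \<in> carrier R" "s' \<in> S" "b' \<in> carrier R" "t' \<in> S" using d by auto
    note cc = assms c assms(2,4)[THEN S_closed] c(2,4)[THEN S_closed]
    have "(s \<otimes> t) \<otimes> (a' \<otimes> b') = (s \<otimes> a') \<otimes> (t \<otimes> b')" using cc by (simp add: m_ac)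
    also have "\<dots> = (s' \<otimes> a) \<otimes> (t' \<otimes> b)" using d by simp
    also have "\<dots> = (s' \<otimes> t') \<otimes> (a \<otimes> b)" using cc by (simp add: m_ac)
    finally show ?thesis using cc by (simp add: frac_eq_iff)
  qed
  then show ?thesis
    using Union_frac[OF assms, where F = "\<lambda>a s b t. frac (a \<otimes> b) (s \<otimes> t)"]
    by (simp add: loc_at_def localization_def)
qed

lemma frac_add [simp]:
  assumes "a \<in> carrier R" "s \<in> S" "b \<in> carrier R" "t \<in> S"
  shows "frac a s \<oplus>\<^bsub>L\<^esub> frac b t = frac (t \<otimes> a \<oplus> s \<otimes> b) (s \<otimes> t)"
proof -
  have "frac (t' \<otimes> a' \<oplus> s' \<otimes> b') (s' \<otimes> t') = frac (t \<otimes> a \<oplus> s \<otimes> b) (s \<otimes> t)"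
    if m: "(a', s') \<in> frac a s" "(b', t') \<in> frac b t" for a' s' b' t'
  proof -
    note d = frac_memD[OF m(1)] frac_memD[OF m(2)]
    have c: "a' \<in> carrier R" "s' \<in> S" "b' \<in> carrier R" "t' \<in> S" using d by auto
    note cc = assms c assms(2,4)[THEN S_closed] c(2,4)[THEN S_closed]
    have "(s \<otimes> t) \<otimes> (t' \<otimes> a' \<oplus> s' \<otimes> b') = (t \<otimes> t') \<otimes> (s \<otimes> a') \<oplus> (s \<otimes> s') \<otimes> (t \<otimes> b')"
      using cc by (simp add: r_distr m_ac)
    also have "\<dots> = (t \<otimes> t') \<otimes> (s' \<otimes> a) \<oplus> (s \<otimes> s') \<otimes> (t' \<otimes> b)" using d by simp
    also have "\<dots> = (s' \<otimes> t') \<otimes> (t \<otimes> a \<oplus> s \<otimes> b)" using cc by (simp add: r_distr m_ac)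
    finally show ?thesis using cc by (simp add: frac_eq_iff)
  qed
  then show ?thesis
    using Union_frac[OF assms, where F = "\<lambda>a s b t. frac (t \<otimes> a \<oplus> s \<otimes> b) (s \<otimes> t)"]
    by (simp add: loc_at_def localization_def)
qed

lemma L_one: "\<one>\<^bsub>L\<^esub> = frac \<one> \<one>" and L_zero: "\<zero>\<^bsub>L\<^esub> = frac \<zero> \<one>"
  by (simp_all add: loc_at_def localization_def)

lemma L_cring: "cring L"
proof (rule cringI)
  show "abelian_group L"
  proof (rule abelian_groupI)
    fix x y assume "x \<in> carrier L" "y \<in> carrier L"
    then show "x \<oplus>\<^bsub>L\<^esub> y \<in> carrier L" by (elim L_cases) (simp add: S_closed)
  next
    show "\<zero>\<^bsub>L\<^esub> \<in> carrier L" by (simp add: L_zero)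
  next
    fix x y z assume "x \<in> carrier L" "y \<in> carrier L" "z \<in> carrier L"
    then show "x \<oplus>\<^bsub>L\<^esub> y \<oplus>\<^bsub>L\<^esub> z = x \<oplus>\<^bsub>L\<^esub> (y \<oplus>\<^bsub>L\<^esub> z)"
      by (elim L_cases) (simp add: S_closed r_distr m_ac a_ac)
  next
    fix x y assume "x \<in> carrier L" "y \<in> carrier L"
    then show "x \<oplus>\<^bsub>L\<^esub> y = y \<oplus>\<^bsub>L\<^esub> x" by (elim L_cases) (simp add: S_closed m_comm a_comm)
  next
    fix x assume "x \<in> carrier L"
    then show "\<zero>\<^bsub>L\<^esub> \<oplus>\<^bsub>L\<^esub> x = x" by (elim L_cases) (simp add: L_zero S_closed)
  next
    fix x assume "x \<in> carrier L"
    then obtain a s where x: "x = frac a s" "a \<in> carrier R" "s \<in> S" by (elim L_cases)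
    have "frac (\<ominus> a) s \<oplus>\<^bsub>L\<^esub> x = \<zero>\<^bsub>L\<^esub>" using x by (simp add: L_zero frac_eq_iff S_closed r_minus l_neg)
    then show "\<exists>y\<in>carrier L. y \<oplus>\<^bsub>L\<^esub> x = \<zero>\<^bsub>L\<^esub>" using x by (intro bexI[of _ "frac (\<ominus> a) s"]) auto
  qed
  show "comm_monoid L"
  proof (rule comm_monoidI)
    fix x y assume "x \<in> carrier L" "y \<in> carrier L"
    then show "x \<otimes>\<^bsub>L\<^esub> y \<in> carrier L" by (elim L_cases) simp
  next
    show "\<one>\<^bsub>L\<^esub> \<in> carrier L" by (simp add: L_one)
  next
    fix x y z assume "x \<in> carrier L" "y \<in> carrier L" "z \<in> carrier L"
    then show "x \<otimes>\<^bsub>L\<^esub> y \<otimes>\<^bsub>L\<^esub> z = x \<otimes>\<^bsub>L\<^esub> (y \<otimes>\<^bsub>L\<^esub> z)" by (elim L_cases) (simp add: S_closed m_assoc)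
  next
    fix x assume "x \<in> carrier L"
    then show "\<one>\<^bsub>L\<^esub> \<otimes>\<^bsub>L\<^esub> x = x" by (elim L_cases) (simp add: L_one S_closed)
  next
    fix x y assume "x \<in> carrier L" "y \<in> carrier L"
    then show "x \<otimes>\<^bsub>L\<^esub> y = y \<otimes>\<^bsub>L\<^esub> x" by (elim L_cases) (simp add: S_closed m_comm)
  qed
  fix x y z assume "x \<in> carrier L" "y \<in> carrier L" "z \<in> carrier L"
  then show "(x \<oplus>\<^bsub>L\<^esub> y) \<otimes>\<^bsub>L\<^esub> z = x \<otimes>\<^bsub>L\<^esub> z \<oplus>\<^bsub>L\<^esub> y \<otimes>\<^bsub>L\<^esub> z"
    by (elim L_cases) (simp add: S_closed frac_eq_iff r_distr l_distr m_ac)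
qed

lemma loc_hom_frac: "j a = frac a \<one>"
  by (simp add: loc_hom_def)

lemma loc_hom_ring_hom: "j \<in> ring_hom R L"
  by (rule ring_hom_memI) (auto simp: loc_hom_frac L_one)

lemma loc_hom_inj: "inj_on j (carrier R)"
  by (rule inj_onI) (simp add: loc_hom_frac frac_eq_iff)

lemma loc_hom_Units: "j h \<in> Units L"
proof -
  interpret L: cring L by (rule L_cring)
  have "h \<in> S" using S_pow[of 1] by simp
  then have "frac \<one> h \<in> carrier L" "frac \<one> h \<otimes>\<^bsub>L\<^esub> j h = \<one>\<^bsub>L\<^esub>"
    by (simp_all add: loc_hom_frac L_one frac_eq_iff)
  then show ?thesis using L.m_comm[of "frac \<one> h" "j h"] by (auto simp: Units_def loc_hom_frac)
qed

lemma loc_hom_pow_mult_frac: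
  assumes a: "a \<in> carrier R"
  shows "j h [^]\<^bsub>L\<^esub> (n::nat) \<otimes>\<^bsub>L\<^esub> frac a (h [^] n) = j a"
proof -
  have "j h [^]\<^bsub>L\<^esub> n = j (h [^] n)" by (rule ring_hom_nat_pow[OF loc_hom_ring_hom h_closed monoid_axioms])
  then show ?thesis using a S_closed[OF S_pow] by (simp add: loc_hom_frac frac_eq_iff)
qed

end

section \<open>Functoriality of the Steinberg group\<close>

lemma ring_hom_add_pow:
  assumes "ring R" "ring S" "f \<in> ring_hom R S" "x \<in> carrier R"
  shows "f ([(n::int)] \<cdot>\<^bsub>R\<^esub> x) = [n] \<cdot>\<^bsub>S\<^esub> f x"
proof -
  interpret ring_hom_ring R S f by (rule ring_hom_ringI2[OF assms(1-3)])
  show ?thesis using group_hom.hom_int_pow[OF a_group_hom, of x n] assms(4) by (simp add: add_pow_def)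
qed

lemma steinberg_rels_cases:
  assumes "(r, s) \<in> steinberg_rels \<Phi> N R"
  obtains
    (add) \<alpha> a b where "\<alpha> \<in> \<Phi>" "a \<in> carrier R" "b \<in> carrier R"
      "r = gen (\<alpha>, a) @ gen (\<alpha>, b)" "s = gen (\<alpha>, a \<oplus>\<^bsub>R\<^esub> b)"
  | (comm) \<alpha> \<beta> a b where "\<alpha> \<in> \<Phi>" "\<beta> \<in> \<Phi>" "a \<in> carrier R" "b \<in> carrier R" "\<alpha> + \<beta> \<notin> \<Phi> \<union> {0}"
      "r = comm_word (\<alpha>, a) (\<beta>, b)" "s = []"
  | (root) \<alpha> \<beta> a b where "\<alpha> \<in> \<Phi>" "\<beta> \<in> \<Phi>" "a \<in> carrier R" "b \<in> carrier R" "\<alpha> + \<beta> \<in> \<Phi>"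
      "r = comm_word (\<alpha>, a) (\<beta>, b)" "s = gen (\<alpha> + \<beta>, [N \<alpha> \<beta>] \<cdot>\<^bsub>R\<^esub> (a \<otimes>\<^bsub>R\<^esub> b))"
    using assms unfolding steinberg_rels_def
  by (elim UnE CollectE exE conjE Pair_inject) ((rule add comm root; assumption)+)

lemma steinberg_rels_map:
  assumes "ring R" "ring S" "f \<in> ring_hom R S" "(r, s) \<in> steinberg_rels \<Phi> N R"
  shows "(map_word (apsnd f) r, map_word (apsnd f) s) \<in> steinberg_rels \<Phi> N S"
proof -
  interpret R: ring R by fact
  note f = ring_hom_add[OF assms(3)] ring_hom_mult[OF assms(3)] ring_hom_closed[OF assms(3)]
    ring_hom_add_pow[OF assms(1-3)]
  from assms(4) show ?thesis
  proof (cases rule: steinberg_rels_cases)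
    case add
    then show ?thesis unfolding steinberg_rels_def by (intro UnI1) (auto simp: gen_def f)
  next
    case comm
    then show ?thesis unfolding steinberg_rels_def
      by (intro UnI1[OF UnI2]) (force simp: comm_word_def gen_def gen_inv_def f)
  next
    case root
    then show ?thesis unfolding steinberg_rels_def
      by (intro UnI2) (force simp: comm_word_def gen_def gen_inv_def f)
  qed
qed

abbreviation stein_rel where
  "stein_rel \<Phi> N R \<equiv> pres_rel (steinberg_gens \<Phi> R) (steinberg_rels \<Phi> N R)"

abbreviation stein_cls where
  "stein_cls \<Phi> N R \<equiv> cls (steinberg_gens \<Phi> R) (steinberg_rels \<Phi> N R)"

lemma apsnd_gens: "f \<in> ring_hom R S \<Longrightarrow> apsnd f ` steinberg_gens \<Phi> R \<subseteq> steinberg_gens \<Phi> S"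
  by (auto simp: steinberg_gens_def ring_hom_closed)

lemma steinberg_pres_rel_map:
  assumes "ring R" "ring S" "f \<in> ring_hom R S" "(u, v) \<in> stein_rel \<Phi> N R"
  shows "(map_word (apsnd f) u, map_word (apsnd f) v) \<in> stein_rel \<Phi> N S"
  using steinberg_rels_map[OF assms(1-3)] by (intro pres_rel_map[OF apsnd_gens[OF assms(3)] _ assms(4)]) blast

lemma steinberg_map_cls:
  assumes "ring R" "ring S" "f \<in> ring_hom R S" "w \<in> words (steinberg_gens \<Phi> R)"
  shows "steinberg_map \<Phi> N S f (stein_cls \<Phi> N R w) = stein_cls \<Phi> N S (map_word (apsnd f) w)"
proof -
  have e: "(\<lambda>((\<alpha>, \<xi>), s). ((\<alpha>, f \<xi>), s)) = (\<lambda>(x, s). (apsnd f x, s))" by (auto simp: fun_eq_iff)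
  show ?thesis unfolding steinberg_map_def e cls_def[symmetric]
    by (rule cls_Union_map[OF assms(4)]) (rule steinberg_pres_rel_map[OF assms(1-3)])
qed

lemma steinberg_map_hom:
  assumes "ring R" "ring S" "f \<in> ring_hom R S"
  shows "steinberg_map \<Phi> N S f \<in> hom (steinberg \<Phi> N R) (steinberg \<Phi> N S)"
proof (rule homI)
  note w = map_word_words[OF _ apsnd_gens[OF assms(3)]]
  fix P assume "P \<in> carrier (steinberg \<Phi> N R)"
  then show "steinberg_map \<Phi> N S f P \<in> carrier (steinberg \<Phi> N S)"
    by (auto simp: steinberg_def presented_group_carrier steinberg_map_cls[OF assms] w)
  fix Q assume "Q \<in> carrier (steinberg \<Phi> N R)"
  with \<open>P \<in> carrier (steinberg \<Phi> N R)\<close>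
  show "steinberg_map \<Phi> N S f (P \<otimes>\<^bsub>steinberg \<Phi> N R\<^esub> Q) =
      steinberg_map \<Phi> N S f P \<otimes>\<^bsub>steinberg \<Phi> N S\<^esub> steinberg_map \<Phi> N S f Q"
    by (auto simp: steinberg_def presented_group_carrier presented_group_mult steinberg_map_cls[OF assms] w)
qed

context steinberg_ring
begin

lemma pr_carrier: "pr (carrier K) = stein_rel \<Phi> N K"
  by (simp add: srel_def steinberg_rels_def steinberg_gens_def)

text \<open>The inverse of \<open>f\<close> on its image carries the defining relations over the
  image back to those over \<open>R\<close>. So the group over a subset of \<open>K\<close> can
  stand for the Steinberg group of a ring embedded in \<open>K\<close>.\<close>

lemma pr_image_pullback:
  assumes R: "ring R" and f: "f \<in> ring_hom R K" "inj_on f (carrier R)"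
    and u: "u \<in> words (steinberg_gens \<Phi> R)" and v: "v \<in> words (steinberg_gens \<Phi> R)"
    and uv: "(map_word (apsnd f) u, map_word (apsnd f) v) \<in> pr (f ` carrier R)"
  shows "(u, v) \<in> stein_rel \<Phi> N R"
proof -
  interpret R: ring R by fact
  define g where "g = inv_into (carrier R) f"
  have gf: "g (f a) = a" if "a \<in> carrier R" for a using that f(2) by (simp add: g_def)
  note ff = ring_hom_add[OF f(1), symmetric] ring_hom_mult[OF f(1), symmetric] 
    ring_hom_add_pow[OF R ring_axioms f(1), symmetric]
  have unmap: "map_word (apsnd g) (map_word (apsnd f) w) = w" if "w \<in> words (steinberg_gens \<Phi> R)" for w
    using that by (induction w) (auto simp: steinberg_gens_def gf words_def)
  have "(map_word (apsnd g) r, map_word (apsnd g) s) \<in> steinberg_rels \<Phi> N R"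
    if rs: "(r, s) \<in> srel (f ` carrier R)" for r s
  proof -
    let ?I = "f ` carrier R"
    consider
      (add) \<alpha> a b where "\<alpha> \<in> \<Phi>" "a \<in> ?I" "b \<in> ?I"
        "r = gen (\<alpha>, a) @ gen (\<alpha>, b)" "s = gen (\<alpha>, a \<oplus> b)"
    | (comm) \<alpha> \<beta> a b where "\<alpha> \<in> \<Phi>" "\<beta> \<in> \<Phi>" "a \<in> ?I" "b \<in> ?I" "\<alpha> + \<beta> \<notin> \<Phi> \<union> {0}"
        "r = comm_word (\<alpha>, a) (\<beta>, b)" "s = []"
    | (root) \<alpha> \<beta> a b where "\<alpha> \<in> \<Phi>" "\<beta> \<in> \<Phi>" "a \<in> ?I" "b \<in> ?I" "\<alpha> + \<beta> \<in> \<Phi>"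
        "r = comm_word (\<alpha>, a) (\<beta>, b)" "s = gen (\<alpha> + \<beta>, [(N \<alpha> \<beta>)] \<cdot> (a \<otimes> b))"
      using rs unfolding srel_def
      by (elim UnE CollectE exE conjE Pair_inject) ((rule add comm root; assumption)+)
    then show ?thesis
    proof cases
      case add
      then obtain a' b' where ab: "a' \<in> carrier R" "b' \<in> carrier R" "a = f a'" "b = f b'" by blast
      have "map_word (apsnd g) r = gen (\<alpha>, a') @ gen (\<alpha>, b')"
        "map_word (apsnd g) s = gen (\<alpha>, a' \<oplus>\<^bsub>R\<^esub> b')"
        using add ab by (simp_all add: gen_def ff gf)
      then show ?thesis unfolding steinberg_rels_def using ab add(1) by (intro UnI1) force
    next
      case comm
      then obtain a' b' where ab: "a' \<in> carrier R" "b' \<in> carrier R" "a = f a'" "b = f b'" by blast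
      have "map_word (apsnd g) r = comm_word (\<alpha>, a') (\<beta>, b')" "map_word (apsnd g) s = []"
        using comm ab by (simp_all add: comm_word_def gen_def gen_inv_def gf)
      then show ?thesis unfolding steinberg_rels_def using ab comm(1,2,5) by (intro UnI1[OF UnI2]) force
    next
      case root
      then obtain a' b' where ab: "a' \<in> carrier R" "b' \<in> carrier R" "a = f a'" "b = f b'" by blast
      have "map_word (apsnd g) r = comm_word (\<alpha>, a') (\<beta>, b')"
        "map_word (apsnd g) s = gen (\<alpha> + \<beta>, add_pow R (N \<alpha> \<beta>) (a' \<otimes>\<^bsub>R\<^esub> b'))"
        using root ab by (simp_all add: comm_word_def gen_def gen_inv_def ff gf)
      then show ?thesis unfolding steinberg_rels_def using ab root(1,2,5) by (intro UnI2) force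
    qed
  qed
  moreover have "apsnd g ` (\<Phi> \<times> f ` carrier R) \<subseteq> steinberg_gens \<Phi> R"
    by (auto simp: steinberg_gens_def gf)
  ultimately have "(map_word (apsnd g) (map_word (apsnd f) u), map_word (apsnd g) (map_word (apsnd f) v))
      \<in> stein_rel \<Phi> N R"
    by (intro pres_rel_map[OF _ _ uv]) blast+
  then show ?thesis using unmap u v by simp
qed

end

section \<open>Gluing along a localization\<close>

locale patching_square =
  B: localized_domain B h + A: localized_domain A "\<iota> h"
  for B :: "('b, 'm) ring_scheme" and A :: "('a, 'n) ring_scheme" and \<iota> :: "'b \<Rightarrow> 'a" and h +
  assumes iota: "\<iota> \<in> ring_hom B A" and iota_inj: "inj_on \<iota> (carrier B)"
    and quot: "\<exists>\<phi> \<in> ring_iso (B Quot (PIdl\<^bsub>B\<^esub> h)) (A Quot (PIdl\<^bsub>A\<^esub> (\<iota> h))).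
           \<forall>b \<in> carrier B. \<phi> (PIdl\<^bsub>B\<^esub> h +>\<^bsub>B\<^esub> b) = PIdl\<^bsub>A\<^esub> (\<iota> h) +>\<^bsub>A\<^esub> \<iota> b"
begin

abbreviation m where "m \<equiv> loc_map A (\<iota> h) \<iota>"

lemma iota_closed [simp]: "b \<in> carrier B \<Longrightarrow> \<iota> b \<in> carrier A"
  by (rule ring_hom_closed[OF iota])

lemma iota_pow: "\<iota> (h [^]\<^bsub>B\<^esub> n) = \<iota> h [^]\<^bsub>A\<^esub> (n::nat)"
  by (rule ring_hom_nat_pow[OF iota B.h_closed B.monoid_axioms, symmetric])

lemma iota_S [simp]: "s \<in> B.S \<Longrightarrow> \<iota> s \<in> A.S"
  by (auto simp: B.S_iff iota_pow)

lemma iota_eq_iff: "a \<in> carrier B \<Longrightarrow> b \<in> carrier B \<Longrightarrow> \<iota> a = \<iota> b \<longleftrightarrow> a = b"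
  using iota_inj by (auto dest: inj_onD)

text \<open>Surjectivity of the map between the quotients: every coset modulo
  \<open>\<iota> h\<close> is the coset of an element of \<open>B\<close>.\<close>

lemma split: "r \<in> carrier A \<Longrightarrow> \<exists>b\<in>carrier B. \<exists>s\<in>carrier A. r = \<iota> b \<oplus>\<^bsub>A\<^esub> \<iota> h \<otimes>\<^bsub>A\<^esub> s"
proof -
  assume r: "r \<in> carrier A"
  obtain \<phi> where p: "\<phi> \<in> ring_iso (B Quot (PIdl\<^bsub>B\<^esub> h)) (A Quot (PIdl\<^bsub>A\<^esub> (\<iota> h)))"
    "\<And>b. b \<in> carrier B \<Longrightarrow> \<phi> (PIdl\<^bsub>B\<^esub> h +>\<^bsub>B\<^esub> b) = PIdl\<^bsub>A\<^esub> (\<iota> h) +>\<^bsub>A\<^esub> \<iota> b" using quot by blast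
  have I: "ideal (PIdl\<^bsub>A\<^esub> (\<iota> h)) A" by (rule A.cgenideal_ideal) simp
  have "PIdl\<^bsub>A\<^esub> (\<iota> h) +>\<^bsub>A\<^esub> r \<in> carrier (A Quot (PIdl\<^bsub>A\<^esub> (\<iota> h)))"
    using r by (auto simp: FactRing_def A_RCOSETS_def')
  also have "\<dots> = \<phi> ` carrier (B Quot (PIdl\<^bsub>B\<^esub> h))" using p(1) by (auto simp: ring_iso_def bij_betw_def)
  also have "\<dots> = {PIdl\<^bsub>A\<^esub> (\<iota> h) +>\<^bsub>A\<^esub> \<iota> b | b. b \<in> carrier B}"
    using p(2) by (auto simp: FactRing_def A_RCOSETS_def')
  finally obtain b where b: "b \<in> carrier B" "PIdl\<^bsub>A\<^esub> (\<iota> h) +>\<^bsub>A\<^esub> r = PIdl\<^bsub>A\<^esub> (\<iota> h) +>\<^bsub>A\<^esub> \<iota> b" by blast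
  then have "r \<ominus>\<^bsub>A\<^esub> \<iota> b \<in> PIdl\<^bsub>A\<^esub> (\<iota> h)" using A.quotient_eq_iff_same_a_r_cos[OF I r] by simp
  then obtain s where s: "s \<in> carrier A" "r \<ominus>\<^bsub>A\<^esub> \<iota> b = s \<otimes>\<^bsub>A\<^esub> \<iota> h" by (auto simp: cgenideal_def)
  have "r = \<iota> b \<oplus>\<^bsub>A\<^esub> (r \<ominus>\<^bsub>A\<^esub> \<iota> b)" using r b(1) by (simp add: A.minus_eq A.a_lcomm A.r_neg)
  then have "r = \<iota> b \<oplus>\<^bsub>A\<^esub> \<iota> h \<otimes>\<^bsub>A\<^esub> s" using s by (simp add: A.m_comm)
  then show ?thesis using b s by blast
qed

text \<open>Injectivity of the map between the quotients: \<open>\<iota> b\<close> lies in the zero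
  coset, hence \<open>b\<close> is a multiple of \<open>h\<close> already in \<open>B\<close>, and
  \<open>\<iota> h\<close> can be cancelled in the domain \<open>A\<close>.\<close>

lemma iota_dvd:
  assumes "b \<in> carrier B" "a \<in> carrier A" "\<iota> b = \<iota> h \<otimes>\<^bsub>A\<^esub> a"
  shows "a \<in> \<iota> ` carrier B"
proof -
  obtain \<phi> where p: "\<phi> \<in> ring_iso (B Quot (PIdl\<^bsub>B\<^esub> h)) (A Quot (PIdl\<^bsub>A\<^esub> (\<iota> h)))"
    "\<And>b. b \<in> carrier B \<Longrightarrow> \<phi> (PIdl\<^bsub>B\<^esub> h +>\<^bsub>B\<^esub> b) = PIdl\<^bsub>A\<^esub> (\<iota> h) +>\<^bsub>A\<^esub> \<iota> b" using quot by blast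
  have I: "ideal (PIdl\<^bsub>A\<^esub> (\<iota> h)) A" "ideal (PIdl\<^bsub>B\<^esub> h) B" by (rule A.cgenideal_ideal B.cgenideal_ideal; simp)+
  have z: "\<iota> \<zero>\<^bsub>B\<^esub> = \<zero>\<^bsub>A\<^esub>" by (rule ring_hom_zero[OF iota B.ring_axioms A.ring_axioms])
  have "\<iota> b \<ominus>\<^bsub>A\<^esub> \<iota> \<zero>\<^bsub>B\<^esub> = a \<otimes>\<^bsub>A\<^esub> \<iota> h" using assms by (simp add: z A.m_comm A.minus_eq)
  then have "\<iota> b \<ominus>\<^bsub>A\<^esub> \<iota> \<zero>\<^bsub>B\<^esub> \<in> PIdl\<^bsub>A\<^esub> (\<iota> h)" using assms(2) by (auto simp: cgenideal_def)
  then have "PIdl\<^bsub>A\<^esub> (\<iota> h) +>\<^bsub>A\<^esub> \<iota> b = PIdl\<^bsub>A\<^esub> (\<iota> h) +>\<^bsub>A\<^esub> \<iota> \<zero>\<^bsub>B\<^esub>"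
    using A.quotient_eq_iff_same_a_r_cos[OF I(1), of "\<iota> b" "\<iota> \<zero>\<^bsub>B\<^esub>"] assms(1) by simp
  then have "\<phi> (PIdl\<^bsub>B\<^esub> h +>\<^bsub>B\<^esub> b) = \<phi> (PIdl\<^bsub>B\<^esub> h +>\<^bsub>B\<^esub> \<zero>\<^bsub>B\<^esub>)" using p(2) assms(1) by simp
  moreover have inj: "inj_on \<phi> (carrier (B Quot (PIdl\<^bsub>B\<^esub> h)))" using p(1) by (auto simp: ring_iso_def bij_betw_def)
  moreover have "PIdl\<^bsub>B\<^esub> h +>\<^bsub>B\<^esub> b \<in> carrier (B Quot (PIdl\<^bsub>B\<^esub> h))"
    "PIdl\<^bsub>B\<^esub> h +>\<^bsub>B\<^esub> \<zero>\<^bsub>B\<^esub> \<in> carrier (B Quot (PIdl\<^bsub>B\<^esub> h))"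
    using assms(1) B.zero_closed unfolding FactRing_def A_RCOSETS_def' partial_object.simps by blast+
  ultimately have "PIdl\<^bsub>B\<^esub> h +>\<^bsub>B\<^esub> b = PIdl\<^bsub>B\<^esub> h +>\<^bsub>B\<^esub> \<zero>\<^bsub>B\<^esub>" using inj by (auto dest: inj_onD)
  then have "b \<ominus>\<^bsub>B\<^esub> \<zero>\<^bsub>B\<^esub> \<in> PIdl\<^bsub>B\<^esub> h"
    using B.quotient_eq_iff_same_a_r_cos[OF I(2) assms(1) B.zero_closed] by simp
  then obtain c where c: "c \<in> carrier B" "b = c \<otimes>\<^bsub>B\<^esub> h"
    using assms(1) by (auto simp: cgenideal_def B.minus_eq)
  have "\<iota> h \<otimes>\<^bsub>A\<^esub> a = \<iota> h \<otimes>\<^bsub>A\<^esub> \<iota> c" using assms c by (simp add: ring_hom_mult[OF iota] A.m_comm)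
  then have "a = \<iota> c" using A.m_lcancel[OF A.h_nonzero A.h_closed assms(2)] c(1) by simp
  then show ?thesis using c by blast
qed

lemma iota_dvd_pow:
  "b \<in> carrier B \<Longrightarrow> a \<in> carrier A \<Longrightarrow> \<iota> b = \<iota> h [^]\<^bsub>A\<^esub> (n::nat) \<otimes>\<^bsub>A\<^esub> a \<Longrightarrow> a \<in> \<iota> ` carrier B"
proof (induction n arbitrary: b)
  case 0
  then show ?case using A.l_one by (auto intro: rev_image_eqI)
next
  case (Suc n)
  have "\<iota> b = \<iota> h \<otimes>\<^bsub>A\<^esub> (\<iota> h [^]\<^bsub>A\<^esub> n \<otimes>\<^bsub>A\<^esub> a)" using Suc.prems by (simp add: A.m_ac)
  then have "\<iota> h [^]\<^bsub>A\<^esub> n \<otimes>\<^bsub>A\<^esub> a \<in> \<iota> ` carrier B" using Suc.prems by (intro iota_dvd[of b]) simp_all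
  then obtain c where "c \<in> carrier B" "\<iota> c = \<iota> h [^]\<^bsub>A\<^esub> n \<otimes>\<^bsub>A\<^esub> a" by (metis imageE)
  then show ?case using Suc.IH[OF _ Suc.prems(2)] by simp
qed

lemma m_frac [simp]:
  assumes "a \<in> carrier B" "s \<in> B.S"
  shows "m (B.frac a s) = A.frac (\<iota> a) (\<iota> s)"
proof -
  have "A.frac (\<iota> a') (\<iota> s') = A.frac (\<iota> a) (\<iota> s)" if e: "(a', s') \<in> B.frac a s" for a' s'
  proof -
    have c: "a' \<in> carrier B" "s' \<in> B.S" "s' \<otimes>\<^bsub>B\<^esub> a = s \<otimes>\<^bsub>B\<^esub> a'"
      using B.frac_memD[OF e] B.frac_eq_iff[of a' s' a s] assms by auto
    then have "\<iota> s \<otimes>\<^bsub>A\<^esub> \<iota> a' = \<iota> s' \<otimes>\<^bsub>A\<^esub> \<iota> a"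
      using assms ring_hom_mult[OF iota] B.S_closed by metis
    then show ?thesis using c assms by (simp add: A.frac_eq_iff)
  qed
  moreover have "(a, s) \<in> B.frac a s" using assms B.frac_self by simp
  ultimately show ?thesis unfolding loc_map_def by blast
qed

lemma m_ring_hom: "m \<in> ring_hom B.L A.L"
proof (rule ring_hom_memI)
  fix x y assume "x \<in> carrier B.L" "y \<in> carrier B.L"
  then show "m (x \<otimes>\<^bsub>B.L\<^esub> y) = m x \<otimes>\<^bsub>A.L\<^esub> m y" "m (x \<oplus>\<^bsub>B.L\<^esub> y) = m x \<oplus>\<^bsub>A.L\<^esub> m y"
    by (elim B.L_cases; simp add: B.S_closed ring_hom_mult[OF iota] ring_hom_add[OF iota])+
next
  fix x assume "x \<in> carrier B.L"
  then show "m x \<in> carrier A.L" by (elim B.L_cases) simp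
qed (simp add: B.L_one A.L_one ring_hom_one[OF iota])

lemma m_inj: "inj_on m (carrier B.L)"
proof (rule inj_onI)
  fix x y assume c: "x \<in> carrier B.L" "y \<in> carrier B.L" and e: "m x = m y"
  obtain a s where x: "x = B.frac a s" "a \<in> carrier B" "s \<in> B.S" using c(1) by (rule B.L_cases)
  obtain b t where y: "y = B.frac b t" "b \<in> carrier B" "t \<in> B.S" using c(2) by (rule B.L_cases)
  have "\<iota> t \<otimes>\<^bsub>A\<^esub> \<iota> a = \<iota> s \<otimes>\<^bsub>A\<^esub> \<iota> b" using e x y by (simp add: A.frac_eq_iff)
  then have "\<iota> (t \<otimes>\<^bsub>B\<^esub> a) = \<iota> (s \<otimes>\<^bsub>B\<^esub> b)" using x y by (simp add: ring_hom_mult[OF iota] B.S_closed)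
  then have "t \<otimes>\<^bsub>B\<^esub> a = s \<otimes>\<^bsub>B\<^esub> b" using x y by (simp add: iota_eq_iff B.S_closed)
  then show "x = y" using x y by (simp add: B.frac_eq_iff)
qed

lemma m_loc_hom: "b \<in> carrier B \<Longrightarrow> m (B.j b) = A.j (\<iota> b)"
  by (simp add: B.loc_hom_frac A.loc_hom_frac ring_hom_one[OF iota])

text \<open>Powers of \<open>h\<close> are units in the localization, so such an element is
  \<open>\<iota> b\<close> divided by a power of \<open>h\<close>. This identifies the set
  \<open>SB\<close> of the abstract setting with the copy of \<open>B_h\<close> in
  \<open>A_h\<close>.\<close>

lemma fractions_B:
  "{\<xi> \<in> carrier A.L. \<exists>n::nat. A.j (\<iota> h) [^]\<^bsub>A.L\<^esub> n \<otimes>\<^bsub>A.L\<^esub> \<xi> \<in> A.j ` \<iota> ` carrier B} = m ` carrier B.L"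
  (is "?F = _")
proof (intro equalityI subsetI)
  interpret L: cring A.L by (rule A.L_cring)
  fix x assume "x \<in> ?F"
  then obtain n :: nat and b where x: "x \<in> carrier A.L" "b \<in> carrier B"
    "A.j (\<iota> h) [^]\<^bsub>A.L\<^esub> n \<otimes>\<^bsub>A.L\<^esub> x = A.j (\<iota> b)" by blast
  let ?y = "A.frac (\<iota> b) (\<iota> h [^]\<^bsub>A\<^esub> n)"
  have "A.j (\<iota> h) [^]\<^bsub>A.L\<^esub> n \<otimes>\<^bsub>A.L\<^esub> x = A.j (\<iota> h) [^]\<^bsub>A.L\<^esub> n \<otimes>\<^bsub>A.L\<^esub> ?y"
    using x A.loc_hom_pow_mult_frac[of "\<iota> b" n] by simp
  then have "x = ?y" using L.Units_l_cancel[OF L.Units_pow_closed[OF A.loc_hom_Units]] x by simp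
  also have "\<dots> = m (B.frac b (h [^]\<^bsub>B\<^esub> n))" using x by (simp add: iota_pow)
  finally show "x \<in> m ` carrier B.L" by (rule image_eqI) (use x in simp)
next
  fix x assume "x \<in> m ` carrier B.L"
  then obtain y where y: "y \<in> carrier B.L" "x = m y" by blast
  obtain b s where "y = B.frac b s" and b: "b \<in> carrier B" "s \<in> B.S" using y(1) by (rule B.L_cases)
  obtain n :: nat where "s = h [^]\<^bsub>B\<^esub> n" using b by (auto simp: B.S_iff)
  then have x: "x = A.frac (\<iota> b) (\<iota> h [^]\<^bsub>A\<^esub> n)" using b \<open>y = B.frac b s\<close> y(2) by (simp add: iota_pow)
  then have "A.j (\<iota> h) [^]\<^bsub>A.L\<^esub> n \<otimes>\<^bsub>A.L\<^esub> x = A.j (\<iota> b)" using A.loc_hom_pow_mult_frac b by simp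
  then show "x \<in> ?F" using x b by auto
qed

lemma gluing:
  assumes "structure_constants \<Phi> N"
  shows "gluing \<Phi> N A.L (A.j (\<iota> h)) (A.j ` carrier A) (A.j ` \<iota> ` carrier B)"
proof -
  interpret L: cring A.L by (rule A.L_cring)
  interpret J: ring_hom_ring A A.L A.j
    by (rule ring_hom_ringI2[OF A.ring_axioms L.ring_axioms A.loc_hom_ring_hom])
  interpret I: ring_hom_ring B A \<iota> by (rule ring_hom_ringI2[OF B.ring_axioms A.ring_axioms iota])
  have loc: "steinberg_local \<Phi> N A.L (A.j (\<iota> h))"
    using assms A.loc_hom_Units L.is_cring
    by (simp add: steinberg_local_def steinberg_ring_def steinberg_local_axioms_def)
  interpret steinberg_local \<Phi> N A.L "A.j (\<iota> h)" by (rule loc)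
  have fB: "fractions (A.j ` \<iota> ` carrier B) = m ` carrier B.L" using fractions_B by (simp add: fractions_def)
  show ?thesis
  proof (intro gluing.intro steinberg_level.intro gluing_axioms.intro steinberg_level_axioms.intro loc)
    show "subring (A.j ` carrier A) A.L" by (rule J.img_is_subring[OF A.carrier_is_subring])
    show "subring (A.j ` \<iota> ` carrier B) A.L"
      by (rule J.img_is_subring[OF I.img_is_subring[OF B.carrier_is_subring]])
    show "A.j (\<iota> h) \<in> A.j ` carrier A" "A.j (\<iota> h) \<in> A.j ` \<iota> ` carrier B" by simp_all
    show "A.j ` \<iota> ` carrier B \<subseteq> A.j ` carrier A" by auto
    show "carrier A.L \<subseteq> fractions (A.j ` carrier A)"
    proof
      fix x assume x: "x \<in> carrier A.L"
      then obtain a s where a: "x = A.frac a s" "a \<in> carrier A" "s \<in> A.S" by (rule A.L_cases)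
      then obtain n :: nat where "s = \<iota> h [^]\<^bsub>A\<^esub> n" by (auto simp: A.S_iff)
      then have "A.j (\<iota> h) [^]\<^bsub>A.L\<^esub> n \<otimes>\<^bsub>A.L\<^esub> x \<in> A.j ` carrier A" using a A.loc_hom_pow_mult_frac by simp
      then show "x \<in> fractions (A.j ` carrier A)" using x by (auto simp: fractions_def)
    qed
    show "A.j ` carrier A \<inter> fractions (A.j ` \<iota> ` carrier B) \<subseteq> A.j ` \<iota> ` carrier B"
    proof
      fix x assume "x \<in> A.j ` carrier A \<inter> fractions (A.j ` \<iota> ` carrier B)"
      then obtain a n b where x: "x = A.j a" "a \<in> carrier A" "b \<in> carrier B"
        "A.j (\<iota> h) [^]\<^bsub>A.L\<^esub> (n::nat) \<otimes>\<^bsub>A.L\<^esub> A.j a = A.j (\<iota> b)" by (auto simp: fractions_def)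
      have c: "\<iota> h [^]\<^bsub>A\<^esub> n \<otimes>\<^bsub>A\<^esub> a \<in> carrier A" "\<iota> b \<in> carrier A" using x by simp_all
      have "A.j (\<iota> h [^]\<^bsub>A\<^esub> n) \<otimes>\<^bsub>A.L\<^esub> A.j a = A.j (\<iota> b)"
        using x(4) by (simp add: ring_hom_nat_pow[OF A.loc_hom_ring_hom _ A.monoid_axioms])
      moreover have "A.j (\<iota> h [^]\<^bsub>A\<^esub> n \<otimes>\<^bsub>A\<^esub> a) = A.j (\<iota> h [^]\<^bsub>A\<^esub> n) \<otimes>\<^bsub>A.L\<^esub> A.j a"
        by (rule ring_hom_mult[OF A.loc_hom_ring_hom]) (use x(2) in simp_all)
      ultimately have "\<iota> h [^]\<^bsub>A\<^esub> n \<otimes>\<^bsub>A\<^esub> a = \<iota> b"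
        by (intro inj_onD[OF A.loc_hom_inj _ c]) (rule HOL.trans)
      from iota_dvd_pow[OF x(3,2) this[symmetric]] show "x \<in> A.j ` \<iota> ` carrier B" unfolding x(1) by (rule imageI)
    qed
    fix r assume "r \<in> A.j ` carrier A"
    then obtain a where a: "a \<in> carrier A" "r = A.j a" by blast
    obtain b s where b: "b \<in> carrier B" "s \<in> carrier A" "a = \<iota> b \<oplus>\<^bsub>A\<^esub> \<iota> h \<otimes>\<^bsub>A\<^esub> s" using split[OF a(1)] by blast
    have "r = A.j (\<iota> b) \<oplus>\<^bsub>A.L\<^esub> A.j (\<iota> h) \<otimes>\<^bsub>A.L\<^esub> A.j s" unfolding a(2) b(3) using b(1,2) by simp
    then show "\<exists>b\<in>A.j ` \<iota> ` carrier B. \<exists>s\<in>A.j ` carrier A. r = b \<oplus>\<^bsub>A.L\<^esub> A.j (\<iota> h) \<otimes>\<^bsub>A.L\<^esub> s"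
      by (intro bexI[where x = "A.j (\<iota> b)"] bexI[where x = "A.j s"] imageI b(1,2))
  qed
qed

end

lemma words_image: "w \<in> words (f ` X) \<Longrightarrow> \<exists>v\<in>words X. w = map_word f v"
proof (induction w)
  case Nil
  show ?case by (intro bexI[of _ "[]"]) simp_all
next
  case (Cons l w)
  obtain x b v where "l = (f x, b)" "x \<in> X" "v \<in> words X" "w = map_word f v"
    using Cons by (cases l) auto
  then show ?case by (intro bexI[of _ "(x, b) # v"]) simp_all
qed

lemma map_word_apsnd_cong:
  assumes "w \<in> words (\<Phi> \<times> X)" "\<And>x. x \<in> X \<Longrightarrow> f (g x) = f' (g' x)"
  shows "map_word (apsnd f) (map_word (apsnd g) w) = map_word (apsnd f') (map_word (apsnd g') w)"
  using assms(1) by (induction w) (auto simp: words_def assms(2))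

section \<open>Surjectivity onto the pullback\<close>

context patching_square
begin

text \<open>The words are mapped into \<open>A_h\<close>, where \<open>gluing_words\<close> applies.
  As \<open>A\<close> and \<open>B_h\<close> embed into \<open>A_h\<close>, the relations obtained
  there are pulled back to the two original Steinberg groups.\<close>

lemma patch_words:
  assumes SC: "structure_constants \<Phi> N"
    and u: "u \<in> words (steinberg_gens \<Phi> B.L)" and v: "v \<in> words (steinberg_gens \<Phi> A)"
    and uv: "(map_word (apsnd m) u, map_word (apsnd A.j) v) \<in> stein_rel \<Phi> N A.L"
  shows "\<exists>w\<in>words (steinberg_gens \<Phi> B).
    (u, map_word (apsnd B.j) w) \<in> stein_rel \<Phi> N B.L \<and> (v, map_word (apsnd \<iota>) w) \<in> stein_rel \<Phi> N A"
proof -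
  interpret G: gluing \<Phi> N A.L "A.j (\<iota> h)" "A.j ` carrier A" "A.j ` \<iota> ` carrier B" by (rule gluing[OF SC])
  interpret BL: cring B.L by (rule B.L_cring)
  have SB: "G.SB = m ` carrier B.L" using fractions_B by (simp add: G.A.fractions_def)
  have u': "map_word (apsnd m) u \<in> G.A.wd G.SB" unfolding SB
    by (rule map_word_words[OF u]) (auto simp: steinberg_gens_def)
  have v': "map_word (apsnd A.j) v \<in> G.A.wd (A.j ` carrier A)"
    by (rule map_word_words[OF v]) (auto simp: steinberg_gens_def)
  obtain w' where w': "w' \<in> G.A.wd (A.j ` \<iota> ` carrier B)" "(map_word (apsnd m) u, w') \<in> G.A.pr G.SB"
    "(map_word (apsnd A.j) v, w') \<in> G.A.pr (A.j ` carrier A)"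
    using G.gluing_words[OF u' v'] uv unfolding G.A.pr_carrier by blast
  have "\<Phi> \<times> A.j ` \<iota> ` carrier B = apsnd A.j ` apsnd \<iota> ` steinberg_gens \<Phi> B"
    by (force simp: steinberg_gens_def image_iff)
  then obtain w'' where "w'' \<in> words (apsnd \<iota> ` steinberg_gens \<Phi> B)" "w' = map_word (apsnd A.j) w''"
    using w'(1) words_image by metis
  then obtain w where w: "w \<in> words (steinberg_gens \<Phi> B)" "w' = map_word (apsnd A.j) (map_word (apsnd \<iota>) w)"
    using words_image by metis
  \<comment> \<open>By commutativity of the square of rings, the word that was found in the image of
    \<open>A\<close> is also the image of a word over \<open>B_h\<close>.\<close>
  have mw: "w' = map_word (apsnd m) (map_word (apsnd B.j) w)"
    unfolding w(2) by (rule map_word_apsnd_cong[OF w(1)[unfolded steinberg_gens_def]]) (simp add: m_loc_hom)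
  have wB: "map_word (apsnd B.j) w \<in> words (steinberg_gens \<Phi> B.L)"
    by (rule map_word_words[OF w(1) apsnd_gens[OF B.loc_hom_ring_hom]])
  have wA: "map_word (apsnd \<iota>) w \<in> words (steinberg_gens \<Phi> A)"
    by (rule map_word_words[OF w(1) apsnd_gens[OF iota]])
  have "(u, map_word (apsnd B.j) w) \<in> stein_rel \<Phi> N B.L"
    using G.A.pr_image_pullback[OF BL.ring_axioms m_ring_hom m_inj u wB] w'(2) by (simp only: SB mw)
  moreover have "(v, map_word (apsnd \<iota>) w) \<in> stein_rel \<Phi> N A"
    using G.A.pr_image_pullback[OF A.ring_axioms A.loc_hom_ring_hom A.loc_hom_inj v wA] w'(3) by (simp only: w(2))
  ultimately show ?thesis using w(1) by blast
qed

theorem patch_epi: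
  assumes SC: "structure_constants \<Phi> N"
  shows "(\<lambda>g. (steinberg_map \<Phi> N B.L B.j g, steinberg_map \<Phi> N A \<iota> g))
    \<in> epi (steinberg \<Phi> N B)
          (pullback (steinberg \<Phi> N B.L) (steinberg \<Phi> N A)
             (steinberg_map \<Phi> N A.L m) (steinberg_map \<Phi> N A.L A.j))"
proof -
  interpret AL: cring A.L by (rule A.L_cring)
  interpret BL: cring B.L by (rule B.L_cring)
  note hB = steinberg_map_hom[OF B.ring_axioms BL.ring_axioms B.loc_hom_ring_hom, of \<Phi> N]
  note hA = steinberg_map_hom[OF B.ring_axioms A.ring_axioms iota, of \<Phi> N]
  note cB = steinberg_map_cls[OF B.ring_axioms BL.ring_axioms B.loc_hom_ring_hom]
  note cA = steinberg_map_cls[OF B.ring_axioms A.ring_axioms iota]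
  note cm = steinberg_map_cls[OF BL.ring_axioms AL.ring_axioms m_ring_hom]
  note cj = steinberg_map_cls[OF A.ring_axioms AL.ring_axioms A.loc_hom_ring_hom]
  note wB = map_word_words[OF _ apsnd_gens[OF B.loc_hom_ring_hom]]
  note wA = map_word_words[OF _ apsnd_gens[OF iota]]
  note wm = map_word_words[OF _ apsnd_gens[OF m_ring_hom]]
  note wj = map_word_words[OF _ apsnd_gens[OF A.loc_hom_ring_hom]]
  have comm: "steinberg_map \<Phi> N A.L m (steinberg_map \<Phi> N B.L B.j g) =
      steinberg_map \<Phi> N A.L A.j (steinberg_map \<Phi> N A \<iota> g)" if g: "g \<in> carrier (steinberg \<Phi> N B)" for g
  proof -
    obtain w where w: "w \<in> words (steinberg_gens \<Phi> B)" "g = stein_cls \<Phi> N B w"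
      using g by (auto simp: steinberg_def presented_group_carrier)
    have "map_word (apsnd m) (map_word (apsnd B.j) w) = map_word (apsnd A.j) (map_word (apsnd \<iota>) w)"
      by (rule map_word_apsnd_cong[OF w(1)[unfolded steinberg_gens_def]]) (simp add: m_loc_hom)
    then show ?thesis unfolding w(2) cB[OF w(1)] cA[OF w(1)] cm[OF wB[OF w(1)]] cj[OF wA[OF w(1)]]
      by (rule arg_cong)
  qed
  show ?thesis
    unfolding epi_iff_subset
  proof (intro conjI homI subsetI)
    fix g assume g: "g \<in> carrier (steinberg \<Phi> N B)"
    then show "(steinberg_map \<Phi> N B.L B.j g, steinberg_map \<Phi> N A \<iota> g) \<in>
        carrier (pullback (steinberg \<Phi> N B.L) (steinberg \<Phi> N A)
             (steinberg_map \<Phi> N A.L m) (steinberg_map \<Phi> N A.L A.j))"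
      using comm[OF g] hom_in_carrier[OF hB g] hom_in_carrier[OF hA g] by (simp add: pullback_def)
    fix g' assume g': "g' \<in> carrier (steinberg \<Phi> N B)"
    show "(steinberg_map \<Phi> N B.L B.j (g \<otimes>\<^bsub>steinberg \<Phi> N B\<^esub> g'), steinberg_map \<Phi> N A \<iota> (g \<otimes>\<^bsub>steinberg \<Phi> N B\<^esub> g')) =
      (steinberg_map \<Phi> N B.L B.j g, steinberg_map \<Phi> N A \<iota> g)
      \<otimes>\<^bsub>pullback (steinberg \<Phi> N B.L) (steinberg \<Phi> N A) (steinberg_map \<Phi> N A.L m) (steinberg_map \<Phi> N A.L A.j)\<^esub>
      (steinberg_map \<Phi> N B.L B.j g', steinberg_map \<Phi> N A \<iota> g')"
      using hom_mult[OF hB g g'] hom_mult[OF hA g g'] by (simp add: pullback_def DirProd_def)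
  next
    fix p assume "p \<in> carrier (pullback (steinberg \<Phi> N B.L) (steinberg \<Phi> N A)
             (steinberg_map \<Phi> N A.L m) (steinberg_map \<Phi> N A.L A.j))"
    then obtain u v where u: "u \<in> words (steinberg_gens \<Phi> B.L)" and v: "v \<in> words (steinberg_gens \<Phi> A)"
      and p: "p = (stein_cls \<Phi> N B.L u, stein_cls \<Phi> N A v)"
        "steinberg_map \<Phi> N A.L m (stein_cls \<Phi> N B.L u) = steinberg_map \<Phi> N A.L A.j (stein_cls \<Phi> N A v)"
      by (auto simp: pullback_def steinberg_def presented_group_carrier)
    have "(map_word (apsnd m) u, map_word (apsnd A.j) v) \<in> stein_rel \<Phi> N A.L"
      using p(2) cls_eq_iff[OF wm[OF u] wj[OF v]] unfolding cm[OF u] cj[OF v] by simp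
    then obtain w where w: "w \<in> words (steinberg_gens \<Phi> B)"
      "(u, map_word (apsnd B.j) w) \<in> stein_rel \<Phi> N B.L" "(v, map_word (apsnd \<iota>) w) \<in> stein_rel \<Phi> N A"
      using patch_words[OF SC u v] by blast
    have "p = (steinberg_map \<Phi> N B.L B.j (stein_cls \<Phi> N B w), steinberg_map \<Phi> N A \<iota> (stein_cls \<Phi> N B w))"
      using w(2,3) cls_eq_iff[OF u wB[OF w(1)]] cls_eq_iff[OF v wA[OF w(1)]]
      unfolding p(1) cB[OF w(1)] cA[OF w(1)] by simp
    then show "p \<in> (\<lambda>g. (steinberg_map \<Phi> N B.L B.j g, steinberg_map \<Phi> N A \<iota> g)) ` carrier (steinberg \<Phi> N B)"
      using w(1) by (auto simp: steinberg_def presented_group_carrier)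
  qed
qed

end

theorem theorem4p1:
  fixes B :: "('b, 'm) ring_scheme"
    and A :: "('a, 'n) ring_scheme"
    and \<iota> :: "'b \<Rightarrow> 'a"
    and h :: 'b
    and \<Phi> \<Delta> :: "'v::euclidean_space set"
    and scale :: "complex \<Rightarrow> 'l::ab_group_add \<Rightarrow> 'l"
    and brk :: "'l \<Rightarrow> 'l \<Rightarrow> 'l"
    and hb eb :: "'v \<Rightarrow> 'l"
    and N :: "'v \<Rightarrow> 'v \<Rightarrow> int"
  assumes "domain B" and "domain A"
    and "\<iota> \<in> ring_hom B A" and "inj_on \<iota> (carrier B)"
    and "h \<in> carrier B" and "h \<noteq> \<zero>\<^bsub>B\<^esub>"
    and "\<exists>\<phi> \<in> ring_iso (B Quot (PIdl\<^bsub>B\<^esub> h)) (A Quot (PIdl\<^bsub>A\<^esub> (\<iota> h))).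
           \<forall>b \<in> carrier B. \<phi> (PIdl\<^bsub>B\<^esub> h +>\<^bsub>B\<^esub> b) = PIdl\<^bsub>A\<^esub> (\<iota> h) +>\<^bsub>A\<^esub> \<iota> b"
    and "root_system \<Phi>" and "irreducible_roots \<Phi>" and "simply_laced \<Phi>" and "dim \<Phi> \<ge> 3"
    and "chevalley_basis scale brk \<Phi> \<Delta> hb eb N"
  shows "(\<lambda>g. (steinberg_map \<Phi> N (loc_at B h) (loc_hom B h) g, steinberg_map \<Phi> N A \<iota> g))
    \<in> epi (steinberg \<Phi> N B)
          (pullback (steinberg \<Phi> N (loc_at B h)) (steinberg \<Phi> N A)
             (steinberg_map \<Phi> N (loc_at A (\<iota> h)) (loc_map A (\<iota> h) \<iota>))
             (steinberg_map \<Phi> N (loc_at A (\<iota> h)) (loc_hom A (\<iota> h))))"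
proof -
  interpret B: domain B by fact
  interpret A: domain A by fact
  have "\<iota> \<zero>\<^bsub>B\<^esub> = \<zero>\<^bsub>A\<^esub>" by (rule ring_hom_zero[OF assms(3) B.ring_axioms A.ring_axioms])
  then have "\<iota> h \<noteq> \<zero>\<^bsub>A\<^esub>" using inj_onD[OF assms(4), of h "\<zero>\<^bsub>B\<^esub>"] assms(5,6) by auto
  then interpret patching_square B A \<iota> h
    using assms ring_hom_closed[OF assms(3,5)]
    by (simp add: patching_square_def patching_square_axioms_def localized_domain_def localized_domain_axioms_def)
  show ?thesis
    by (rule patch_epi, rule chevalley_basis.structure_constants[OF assms(12)])
      (use assms in \<open>simp add: simply_laced_roots_def\<close>)
qed

end
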